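(* Let $p$ be a prime, let $m\le p$ be a positive integer, let $k_1,\dots,k_p$ be fixed integers with $1\le k_j<p$, and let $\Phi=(\phi_{ij})_{1\le i\le m,\,1\le j\le p}$ be an integer matrix with $$\phi_{ij}\equiv k_j\, j^{\,i-1}\pmod p,\qquad |\phi_{ij}|\le p^{1-1/m}\qquad(1\le i\le m,\ 1\le j\le p).$$ Let $x\in\mathbb{Z}^p$ be an unknown nonzero integer vector whose number of nonzero coordinates $s=\|x\|_0$ satisfies $s\le m/2$ (the exact value of $s$ is not known), let $M=\max_{1\le j\le p}|x_j|$, and let $y=(y_0,\dots,y_{m-1})=\Phi x\in\mathbb{Z}^m$. Let $\omega>2$ be an exponent such that every non-homogeneous $t\times t$ system of linear equations over $\mathbb{F}_p$ can be solved with $O(t^{\omega})$ operations in $\mathbb{F}_p$. There is a deterministic algorithm that takes as an input the vector $y=\Phi x$ and finds the unknown vector $x$ after $$O\!\left(m^{\omega}\log_p M+m^{2+o(1)}\,p^{1/2+o(1)}\right)$$ arithmetical operations in the field $\mathbb{F}_p$ and $$O\!\left(m^{2}\log_p M\right)$$ operations in $\mathbb{Z}$. Moreover, the operations in $\mathbb{Z}$ are carried out with numbers not exceeding in absolute value $$\max\Big\{Mp,\ \max_{0\le l\le m-1}|y_l|+m\,p^{1-1/m}\Big\}.$$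
   Context: $\mathbb{F}_p$ is the field of residues modulo the prime $p$; the column indices $1\le j\le p$ are identified with the elements of $\mathbb{F}_p$ (so $j=p$ corresponds to $0$, and the first row satisfies $\phi_{1j}\equiv k_j \pmod p$ for all $j$). For $x\in\mathbb{Z}^p$, $\|x\|_0$ denotes the number of nonzero coordinates of $x$. The matrix $\Phi$ (hence $p$, $m$, $k_1,\dots,k_p$) is known. The complexity of the algorithm is measured in terms of $m$, $p$ and $M$, by counting arithmetical operations in $\mathbb{F}_p$ and operations in the ring $\mathbb{Z}$ (including division by powers of $p$). It is known that an exponent $\omega$ as in the claim exists with $\omega<2.4$.
   Formalization: The number of operations in Z is bounded by O(m^2 max{1, log_p M}) instead of O(m^2 log_p M), because for M = 1 the latter would allow no operation in Z at all, so y could not even be inspected; for M ≥ p the two bounds agree. *)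

theory Defs
  imports
    "HOL-Analysis.Analysis"
    "HOL-Number_Theory.Number_Theory"
begin

section \<open>The machine model\<close>

text \<open>
  Algorithms are programs of a small imperative language over three disjoint stores:
  words (natural numbers below a modulus \<open>W\<close>; they serve as indices and for control),
  elements of the field of residues modulo \<open>p\<close> (represented by \<open>0, \<dots>, p - 1\<close>), and integers.
  A program is one fixed piece of syntax; \<open>p\<close> and \<open>W\<close> are parameters of the machine on which it
  is run. Memory is addressed by tuples of words, so that arrays of any dimension are available.
  Field operations, integer operations and the remaining (control) steps are counted separately.
\<close>

datatype atom = Const nat | Reg nat

type_synonym loc = "atom list"

record state =
  regs :: "nat \<Rightarrow> nat"
  wmem :: "nat list \<Rightarrow> nat"
  fmem :: "nat list \<Rightarrow> int"
  zmem :: "nat list \<Rightarrow> int"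

fun atom_val :: "state \<Rightarrow> atom \<Rightarrow> nat" where
  "atom_val \<sigma> (Const n) = n"
| "atom_val \<sigma> (Reg r) = regs \<sigma> r"

definition addr :: "state \<Rightarrow> loc \<Rightarrow> nat list" where
  "addr \<sigma> l = map (atom_val \<sigma>) l"

definition fval :: "state \<Rightarrow> loc \<Rightarrow> int" where
  "fval \<sigma> l = fmem \<sigma> (addr \<sigma> l)"

definition zval :: "state \<Rightarrow> loc \<Rightarrow> int" where
  "zval \<sigma> l = zmem \<sigma> (addr \<sigma> l)"

definition set_reg :: "nat \<Rightarrow> nat \<Rightarrow> state \<Rightarrow> state" where
  "set_reg r v \<sigma> = \<sigma>\<lparr>regs := (regs \<sigma>)(r := v)\<rparr>"

definition set_word :: "loc \<Rightarrow> nat \<Rightarrow> state \<Rightarrow> state" where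
  "set_word l v \<sigma> = \<sigma>\<lparr>wmem := (wmem \<sigma>)(addr \<sigma> l := v)\<rparr>"

definition set_felt :: "loc \<Rightarrow> int \<Rightarrow> state \<Rightarrow> state" where
  "set_felt l v \<sigma> = \<sigma>\<lparr>fmem := (fmem \<sigma>)(addr \<sigma> l := v)\<rparr>"

definition set_int :: "loc \<Rightarrow> int \<Rightarrow> state \<Rightarrow> state" where
  "set_int l v \<sigma> = \<sigma>\<lparr>zmem := (zmem \<sigma>)(addr \<sigma> l := v)\<rparr>"

datatype wop = WAdd | WSub | WMul | WDiv | WMod
datatype fop = FAdd | FSub | FMul | FDiv
datatype zop = ZAdd | ZSub | ZMul

fun wop_val :: "wop \<Rightarrow> nat \<Rightarrow> nat \<Rightarrow> nat" where
  "wop_val WAdd a b = a + b"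
| "wop_val WSub a b = a - b"
| "wop_val WMul a b = a * b"
| "wop_val WDiv a b = a div b"
| "wop_val WMod a b = a mod b"

text \<open>Division by zero in the field yields zero, as \<^const>\<open>modular_inverse\<close> does.\<close>

fun fop_val :: "nat \<Rightarrow> fop \<Rightarrow> int \<Rightarrow> int \<Rightarrow> int" where
  "fop_val p FAdd a b = (a + b) mod int p"
| "fop_val p FSub a b = (a - b) mod int p"
| "fop_val p FMul a b = (a * b) mod int p"
| "fop_val p FDiv a b = (a * modular_inverse (int p) b) mod int p"

fun zop_val :: "zop \<Rightarrow> int \<Rightarrow> int \<Rightarrow> int" where
  "zop_val ZAdd a b = a + b"
| "zop_val ZSub a b = a - b"
| "zop_val ZMul a b = a * b"

text \<open>
  The only integer division is \<open>ZDivPow\<close>, the floor of the quotient by a power of \<open>p\<close>.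
  Conversions: \<open>FofW\<close> and \<open>WofF\<close> identify an index with a residue class, \<open>ZofW\<close> makes an index
  an integer, and \<open>FofZ\<close> reduces an integer modulo \<open>p\<close>. There is deliberately no conversion
  of integers to words.
\<close>

datatype instr =
    WOp nat wop atom atom
  | WLoad nat loc
  | WStore loc atom
  | FOp loc fop loc loc
  | FofW loc atom
  | WofF nat loc
  | ZOp loc zop loc loc
  | ZDivPow loc loc loc
  | ZofW loc atom
  | FofZ loc loc

datatype cond =
    WLess atom atom
  | WEq atom atom
  | FEq loc loc
  | ZLess loc loc
  | ZEq loc loc

datatype com =
    Do instr
  | Seq com com
  | If cond com com
  | While cond com

fun instr_ok :: "nat \<Rightarrow> instr \<Rightarrow> state \<Rightarrow> bool" where
  "instr_ok p (ZDivPow d a b) \<sigma> \<longleftrightarrow> (\<exists>e. zval \<sigma> b = int p ^ e)"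
| "instr_ok p _ \<sigma> \<longleftrightarrow> True"

fun instr_step :: "nat \<Rightarrow> nat \<Rightarrow> instr \<Rightarrow> state \<Rightarrow> state" where
  "instr_step p W (WOp r f a b) \<sigma> =
     set_reg r (wop_val f (atom_val \<sigma> a) (atom_val \<sigma> b) mod W) \<sigma>"
| "instr_step p W (WLoad r l) \<sigma> = set_reg r (wmem \<sigma> (addr \<sigma> l)) \<sigma>"
| "instr_step p W (WStore l a) \<sigma> = set_word l (atom_val \<sigma> a mod W) \<sigma>"
| "instr_step p W (FOp d f a b) \<sigma> = set_felt d (fop_val p f (fval \<sigma> a) (fval \<sigma> b)) \<sigma>"
| "instr_step p W (FofW d a) \<sigma> = set_felt d (int (atom_val \<sigma> a) mod int p) \<sigma>"
| "instr_step p W (WofF r a) \<sigma> = set_reg r (nat (fval \<sigma> a) mod W) \<sigma>"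
| "instr_step p W (ZOp d f a b) \<sigma> = set_int d (zop_val f (zval \<sigma> a) (zval \<sigma> b)) \<sigma>"
| "instr_step p W (ZDivPow d a b) \<sigma> = set_int d (zval \<sigma> a div zval \<sigma> b) \<sigma>"
| "instr_step p W (ZofW d a) \<sigma> = set_int d (int (atom_val \<sigma> a)) \<sigma>"
| "instr_step p W (FofZ d a) \<sigma> = set_felt d (zval \<sigma> a mod int p) \<sigma>"

fun cond_val :: "cond \<Rightarrow> state \<Rightarrow> bool" where
  "cond_val (WLess a b) \<sigma> \<longleftrightarrow> atom_val \<sigma> a < atom_val \<sigma> b"
| "cond_val (WEq a b) \<sigma> \<longleftrightarrow> atom_val \<sigma> a = atom_val \<sigma> b"
| "cond_val (FEq a b) \<sigma> \<longleftrightarrow> fval \<sigma> a = fval \<sigma> b"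
| "cond_val (ZLess a b) \<sigma> \<longleftrightarrow> zval \<sigma> a < zval \<sigma> b"
| "cond_val (ZEq a b) \<sigma> \<longleftrightarrow> zval \<sigma> a = zval \<sigma> b"

text \<open>
  \<open>zmax\<close> is the largest absolute value of an operand or a result of an integer operation;
  conversions and comparisons involving integers count as integer operations.
\<close>

record cost =
  ctl :: nat
  fops :: nat
  zops :: nat
  zmax :: nat

definition ctl_cost :: cost where
  "ctl_cost = \<lparr>ctl = 1, fops = 0, zops = 0, zmax = 0\<rparr>"

definition fop_cost :: cost where
  "fop_cost = \<lparr>ctl = 0, fops = 1, zops = 0, zmax = 0\<rparr>"

definition zop_cost :: "int set \<Rightarrow> cost" where
  "zop_cost V = \<lparr>ctl = 0, fops = 0, zops = 1, zmax = Max ((\<lambda>v. nat \<bar>v\<bar>) ` V)\<rparr>"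

definition add_cost :: "cost \<Rightarrow> cost \<Rightarrow> cost"  (infixl "\<oplus>\<^sub>c" 65) where
  "\<kappa> \<oplus>\<^sub>c \<kappa>' = \<lparr>ctl = ctl \<kappa> + ctl \<kappa>', fops = fops \<kappa> + fops \<kappa>',
     zops = zops \<kappa> + zops \<kappa>', zmax = max (zmax \<kappa>) (zmax \<kappa>')\<rparr>"

fun instr_cost :: "instr \<Rightarrow> state \<Rightarrow> cost" where
  "instr_cost (WOp r f a b) \<sigma> = ctl_cost"
| "instr_cost (WLoad r l) \<sigma> = ctl_cost"
| "instr_cost (WStore l a) \<sigma> = ctl_cost"
| "instr_cost (FOp d f a b) \<sigma> = fop_cost"
| "instr_cost (FofW d a) \<sigma> = fop_cost"
| "instr_cost (WofF r a) \<sigma> = fop_cost"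
| "instr_cost (ZOp d f a b) \<sigma> =
     zop_cost {zval \<sigma> a, zval \<sigma> b, zop_val f (zval \<sigma> a) (zval \<sigma> b)}"
| "instr_cost (ZDivPow d a b) \<sigma> = zop_cost {zval \<sigma> a, zval \<sigma> b, zval \<sigma> a div zval \<sigma> b}"
| "instr_cost (ZofW d a) \<sigma> = zop_cost {int (atom_val \<sigma> a)}"
| "instr_cost (FofZ d a) \<sigma> = zop_cost {zval \<sigma> a}"

fun cond_cost :: "cond \<Rightarrow> state \<Rightarrow> cost" where
  "cond_cost (WLess a b) \<sigma> = ctl_cost"
| "cond_cost (WEq a b) \<sigma> = ctl_cost"
| "cond_cost (FEq a b) \<sigma> = fop_cost"
| "cond_cost (ZLess a b) \<sigma> = zop_cost {zval \<sigma> a, zval \<sigma> b}"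
| "cond_cost (ZEq a b) \<sigma> = zop_cost {zval \<sigma> a, zval \<sigma> b}"

text \<open>\<open>exec p W c \<sigma> \<kappa> \<sigma>'\<close>: started in \<open>\<sigma>\<close>, the program \<open>c\<close> halts in \<open>\<sigma>'\<close> at total cost \<open>\<kappa>\<close>.\<close>

inductive exec :: "nat \<Rightarrow> nat \<Rightarrow> com \<Rightarrow> state \<Rightarrow> cost \<Rightarrow> state \<Rightarrow> bool"
  for p W :: nat where
  Do: "instr_ok p i \<sigma> \<Longrightarrow> exec p W (Do i) \<sigma> (instr_cost i \<sigma>) (instr_step p W i \<sigma>)"
| Seq: "exec p W c \<sigma> \<kappa> \<sigma>' \<Longrightarrow> exec p W d \<sigma>' \<kappa>' \<sigma>'' \<Longrightarrow>
     exec p W (Seq c d) \<sigma> (\<kappa> \<oplus>\<^sub>c \<kappa>') \<sigma>''"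
| IfTrue: "cond_val b \<sigma> \<Longrightarrow> exec p W c \<sigma> \<kappa> \<sigma>' \<Longrightarrow>
     exec p W (If b c d) \<sigma> (cond_cost b \<sigma> \<oplus>\<^sub>c \<kappa>) \<sigma>'"
| IfFalse: "\<not> cond_val b \<sigma> \<Longrightarrow> exec p W d \<sigma> \<kappa> \<sigma>' \<Longrightarrow>
     exec p W (If b c d) \<sigma> (cond_cost b \<sigma> \<oplus>\<^sub>c \<kappa>) \<sigma>'"
| WhileFalse: "\<not> cond_val b \<sigma> \<Longrightarrow> exec p W (While b c) \<sigma> (cond_cost b \<sigma>) \<sigma>"
| WhileTrue: "cond_val b \<sigma> \<Longrightarrow> exec p W c \<sigma> \<kappa> \<sigma>' \<Longrightarrow> exec p W (While b c) \<sigma>' \<kappa>' \<sigma>'' \<Longrightarrow>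
     exec p W (While b c) \<sigma> (cond_cost b \<sigma> \<oplus>\<^sub>c \<kappa> \<oplus>\<^sub>c \<kappa>') \<sigma>''"

lemma exec_deterministic:
  assumes "exec p W c \<sigma> \<kappa>\<^sub>1 \<sigma>\<^sub>1" and "exec p W c \<sigma> \<kappa>\<^sub>2 \<sigma>\<^sub>2"
  shows "\<kappa>\<^sub>1 = \<kappa>\<^sub>2 \<and> \<sigma>\<^sub>1 = \<sigma>\<^sub>2"
  using assms
proof (induction arbitrary: \<kappa>\<^sub>2 \<sigma>\<^sub>2 rule: exec.induct)
  case (Do i \<sigma>)
  from Do.prems show ?case by cases simp_all
next
  case (Seq c \<sigma> \<kappa> \<sigma>' d \<kappa>' \<sigma>'')
  from Seq.prems show ?case by cases (metis Seq.IH)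
next
  case (IfTrue b \<sigma> c \<kappa> \<sigma>' d)
  from IfTrue.prems show ?case by cases (use IfTrue.IH IfTrue.hyps in metis)+
next
  case (IfFalse b \<sigma> d \<kappa> \<sigma>' c)
  from IfFalse.prems show ?case by cases (use IfFalse.IH IfFalse.hyps in metis)+
next
  case (WhileFalse b \<sigma> c)
  from WhileFalse.prems show ?case by cases (use WhileFalse.hyps in simp_all)
next
  case (WhileTrue b \<sigma> c \<kappa> \<sigma>' \<kappa>' \<sigma>'')
  from WhileTrue.prems show ?case by cases (use WhileTrue.IH WhileTrue.hyps in metis)+
qed


section \<open>Exponents for solving linear systems\<close>

text \<open>
  Memory is zero except for the input. For a linear system, register 0 holds \<open>p\<close>, register 1
  holds \<open>t\<close>, and the field cells \<open>[0, i, j]\<close> and \<open>[1, i]\<close> hold the matrix and the right-hand side.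
  On output register 0 tells whether the system is solvable, and if so a solution is in the field
  cells \<open>[2, j]\<close>.
\<close>

definition system_input ::
    "nat \<Rightarrow> nat \<Rightarrow> (nat \<Rightarrow> nat \<Rightarrow> int) \<Rightarrow> (nat \<Rightarrow> int) \<Rightarrow> state" where
  "system_input p t A b =
     \<lparr>regs = (\<lambda>_. 0)(0 := p, 1 := t),
      wmem = (\<lambda>_. 0),
      fmem = (\<lambda>a. case a of
          [i0, i, j] \<Rightarrow> if i0 = 0 \<and> i < t \<and> j < t then A i j else 0
        | [i0, i] \<Rightarrow> if i0 = 1 \<and> i < t then b i else 0
        | _ \<Rightarrow> 0),
      zmem = (\<lambda>_. 0)\<rparr>"

definition is_solution ::
    "nat \<Rightarrow> nat \<Rightarrow> (nat \<Rightarrow> nat \<Rightarrow> int) \<Rightarrow> (nat \<Rightarrow> int) \<Rightarrow> (nat \<Rightarrow> int) \<Rightarrow> bool" where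
  "is_solution p t A b z \<longleftrightarrow>
     (\<forall>j<t. 0 \<le> z j \<and> z j < int p) \<and>
     (\<forall>i<t. [(\<Sum>j<t. A i j * z j) = b i] (mod int p))"

definition system_output ::
    "nat \<Rightarrow> nat \<Rightarrow> (nat \<Rightarrow> nat \<Rightarrow> int) \<Rightarrow> (nat \<Rightarrow> int) \<Rightarrow> state \<Rightarrow> bool" where
  "system_output p t A b \<sigma> \<longleftrightarrow>
     (if \<exists>z. is_solution p t A b z
      then regs \<sigma> 0 = 1 \<and> is_solution p t A b (\<lambda>j. fmem \<sigma> [2, j])
      else regs \<sigma> 0 = 0)"

text \<open>
  One program solves all non-homogeneous \<open>t \<times> t\<close> systems, over all prime fields, in
  \<open>O(t powr \<omega>)\<close> field operations. It uses no integers, and its control steps obey the same bound,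
  so that field arithmetic cannot be hidden in word arithmetic. Words have
  \<open>O(log (p + t))\<close> bits.
\<close>

definition linear_system_exponent :: "real \<Rightarrow> bool" where
  "linear_system_exponent \<omega> \<longleftrightarrow>
     (\<exists>(prog :: com) (e :: nat) (C :: real).
        \<forall>(p :: nat) (t :: nat) A b.
          prime p \<longrightarrow> 0 < t \<longrightarrow>
          (\<forall>i<t. \<forall>j<t. 0 \<le> A i j \<and> A i j < int p) \<longrightarrow>
          (\<forall>i<t. 0 \<le> b i \<and> b i < int p) \<longrightarrow>
          (\<exists>i<t. b i \<noteq> 0) \<longrightarrow>
          (\<exists>\<kappa> \<sigma>. exec p ((p + t) ^ e) prog (system_input p t A b) \<kappa> \<sigma> \<and>
             system_output p t A b \<sigma> \<and>
             real (fops \<kappa>) \<le> C * real t powr \<omega> \<and>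
             zops \<kappa> = 0 \<and>
             real (ctl \<kappa>) \<le> C * real t powr \<omega>))"


section \<open>Sparse integer vectors and their measurements\<close>

text \<open>Vectors in \<open>\<int>\<^sup>p\<close> are indexed by \<open>1, \<dots>, p\<close>; values at other indices are irrelevant.\<close>

definition norm0 :: "nat \<Rightarrow> (nat \<Rightarrow> int) \<Rightarrow> nat" where
  "norm0 p x = card {j \<in> {1..p}. x j \<noteq> 0}"

definition max_abs :: "nat \<Rightarrow> (nat \<Rightarrow> int) \<Rightarrow> int" where
  "max_abs p x = Max ((\<lambda>j. \<bar>x j\<bar>) ` {1..p})"

text \<open>Rows of \<open>\<Phi>\<close> are indexed from 1, but coordinates of \<open>y\<close> from 0.\<close>

definition measurement :: "nat \<Rightarrow> (nat \<Rightarrow> nat \<Rightarrow> int) \<Rightarrow> (nat \<Rightarrow> int) \<Rightarrow> nat \<Rightarrow> int" where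
  "measurement p \<Phi> x l = (\<Sum>j = 1..p. \<Phi> (l + 1) j * x j)"

definition admissible_matrix ::
    "nat \<Rightarrow> nat \<Rightarrow> (nat \<Rightarrow> int) \<Rightarrow> (nat \<Rightarrow> nat \<Rightarrow> int) \<Rightarrow> bool" where
  "admissible_matrix p m k \<Phi> \<longleftrightarrow>
     (\<forall>i\<in>{1..m}. \<forall>j\<in>{1..p}.
        [\<Phi> i j = k j * int j ^ (i - 1)] (mod int p) \<and>
        \<bar>real_of_int (\<Phi> i j)\<bar> \<le> real p powr (1 - 1 / real m))"

text \<open>
  The program knows \<open>p\<close>, \<open>m\<close> (registers 0 and 1), \<open>\<Phi>\<close> (integer cells \<open>[0, i, j]\<close>) and \<open>y\<close>
  (integer cells \<open>[1, l]\<close>). It returns \<open>x\<close> in the integer cells \<open>[2, j]\<close>; these are zero initially,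
  so that the zero coordinates of \<open>x\<close> need not be written.
\<close>

definition recovery_input ::
    "nat \<Rightarrow> nat \<Rightarrow> (nat \<Rightarrow> nat \<Rightarrow> int) \<Rightarrow> (nat \<Rightarrow> int) \<Rightarrow> state" where
  "recovery_input p m \<Phi> y =
     \<lparr>regs = (\<lambda>_. 0)(0 := p, 1 := m),
      wmem = (\<lambda>_. 0),
      fmem = (\<lambda>_. 0),
      zmem = (\<lambda>a. case a of
          [i0, i, j] \<Rightarrow> if i0 = 0 \<and> i \<in> {1..m} \<and> j \<in> {1..p} then \<Phi> i j else 0
        | [i0, l] \<Rightarrow> if i0 = 1 \<and> l < m then y l else 0
        | _ \<Rightarrow> 0)\<rparr>"

definition recovery_output :: "nat \<Rightarrow> (nat \<Rightarrow> int) \<Rightarrow> state \<Rightarrow> bool" where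
  "recovery_output p x \<sigma> \<longleftrightarrow> (\<forall>j\<in>{1..p}. zmem \<sigma> [2, j] = x j)"

end

theory Submission
  imports
   Defs
   "HOL-Algebra.Algebraic_Closure_Type"
   "Berlekamp_Zassenhaus.Finite_Field"
   "HOL-Real_Asymp.Real_Asymp"
begin

text \<open>The support of \<open>x\<close> modulo \<open>p\<close> is found by Massey's algorithm from the residues of \<open>y\<close>, which are power
 sums with weights \<open>k\<^sub>j x\<^sub>j\<close>: its output is the product of the \<open>X - j\<close>. Interpolating at these points gives
 \<open>x\<close> modulo \<open>p\<close>; with balanced digits, \<open>(x - d) / p\<close> is again sparse and \<open>y\<close> shrinks accordingly, so
 \<open>O(log\<^sub>p M)\<close> rounds of \<open>O(m\<^sup>2)\<close> operations suffice. Roots found earlier are removed from the power sums, so each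
 root is isolated only once. To split a product of linear factors deterministically, one separates its roots
 by the values of \<open>(X + t)\<^bsup>(p-1)/2\<^esup>\<close> for \<open>t = 0, 1, \<dots>\<close>; Stepanov's method shows that two roots agree for at
 most \<open>O(p\<^bsup>1/2\<^esup> log\<^sup>2 p)\<close> consecutive \<open>t\<close>. The exponent \<open>\<omega>\<close> enters only through \<open>m\<^sup>2 \<le> m\<^bsup>\<omega>\<^esup>\<close>.\<close>

text \<open>One product \<open>(t + a) * (t + b)\<close> is a square for about half of all
  \<open>t\<close>, so it cannot bound a run of shifts that fail to separate \<open>a\<close> from
  \<open>b\<close>. Hence \<open>r\<close> consecutive shifts are treated at once. The auxiliary
  polynomial combines the \<open>2 ^ r\<close> products of half powers
  \<open>gp g ^ ((p + 1) div 2)\<close>. Its many coefficients buy zeros of order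
  \<open>2 ^ (r - 1)\<close> while the degree is only about \<open>r * p\<close>, and choosing
  \<open>r * 4 ^ r\<close> close to \<open>p\<close> produces the square root. The obstacle is to
  show that the combination is not the zero polynomial. It is met by keeping combinations formal, as
  binary trees, and by treating \<open>X ^ p\<close> as a second variable, in which each new
  quadratic has a simple root that the others lack. The rest is shaped by the size limit on
  integers: long sums of products must not be formed, and the power of \<open>p\<close> may be
  raised only while some residual is left. The prime 2, which has neither useful half powers nor
  balanced digits, is solved directly.\<close>

hide_const (open) UnivPoly.bound up_ring.coeff up_ring.monom Polynomials.degree Polynomials.lead_coeff Divisibility.prime Coset.order


section \<open>Formal adjunction of square roots\<close>

datatype 'a mq = Lf 'a | Nd "'a mq" "'a mq"

fun deep :: "nat => 'a mq => bool" where
  "deep 0 (Lf _) \<longleftrightarrow> True"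
| "deep (Suc n) (Nd A B) \<longleftrightarrow> deep n A \<and> deep n B"
| "deep _ _ \<longleftrightarrow> False"

lemma deep_0_iff: "deep 0 t \<longleftrightarrow> (\<exists>a. t = Lf a)" by (cases t) auto
lemma deep_Suc_iff: "deep (Suc n) t \<longleftrightarrow> (\<exists>A B. t = Nd A B \<and> deep n A \<and> deep n B)" by (cases t) auto

lemma deep_map [simp]: "deep n (map_mq f t) \<longleftrightarrow> deep n t"
  by (induction n t rule: deep.induct) auto

fun tadd :: "'a::comm_ring_1 mq => 'a mq => 'a mq" where
  "tadd (Lf a) (Lf b) = Lf (a + b)"
| "tadd (Nd A B) (Nd C D) = Nd (tadd A C) (tadd B D)"
| "tadd _ _ = Lf 0"

definition tsm :: "'a::comm_ring_1 => 'a mq => 'a mq" where "tsm c t = map_mq ((*) c) t"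

lemma tsm_simps [simp]: "tsm c (Lf a) = Lf (c * a)" "tsm c (Nd A B) = Nd (tsm c A) (tsm c B)"
  "deep n (tsm c t) \<longleftrightarrow> deep n t"
  by (simp_all add: tsm_def)

lemma set_tsm: "set_mq (tsm c t) = (*) c ` set_mq t" by (simp add: tsm_def mq.set_map)

text \<open>\<open>Nd A B\<close> stands for A + v B, where v is the root adjoined at that level, so
  a tree of depth n is an element of R[v_1, ..., v_n] / (v_i^2 - q_i) written in the basis of 2^n
  products. Depth is the predicate \<open>deep\<close> and not part of the type, because the
  inductions peel off one root at a time. The last equation is a default for shapes that
  \<open>deep\<close> excludes.\<close>

fun tmul :: "'a::comm_ring_1 list => 'a mq => 'a mq => 'a mq" where
  "tmul [] (Lf a) (Lf b) = Lf (a * b)"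
| "tmul (q # qs) (Nd A B) (Nd C D) =
   Nd (tadd (tmul qs A C) (tsm q (tmul qs B D))) (tadd (tmul qs A D) (tmul qs B C))"
| "tmul _ _ _ = Lf 0"

fun teval :: "'a::comm_ring_1 list => 'a mq => 'a" where
  "teval [] (Lf a) = a"
| "teval (v # vs) (Nd A B) = teval vs A + v * teval vs B"
| "teval _ _ = 0"

definition tzero :: "'a::zero mq => bool" where "tzero t \<longleftrightarrow> (\<forall>x\<in>set_mq t. x = 0)"

lemma tzero_simps [simp]: "tzero (Lf a) \<longleftrightarrow> a = 0" "tzero (Nd A B) \<longleftrightarrow> tzero A \<and> tzero B"
  by (auto simp: tzero_def)

lemma deep_tadd: "deep n s ==> deep n t ==> deep n (tadd s t)"
  by (induction n arbitrary: s t) (auto simp: deep_0_iff deep_Suc_iff)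

lemma deep_tmul: "length qs = n ==> deep n s ==> deep n t ==> deep n (tmul qs s t)"
  by (induction qs arbitrary: s t n) (auto simp: deep_0_iff deep_Suc_iff intro!: deep_tadd)

lemma teval_tadd: "deep (length vs) s ==> deep (length vs) t ==> teval vs (tadd s t) = teval vs s + teval vs t"
  by (induction vs arbitrary: s t) (auto simp: deep_0_iff deep_Suc_iff algebra_simps)

lemma teval_tsm: "deep (length vs) t ==> teval vs (tsm c t) = c * teval vs t"
  by (induction vs arbitrary: t) (auto simp: deep_0_iff deep_Suc_iff algebra_simps)

lemma teval_tmul:
  "list_all2 (\<lambda>v q. v * v = q) vs qs ==> deep (length vs) s ==> deep (length vs) t ==>
  teval vs (tmul qs s t) = teval vs s * teval vs t"
proof (induction vs qs arbitrary: s t rule: list_all2_induct)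
  case Nil
  then show ?case by (auto simp: deep_0_iff)
next
  case (Cons v vs q qs)
  have len: "length vs = length qs" using Cons.hyps(2) by (rule list_all2_lengthD)
  from Cons.prems obtain A B C D where *: "s = Nd A B" "t = Nd C D"
   "deep (length vs) A" "deep (length vs) B" "deep (length vs) C" "deep (length vs) D"
   by (auto simp: deep_Suc_iff)

  from * show ?case
   by (simp add: teval_tadd teval_tsm deep_tadd deep_tmul Cons.IH len Cons.hyps(1)[symmetric] algebra_simps)
qed

lemma tzero_tadd: "deep n s ==> deep n t ==> tzero s ==> tzero t ==> tzero (tadd s t)"
  by (induction n arbitrary: s t) (auto simp: deep_0_iff deep_Suc_iff)

lemma tadd_eq_0:
  "deep n s ==> deep n t ==> tzero (tadd s (tsm (- 1) t)) ==> s = t"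
  by (induction n arbitrary: s t) (auto simp: deep_0_iff deep_Suc_iff)

lemma tsm_tsm: "tsm c (tsm d t) = tsm (c * d) t"
  by (induction t) (simp_all add: mult.assoc)

lemma tsm_tadd: "deep n s ==> deep n t ==> tsm c (tadd s t) = tadd (tsm c s) (tsm c t)"
  by (induction n arbitrary: s t) (auto simp: deep_0_iff deep_Suc_iff algebra_simps)

lemma tmul_tsm:
  "deep (length qs) s ==> deep (length qs) t ==> tmul qs (tsm c s) (tsm d t) = tsm (c * d) (tmul qs s t)"
proof (induction qs arbitrary: s t)
  case (Cons q qs)
  then obtain A B C D where *: "s = Nd A B" "t = Nd C D"
   "deep (length qs) A" "deep (length qs) B" "deep (length qs) C" "deep (length qs) D"
   by (auto simp: deep_Suc_iff)
  have "tsm q (tsm (c * d) u) = tsm (c * d) (tsm q u)" for u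
   by (simp add: tsm_tsm mult.commute)
  with * show ?case
   by (simp add: tsm_tadd[where n = "length qs"] deep_tmul Cons.IH)
qed (auto simp: deep_0_iff algebra_simps)

lemma teval_tzero: "deep (length vs) t ==> tzero t ==> teval vs t = 0"
  by (induction vs arbitrary: t) (auto simp: deep_0_iff deep_Suc_iff)

text \<open>The choices s and -s at the top level give A + s B = 0 and A - s B = 0; adding and
  subtracting isolates both halves, because neither 2 nor s is zero.\<close>

lemma tzero_if_all_signs:
  fixes t :: "'a::idom mq"
  assumes "(2::'a) ~= 0" "\<And>s. s \<in> set ss ==> s ~= 0" "deep (length ss) t"
   and "\<And>vs. list_all2 (\<lambda>v s. v = s \<or> v = - s) vs ss ==> teval vs t = 0"
  shows "tzero t"
  using assms
proof (induction ss arbitrary: t)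
  case Nil
  then show ?case by (auto simp: deep_0_iff)
next
  case (Cons s ss)
  then obtain A B where t: "t = Nd A B" "deep (length ss) A" "deep (length ss) B"
   by (auto simp: deep_Suc_iff)
  have "teval vs A = 0 \<and> teval vs B = 0" if "list_all2 (\<lambda>v s. v = s \<or> v = - s) vs ss" for vs
  proof -
   have 1: "teval vs A + s * teval vs B = 0" using Cons.prems(4)[of "s # vs"] that t by simp
   have 2: "teval vs A + (- s) * teval vs B = 0" using Cons.prems(4)[of "- s # vs"] that t by simp
   have "2 * teval vs A = 0" using 1 2 by (simp add: algebra_simps)
   then have "teval vs A = 0" using Cons.prems(1) by simp
   then show ?thesis using 1 Cons.prems(2) by simp
  qed
  then show ?case using Cons.IH[of A] Cons.IH[of B] Cons.prems t by auto
qed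

text \<open>Over an algebraically closed extension the elements \<open>v\<^sub>i\<close> split into two signs each, and an element
  vanishing for every choice of the signs is zero; hence the formal ring has no nilpotents.\<close>

lemma teval_map:
  assumes "\<And>a b. h (a + b) = h a + h b" "\<And>a b. h (a * b) = h a * h b"
  shows "deep (length vs) t ==> teval (map h vs) (map_mq h t) = h (teval vs t)"
  by (induction vs arbitrary: t) (auto simp: deep_0_iff deep_Suc_iff assms)

lemma tadd_map:
  assumes "\<And>a b. h (a + b) = h a + h b"
  shows "deep n s ==> deep n t ==> map_mq h (tadd s t) = tadd (map_mq h s) (map_mq h t)"
  by (induction n arbitrary: s t) (auto simp: deep_0_iff deep_Suc_iff assms)

lemma tmul_map:
  assumes "\<And>a b. h (a + b) = h a + h b" "\<And>a b. h (a * b) = h a * h b"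
  shows "deep (length qs) s ==> deep (length qs) t ==>
   map_mq h (tmul qs s t) = tmul (map h qs) (map_mq h s) (map_mq h t)"
proof (induction qs arbitrary: s t)
  case (Cons q qs)
  have 1: "map_mq h (tsm c u) = tsm (h c) (map_mq h u)" for c u
   by (induction u) (simp_all add: assms)
  from Cons show ?case
   by (auto simp: deep_Suc_iff tadd_map[OF assms(1), where n = "length qs"] deep_tmul 1)
qed (auto simp: deep_0_iff assms)

lemma tmul_self_eq_0:
  fixes t :: "'a::idom mq"
  assumes two: "(2::'a) ~= 0" and q: "\<And>q. q \<in> set qs ==> q ~= 0" and d: "deep (length qs) t"
   and z: "tzero (tmul qs t t)"
  shows "tzero t"
proof -
  \<comment> \<open>The embedding passes through the fraction field, since algebraic closures exist
    for fields only; in the closure every q has a square root.\<close>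
  define h :: "'a => 'a fract alg_closure" where "h = (\<lambda>x. to_ac (Fract x 1))"
  have h: "h (a + b) = h a + h b" "h (a * b) = h a * h b" "h x = 0 \<longleftrightarrow> x = 0" for a b x
   by (simp_all add: h_def eq_fract Zero_fract_def flip: to_ac_add to_ac_mult)
  have h0: "h 0 = 0" using h(3) by simp
  have "h 1 = 1" by (simp add: h_def flip: One_fract_def)
  then have two': "(2 :: 'a fract alg_closure) ~= 0"
   using h(1)[of 1 1] h(3)[of 2] two by simp
  have "\<exists>s. s * s = c" for c :: "'a fract alg_closure"
   using nth_root_exists[of 2 c] by (auto simp: power2_eq_square)
  then obtain r where r: "\<And>c :: 'a fract alg_closure. r c * r c = c" by metis
  define ss where "ss = map (\<lambda>q. r (h q)) qs"
  have "tzero (map_mq h t)"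
  proof (rule tzero_if_all_signs[OF two'])
   show "s ~= 0" if "s \<in> set ss" for s
    using that q h(3) r unfolding ss_def by (auto) (metis mult_zero_left)
   show "deep (length ss) (map_mq h t)" using d by (simp add: ss_def)
   show "teval vs (map_mq h t) = 0" if "list_all2 (\<lambda>v s. v = s \<or> v = - s) vs ss" for vs
   proof -
    have len: "length vs = length qs" using list_all2_lengthD[OF that] by (simp add: ss_def)
    have "list_all2 (\<lambda>v q. v * v = q) vs (map h qs)"
     using that unfolding ss_def by (auto simp: list_all2_conv_all_nth r)
    then have "teval vs (map_mq h t) * teval vs (map_mq h t) = teval vs (map_mq h (tmul qs t t))"
     using d len by (subst teval_tmul[symmetric]) (auto simp: tmul_map h)
    also have "tzero (map_mq h (tmul qs t t))" using z by (auto simp: tzero_def mq.set_map h0)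
    then have "teval vs (map_mq h (tmul qs t t)) = 0"
     using d len by (intro teval_tzero) (auto simp: deep_tmul)
    finally show ?thesis by simp
   qed
  qed
  then show ?thesis by (auto simp: tzero_def mq.set_map h)
qed

section \<open>Independence of the half powers\<close>

definition xdeg :: "nat => 'a::comm_ring_1 poly poly => bool" where
  "xdeg d c \<longleftrightarrow> (\<forall>j. degree (coeff c j) \<le> d)"

lemma xdeg_mono: "xdeg d c ==> d \<le> d' ==> xdeg d' c"
  unfolding xdeg_def by (meson order_trans)

lemma xdeg_add: "xdeg d c ==> xdeg d c' ==> xdeg d (c + c')"
  unfolding xdeg_def by (simp add: degree_add_le)

lemma xdeg_mult: "xdeg d c ==> xdeg d' c' ==> xdeg (d + d') (c * c')"
  unfolding xdeg_def coeff_mult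
  by (auto intro!: degree_sum_le order_trans[OF degree_mult_le] add_mono)

lemma xdeg_minus: "xdeg d c ==> xdeg d (- c)"
  unfolding xdeg_def by simp

lemma set_mq_tadd:
  "deep n s ==> deep n t ==> set_mq (tadd s t) \<subseteq> {a + b |a b. a \<in> set_mq s \<and> b \<in> set_mq t}"
  by (induction n arbitrary: s t) (fastforce simp: deep_0_iff deep_Suc_iff)+

lemma xdeg_tadd:
  assumes "deep n s" "deep n t" "\<forall>c\<in>set_mq s. xdeg d c" "\<forall>c\<in>set_mq t. xdeg d c"
  shows "\<forall>c\<in>set_mq (tadd s t). xdeg d c"
  using set_mq_tadd[OF assms(1,2)] assms(3,4) by (auto intro!: xdeg_add dest!: subsetD)

text \<open>Each level multiplies by its q at most once, and a q has degree at most 2 in the inner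
  variable; hence the summand \<open>2 * length qs\<close>.\<close>

lemma xdeg_tmul:
  assumes "deep (length qs) s" "deep (length qs) t" "\<forall>c\<in>set_mq s. xdeg d c" "\<forall>c\<in>set_mq t. xdeg d' c"
   "\<forall>q\<in>set qs. xdeg 2 q"
  shows "\<forall>c\<in>set_mq (tmul qs s t). xdeg (d + d' + 2 * length qs) c"
  using assms
proof (induction qs arbitrary: s t)
  case Nil
  then show ?case by (auto simp: deep_0_iff xdeg_mult)
next
  case (Cons q qs)
  then obtain A B C D where *: "s = Nd A B" "t = Nd C D"
   "deep (length qs) A" "deep (length qs) B" "deep (length qs) C" "deep (length qs) D"
   by (auto simp: deep_Suc_iff)
  let ?n = "d + d' + 2 * length qs"
  have le: "?n \<le> 2 + ?n" by simp
  have "\<forall>c\<in>set_mq (tmul qs A C). xdeg ?n c" "\<forall>c\<in>set_mq (tmul qs B D). xdeg ?n c"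
   "\<forall>c\<in>set_mq (tmul qs A D). xdeg ?n c" "\<forall>c\<in>set_mq (tmul qs B C). xdeg ?n c"
   using Cons.IH[OF *(3) *(5)] Cons.IH[OF *(4) *(6)] Cons.IH[OF *(3) *(6)] Cons.IH[OF *(4) *(5)]
    Cons.prems * by auto
  then have IH: "\<forall>c\<in>set_mq (tmul qs A C). xdeg (2 + ?n) c" "\<forall>c\<in>set_mq (tmul qs B D). xdeg ?n c"
   "\<forall>c\<in>set_mq (tmul qs A D). xdeg (2 + ?n) c" "\<forall>c\<in>set_mq (tmul qs B C). xdeg (2 + ?n) c"
   using xdeg_mono[OF _ le] by blast+
  have "\<forall>c\<in>set_mq (tsm q (tmul qs B D)). xdeg (2 + ?n) c"
   using IH(2) Cons.prems(5) by (auto simp: set_tsm simp del: add_2_eq_Suc intro!: xdeg_mult)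
  then have "\<forall>c\<in>set_mq (tmul (q # qs) s t). xdeg (2 + ?n) c"
   using IH(1,3,4) unfolding * tmul.simps
   by (simp only: mq.set Un_iff ball_Un) (intro conjI xdeg_tadd[of "length qs"]; simp add: deep_tmul *)
  moreover have "2 + ?n = d + d' + 2 * length (q # qs)" by simp
  ultimately show ?case by metis
qed

text \<open>The inner variable is X and the outer one, Z, is later replaced by X^p. If all inner
  degrees are below n, putting Z = X^n places the coefficients in disjoint blocks of exponents, so
  nothing can cancel. This is what allows X^p to be handled as an independent variable, and why
  \<open>xdeg\<close> records only the degree in X.\<close>

lemma poly_monom_eq_0:
  fixes c :: "'a::field poly poly"
  assumes "xdeg d c" "d < n" "poly c (monom 1 n) = 0"
  shows "c = 0"
  using assms(1,3)
proof (induction c)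
  case (pCons a c)
  have a: "degree a \<le> d" and c: "xdeg d c"
   using pCons.prems(1) unfolding xdeg_def by (metis coeff_pCons_0, metis coeff_pCons_Suc)
  have eq: "a + monom 1 n * poly c (monom 1 n) = 0" using pCons.prems(2) by simp
  have "poly c (monom 1 n) = 0"
  proof (rule ccontr)
   assume nz: "poly c (monom 1 n) ~= 0"
   have "degree a = degree (monom (1::'a) n * poly c (monom 1 n))"
    using eq by (metis add_eq_0_iff2 degree_minus)
   also have "\<dots> \<ge> n" using nz by (simp add: degree_mult_eq degree_monom_eq)
   finally show False using a assms(2) by simp
  qed
  with eq pCons.IH[OF c] show ?case by simp
qed simp

text \<open>\<open>gp g\<close> is a quadratic in X and \<open>gz g\<close> the same quadratic in Z.
  By Frobenius, \<open>gz g\<close> becomes \<open>gp g ^ p\<close> at Z = X^p, so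
  \<open>gq g\<close> is the two-variable form of \<open>gp g ^ (p + 1)\<close>, the square of the
  half power \<open>gv g\<close>.\<close>

definition gp :: "'a::comm_ring_1 \<times> 'a => 'a poly" where
  "gp = (\<lambda>(a, b). [:- a, 1:] * [:- b, 1:])"
definition gz :: "'a::comm_ring_1 \<times> 'a => 'a poly poly" where
  "gz = (\<lambda>(a, b). [:[:- a:], 1:] * [:[:- b:], 1:])"
definition gq :: "'a::comm_ring_1 \<times> 'a => 'a poly poly" where
  "gq g = [:gp g:] * gz g"

text \<open>Only \<open>a\<close> has to be new. That makes Z - a a simple factor of
  \<open>gq (a, b)\<close> and no factor of any later \<open>gq\<close>; \<open>b\<close> may recur
  further on, as can happen for shifted copies of one pair.\<close>

fun fresh :: "('a \<times> 'a) list => bool" where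
  "fresh [] \<longleftrightarrow> True"
| "fresh ((a, b) # gs) \<longleftrightarrow> a ~= b \<and> (\<forall>(c, d)\<in>set gs. a ~= c \<and> a ~= d) \<and> fresh gs"

lemma xdeg_gq: "xdeg 2 (gq g)"
proof -
  have "xdeg 2 [:gp g:]"
   by (cases g) (auto simp: xdeg_def coeff_pCons gp_def split: nat.splits)
  moreover have "xdeg 0 (gz g)"
   by (cases g) (auto simp: xdeg_def coeff_pCons gz_def split: nat.splits)
  ultimately show ?thesis unfolding gq_def using xdeg_mult by fastforce
qed

lemma gp_neq_0: "gp g ~= (0 :: 'a::idom poly)" by (cases g) (auto simp: gp_def)

lemma gp_power:
  fixes g :: "'a::prime_card mod_ring \<times> 'a mod_ring"
  shows "gp g ^ CARD('a) = poly (gz g) (monom 1 CARD('a))"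
proof -
  have p: "prime CARD('a)" by (rule prime_card)
  have char: "CHAR('a mod_ring poly) = CARD('a)" by simp
  have "[:- a, 1:] ^ CARD('a) = [:- a:] + monom 1 CARD('a)" for a :: "'a mod_ring"
  proof -
   have "[:- a, 1:] = [:- a:] + monom 1 1" by (simp add: monom_altdef)
   also have "\<dots> ^ CARD('a) = [:- a:] ^ CARD('a) + monom 1 1 ^ CARD('a)"
    using freshmans_dream[where 'a = "'a mod_ring poly"] p char by metis
   also have "[:- a:] ^ CARD('a) = [:- a:]"
    using finite_field_power_card_eq_same[of "- a"] by (simp add: poly_const_pow)
   finally show ?thesis by (simp add: monom_power)
  qed
  then show ?thesis by (cases g) (simp add: gp_def gz_def power_mult_distrib del: mult_pCons_left mult_pCons_right)
qed

lemma two_neq_0_poly: "(2 :: 'a::idom) ~= 0 ==> (2 :: 'a poly) ~= 0"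
  by (metis numeral_poly pCons_eq_0_iff)

lemma dvd_all_powers:
  fixes c :: "'a::idom poly poly"
  assumes "\<And>n. [:- r, 1:] ^ n dvd c"
  shows "c = 0"
proof (rule ccontr)
  assume "c ~= 0"
  then have "degree ([:- r, 1:] ^ Suc (degree c)) \<le> degree c" using assms dvd_imp_degree_le by blast
  then show False by (simp add: degree_linear_power del: power_Suc)
qed

lemma tsm_cancel:
  fixes c :: "'a::idom"
  shows "c ~= 0 ==> tsm c s = tsm c t ==> s = t"
proof (induction s arbitrary: t)
  case (Lf x)
  then show ?case by (cases t) auto
next
  case (Nd s1 s2)
  then show ?case by (cases t) auto
qed

lemma dvd_leaves_tsm:
  fixes c :: "'a::idom"
  assumes "\<forall>x\<in>set_mq t. c dvd x"
  obtains s where "t = tsm c s"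
proof -
  have "\<exists>s. t = tsm c s"
   using assms
  proof (induction t)
   case (Lf x)
   then obtain y where "x = c * y" by (auto elim: dvdE)
   then show ?case by (intro exI[of _ "Lf y"]) simp
  next
   case (Nd t1 t2)
   then obtain s1 s2 where "t1 = tsm c s1" "t2 = tsm c s2" by auto
   then show ?case by (intro exI[of _ "Nd s1 s2"]) simp
  qed
  then show ?thesis using that by blast
qed

text \<open>If \<open>A\<^sup>2 = q B\<^sup>2\<close> then, as \<open>Z - r\<close> divides \<open>q\<close> exactly once, infinite descent in powers of
  \<open>Z - r\<close> shows \<open>A = B = 0\<close>.\<close>

lemma square_descent:
  fixes A B :: "'a::field poly poly mq"
  assumes two: "(2 :: 'a) ~= 0" and ab: "a ~= b" and fr: "\<forall>(c, d)\<in>set gs. a ~= c \<and> a ~= d"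
   and "deep (length gs) A" "deep (length gs) B"
   and "tmul (map gq gs) A A = tsm (gq (a, b)) (tmul (map gq gs) B B)"
  shows "\<forall>c\<in>set_mq A \<union> set_mq B. [:- [:a:], 1:] ^ n dvd c"
  using assms(4-6)
proof (induction n arbitrary: A B)
  case 0
  then show ?case by simp
next
  case (Suc n)
  define z :: "'a poly poly" where "z = [:- [:a:], 1:]"
  let ?qs = "map gq gs"
  let ?h = "\<lambda>c :: 'a poly poly. poly c [:a:]"
  have za: "[:[:- a:], 1:] = z" by (simp add: z_def)
  have ev: "poly [:[:- c:], 1:] [:a:] = [:a - c:]" "poly [:x:] y = x" for c and x y :: "'a poly" by simp_all
  have z0: "z ~= 0" and hz0: "poly z [:a:] = 0" by (simp_all add: z_def)
  have hz: "?h c = 0 \<longleftrightarrow> z dvd c" for c by (simp add: poly_eq_0_iff_dvd z_def)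
  have q0: "q ~= 0" if "q \<in> set (map ?h ?qs)" for q
  proof -
   from that obtain c d where cd: "(c, d) \<in> set gs" "q = ?h (gq (c, d))" by auto
   with fr have "a ~= c" "a ~= d" by auto
   have "q = gp (c, d) * ([:a - c:] * [:a - d:])"
    unfolding cd(2) by (simp only: gq_def gz_def split poly_mult ev)
   then show ?thesis using gp_neq_0[of "(c, d)"] \<open>a ~= c\<close> \<open>a ~= d\<close> by simp
  qed
  \<comment> \<open>At Z = a all remaining q stay nonzero, so the reduced formal ring has no
    nilpotents, and a tree whose square vanishes there is divisible by Z - a.\<close>
  have red: "\<exists>s. t = tsm z s" if "deep (length gs) t" "tzero (map_mq ?h (tmul ?qs t t))" for t
  proof -
   have "map_mq ?h (tmul ?qs t t) = tmul (map ?h ?qs) (map_mq ?h t) (map_mq ?h t)"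
    by (rule tmul_map) (use that(1) in simp_all)
   with that(2) have *: "tzero (tmul (map ?h ?qs) (map_mq ?h t) (map_mq ?h t))" by (simp only:)
   have "tzero (map_mq ?h t)"
   proof (rule tmul_self_eq_0[OF two_neq_0_poly[OF two]])
    show "tzero (tmul (map ?h ?qs) (map_mq ?h t) (map_mq ?h t))" by fact
    show "deep (length (map ?h ?qs)) (map_mq ?h t)" using that(1) by simp
   qed (fact q0)
   then have "\<forall>x\<in>set_mq t. z dvd x" by (auto simp: tzero_def mq.set_map hz)
   then show ?thesis by (elim dvd_leaves_tsm) blast
  qed
  define q1 where "q1 = [:gp (a, b):] * [:[:- b:], 1:]"
  have q: "gq (a, b) = z * q1" by (simp only: gq_def gz_def q1_def za split mult_ac)
  have "tzero (map_mq ?h (tmul ?qs A A))"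
   unfolding Suc.prems(3) q by (auto simp: tzero_def mq.set_map set_tsm hz0)
  then obtain A1 where A1: "A = tsm z A1" using red Suc.prems by blast
  have d1: "deep (length gs) A1" using Suc.prems A1 by simp
  have "tsm z (tsm z (tmul ?qs A1 A1)) = tsm z (tsm q1 (tmul ?qs B B))"
   using Suc.prems(3) d1 unfolding A1 q by (simp add: tmul_tsm tsm_tsm)
  then have eq: "tsm z (tmul ?qs A1 A1) = tsm q1 (tmul ?qs B B)" using tsm_cancel z0 by blast
  have "tzero (tsm (?h q1) (map_mq ?h (tmul ?qs B B)))"
  proof -
   have "map_mq ?h (tsm c u) = tsm (?h c) (map_mq ?h u)" for c u by (induction u) simp_all
   from arg_cong[OF eq, of "map_mq ?h", unfolded this]
   have "tsm (?h q1) (map_mq ?h (tmul ?qs B B)) = tsm (?h z) (map_mq ?h (tmul ?qs A1 A1))" by (rule sym)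
   then show ?thesis by (auto simp: tzero_def set_tsm hz0)
  qed
  moreover have "?h q1 = gp (a, b) * [:a - b:]"
   by (simp only: q1_def poly_mult ev)
  then have "?h q1 ~= 0" using ab gp_neq_0[of "(a, b)"] by simp
  ultimately have "tzero (map_mq ?h (tmul ?qs B B))" by (auto simp: tzero_def set_tsm)
  then obtain B1 where B1: "B = tsm z B1" using red Suc.prems by blast
  have d2: "deep (length gs) B1" using Suc.prems B1 by simp
  have "tsm z (tmul ?qs A1 A1) = tsm z (tsm (gq (a, b)) (tmul ?qs B1 B1))"
   using eq d2 unfolding B1 by (simp add: tmul_tsm tsm_tsm q mult_ac)
  then have "tmul ?qs A1 A1 = tsm (gq (a, b)) (tmul ?qs B1 B1)" using tsm_cancel z0 by blast
  from Suc.IH[OF d1 d2 this] have "\<forall>c\<in>set_mq A1 \<union> set_mq B1. z ^ n dvd c" unfolding z_def .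
  then show ?case unfolding A1 B1 z_def[symmetric] by (auto simp: set_tsm intro!: mult_dvd_mono)
qed

text \<open>The exponent serves twice: the square is a polynomial in X and X^p, and the value equals
  that of \<open>gp g\<close> wherever the power with exponent (p - 1)/2 is 1.\<close>

definition gv :: "'a::prime_card mod_ring \<times> 'a mod_ring => 'a mod_ring poly" where
  "gv g = gp g ^ ((CARD('a) + 1) div 2)"

lemma gv_square:
  fixes g :: "'a::prime_card mod_ring \<times> 'a mod_ring"
  assumes "odd CARD('a)"
  shows "gv g * gv g = poly (gq g) (monom 1 CARD('a))"
proof -
  have "gv g * gv g = gp g ^ (((CARD('a) + 1) div 2) * 2)" by (simp add: gv_def power_mult power2_eq_square)
  also have "((CARD('a) + 1) div 2) * 2 = CARD('a) + 1" using assms by (metis dvd_div_mult_self even_Suc Suc_eq_plus1)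
  finally show ?thesis by (simp add: gp_power gq_def)
qed

lemma two_neq_0:
  assumes "odd CARD('a::prime_card)"
  shows "(2 :: 'a mod_ring) ~= 0"
proof
  assume "(2 :: 'a mod_ring) = 0"
  then have "CARD('a) dvd 2" using of_nat_0_mod_ring_dvd[of 2, where 'a = 'a] by simp
  then have "CARD('a) = 2" by (intro primes_dvd_imp_eq prime_card two_is_prime_nat)
  then show False using assms by simp
qed

text \<open>A relation A + v B = 0 gives A^2 = q B^2, in which v no longer occurs. By the induction
  hypothesis this holds already formally, and then the descent at Z = a kills A and B. Squaring
  doubles the degree in X at each step; the power of 2 in the smallness condition pays for
  that.\<close>

theorem independence:
  fixes gs :: "('a::prime_card mod_ring \<times> 'a mod_ring) list"
  assumes odd: "odd CARD('a)"
   and "fresh gs" "deep (length gs) t" "\<forall>c\<in>set_mq t. xdeg d c"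
   and "2 ^ length gs * (d + 2 * length gs) < CARD('a)"
   and "teval (map gv gs) (map_mq (\<lambda>c. poly c (monom 1 CARD('a))) t) = 0"
  shows "tzero t"
  using assms(2-)
proof (induction gs arbitrary: t d)
  case Nil
  then show ?case by (auto simp: deep_0_iff poly_monom_eq_0)
next
  case (Cons g gs)
  obtain a b where g: "g = (a, b)" by (cases g)
  obtain A B where t: "t = Nd A B" and AB: "deep (length gs) A" "deep (length gs) B"
   using Cons.prems(2) by (auto simp: deep_Suc_iff)
  let ?p = "CARD('a)" and ?qs = "map gq gs"
  let ?h = "\<lambda>c. poly c (monom 1 ?p) :: 'a mod_ring poly"
  let ?vs = "map gv gs"
  note two = two_neq_0[OF odd] and vv = gv_square[OF odd]
  have all2: "list_all2 (\<lambda>v q. v * v = q) ?vs (map ?h ?qs)"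
   by (simp add: list_all2_conv_all_nth vv)
  have ev: "teval ?vs (map_mq ?h (tmul ?qs u u)) = teval ?vs (map_mq ?h u) * teval ?vs (map_mq ?h u)"
   if "deep (length gs) u" for u
   using that tmul_map[of ?h ?qs u u] teval_tmul[OF all2, of "map_mq ?h u" "map_mq ?h u"] by simp
  define T where "T = tadd (tmul ?qs A A) (tsm (- 1) (tsm (gq g) (tmul ?qs B B)))"
  have hs: "map_mq ?h (tsm c u) = tsm (?h c) (map_mq ?h u)" for c u by (induction u) simp_all
  have "tzero T"
  proof (rule Cons.IH)
   show "fresh gs" using Cons.prems(1) g by simp
   show "deep (length gs) T" using AB unfolding T_def by (intro deep_tadd) (auto simp: deep_tmul)
   show "teval ?vs (map_mq ?h T) = 0"
   proof -
    have "teval ?vs (map_mq ?h A) + gv g * teval ?vs (map_mq ?h B) = 0"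
     using Cons.prems(5) t by simp
    then have "teval ?vs (map_mq ?h A) = - (gv g * teval ?vs (map_mq ?h B))" by (simp add: eq_neg_iff_add_eq_0)
    then have "teval ?vs (map_mq ?h A) * teval ?vs (map_mq ?h A)
     = (gv g * gv g) * (teval ?vs (map_mq ?h B) * teval ?vs (map_mq ?h B))"
     by (simp add: mult_ac)
    then show ?thesis unfolding T_def using AB
     by (subst tadd_map[where n = "length gs"])
     (auto simp: deep_tmul teval_tadd teval_tsm hs ev vv)
   qed
   have xA: "\<forall>c\<in>set_mq A. xdeg d c" "\<forall>c\<in>set_mq B. xdeg d c" using Cons.prems(3) t by auto
   \<comment> \<open>Squaring turns \<open>d\<close> into \<open>2 * d\<close>; the remaining
     \<open>length gs\<close> levels and the factor \<open>gq g\<close> add 2 each.\<close>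
   let ?e = "2 * d + 2 * length (g # gs)"
   have x1: "\<forall>c\<in>set_mq (tmul ?qs A A). xdeg (2 * d + 2 * length gs) c"
    "\<forall>c\<in>set_mq (tmul ?qs B B). xdeg (2 * d + 2 * length gs) c"
    using xdeg_tmul[of ?qs A A d d] xdeg_tmul[of ?qs B B d d] AB xA
    by (auto simp: mult_2 xdeg_gq)
   have "xdeg ?e (gq g * x)" if "xdeg (2 * d + 2 * length gs) x" for x
    using xdeg_mult[OF xdeg_gq that] by simp
   then show "\<forall>c\<in>set_mq T. xdeg ?e c"
    unfolding T_def
   proof (intro xdeg_tadd[where n = "length gs"])
    have "2 * d + 2 * length gs \<le> ?e" by simp
    then show "\<forall>c\<in>set_mq (tmul ?qs A A). xdeg ?e c" using x1(1) xdeg_mono by blast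
   qed (use x1 AB in \<open>auto simp: deep_tmul set_tsm intro!: xdeg_minus\<close>)
   show "2 ^ length gs * (?e + 2 * length gs) < ?p"
   proof -
    have "2 ^ length gs * (?e + 2 * length gs) \<le> 2 ^ length (g # gs) * (d + 2 * length (g # gs))"
     by (simp add: algebra_simps)
    then show ?thesis using Cons.prems(4) by linarith
   qed
  qed
  then have eq: "tmul ?qs A A = tsm (gq (a, b)) (tmul ?qs B B)"
   unfolding T_def g[symmetric] using AB by (intro tadd_eq_0[where n = "length gs"]) (auto simp: deep_tmul)
  have "c = 0" if "c \<in> set_mq A \<union> set_mq B" for c
  proof (rule dvd_all_powers[of "[:a:]"])
   show "[:- [:a:], 1:] ^ n dvd c" for n
    using square_descent[OF two _ _ AB eq, of n] Cons.prems(1) that g by auto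
  qed
  then show ?case by (auto simp: t tzero_def)
qed

section \<open>Stepanov's auxiliary polynomial\<close>

fun tder :: "'a::idom poly => 'a poly => 'a poly list => 'a poly mq => 'a poly mq" where
  "tder G k [] (Lf c) = Lf (G * pderiv c + k * c)"
| "tder G k (w # ws) (Nd A B) = Nd (tder G k ws A) (tder G (k + w) ws B)"
| "tder G k _ _ = Lf 0"

lemma deep_tder: "length ws = n ==> deep n t ==> deep n (tder G k ws t)"
  by (induction ws arbitrary: n t k) (auto simp: deep_0_iff deep_Suc_iff)

text \<open>Since G v' = w v, the operator G d/dX maps every product of the v to a polynomial
  multiple of itself, so derivatives of a combination keep its shape and only the leaves change.
  \<open>k\<close> collects the sum of the \<open>w\<close> along a branch, and G is a common
  denominator of the logarithmic derivatives.\<close>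

lemma teval_tder:
  assumes "list_all2 (\<lambda>v w. G * pderiv v = w * v) vs ws" "deep (length vs) t"
  shows "teval vs (tder G k ws t) = G * pderiv (teval vs t) + k * teval vs t"
  using assms
proof (induction vs ws arbitrary: t k rule: list_all2_induct)
  case Nil
  then show ?case by (auto simp: deep_0_iff)
next
  case (Cons v vs w ws)
  then obtain A B where t: "t = Nd A B" "deep (length vs) A" "deep (length vs) B"
   by (auto simp: deep_Suc_iff)
  have "teval (v # vs) (tder G k (w # ws) t)
    = G * pderiv (teval vs A) + k * teval vs A + v * (G * pderiv (teval vs B)) + k * (v * teval vs B) + (w * v) * teval vs B"
   using t Cons.IH by (simp add: algebra_simps)
  also have "w * v = G * pderiv v" using Cons.hyps(1) by simp
  finally show ?case using t by (simp add: pderiv_add pderiv_mult algebra_simps)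
qed

lemma tder_tadd:
  "length ws = n ==> deep n s ==> deep n t ==> tder G k ws (tadd s t) = tadd (tder G k ws s) (tder G k ws t)"
  by (induction ws arbitrary: n s t k) (auto simp: deep_0_iff deep_Suc_iff pderiv_add algebra_simps)

lemma tder_neg: "length ws = n ==> deep n t ==> tder G k ws (tsm (- 1) t) = tsm (- 1) (tder G k ws t)"
  by (induction ws arbitrary: n t k) (auto simp: deep_0_iff deep_Suc_iff pderiv_minus)

lemma tder_degree:
  assumes "degree G \<le> e" "degree k \<le> e" "\<forall>w\<in>set ws. degree w \<le> e" "deep (length ws) t"
   "\<forall>c\<in>set_mq t. degree c \<le> d"
  shows "\<forall>c\<in>set_mq (tder G k ws t). degree c \<le> d + e"
  using assms
proof (induction ws arbitrary: t k)
  case Nil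
  then obtain c where c: "t = Lf c" "degree c \<le> d" by (auto simp: deep_0_iff)
  have "degree (G * pderiv c) \<le> d + e"
   using degree_mult_le[of G "pderiv c"] degree_pderiv_le[of c] c(2) Nil.prems(1) by linarith
  moreover have "degree (k * c) \<le> d + e"
   using degree_mult_le[of k c] c(2) Nil.prems(2) by linarith
  ultimately show ?case using c(1) by (auto intro: degree_add_le)
next
  case (Cons w ws)
  from Cons.prems(4) obtain A B where t: "t = Nd A B" "deep (length ws) A" "deep (length ws) B"
   by (auto simp: deep_Suc_iff)
  have dAB: "\<forall>c\<in>set_mq A. degree c \<le> d" "\<forall>c\<in>set_mq B. degree c \<le> d" and ws: "\<forall>w\<in>set ws. degree w \<le> e"
   using Cons.prems(3,5) t(1) by auto
  have "degree (k + w) \<le> e" using Cons.prems(2,3) by (intro degree_add_le) simp_all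
  note Cons.IH[OF Cons.prems(1,2) ws t(2) dAB(1)] Cons.IH[OF Cons.prems(1) this ws t(3) dAB(2)]
  with t(1) show ?case by auto
qed

lemma teval_degree:
  assumes "\<forall>v\<in>set vs. degree v \<le> e" "deep (length vs) t" "\<forall>c\<in>set_mq t. degree c \<le> d"
  shows "degree (teval vs t) \<le> d + length vs * e"
  using assms
proof (induction vs arbitrary: t)
  case (Cons v vs)
  from Cons.prems(2) obtain A B where t: "t = Nd A B" "deep (length vs) A" "deep (length vs) B"
   by (auto simp: deep_Suc_iff)
  have dAB: "\<forall>c\<in>set_mq A. degree c \<le> d" "\<forall>c\<in>set_mq B. degree c \<le> d"
   and vs: "\<forall>v\<in>set vs. degree v \<le> e" "degree v \<le> e"
   using Cons.prems(1,3) t(1) by auto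
  note IH = Cons.IH[OF vs(1) t(2) dAB(1)] Cons.IH[OF vs(1) t(3) dAB(2)]
  have "degree (v * teval vs B) \<le> d + length (v # vs) * e"
   using degree_mult_le[of v "teval vs B"] vs(2) IH(2) by simp
  moreover have "degree (teval vs A) \<le> d + length (v # vs) * e" using IH(1) by simp
  ultimately show ?case unfolding t(1) teval.simps by (rule degree_add_le[rotated])
qed (auto simp: deep_0_iff)

lemma poly_teval_cong:
  assumes "list_all2 (\<lambda>v w. poly v x = poly w x) vs ws" "deep (length vs) t"
  shows "poly (teval vs t) x = poly (teval ws t) x"
  using assms
  by (induction vs ws arbitrary: t rule: list_all2_induct) (auto simp: deep_0_iff deep_Suc_iff)

lemma card_polys:
  "finite {q :: 'a::{finite,zero} poly. degree q \<le> d}"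
  "card {q :: 'a::{finite,zero} poly. degree q \<le> d} = CARD('a) ^ Suc d"
proof -
  let ?f = "\<lambda>q :: 'a poly. map (coeff q) [0..<Suc d]"
  have bij: "bij_betw ?f {q. degree q \<le> d} {xs. set xs \<subseteq> UNIV \<and> length xs = Suc d}"
  proof (rule bij_betw_byWitness[where f' = Poly])
   show "\<forall>q\<in>{q. degree q \<le> d}. Poly (?f q) = q"
    by (auto intro!: poly_eqI simp: nth_default_def coeff_eq_0 simp del: upt_Suc)
   show "\<forall>xs\<in>{xs. set xs \<subseteq> UNIV \<and> length xs = Suc d}. ?f (Poly xs) = xs"
    by (auto intro!: nth_equalityI simp: nth_default_def simp del: upt_Suc)
   show "Poly ` {xs. set xs \<subseteq> UNIV \<and> length xs = Suc d} \<subseteq> {q. degree q \<le> d}"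
    by (auto intro!: degree_le simp: nth_default_def)
  qed auto
  have "finite {xs :: 'a list. set xs \<subseteq> UNIV \<and> length xs = Suc d}"
   by (rule finite_lists_length_eq) simp
  then show "finite {q :: 'a poly. degree q \<le> d}" by (simp only: bij_betw_finite[OF bij])
  have "card {xs :: 'a list. set xs \<subseteq> UNIV \<and> length xs = Suc d} = CARD('a) ^ Suc d"
   by (rule card_lists_length_eq) simp
  then show "card {q :: 'a poly. degree q \<le> d} = CARD('a) ^ Suc d"
   by (simp only: bij_betw_same_card[OF bij])
qed

lemma card_trees:
  assumes "finite U"
  shows "finite {t. deep n t \<and> set_mq t \<subseteq> U} \<and> card {t. deep n t \<and> set_mq t \<subseteq> U} = card U ^ (2 ^ n)"
proof -
  define S where "S = (\<lambda>n. {t. deep n t \<and> set_mq t \<subseteq> U})"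
  have "finite (S n) \<and> card (S n) = card U ^ (2 ^ n)"
  proof (induction n)
   case 0
   have "S 0 = Lf ` U" by (auto simp: S_def deep_0_iff)
   then show ?case using assms by (simp add: card_image inj_on_def)
  next
   case (Suc n)
   have eq: "S (Suc n) = (\<lambda>x. Nd (fst x) (snd x)) ` (S n \<times> S n)"
   proof (intro equalityI subsetI)
    fix t assume "t \<in> S (Suc n)"
    then obtain A B where "t = Nd A B" "A \<in> S n" "B \<in> S n" by (auto simp: deep_Suc_iff S_def)
    then show "t \<in> (\<lambda>x. Nd (fst x) (snd x)) ` (S n \<times> S n)"
     by (intro image_eqI[of _ _ "(A, B)"]) simp_all
   next
    fix t assume "t \<in> (\<lambda>x. Nd (fst x) (snd x)) ` (S n \<times> S n)"
    then show "t \<in> S (Suc n)" by (auto simp: S_def)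
   qed
   have "inj_on (\<lambda>x. Nd (fst x) (snd x)) (S n \<times> S n)" by (auto simp: inj_on_def)
   then have "card (S (Suc n)) = card (S n) * card (S n)"
    unfolding eq by (simp only: card_image card_cartesian_product)
   also have "\<dots> = card U ^ (2 ^ n + 2 ^ n)" unfolding power_add using Suc by simp
   also have "2 ^ n + 2 ^ n = (2 :: nat) ^ Suc n" by simp
   finally have "card (S (Suc n)) = card U ^ (2 ^ Suc n)" .
   moreover have "finite (S (Suc n))"
    unfolding eq using Suc by (intro finite_imageI finite_cartesian_product) simp_all
   ultimately show ?case by simp
  qed
  then show ?thesis unfolding S_def .
qed

text \<open>A dimension count done with cardinalities: \<open>2 ^ n * Suc d\<close> free
  coefficients face L conditions, each a polynomial of degree at most \<open>d + e * L\<close>. Over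
  a finite field the pigeonhole principle yields two trees with the same image, and their difference
  is the required element of the kernel.\<close>

lemma exists_annihilated_tree:
  fixes G :: "'a::{finite,field} poly"
  assumes len: "length gs = n" "length ws = n"
   and deg: "degree G \<le> e" "\<forall>w\<in>set ws. degree w \<le> e" "\<forall>g\<in>set gs. degree g \<le> 2" "2 * n \<le> e"
   and count: "L * Suc (d + e * L) < 2 ^ n * Suc d"
  obtains t where "deep n t" "\<forall>c\<in>set_mq t. degree c \<le> d" "\<not> tzero t"
   "\<forall>l<L. teval gs ((tder G 0 ws ^^ l) t) = 0"
proof -
  define T where "T = {t :: 'a poly mq. deep n t \<and> set_mq t \<subseteq> {c. degree c \<le> d}}"
  define Y where "Y = {q :: 'a poly. degree q \<le> d + e * L}"
  define f where "f = (\<lambda>t :: 'a poly mq. map (\<lambda>l. teval gs ((tder G 0 ws ^^ l) t)) [0..<L])"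
  have dl: "deep n ((tder G 0 ws ^^ l) t)" if "deep n t" for l t
   using that by (induction l) (auto intro: deep_tder len)
  have fT: "f ` T \<subseteq> {xs. set xs \<subseteq> Y \<and> length xs = L}"
  proof -
   have "teval gs ((tder G 0 ws ^^ l) t) \<in> Y" if "l < L" "t \<in> T" for l t
   proof -
    have t: "deep n t" "\<forall>c\<in>set_mq t. degree c \<le> d" using that by (auto simp: T_def)
    have "\<forall>c\<in>set_mq ((tder G 0 ws ^^ l) t). degree c \<le> d + e * l"
    proof (induction l)
     case (Suc l)
     then show ?case using tder_degree[of G e 0 ws "(tder G 0 ws ^^ l) t" "d + e * l"] deg len dl t(1)
     by (simp add: algebra_simps)
    qed (use t in simp)
    then have "degree (teval gs ((tder G 0 ws ^^ l) t)) \<le> d + e * l + length gs * 2"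
     using teval_degree[of gs 2 "(tder G 0 ws ^^ l) t" "d + e * l"] deg len dl t(1) by simp
    \<comment> \<open>The products of \<open>gs\<close> have degree at most \<open>2 * n\<close>,
      hence at most \<open>e\<close>; as l < L, the target degree has room for one more
      \<open>e\<close>.\<close>
    also have "\<dots> \<le> d + e * l + e" using deg len by simp
    also have "\<dots> \<le> d + e * L" using mult_le_mono2[of "Suc l" L e] that by simp
    finally show ?thesis by (simp add: Y_def)
   qed
   then show ?thesis by (auto simp: f_def)
  qed
  have fin: "finite {xs. set xs \<subseteq> Y \<and> length xs = L}"
   by (rule finite_lists_length_eq) (simp add: Y_def card_polys)
  have "card {xs. set xs \<subseteq> Y \<and> length xs = L} = (CARD('a) ^ Suc (d + e * L)) ^ L"
   by (subst card_lists_length_eq) (simp_all add: Y_def card_polys)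
  also have "\<dots> = CARD('a) ^ (L * Suc (d + e * L))" by (simp only: power_mult[symmetric] mult.commute)
  also have "\<dots> < CARD('a) ^ (2 ^ n * Suc d)"
  proof (intro power_strict_increasing count)
   have "card {0 :: 'a, 1} \<le> CARD('a)" by (rule card_mono) auto
   then show "1 < CARD('a)" by simp
  qed
  also have "\<dots> = card T"
   unfolding T_def using card_trees[of "{c :: 'a poly. degree c \<le> d}" n, OF card_polys(1)]
   by (simp only: card_polys power_mult[symmetric] mult.commute[of "Suc d"])
  finally have "card (f ` T) < card T" using card_mono[OF fin fT] by linarith
  then have "\<not> inj_on f T" using pigeonhole by blast
  then obtain s t where st: "s \<in> T" "t \<in> T" "s ~= t" "f s = f t" by (auto simp: inj_on_def)
  define u where "u = tadd s (tsm (- 1) t)"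
  have ds: "deep n s" "deep n t" using st by (auto simp: T_def)
  show ?thesis
  proof (rule that[of u])
   show "deep n u" using ds by (simp add: u_def deep_tadd)
   show "\<forall>c\<in>set_mq u. degree c \<le> d"
    using set_mq_tadd[of n s "tsm (- 1) t"] ds st
    by (fastforce simp: u_def T_def set_tsm intro!: degree_add_le degree_diff_le)
   show "\<not> tzero u" using tadd_eq_0[OF ds] st(3) by (auto simp: u_def)
   have lin: "(tder G 0 ws ^^ l) u = tadd ((tder G 0 ws ^^ l) s) (tsm (- 1) ((tder G 0 ws ^^ l) t))" for l
    by (induction l) (simp_all add: u_def tder_tadd[OF len(2)] tder_neg[OF len(2)] dl ds)
   show "\<forall>l<L. teval gs ((tder G 0 ws ^^ l) u) = 0"
   proof (intro allI impI)
    fix l assume "l < L"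
    then have "f s ! l = f t ! l" using st(4) by simp
    then have "teval gs ((tder G 0 ws ^^ l) s) = teval gs ((tder G 0 ws ^^ l) t)"
     using \<open>l < L\<close> by (simp add: f_def)
    then show "teval gs ((tder G 0 ws ^^ l) u) = 0"
     unfolding lin by (simp add: teval_tadd teval_tsm dl ds len)
   qed
  qed
qed

lemma of_nat_neq_0:
  assumes "0 < k" "k < CARD('a::prime_card)"
  shows "(of_nat k :: 'a mod_ring) ~= 0"
  using of_nat_0_mod_ring_dvd[of k, where 'a = 'a] assms dvd_imp_le[of "CARD('a)" k] by linarith

text \<open>G d/dX lowers the multiplicity of x by exactly one, because the factor produced by
  differentiation is a multiplicity below p and hence not zero in characteristic p.\<close>

lemma iterated_derivative_neq_0:
  fixes G F H :: "'a::prime_card mod_ring poly"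
  assumes "poly G x ~= 0" "F = [:- x, 1:] ^ k * H" "poly H x ~= 0" "k < CARD('a)"
  shows "poly (((\<lambda>F. G * pderiv F) ^^ k) F) x ~= 0"
  using assms(2-)
proof (induction k arbitrary: F H)
  case (Suc k)
  define U :: "'a mod_ring poly" where "U = [:- x, 1:]"
  define H1 where "H1 = G * (of_nat (Suc k) * H + U * pderiv H)"
  have pU: "pderiv U = 1" and U0: "poly U x = 0" by (simp_all add: U_def pderiv_pCons)
  have pUk: "pderiv (U ^ Suc k) = of_nat (Suc k) * U ^ k"
   unfolding pderiv_power_Suc pU by (simp add: of_nat_poly)
  have "G * pderiv F = U ^ k * H1"
   unfolding Suc.prems(1) U_def[symmetric] pderiv_mult pUk H1_def by (simp add: algebra_simps del: of_nat_Suc)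
  moreover have "poly H1 x ~= 0"
   using assms(1) Suc.prems(2,3) of_nat_neq_0[of "Suc k", where 'a = 'a]
   by (simp add: H1_def U0 of_nat_poly del: of_nat_Suc)
  ultimately have "poly (((\<lambda>F. G * pderiv F) ^^ k) (G * pderiv F)) x ~= 0"
   using Suc.IH[of "G * pderiv F" H1] Suc.prems(3) unfolding U_def by simp
  then show ?case unfolding funpow_Suc_right o_apply .
qed simp

lemma order_ge:
  fixes G F :: "'a::prime_card mod_ring poly"
  assumes "F ~= 0" "poly G x ~= 0" "L \<le> CARD('a)" "\<forall>l<L. poly (((\<lambda>F. G * pderiv F) ^^ l) F) x = 0"
  shows "L \<le> order x F"
proof (rule ccontr)
  assume *: "\<not> L \<le> order x F"
  obtain H where H: "F = [:- x, 1:] ^ order x F * H" "\<not> [:- x, 1:] dvd H"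
   using order_decomp[OF assms(1), of x] by (elim exE conjE) (rule that)
  have "poly H x ~= 0" using H(2) by (simp add: poly_eq_0_iff_dvd)
  moreover have "order x F < CARD('a)" using * assms(3) by simp
  ultimately have "poly (((\<lambda>F. G * pderiv F) ^^ order x F) F) x ~= 0"
   by (rule iterated_derivative_neq_0[OF assms(2) H(1)])
  moreover have "order x F < L" using * by simp
  ultimately show False using assms(4) by simp
qed

lemma sum_order_le_degree:
  fixes F :: "'a::field poly"
  assumes "F ~= 0" "finite S" "\<And>x. x \<in> S ==> L \<le> order x F"
  shows "L * card S \<le> degree F"
proof (cases "L = 0")
  case False
  have "L * card S = (\<Sum>x\<in>S. L)" by simp
  also have "\<dots> \<le> (\<Sum>x\<in>S. count (proots F) x)" using assms by (intro sum_mono) simp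
  also have "\<dots> \<le> (\<Sum>x\<in>set_mset (proots F). count (proots F) x)"
  proof (rule sum_mono2)
   show "S \<subseteq> set_mset (proots F)" using assms False by (fastforce simp: order_root)
  qed auto
  also have "\<dots> = size (proots F)" by (simp add: size_multiset_overloaded_eq)
  also have "\<dots> \<le> degree F" by (rule size_proots_le)
  finally show ?thesis .
qed simp

lemma degree_gp: "degree (gp g :: 'a::idom poly) = 2"
  by (cases g) (simp add: gp_def degree_mult_eq del: mult_pCons_left mult_pCons_right)

lemma degree_prod_gp: "degree (prod_list (map gp gs) :: 'a::idom poly) \<le> 2 * length gs"
proof (induction gs)
  case (Cons g gs)
  then show ?case using degree_mult_le[of "gp g" "prod_list (map gp gs)"] degree_gp[of g] by simp
qed simp

lemma gp_mult_div:
  assumes "g \<in> set gs"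
  shows "prod_list (map gp gs) = (gp g :: 'a::field poly) * (prod_list (map gp gs) div gp g)"
proof -
  have "gp g dvd prod_list (map gp gs)"
   using assms by (induction gs) auto
  then show ?thesis by (rule dvd_mult_div_cancel[symmetric])
qed

text \<open>At the points counted here \<open>gv g\<close> and \<open>gp g\<close> take the same
  value. So the derivatives of F, a combination of the \<open>gv\<close>, agree there with the
  low-degree combinations of the \<open>gp\<close>, and those were made to vanish identically. Hence
  F has a zero of order at least L at every such point, while its degree is about
  \<open>r * (p + 1)\<close>.\<close>

theorem stepanov_bound:
  fixes gs :: "('a::prime_card mod_ring \<times> 'a mod_ring) list"
  assumes odd: "odd CARD('a)" and "fresh gs" and r: "length gs = r" and "2 * L \<le> 2 ^ r" "0 < L"
   and small: "2 ^ r * (2 * r * L + 2 * r) < CARD('a)"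
  shows "L * card {x. \<forall>g\<in>set gs. poly (gp g) x ^ ((CARD('a) - 1) div 2) = 1} \<le> 2 * r * L + r * (CARD('a) + 1)"
   (is "L * card ?S \<le> _")
proof -
  let ?p = "CARD('a)" and ?k = "(CARD('a) + 1) div 2"
  define G where "G = prod_list (map gp gs)"
  \<comment> \<open>\<open>gv g\<close> is a power of \<open>gp g\<close> with exponent
    \<open>?k\<close>, so these are its logarithmic derivatives multiplied by G.\<close>
  define ws where "ws = map (\<lambda>g. of_nat ?k * pderiv (gp g) * (G div gp g)) gs"
  let ?vs = "map gv gs" and ?gs = "map gp gs"
  let ?d = "2 * r * L"
  have dG: "degree G \<le> 2 * r" unfolding G_def using degree_prod_gp[of gs] r by (simp only:)
  have gG: "G = gp g * (G div gp g)" if "g \<in> set gs" for g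
   unfolding G_def by (rule gp_mult_div[OF that])
  have dw: "\<forall>w\<in>set ws. degree w \<le> 2 * r"
  proof
   fix w assume "w \<in> set ws"
   then obtain g where g: "g \<in> set gs" "w = of_nat ?k * pderiv (gp g) * (G div gp g)"
    unfolding ws_def set_map by blast
   have "degree (G div gp g) + 2 \<le> 2 * r"
   proof (cases "G div gp g = 0")
    case True
    have "0 < r" using g(1) r by (cases gs) auto
    then show ?thesis using True by simp
   next
    case False
    then have "degree G = 2 + degree (G div gp g)"
     using gG[OF g(1)] degree_mult_eq[of "gp g" "G div gp g"] gp_neq_0[of g] degree_gp[of g] by metis
    then show ?thesis using dG by simp
   qed
   moreover have "degree w \<le> degree (of_nat ?k * pderiv (gp g)) + degree (G div gp g)"
    unfolding g(2) by (rule degree_mult_le)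
   moreover have "degree (of_nat ?k * pderiv (gp g)) \<le> 2"
    by (rule order_trans[OF degree_mult_le]) (simp add: order_trans[OF degree_pderiv_le] degree_gp)
   ultimately show "degree w \<le> 2 * r" by linarith
  qed
  obtain t where t: "deep r t" "\<forall>c\<in>set_mq t. degree c \<le> ?d" "\<not> tzero t"
   "\<forall>l<L. teval ?gs ((tder G 0 ws ^^ l) t) = 0"
  proof (rule exists_annihilated_tree[of ?gs r ws G "2 * r" L ?d])
   show "length ?gs = r" "length ws = r" using r by (simp_all add: ws_def)
   show "degree G \<le> 2 * r" "\<forall>w\<in>set ws. degree w \<le> 2 * r" by (fact dG, fact dw)
   show "\<forall>g\<in>set ?gs. degree g \<le> 2" by (simp add: degree_gp)
   \<comment> \<open>With \<open>?d = 2 * r * L\<close> the degree growth under L derivations equals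
     the initial degree, so \<open>2 * L\<close> leaf coefficients per degree are enough for L
     conditions.\<close>
   have "L * Suc (?d + 2 * r * L) < 2 * L * Suc ?d" using \<open>0 < L\<close> by simp
   also have "2 * L * Suc ?d \<le> 2 ^ r * Suc ?d" using assms(4) by (rule mult_le_mono1)
   finally show "L * Suc (?d + 2 * r * L) < 2 ^ r * Suc ?d" .
  qed (rule order_refl, rule that, assumption+)
  define F where "F = teval ?vs t"
  have "F ~= 0"
  proof
   assume "F = 0"
   have "tzero (map_mq (\<lambda>c. [:c:]) t)"
   proof (rule independence[OF odd assms(2)])
    show "deep (length gs) (map_mq (\<lambda>c. [:c:]) t)" using t r by simp
    show "\<forall>c\<in>set_mq (map_mq (\<lambda>c. [:c:]) t). xdeg ?d c"
     using t(2) by (auto simp: mq.set_map xdeg_def coeff_pCons split: nat.splits)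
    show "2 ^ length gs * (?d + 2 * length gs) < ?p" using small r by simp
    have "map_mq (\<lambda>c. poly c (monom 1 ?p)) (map_mq (\<lambda>c. [:c:]) t) = t"
     by (simp add: mq.map_comp comp_def mq.map_ident)
    then show "teval ?vs (map_mq (\<lambda>c. poly c (monom 1 ?p)) (map_mq (\<lambda>c. [:c:]) t)) = 0"
     using \<open>F = 0\<close> by (simp add: F_def)
   qed
   then show False using t(3) by (auto simp: tzero_def mq.set_map)
  qed
  have gv': "G * pderiv (gv g) = (of_nat ?k * pderiv (gp g) * (G div gp g)) * gv g" if "g \<in> set gs" for g
  proof -
   obtain k where k: "?k = Suc k" using odd by (cases ?k) (auto elim: oddE)
   have "pderiv (gv g) = of_nat ?k * gp g ^ k * pderiv (gp g)"
    unfolding gv_def k pderiv_power_Suc by (simp add: of_nat_poly mult_ac)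
   then have "G * pderiv (gv g) = gp g * (G div gp g) * (of_nat ?k * gp g ^ k * pderiv (gp g))"
    using gG[OF that] by metis
   then show ?thesis unfolding gv_def k by (simp add: mult_ac)
  qed
  have all2: "list_all2 (\<lambda>v w. G * pderiv v = w * v) ?vs ws"
   unfolding ws_def using gv' by (auto simp: list_all2_conv_all_nth)
  have dl: "deep r ((tder G 0 ws ^^ l) t)" for l
   using t(1) r by (induction l) (auto intro!: deep_tder simp: ws_def)
  have Fl: "((\<lambda>F. G * pderiv F) ^^ l) F = teval ?vs ((tder G 0 ws ^^ l) t)" for l
  proof (induction l)
   case (Suc l)
   then show ?case using teval_tder[OF all2, of "(tder G 0 ws ^^ l) t" 0] dl r by simp
  qed (simp add: F_def)
  have "L \<le> order x F" if x: "x \<in> ?S" for x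
  proof (rule order_ge[OF \<open>F ~= 0\<close>])
   have p1: "0 < (?p - 1) div 2"
   proof -
    have "?p ~= 1" "?p ~= 0" using prime_card[where 'a = 'a] by auto
    then show ?thesis using odd by (auto elim!: oddE)
   qed
   have nz: "poly (gp g) x ~= 0" if "g \<in> set gs" for g
   proof
    assume "poly (gp g) x = 0"
    moreover have "poly (gp g) x ^ ((?p - 1) div 2) = 1" using that x by blast
    ultimately show False using p1 by (simp add: power_0_left)
   qed
   then show "poly G x ~= 0" unfolding G_def by (induction gs) auto
   have "1 * L \<le> 2 ^ r * (2 * r * L + 2 * r)" if "0 < r"
    using that by (intro mult_le_mono) (auto intro: trans_le_add1)
   moreover have "L = 0" if "r = 0" using assms(4) that by simp
   ultimately show "L \<le> ?p" using small by (cases "r = 0") auto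
   have "?k = Suc ((?p - 1) div 2)" using odd by (auto elim!: oddE)
   then have "poly (gv g) x = poly (gp g) x" if "g \<in> set gs" for g
    using x that by (simp add: gv_def)
   then have "list_all2 (\<lambda>v w. poly v x = poly w x) ?vs ?gs" by (simp add: list_all2_conv_all_nth)
   then have "poly (teval ?vs ((tder G 0 ws ^^ l) t)) x = poly (teval ?gs ((tder G 0 ws ^^ l) t)) x" for l
    using dl r by (intro poly_teval_cong) auto
   then show "\<forall>l<L. poly (((\<lambda>F. G * pderiv F) ^^ l) F) x = 0" using t(4) by (simp add: Fl)
  qed
  then have "L * card ?S \<le> degree F" by (intro sum_order_le_degree \<open>F ~= 0\<close>) auto
  also have "\<dots> \<le> ?d + r * (2 * ?k)"
   unfolding F_def
  proof (rule order_trans[OF teval_degree])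
   show "\<forall>v\<in>set ?vs. degree v \<le> 2 * ?k"
    by (auto simp: gv_def degree_power_eq gp_neq_0 degree_gp)
  qed (use t r in auto)
  also have "2 * ?k = ?p + 1" using odd by (auto elim!: oddE)
  finally show ?thesis .
qed

section \<open>Shifts that fail to separate two elements\<close>

fun shifts :: "'a::comm_ring_1 => 'a => nat => ('a \<times> 'a) list" where
  "shifts a b 0 = []"
| "shifts a b (Suc i) = (- (a + of_nat i), - (b + of_nat i)) # shifts a b i"

lemma set_shifts: "set (shifts a b r) = {(- (a + of_nat i), - (b + of_nat i)) |i. i < r}"
  by (induction r) (auto simp: less_Suc_eq)

lemma length_shifts [simp]: "length (shifts a b r) = r" by (induction r) auto

text \<open>The largest shift stands at the head of the list. Its first component could meet a later
  entry only through a + k = b with 0 < k < r, which is excluded; b + k = a remains possible and is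
  harmless.\<close>

lemma fresh_shifts:
  fixes a b :: "'a::prime_card mod_ring"
  assumes "a ~= b" "r \<le> CARD('a)" "\<forall>k. 0 < k \<and> k < r --> a + of_nat k ~= b"
  shows "fresh (shifts a b r)"
  using assms(2,3)
proof (induction r)
  case (Suc r)
  have "a + of_nat r ~= a + of_nat i \<and> a + of_nat r ~= b + of_nat i" if "i < r" for i
  proof -
   have r: "(of_nat r :: 'a mod_ring) = of_nat i + of_nat (r - i)"
    using that by (simp flip: of_nat_add)
   have "(of_nat (r - i) :: 'a mod_ring) ~= 0" using that Suc.prems(1) by (intro of_nat_neq_0) auto
   moreover have "a + of_nat (r - i) ~= b" using that Suc.prems(2) by (auto simp del: of_nat_diff)
   ultimately show ?thesis unfolding r by (simp add: algebra_simps del: of_nat_diff)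
  qed
  then have "- (a + of_nat r) ~= - (a + of_nat i) \<and> - (a + of_nat r) ~= - (b + of_nat i)" if "i < r" for i
   using that by (simp only: neg_equal_iff_equal) blast
  moreover have "fresh (shifts a b r)" using Suc by simp
  ultimately show ?case using assms(1) by (auto simp: set_shifts simp del: minus_add_distrib)
qed simp

text \<open>Only equality with 1 is tested, so nonresidues and 0 form one class; this matches the
  test made by \<open>split\<close>.\<close>

definition inseparable :: "'a::prime_card mod_ring => 'a mod_ring => nat => bool" where
  "inseparable a b t \<longleftrightarrow>
   ((a + of_nat t) ^ ((CARD('a) - 1) div 2) = 1 \<longleftrightarrow> (b + of_nat t) ^ ((CARD('a) - 1) div 2) = 1)"

lemma inseparable_commute: "inseparable a b t \<longleftrightarrow> inseparable b a t" by (auto simp: inseparable_def)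

lemma power_half_cases:
  fixes x :: "'a::prime_card mod_ring"
  assumes "odd CARD('a)" "x ~= 0"
  shows "x ^ ((CARD('a) - 1) div 2) = 1 \<or> x ^ ((CARD('a) - 1) div 2) = - 1"
proof -
  have "x ^ ((CARD('a) - 1) div 2) * x ^ ((CARD('a) - 1) div 2) * x = x ^ ((CARD('a) - 1) div 2 * 2 + 1)"
   by (simp only: power_add power_mult power2_eq_square power_one_right)
  also have "(CARD('a) - 1) div 2 * 2 + 1 = CARD('a)" using assms(1) by (auto elim!: oddE)
  also have "x ^ CARD('a) = x" using finite_field_power_card_eq_same[of x] by simp
  finally show ?thesis using assms(2) by (simp add: square_eq_1_iff)
qed

lemma inj_of_nat: "inj_on (of_nat :: nat => 'a::prime_card mod_ring) {..<CARD('a)}"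
proof (rule inj_onI)
  have "i = j" if "i \<le> j" "j < CARD('a)" "(of_nat i :: 'a mod_ring) = of_nat j" for i j
  proof (rule ccontr)
   assume "i ~= j"
   then have "(of_nat (j - i) :: 'a mod_ring) ~= 0" using that by (intro of_nat_neq_0) auto
   then show False using that by (simp add: of_nat_diff)
  qed
  then show "i = j" if "i \<in> {..<CARD('a)}" "j \<in> {..<CARD('a)}" "(of_nat i :: 'a mod_ring) = of_nat j" for i j
   using that by (metis lessThan_iff linear)
qed

text \<open>If the shifts t, ..., t + r - 1 all fail to separate and no shifted element is 0, then
  the two half powers carry equal signs at each of them, so each product is a square and t is
  counted by Stepanov's bound. Of B shifts, r are lost to the window and at most
  \<open>2 * r\<close> to zeros.\<close>

lemma inseparable_run_bound:
  fixes a b :: "'a::prime_card mod_ring"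
  assumes odd: "odd CARD('a)" and ab: "a ~= b" and L: "2 * L \<le> 2 ^ r" "0 < L"
   and small: "2 ^ r * (2 * r * L + 2 * r) < CARD('a)"
   and B: "B \<le> CARD('a)" "\<forall>t<B. inseparable a b t"
  shows "L * (B - 3 * r) \<le> 2 * r * L + r * (CARD('a) + 1)"
proof -
  let ?p = "CARD('a)" and ?m = "(CARD('a) - 1) div 2"
  have "2 ^ 0 * (2 * r * 0 + 2 * r) \<le> 2 ^ r * (2 * r * L + 2 * r)"
   by (intro mult_le_mono add_mono) auto
  then have rp: "2 * r < ?p" using small by simp
  have main: "L * (B - 3 * r) \<le> 2 * r * L + r * (?p + 1)"
   if ab: "a ~= b" "\<forall>k. 0 < k \<and> k < r --> a + of_nat k ~= b" and insep: "\<forall>t<B. inseparable a b t"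
   for a b :: "'a mod_ring"
  proof -
   define S where "S = {x. \<forall>g\<in>set (shifts a b r). poly (gp g) x ^ ?m = 1}"
   define Z where "Z = {t. t < B - r \<and> (\<exists>i<r. of_nat t + a + of_nat i = 0 \<or> of_nat t + b + of_nat i = 0)}"
   have "L * card S \<le> 2 * r * L + r * (?p + 1)"
    unfolding S_def using rp by (intro stepanov_bound odd fresh_shifts ab L small) auto
   have inj: "inj_on (of_nat :: nat => 'a mod_ring) A" if "A \<subseteq> {..<B}" for A
    using that B(1) by (intro inj_on_subset[OF inj_of_nat]) auto
   define N :: "'a mod_ring => nat set" where "N = (\<lambda>c. {t. t < B - r \<and> of_nat t = c})"
   have one: "card (N c) \<le> 1" for c
   proof -
    have "inj_on (of_nat :: nat => 'a mod_ring) (N c)" by (rule inj) (auto simp: N_def)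
    moreover have "of_nat ` N c \<subseteq> {c}" by (auto simp: N_def)
    ultimately have "card (N c) \<le> card {c}" by (intro card_inj_on_le) auto
    then show ?thesis by simp
   qed
   have "Z = (\<Union>i<r. N (- (a + of_nat i)) \<union> N (- (b + of_nat i)))"
   proof -
    have "of_nat t + c + of_nat i = 0 \<longleftrightarrow> of_nat t = - (c + of_nat i)" for t i and c :: "'a mod_ring"
     by (simp only: eq_neg_iff_add_eq_0 add.assoc)
    then show ?thesis unfolding Z_def N_def by blast
   qed
   then have "card Z \<le> (\<Sum>i<r. card (N (- (a + of_nat i)) \<union> N (- (b + of_nat i))))"
    by (simp only: card_UN_le[OF finite_lessThan])
   also have "\<dots> \<le> (\<Sum>i<r. 2)"
   proof (rule sum_mono)
    fix i
    show "card (N (- (a + of_nat i)) \<union> N (- (b + of_nat i))) \<le> 2"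
     using card_Un_le[of "N (- (a + of_nat i))" "N (- (b + of_nat i))"]
     one[of "- (a + of_nat i)"] one[of "- (b + of_nat i)"] by linarith
   qed
   finally have Z: "card Z \<le> 2 * r" by simp
   have finZ: "finite Z" by (simp add: Z_def)
   have "of_nat ` ({..<B - r} - Z) \<subseteq> S"
   proof
    fix x :: "'a mod_ring" assume "x \<in> of_nat ` ({..<B - r} - Z)"
    then obtain t where t: "x = of_nat t" "t < B - r" "t \<notin> Z" by blast
    have "poly (gp (- (a + of_nat i), - (b + of_nat i))) x ^ ?m = 1" if i: "i < r" for i
    proof -
     let ?u = "a + of_nat (t + i)" and ?v = "b + of_nat (t + i)"
     have "?u ~= 0" "?v ~= 0" using t(2,3) i by (auto simp: Z_def algebra_simps)
     moreover have "?u ^ ?m = 1 \<longleftrightarrow> ?v ^ ?m = 1"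
     using insep t(2) i unfolding inseparable_def by (meson add_less_mono less_diff_conv order_less_trans add_strict_left_mono)
     ultimately have "?u ^ ?m * ?v ^ ?m = 1"
     using power_half_cases[OF odd, of ?u] power_half_cases[OF odd, of ?v] by auto
     moreover have "poly (gp (- (a + of_nat i), - (b + of_nat i))) x = ?u * ?v"
     unfolding t(1) by (simp add: gp_def algebra_simps)
     ultimately show ?thesis by (simp only: power_mult_distrib)
    qed
    then show "x \<in> S" unfolding S_def set_shifts by blast
   qed
   then have "card (of_nat ` ({..<B - r} - Z) :: 'a mod_ring set) \<le> card S" by (intro card_mono) auto
   moreover have "card (of_nat ` ({..<B - r} - Z) :: 'a mod_ring set) = card ({..<B - r} - Z)"
    by (rule card_image[OF inj]) auto
   moreover have "card ({..<B - r} - Z) \<ge> (B - r) - card Z"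
    using diff_card_le_card_Diff[OF finZ, of "{..<B - r}"] by simp
   ultimately have "B - 3 * r \<le> card S" using Z by linarith
   then have "L * (B - 3 * r) \<le> L * card S" by (rule mult_le_mono2)
   also have "\<dots> \<le> 2 * r * L + r * (?p + 1)" by fact
   finally show ?thesis .
  qed
  show ?thesis
  proof (cases "\<forall>k. 0 < k \<and> k < r --> a + of_nat k ~= b")
   case True
   then show ?thesis using main[of a b] ab B by blast
  next
   \<comment> \<open>Freshness depends on the order of the pair, and one of the two orders is always
     good: otherwise k + l would be 0 in the field although 0 < k + l < p.\<close>
   case False
   then obtain k where k: "0 < k" "k < r" "a + of_nat k = b" by blast
   have "b + of_nat l ~= a" if "0 < l" "l < r" for l
   proof
    assume "b + of_nat l = a"
    then have "(of_nat (k + l) :: 'a mod_ring) = 0" using k(3) by (auto simp: algebra_simps)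
    moreover have "(of_nat (k + l) :: 'a mod_ring) ~= 0" using k that rp by (intro of_nat_neq_0) auto
    ultimately show False by simp
   qed
   then show ?thesis using main[of b a] ab B(2) by (auto simp: inseparable_commute[of b a])
  qed
qed

text \<open>If no shift separates, having half power 1 is invariant under translation by b - a.
  Starting from 1, such translations reach 0, whose half power is not 1.\<close>

lemma exists_separating:
  fixes a b :: "'a::prime_card mod_ring"
  assumes odd: "odd CARD('a)" and ab: "a ~= b"
  shows "\<exists>t<CARD('a). \<not> inseparable a b t"
proof (rule ccontr)
  let ?m = "(CARD('a) - 1) div 2"
  assume "\<not> (\<exists>t<CARD('a). \<not> inseparable a b t)"
  then have ins: "inseparable a b t" if "t < CARD('a)" for t using that by blast
  have step: "y ^ ?m = 1 \<longleftrightarrow> (y + (b - a)) ^ ?m = 1" for y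
  proof -
   obtain t where t: "t < CARD('a)" "y - a = of_nat t" using surj_of_nat_mod_ring by blast
   have y: "y = a + of_nat t" "y + (b - a) = b + of_nat t" using t(2) by (simp_all add: algebra_simps)
   show ?thesis unfolding y(2) using ins[OF t(1)] by (simp only: inseparable_def y(1))
  qed
  have all: "(1 + of_nat n * (b - a)) ^ ?m = 1" for n
  proof (induction n)
   case (Suc n)
   then show ?case using step[of "1 + of_nat n * (b - a)"] by (simp add: algebra_simps)
  qed simp
  obtain n where "- inverse (b - a) = of_nat n" using surj_of_nat_mod_ring by blast
  then have "of_nat n * (b - a) = - 1" using ab by (metis left_inverse mult_minus_left right_minus_eq)
  then have "(0 :: 'a mod_ring) ^ ?m = 1" using all[of n] by simp
  moreover have "0 < ?m"
  proof -
   have "CARD('a) ~= 1" using prime_card[where 'a = 'a] by auto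
   then show ?thesis using odd by (auto elim!: oddE)
  qed
  ultimately show False by (simp add: power_0_left)
qed

text \<open>Dividing the run bound by L gives t of order \<open>r * p / L\<close>. Taking r maximal
  with \<open>r * 2 ^ r * (2 ^ r + 2) < p\<close> makes \<open>4 ^ r\<close> comparable with p / r
  up to constants, and \<open>L = 2 ^ (r - 1)\<close> then yields the square root up to
  logarithms.\<close>

theorem separation_bound:
  fixes a b :: "'a::prime_card mod_ring"
  assumes odd: "odd CARD('a)" and ab: "a ~= b"
  shows "\<exists>t<CARD('a). \<not> inseparable a b t \<and>
   real t \<le> 17 * sqrt (real CARD('a)) * (log 2 (real CARD('a)) + 1) ^ 2"
proof -
  let ?p = "CARD('a)"
  define t where "t = (LEAST t. \<not> inseparable a b t)"
  obtain t0 where t0: "t0 < ?p" "\<not> inseparable a b t0" using exists_separating[OF assms] by blast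
  have t: "\<not> inseparable a b t" "t < ?p"
   unfolding t_def using LeastI[of "\<lambda>t. \<not> inseparable a b t", OF t0(2)]
    Least_le[of "\<lambda>t. \<not> inseparable a b t", OF t0(2)] t0(1) by auto
  have less: "\<forall>u<t. inseparable a b u" unfolding t_def using not_less_Least by blast
  have p2: "2 \<le> ?p" using prime_card[where 'a = 'a] prime_ge_2_nat by blast
  have "real t \<le> 17 * sqrt (real ?p) * (log 2 (real ?p) + 1) ^ 2"
  \<comment> \<open>For r = 1 the condition reads 8 < p; smaller primes are covered by the trivial t
    < p.\<close>
  proof (cases "?p \<le> 8")
   case True
   have "1 \<le> sqrt (real ?p)" "1 \<le> log 2 (real ?p)" using p2 by simp_all
   then have "17 * 1 * (1 + 1) ^ 2 \<le> 17 * sqrt (real ?p) * (log 2 (real ?p) + 1) ^ 2"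
    by (intro mult_mono power_mono) auto
   then show ?thesis using True t(2) by simp
  next
   case False
   define c where "c = (\<lambda>r::nat. r * 2 ^ r * (2 ^ r + 2))"
   define R where "R = {r. c r < ?p}"
   have "r \<le> c r" for r
    using mult_le_mono[of r "r * 2 ^ r" 1 "2 ^ r + 2"] by (simp add: c_def)
   then have "R \<subseteq> {..<?p}" unfolding R_def by (auto intro: le_less_trans)
   then have fin: "finite R" using finite_subset by blast
   have "1 \<in> R" using False by (simp add: R_def c_def)
   define r where "r = Max R"
   have r: "r \<in> R" unfolding r_def using fin \<open>1 \<in> R\<close> by (intro Max_in) auto
   have r1: "1 \<le> r" unfolding r_def using fin \<open>1 \<in> R\<close> by (rule Max_ge)
   have r2: "Suc r \<notin> R"
   proof
    assume "Suc r \<in> R"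
    then have "Suc r \<le> r" unfolding r_def using fin by (intro Max_ge)
    then show False by simp
   qed
   obtain q where q: "r = Suc q" using r1 by (cases r) auto
   define L where "L = (2::nat) ^ q"
   have L: "2 * L = 2 ^ r" "0 < L" by (simp_all add: L_def q)
   have cr: "2 ^ r * (2 * r * L + 2 * r) = c r"
   proof -
    have "2 ^ r * (2 * r * L + 2 * r) = r * 2 ^ r * (2 * L + 2)" by (simp add: algebra_simps)
    then show ?thesis by (simp add: L(1) c_def)
   qed
   have "L * (t - 3 * r) \<le> 2 * r * L + r * (?p + 1)"
    using inseparable_run_bound[OF odd ab, of L r t] L cr r t(2) less by (simp add: R_def)
   then have "real (L * (t - 3 * r)) \<le> real (2 * r * L + r * (?p + 1))" by (simp only: of_nat_le_iff)
   then have 1: "real L * real (t - 3 * r) \<le> 2 * real r * real L + real r * (real ?p + 1)"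
    by (simp only: of_nat_mult of_nat_add of_nat_numeral of_nat_1)
   have big: "real ?p \<le> 8 * (real r + 1) * (2 ^ r) ^ 2"
   proof -
    have "?p \<le> c (Suc r)" using r2 by (simp add: R_def)
    also have "c (Suc r) \<le> (r + 1) * (2 * 2 ^ r) * (2 * 2 ^ r + 2 * 2 ^ r)"
     unfolding c_def by (intro mult_le_mono add_mono) auto
    also have "\<dots> = 8 * (r + 1) * (2 ^ r) ^ 2" by (simp add: power2_eq_square algebra_simps)
    finally have "real ?p \<le> real (8 * (r + 1) * (2 ^ r) ^ 2)" by (simp only: of_nat_le_iff)
    then show ?thesis by (simp only: of_nat_mult of_nat_add of_nat_numeral of_nat_1 of_nat_power)
   qed
   have rlog: "real r \<le> log 2 (real ?p)"
   proof -
    have "1 * 2 ^ r * 1 \<le> c r" unfolding c_def using r1 by (intro mult_le_mono) auto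
    also have "\<dots> < ?p" using r by (simp add: R_def)
    finally have "real (2 ^ r) \<le> real ?p" by simp
    then have "2 ^ r \<le> real ?p" by simp
    then show ?thesis using p2 by (subst le_log_iff) (auto simp: powr_realpow)
   qed
   define s where "s = sqrt (real ?p)"
   have s: "0 < s" "s ^ 2 = real ?p" "1 \<le> s" using p2 by (simp_all add: s_def)
   define u where "u = real r"
   have u: "1 \<le> u" using r1 by (simp add: u_def)
   have L2: "(2::real) ^ r = 2 * real L"
    using L(1) by (metis of_nat_mult of_nat_numeral of_nat_power)
   \<comment> \<open>By maximality of r, p is at most \<open>8 * (r + 1) * 4 ^ r\<close>, and
     \<open>2 ^ r = 2 * L\<close>. Allowing u + 1 squared instead of u + 1 makes the right side a
     perfect square.\<close>
   have sL: "s \<le> 6 * (u + 1) * real L"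
   proof (rule power2_le_imp_le)
    have "s ^ 2 \<le> 8 * (u + 1) * (2 * real L) ^ 2" using big s(2) L2 by (simp add: u_def)
    also have "\<dots> \<le> (9 * (u + 1) * (u + 1)) * (2 * real L) ^ 2"
    proof (rule mult_right_mono)
     have "9 * (u + 1) * 1 \<le> 9 * (u + 1) * (u + 1)" using u by (intro mult_left_mono) auto
     moreover have "8 * (u + 1) \<le> 9 * (u + 1) * 1" using u by simp
     ultimately have "8 * (u + 1) \<le> 9 * (u + 1) * (u + 1)" by (rule order_trans[rotated])
     then show "8 * (u + 1) \<le> 9 * (u + 1) * (u + 1)" .
    qed simp
    also have "\<dots> = (6 * (u + 1) * real L) ^ 2" by (simp add: power2_eq_square algebra_simps)
    finally show "s ^ 2 \<le> (6 * (u + 1) * real L) ^ 2" .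
   qed (use u in simp)
   have "real L * real (t - 3 * r) \<le> real L * (2 * u + 12 * u * (u + 1) * s)"
   proof -
    have "u * (real ?p + 1) \<le> u * (2 * s ^ 2)" using s(2) p2 u by (intro mult_left_mono) auto
    moreover have "u * (2 * s ^ 2) \<le> u * (2 * (s * (6 * (u + 1) * real L)))"
     using mult_left_mono[OF sL, of s] s(1) u by (intro mult_left_mono) (auto simp: power2_eq_square)
    moreover have "real L * (2 * u + 12 * u * (u + 1) * s) = 2 * u * real L + u * (2 * (s * (6 * (u + 1) * real L)))"
     by (simp add: algebra_simps)
    ultimately show ?thesis using 1 unfolding u_def[symmetric] by linarith
   qed
   then have "real (t - 3 * r) \<le> 2 * u + 12 * u * (u + 1) * s" using L(2) by simp
   moreover have "real t \<le> real (t - 3 * r) + 3 * u" unfolding u_def by linarith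
   moreover have "u \<le> (u + 1) ^ 2 * s"
   proof -
    have "u \<le> (u + 1) ^ 2" using u by (simp add: power2_eq_square algebra_simps)
    also have "\<dots> \<le> (u + 1) ^ 2 * s" using mult_left_mono[OF s(3), of "(u + 1) ^ 2"] by simp
    finally show ?thesis .
   qed
   moreover have "u * (u + 1) * s \<le> (u + 1) ^ 2 * s"
    using s(1) u by (intro mult_right_mono) (auto simp: power2_eq_square)
   \<comment> \<open>17 = 12 + 2 + 3: the main degree term, the initial degree of the auxiliary
     polynomial divided by L, and the lost shifts.\<close>
   ultimately have "real t \<le> 17 * s * (u + 1) ^ 2" by (simp add: algebra_simps)
   also have "\<dots> \<le> 17 * s * (log 2 (real ?p) + 1) ^ 2"
    using rlog s(1) u by (intro mult_left_mono power_mono) (auto simp: u_def)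
   finally show ?thesis by (simp add: s_def)
  qed
  with t show ?thesis by blast
qed

section \<open>Reasoning about programs\<close>

text \<open>The programs below name an array by a constant first address component, so the arrays a
  program may change can be read off its text. Addresses without such a component count as writing
  everywhere.\<close>

definition tags :: "loc => nat set" where
  "tags l = (case l of Const n # _ => {n} | _ => UNIV)"

fun wr_r :: "instr => nat set" where
  "wr_r (WOp r f a b) = {r}" | "wr_r (WLoad r l) = {r}" | "wr_r (WofF r l) = {r}" | "wr_r _ = {}"
fun wr_w :: "instr => nat set" where
  "wr_w (WStore l a) = tags l" | "wr_w _ = {}"
fun wr_f :: "instr => nat set" where
  "wr_f (FOp d f a b) = tags d" | "wr_f (FofW d a) = tags d" | "wr_f (FofZ d a) = tags d" | "wr_f _ = {}"
fun wr_z :: "instr => nat set" where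
  "wr_z (ZOp d f a b) = tags d" | "wr_z (ZDivPow d a b) = tags d" | "wr_z (ZofW d a) = tags d" | "wr_z _ = {}"

fun written :: "(instr => nat set) => com => nat set" where
  "written f (Do i) = f i"
| "written f (Seq c d) = written f c \<union> written f d"
| "written f (If b c d) = written f c \<union> written f d"
| "written f (While b c) = written f c"

text \<open>The frame condition obtained from the text of a program alone. It works per register and
  per array tag, never per cell.\<close>

definition agree :: "com => state => state => bool" where
  "agree c \<sigma> \<sigma>' \<longleftrightarrow>
   (\<forall>r. r \<notin> written wr_r c --> regs \<sigma>' r = regs \<sigma> r) \<and>
   (\<forall>n as. n \<notin> written wr_w c --> wmem \<sigma>' (n # as) = wmem \<sigma> (n # as)) \<and>
   (\<forall>n as. n \<notin> written wr_f c --> fmem \<sigma>' (n # as) = fmem \<sigma> (n # as)) \<and>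
   (\<forall>n as. n \<notin> written wr_z c --> zmem \<sigma>' (n # as) = zmem \<sigma> (n # as))"

lemma agree_refl: "agree c \<sigma> \<sigma>" by (simp add: agree_def)
lemma agree_trans: "agree c s t ==> agree c t u ==> agree c s u" by (simp add: agree_def)
lemma agree_mono:
  "agree c s t ==> (\<And>f. written f c \<subseteq> written f d) ==> agree d s t"
  by (simp add: agree_def subset_iff) metis

lemma state_step_simps [simp]:
  "regs (set_reg r v \<sigma>) = (regs \<sigma>)(r := v)" "wmem (set_reg r v \<sigma>) = wmem \<sigma>"
  "fmem (set_reg r v \<sigma>) = fmem \<sigma>" "zmem (set_reg r v \<sigma>) = zmem \<sigma>"
  "regs (set_word l v \<sigma>) = regs \<sigma>" "wmem (set_word l v \<sigma>) = (wmem \<sigma>)(addr \<sigma> l := v)"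
  "fmem (set_word l v \<sigma>) = fmem \<sigma>" "zmem (set_word l v \<sigma>) = zmem \<sigma>"
  "regs (set_felt l v' \<sigma>) = regs \<sigma>" "wmem (set_felt l v' \<sigma>) = wmem \<sigma>"
  "fmem (set_felt l v' \<sigma>) = (fmem \<sigma>)(addr \<sigma> l := v')" "zmem (set_felt l v' \<sigma>) = zmem \<sigma>"
  "regs (set_int l v' \<sigma>) = regs \<sigma>" "wmem (set_int l v' \<sigma>) = wmem \<sigma>"
  "fmem (set_int l v' \<sigma>) = fmem \<sigma>" "zmem (set_int l v' \<sigma>) = (zmem \<sigma>)(addr \<sigma> l := v')"
  by (simp_all add: set_reg_def set_word_def set_felt_def set_int_def)

lemma addr_tag: "n \<notin> tags l ==> n # as ~= addr \<sigma> l"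
  by (auto simp: tags_def addr_def split: list.splits atom.splits)

lemma exec_agree: "exec p W c \<sigma> \<kappa> \<sigma>' ==> agree c \<sigma> \<sigma>'"
proof (induction rule: exec.induct)
  case (Do i \<sigma>)
  show ?case by (cases i) (auto simp: agree_def addr_tag)
next
  case (Seq c \<sigma> \<kappa> \<sigma>' d \<kappa>' \<sigma>'')
  show ?case
   by (rule agree_trans; rule agree_mono, rule Seq.IH) auto
next
  case IfTrue
  show ?case by (rule agree_mono, rule IfTrue.IH) auto
next
  case IfFalse
  show ?case by (rule agree_mono, rule IfFalse.IH) auto
next
  case WhileFalse
  show ?case by (rule agree_refl)
next
  case WhileTrue
  show ?case by (rule agree_trans, rule agree_mono, rule WhileTrue.IH(1), simp, rule WhileTrue.IH(2))
qed

definition canon :: "nat => state => bool" where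
  "canon p \<sigma> \<longleftrightarrow> (\<forall>a. 0 \<le> fmem \<sigma> a \<and> fmem \<sigma> a < int p)"

lemma exec_canon: "exec p W c \<sigma> \<kappa> \<sigma>' ==> 0 < p ==> canon p \<sigma> ==> canon p \<sigma>'"
proof (induction rule: exec.induct)
  case (Do i \<sigma>)
  have "0 \<le> fop_val p f x y \<and> fop_val p f x y < int p" for f x y using Do by (cases f) auto
  with Do show ?case by (cases i) (auto simp: canon_def)
qed auto

text \<open>A total-correctness judgement with costs. Field and control steps share the single
  budget T, because the final bounds for both come from the same estimate; Z counts integer
  operations and B limits the integers they touch.\<close>

definition trm :: "nat => nat => com => state => nat => nat => nat => (state => bool) => bool" where
  "trm p W c \<sigma> T Z B Q \<longleftrightarrow>
   (\<exists>\<kappa> \<sigma>'. exec p W c \<sigma> \<kappa> \<sigma>' \<and> ctl \<kappa> + fops \<kappa> \<le> T \<and> zops \<kappa> \<le> Z \<and> zmax \<kappa> \<le> B \<and> Q \<sigma>')"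

lemma trmI:
  "exec p W c \<sigma> \<kappa> \<sigma>' ==> ctl \<kappa> + fops \<kappa> \<le> T ==> zops \<kappa> \<le> Z ==> zmax \<kappa> \<le> B ==> Q \<sigma>' ==>
  trm p W c \<sigma> T Z B Q"
  unfolding trm_def by blast

lemma trm_mono:
  assumes "trm p W c \<sigma> T Z B Q" "T \<le> T'" "Z \<le> Z'" "B \<le> B'" "\<And>s. agree c \<sigma> s ==> Q s ==> Q' s"
  shows "trm p W c \<sigma> T' Z' B' Q'"
  using assms exec_agree unfolding trm_def by (meson order_trans)

lemma trm_strengthen:
  assumes "trm p W c \<sigma> T Z B Q" "0 < p" "canon p \<sigma>"
  shows "trm p W c \<sigma> T Z B (\<lambda>s. Q s \<and> agree c \<sigma> s \<and> canon p s)"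
  using assms exec_agree exec_canon unfolding trm_def by meson

lemma add_cost_simps [simp]:
  "ctl (a \<oplus>\<^sub>c b) = ctl a + ctl b" "fops (a \<oplus>\<^sub>c b) = fops a + fops b"
  "zops (a \<oplus>\<^sub>c b) = zops a + zops b" "zmax (a \<oplus>\<^sub>c b) = max (zmax a) (zmax b)"
  by (simp_all add: add_cost_def)

lemma unit_cost_simps [simp]:
  "ctl ctl_cost = 1" "fops ctl_cost = 0" "zops ctl_cost = 0" "zmax ctl_cost = 0"
  "ctl fop_cost = 0" "fops fop_cost = 1" "zops fop_cost = 0" "zmax fop_cost = 0"
  "ctl (zop_cost V) = 0" "fops (zop_cost V) = 0" "zops (zop_cost V) = 1"
  "zmax (zop_cost V) = Max ((\<lambda>v. nat \<bar>v\<bar>) ` V)"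
  by (simp_all add: ctl_cost_def fop_cost_def zop_cost_def)

lemma trm_Seq:
  assumes "trm p W c \<sigma> T1 Z1 B (\<lambda>s. trm p W d s T2 Z2 B Q)"
  shows "trm p W (Seq c d) \<sigma> (T1 + T2) (Z1 + Z2) B Q"
proof -
  from assms obtain \<kappa> s where 1: "exec p W c \<sigma> \<kappa> s" "ctl \<kappa> + fops \<kappa> \<le> T1" "zops \<kappa> \<le> Z1" "zmax \<kappa> \<le> B"
   "trm p W d s T2 Z2 B Q" unfolding trm_def by blast
  then obtain \<kappa>' s' where 2: "exec p W d s \<kappa>' s'" "ctl \<kappa>' + fops \<kappa>' \<le> T2" "zops \<kappa>' \<le> Z2" "zmax \<kappa>' \<le> B" "Q s'"
   unfolding trm_def by blast
  show ?thesis by (rule trmI[OF exec.Seq[OF 1(1) 2(1)]]) (use 1 2 in auto)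
qed

text \<open>Loop-free programs are run by \<open>ev\<close>; \<open>zgood\<close> collects the side conditions on their integer operations.\<close>

fun ev :: "nat => nat => com => state => state" where
  "ev p W (Do i) \<sigma> = instr_step p W i \<sigma>"
| "ev p W (Seq c d) \<sigma> = ev p W d (ev p W c \<sigma>)"
| "ev p W (If b c d) \<sigma> = (if cond_val b \<sigma> then ev p W c \<sigma> else ev p W d \<sigma>)"
| "ev p W (While b c) \<sigma> = \<sigma>"

fun loopfree :: "com => bool" where
  "loopfree (Do i) \<longleftrightarrow> True"
| "loopfree (Seq c d) \<longleftrightarrow> loopfree c \<and> loopfree d"
| "loopfree (If b c d) \<longleftrightarrow> loopfree c \<and> loopfree d"
| "loopfree (While b c) \<longleftrightarrow> False"

fun steps :: "com => nat" where
  "steps (Do i) = 1"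
| "steps (Seq c d) = steps c + steps d"
| "steps (If b c d) = 1 + max (steps c) (steps d)"
| "steps (While b c) = 0"

fun zfree_instr :: "instr => bool" where
  "zfree_instr (ZOp d f a b) = False" | "zfree_instr (ZDivPow d a b) = False"
| "zfree_instr (ZofW d a) = False" | "zfree_instr (FofZ d a) = False" | "zfree_instr _ = True"

fun zfree_cond :: "cond => bool" where
  "zfree_cond (ZLess a b) = False" | "zfree_cond (ZEq a b) = False" | "zfree_cond _ = True"

fun zfree :: "com => bool" where
  "zfree (Do i) = zfree_instr i"
| "zfree (Seq c d) \<longleftrightarrow> zfree c \<and> zfree d"
| "zfree (If b c d) \<longleftrightarrow> zfree_cond b \<and> zfree c \<and> zfree d"
| "zfree (While b c) \<longleftrightarrow> zfree_cond b \<and> zfree c"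

fun zgood :: "nat => nat => nat => com => state => bool" where
  "zgood p W B (Do i) \<sigma> \<longleftrightarrow> instr_ok p i \<sigma> \<and> zmax (instr_cost i \<sigma>) \<le> B"
| "zgood p W B (Seq c d) \<sigma> \<longleftrightarrow> zgood p W B c \<sigma> \<and> zgood p W B d (ev p W c \<sigma>)"
| "zgood p W B (If b c d) \<sigma> \<longleftrightarrow> zmax (cond_cost b \<sigma>) \<le> B \<and>
   (if cond_val b \<sigma> then zgood p W B c \<sigma> else zgood p W B d \<sigma>)"
| "zgood p W B (While b c) \<sigma> \<longleftrightarrow> True"

lemma instr_cost_le: "ctl (instr_cost i \<sigma>) + fops (instr_cost i \<sigma>) \<le> 1" "zops (instr_cost i \<sigma>) \<le> 1"
  by (cases i; simp)+
lemma cond_cost_le: "ctl (cond_cost b \<sigma>) + fops (cond_cost b \<sigma>) \<le> 1" "zops (cond_cost b \<sigma>) \<le> 1"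
  by (cases b; simp)+
lemma cond_cost_zfree: "zfree_cond b ==> zops (cond_cost b \<sigma>) = 0 \<and> zmax (cond_cost b \<sigma>) = 0"
  by (cases b) simp_all

lemma trm_ev:
  assumes "loopfree c" "zgood p W B c \<sigma>" "Q (ev p W c \<sigma>)"
  shows "trm p W c \<sigma> (steps c) (steps c) B Q"
proof -
  have "\<exists>\<kappa>. exec p W c \<sigma> \<kappa> (ev p W c \<sigma>) \<and> ctl \<kappa> + fops \<kappa> \<le> steps c \<and> zops \<kappa> \<le> steps c \<and> zmax \<kappa> \<le> B"
   using assms(1,2)
  proof (induction c arbitrary: \<sigma>)
   case (Do i)
   then have "exec p W (Do i) \<sigma> (instr_cost i \<sigma>) (instr_step p W i \<sigma>)" by (intro exec.Do) simp
   then show ?case using Do instr_cost_le[of i \<sigma>] by (intro exI[of _ "instr_cost i \<sigma>"]) simp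
  next
   case (Seq c d)
   obtain \<kappa> where 1: "exec p W c \<sigma> \<kappa> (ev p W c \<sigma>)" "ctl \<kappa> + fops \<kappa> \<le> steps c" "zops \<kappa> \<le> steps c" "zmax \<kappa> \<le> B"
    using Seq.IH(1)[of \<sigma>] Seq.prems by auto
   obtain \<kappa>' where 2: "exec p W d (ev p W c \<sigma>) \<kappa>' (ev p W d (ev p W c \<sigma>))" "ctl \<kappa>' + fops \<kappa>' \<le> steps d"
    "zops \<kappa>' \<le> steps d" "zmax \<kappa>' \<le> B"
    using Seq.IH(2)[of "ev p W c \<sigma>"] Seq.prems by auto
   have "exec p W (Seq c d) \<sigma> (\<kappa> \<oplus>\<^sub>c \<kappa>') (ev p W d (ev p W c \<sigma>))" using 1(1) 2(1) by (rule exec.Seq)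
   then show ?case using 1 2 by (intro exI[of _ "\<kappa> \<oplus>\<^sub>c \<kappa>'"]) simp
  next
   case (If b c d)
   show ?case
   proof (cases "cond_val b \<sigma>")
    case True
    then obtain \<kappa> where 1: "exec p W c \<sigma> \<kappa> (ev p W c \<sigma>)" "ctl \<kappa> + fops \<kappa> \<le> steps c" "zops \<kappa> \<le> steps c" "zmax \<kappa> \<le> B"
     using If.IH(1)[of \<sigma>] If.prems by auto
    have "exec p W (If b c d) \<sigma> (cond_cost b \<sigma> \<oplus>\<^sub>c \<kappa>) (ev p W c \<sigma>)" using True 1(1) by (rule exec.IfTrue)
    then show ?thesis using 1 True If.prems cond_cost_le[of b \<sigma>]
     by (intro exI[of _ "cond_cost b \<sigma> \<oplus>\<^sub>c \<kappa>"]) (auto simp: max_def)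
   next
    case False
    then obtain \<kappa> where 1: "exec p W d \<sigma> \<kappa> (ev p W d \<sigma>)" "ctl \<kappa> + fops \<kappa> \<le> steps d" "zops \<kappa> \<le> steps d" "zmax \<kappa> \<le> B"
     using If.IH(2)[of \<sigma>] If.prems by auto
    have "exec p W (If b c d) \<sigma> (cond_cost b \<sigma> \<oplus>\<^sub>c \<kappa>) (ev p W d \<sigma>)" using False 1(1) by (rule exec.IfFalse)
    then show ?thesis using 1 False If.prems cond_cost_le[of b \<sigma>]
     by (intro exI[of _ "cond_cost b \<sigma> \<oplus>\<^sub>c \<kappa>"]) (auto simp: max_def)
   qed
  qed simp
  then show ?thesis using assms(3) unfolding trm_def by blast
qed

lemma exec_zfree: "exec p W c \<sigma> \<kappa> \<sigma>' ==> zfree c ==> zops \<kappa> = 0 \<and> zmax \<kappa> = 0"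
proof (induction rule: exec.induct)
  case (Do i \<sigma>)
  then show ?case by (cases i) simp_all
qed (simp_all add: cond_cost_zfree)

lemma zgood_zfree: "loopfree c ==> zfree c ==> zgood p W B c \<sigma>"
proof (induction c arbitrary: \<sigma>)
  case (Do i)
  then show ?case by (cases i) simp_all
qed (simp_all add: cond_cost_zfree)

text \<open>A program without integer instructions has integer cost 0 whatever was proved before, so
  its budget can be inserted under any size limit.\<close>

lemma trm_zfree:
  assumes "trm p W c \<sigma> T Z B Q" "zfree c"
  shows "trm p W c \<sigma> T 0 B' Q"
  using assms exec_zfree unfolding trm_def by (metis le_zero_eq zero_le)

lemma trm_ev0:
  assumes "loopfree c" "zfree c" "Q (ev p W c \<sigma>)"
  shows "trm p W c \<sigma> (steps c) 0 B Q"
  using trm_zfree[OF trm_ev] zgood_zfree assms by blast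

lemma trm_If:
  assumes "zfree_cond b" "cond_val b \<sigma> ==> trm p W c \<sigma> T Z B Q" "\<not> cond_val b \<sigma> ==> trm p W d \<sigma> T Z B Q"
  shows "trm p W (If b c d) \<sigma> (Suc T) Z B Q"
proof (cases "cond_val b \<sigma>")
  case True
  with assms(2) obtain \<kappa> s where 1: "exec p W c \<sigma> \<kappa> s" "ctl \<kappa> + fops \<kappa> \<le> T" "zops \<kappa> \<le> Z" "zmax \<kappa> \<le> B" "Q s"
   unfolding trm_def by blast
  show ?thesis
   by (rule trmI[OF exec.IfTrue[OF True 1(1)]])
    (use 1 cond_cost_le[of b \<sigma>] cond_cost_zfree[OF assms(1), of \<sigma>] in auto)
next
  case False
  with assms(3) obtain \<kappa> s where 1: "exec p W d \<sigma> \<kappa> s" "ctl \<kappa> + fops \<kappa> \<le> T" "zops \<kappa> \<le> Z" "zmax \<kappa> \<le> B" "Q s"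
   unfolding trm_def by blast
  show ?thesis
   by (rule trmI[OF exec.IfFalse[OF False 1(1)]])
    (use 1 cond_cost_le[of b \<sigma>] cond_cost_zfree[OF assms(1), of \<sigma>] in auto)
qed

text \<open>Costs are paid from the potentials \<Psi> and \<Phi> of the state, so that rounds may
  differ in price. The extra 1 pays for the test, and since \<Psi> then drops strictly, termination
  follows as well.\<close>

lemma trm_While:
  fixes \<Psi> \<Phi> :: "state => nat"
  assumes b: "zfree_cond b" and I: "I \<sigma>"
   and step: "\<And>s. I s ==> cond_val b s ==> \<exists>T Z. trm p W c s T Z B (\<lambda>s'. I s' \<and> T + 1 + \<Psi> s' \<le> \<Psi> s \<and> Z + \<Phi> s' \<le> \<Phi> s)"
  shows "trm p W (While b c) \<sigma> (Suc (\<Psi> \<sigma>)) (\<Phi> \<sigma>) B (\<lambda>s. I s \<and> \<not> cond_val b s)"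
  using I
proof (induction "\<Psi> \<sigma>" arbitrary: \<sigma> rule: less_induct)
  case less
  show ?case
  proof (cases "cond_val b \<sigma>")
   case False
   show ?thesis
    by (rule trmI[OF exec.WhileFalse[OF False]])
     (use less.prems False cond_cost_le[of b \<sigma>] cond_cost_zfree[OF b, of \<sigma>] in auto)
  next
   case True
   obtain T Z where "trm p W c \<sigma> T Z B (\<lambda>s'. I s' \<and> T + 1 + \<Psi> s' \<le> \<Psi> \<sigma> \<and> Z + \<Phi> s' \<le> \<Phi> \<sigma>)"
    using step[OF less.prems True] by blast
   then obtain \<kappa> s where 1: "exec p W c \<sigma> \<kappa> s" "ctl \<kappa> + fops \<kappa> \<le> T" "zops \<kappa> \<le> Z" "zmax \<kappa> \<le> B"
    "I s" "T + 1 + \<Psi> s \<le> \<Psi> \<sigma>" "Z + \<Phi> s \<le> \<Phi> \<sigma>" unfolding trm_def by blast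
   have "trm p W (While b c) s (Suc (\<Psi> s)) (\<Phi> s) B (\<lambda>s. I s \<and> \<not> cond_val b s)"
    by (rule less.hyps) (use 1 in auto)
   then obtain \<kappa>' s' where 2: "exec p W (While b c) s \<kappa>' s'" "ctl \<kappa>' + fops \<kappa>' \<le> Suc (\<Psi> s)" "zops \<kappa>' \<le> \<Phi> s"
    "zmax \<kappa>' \<le> B" "I s' \<and> \<not> cond_val b s'" unfolding trm_def by blast
   show ?thesis
    by (rule trmI[OF exec.WhileTrue[OF True 1(1) 2(1)]])
     (use 1 2 cond_cost_le[of b \<sigma>] cond_cost_zfree[OF b, of \<sigma>] in auto)
  qed
qed

definition For :: "nat => atom => com => com" where
  "For r hi c = Seq (Do (WOp r WAdd (Const 0) (Const 0)))
   (While (WLess (Reg r) hi) (Seq c (Do (WOp r WAdd (Reg r) (Const 1)))))"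

lemma written_For [simp]: "written f (For r hi c) = f (WOp r WAdd (Const 0) (Const 0)) \<union> (written f c \<union> f (WOp r WAdd (Reg r) (Const 1)))"
  by (simp add: For_def)
lemma zfree_For [simp]: "zfree (For r hi c) \<longleftrightarrow> zfree c"
  by (simp add: For_def)

text \<open>The invariant at i speaks of a state whose counter already holds i; hence the
  \<open>set_reg\<close>. Two steps per round are the test and the increment, the other two the
  initialisation and the last test. \<open>n < W\<close> keeps the counter from wrapping
  around.\<close>

lemma trm_For:
  assumes W: "n < W" and p: "0 < p" "canon p \<sigma>" and r: "r \<notin> written wr_r c"
   and hi: "atom_val \<sigma> hi = n" "hi ~= Reg r" "\<And>h. hi = Reg h ==> h \<notin> written wr_r c"
   and I0: "I 0 (set_reg r 0 \<sigma>)"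
   and step: "\<And>i s. i < n ==> agree (For r hi c) \<sigma> s ==> canon p s ==> regs s r = i ==> I i s ==>
    trm p W c s T Z B (\<lambda>s'. agree c s s' --> regs s' r = i --> I (Suc i) (set_reg r (Suc i) s'))"
  shows "trm p W (For r hi c) \<sigma> (2 + n * (T + 2)) (n * Z) B
   (\<lambda>s. I n s \<and> agree (For r hi c) \<sigma> s \<and> canon p s \<and> regs s r = n)"
proof -
  let ?c = "Seq c (Do (WOp r WAdd (Reg r) (Const 1)))" and ?b = "WLess (Reg r) hi"
  let ?J = "\<lambda>s. agree (For r hi c) \<sigma> s \<and> canon p s \<and> regs s r \<le> n \<and> I (regs s r) s"
  let ?\<sigma> = "set_reg r 0 \<sigma>"
  have hin: "atom_val s hi = n" if "agree (For r hi c) \<sigma> s" for s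
   using that hi by (cases hi) (auto simp: agree_def)
  have J0: "?J ?\<sigma>" using I0 p(2) by (auto simp: agree_def canon_def)
  have "trm p W (While ?b ?c) ?\<sigma> (Suc ((n - regs ?\<sigma> r) * (T + 2))) ((n - regs ?\<sigma> r) * Z) B (\<lambda>s. ?J s \<and> \<not> cond_val ?b s)"
  proof (rule trm_While[where I = ?J and \<Psi> = "\<lambda>s. (n - regs s r) * (T + 2)" and \<Phi> = "\<lambda>s. (n - regs s r) * Z", OF _ J0])
   fix s assume J: "?J s" and "cond_val ?b s"
   then have lt: "regs s r < n" using hin by simp
   have Do: "trm p W (Do (WOp r WAdd (Reg r) (Const 1))) s' 1 0 B Q"
    if "Q (set_reg r (Suc (regs s r)) s')" "regs s' r = regs s r" for s' Q
    using trm_ev0[of "Do (WOp r WAdd (Reg r) (Const 1))" Q p W s' B] that W lt by simp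
   have "trm p W c s T Z B (\<lambda>s'. agree c s s' --> regs s' r = regs s r --> I (Suc (regs s r)) (set_reg r (Suc (regs s r)) s'))"
    using step[OF lt] J by blast
   then have "trm p W c s T Z B (\<lambda>s'. (agree c s s' --> regs s' r = regs s r --> I (Suc (regs s r)) (set_reg r (Suc (regs s r)) s'))
     \<and> agree c s s' \<and> canon p s')"
    by (rule trm_strengthen[OF _ p(1)]) (use J in blast)
   then have "trm p W ?c s (T + 1) (Z + 0) B (\<lambda>s'. ?J s' \<and> regs s' r = Suc (regs s r))"
   proof (rule trm_Seq[OF trm_mono], goal_cases)
    case (4 s')
    then have eq: "regs s' r = regs s r" using r by (auto simp: agree_def)
    have "agree (For r hi c) \<sigma> (set_reg r (Suc (regs s r)) s')"
    proof (rule agree_trans)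
     show "agree (For r hi c) \<sigma> s" using J by blast
     have "agree (For r hi c) s s'" by (rule agree_mono[of c]) (use 4 in auto)
     then show "agree (For r hi c) s (set_reg r (Suc (regs s r)) s')" by (auto simp: agree_def)
    qed
    then show ?case using 4 eq lt by (intro Do) (auto simp: canon_def)
   qed auto
   then have "trm p W ?c s (T + 1) Z B (\<lambda>s'. ?J s' \<and> (T + 1) + 1 + (n - regs s' r) * (T + 2) \<le> (n - regs s r) * (T + 2)
     \<and> Z + (n - regs s' r) * Z \<le> (n - regs s r) * Z)"
   proof (rule trm_mono, goal_cases)
    case (4 s')
    define k where "k = n - Suc (regs s r)"
    have k: "n - regs s r = Suc k" using lt by (simp add: k_def)
    from 4 have e: "regs s' r = Suc (regs s r)" by blast
    from 4 have J': "?J s'" by blast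
    have "T + 1 + 1 + (n - regs s' r) * (T + 2) \<le> (n - regs s r) * (T + 2)"
     "Z + (n - regs s' r) * Z \<le> (n - regs s r) * Z"
     unfolding k e k_def[symmetric] by simp_all
    with J' show ?case by blast
   qed auto
   then show "\<exists>T' Z'. trm p W ?c s T' Z' B (\<lambda>s'. ?J s' \<and> T' + 1 + (n - regs s' r) * (T + 2) \<le> (n - regs s r) * (T + 2)
     \<and> Z' + (n - regs s' r) * Z \<le> (n - regs s r) * Z)" by blast
  qed simp
  then have w: "trm p W (While ?b ?c) ?\<sigma> (Suc (n * (T + 2))) (n * Z) B (\<lambda>s. I n s \<and> agree (For r hi c) \<sigma> s \<and> canon p s \<and> regs s r = n)"
  proof (rule trm_mono, goal_cases)
   case (4 s)
   then have "regs s r = n" using hin[of s] by auto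
   then show ?case using 4 by auto
  qed auto
  have "trm p W (For r hi c) \<sigma> (1 + Suc (n * (T + 2))) (0 + n * Z) B (\<lambda>s. I n s \<and> agree (For r hi c) \<sigma> s \<and> canon p s \<and> regs s r = n)"
   unfolding For_def[of r hi c, THEN arg_cong[where f = "\<lambda>x. trm p W x"]]
  proof (rule trm_Seq)
   show "trm p W (Do (WOp r WAdd (Const 0) (Const 0))) \<sigma> 1 0 B
    (\<lambda>s. trm p W (While ?b ?c) s (Suc (n * (T + 2))) (n * Z) B
     (\<lambda>s. I n s \<and> agree (For r hi c) \<sigma> s \<and> canon p s \<and> regs s r = n))"
    by (rule trm_mono[OF trm_ev0[where Q = "\<lambda>s. s = set_reg r 0 \<sigma>"]]) (use w in auto)
  qed
  then show ?thesis by simp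
qed

section \<open>Massey's algorithm\<close>

text \<open>f acts as a recurrence operator: coefficient i meets \<open>s (l + i)\<close>. In this
  orientation the polynomial that annihilates a power sum has the points a as its roots, not their
  inverses.\<close>

definition corr :: "(nat => 'a::comm_ring_1) => nat => (nat => 'a) => nat => 'a" where
  "corr s N f l = (\<Sum>i\<le>N. f i * s (l + i))"

definition shift :: "nat => (nat => 'a::zero) => nat => 'a" where
  "shift a f i = (if i < a then 0 else f (i - a))"

lemma corr_shift:
  assumes "\<And>i. i \<le> N ==> N < i + a ==> f i = 0"
  shows "corr s N (shift a f) l = corr s N f (l + a)"
proof -
  have "corr s N (shift a f) l = (\<Sum>i\<in>{a..<Suc N}. f (i - a) * s (l + i))"
   unfolding corr_def by (rule sum.mono_neutral_cong_right) (auto simp: shift_def)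
  also have "\<dots> = (\<Sum>i\<in>{0..<Suc N - a}. f i * s (l + a + i))"
  proof (cases "a \<le> Suc N")
   case True
   then show ?thesis
    using sum.shift_bounds_nat_ivl[of "\<lambda>i. f (i - a) * s (l + i)" 0 a "Suc N - a"]
    by (simp add: add_ac)
  qed auto
  also have "\<dots> = corr s N f (l + a)"
   unfolding corr_def by (rule sum.mono_neutral_cong_left) (auto simp: assms)
  finally show ?thesis .
qed

text \<open>\<open>f\<close> is the current connection polynomial of degree \<open>d\<close> and \<open>g\<close> the last one before the
  degree grew; \<open>\<delta>\<close> is the discrepancy of \<open>g\<close>.\<close>

definition massey_inv :: "(nat => 'a::field) => nat => nat => nat => (nat => 'a) => (nat => 'a) => 'a => bool" where
  "massey_inv s N k d f g \<delta> \<longleftrightarrow> d \<le> k \<and> f d = 1 \<and> (\<forall>i\<le>N. d < i --> f i = 0) \<and>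
   (\<forall>l. l + d < k --> corr s N f l = 0) \<and> (\<forall>i\<le>N. k < i + d --> g i = 0) \<and> \<delta> ~= 0 \<and>
   (0 < d --> (\<forall>l. l + 1 < d --> corr s N g l = 0) \<and> corr s N g (d - 1) = \<delta>)"

lemma massey_init: "massey_inv s N 0 0 (\<lambda>i. if i = 0 then 1 else 0) (\<lambda>_. 0) 1"
  by (simp add: massey_inv_def)

lemma massey_inv_cong:
  assumes "massey_inv s N k d f g \<delta>" "\<And>i. i \<le> N ==> f' i = f i" "\<And>i. i \<le> N ==> g' i = g i" "k \<le> N"
  shows "massey_inv s N k d f' g' \<delta>"
proof -
  have "corr s N f' = corr s N f" "corr s N g' = corr s N g"
   using assms(2,3) by (auto simp: corr_def fun_eq_iff intro!: sum.cong)
  then show ?thesis using assms by (auto simp: massey_inv_def)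
qed

lemma massey_step_0:
  assumes "massey_inv s N k d f g \<delta>" "corr s N f (k - d) = 0"
  shows "massey_inv s N (Suc k) d f g \<delta>"
proof -
  have "corr s N f l = 0" if "l + d < Suc k" for l
  proof (cases "l + d < k")
   case False
   then have "l = k - d" using that by simp
   then show ?thesis using assms(2) by simp
  qed (use assms(1) in \<open>auto simp: massey_inv_def\<close>)
  then show ?thesis using assms(1) by (auto simp: massey_inv_def)
qed

text \<open>The discrepancy e of f at position k - d is cancelled by that of g at d - 1 once both
  are aligned by \<open>a\<close> or \<open>b\<close>. These are truncated differences, so at most
  one shift is positive; the degree grows exactly when \<open>a\<close> is, and then the old f takes
  over the role of g.\<close>

lemma massey_step:
  fixes s :: "nat => 'a::field"
  assumes inv: "massey_inv s N k d f g \<delta>" and k: "k < N" and e: "corr s N f (k - d) = e" "e ~= 0"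
  defines "a \<equiv> Suc k - 2 * d" and "b \<equiv> 2 * d - Suc k"
  defines "f' \<equiv> \<lambda>i. shift a f i - e / \<delta> * shift b g i"
  shows "massey_inv s N (Suc k) (if 0 < a then Suc k - d else d) f' (if 0 < a then f else g) (if 0 < a then e else \<delta>)"
proof -
  note I = inv[unfolded massey_inv_def]
  have corr': "corr s N f' l = corr s N f (l + a) - e / \<delta> * corr s N g (l + b)" for l
  proof -
   have "corr s N f' l = corr s N (shift a f) l - e / \<delta> * corr s N (shift b g) l"
    unfolding f'_def corr_def by (simp add: sum_subtractf sum_distrib_left left_diff_distrib mult.assoc)
   also have "corr s N (shift a f) l = corr s N f (l + a)"
    by (rule corr_shift) (use I k in \<open>auto simp: a_def\<close>)
   also have "corr s N (shift b g) l = corr s N g (l + b)"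
    by (rule corr_shift) (use I k in \<open>auto simp: b_def\<close>)
   finally show ?thesis .
  qed
  show ?thesis
  proof (cases "0 < a")
   case True
   then have b0: "b = 0" and ak: "a = Suc k - 2 * d" "2 * d \<le> k" by (auto simp: a_def b_def)
   have f0: "corr s N f' l = 0" if l: "l + (Suc k - d) < Suc k" for l
   proof -
    have ld: "l < d" using l ak by simp
    then have d: "0 < d" by simp
    show ?thesis
    proof (cases "l + 1 < d")
     case True
     then have "corr s N f (l + a) = 0" "corr s N g (l + b) = 0" using I ak b0 d by auto
     then show ?thesis by (simp add: corr')
    next
     case False
     then have "l + a = k - d" "l + b = d - 1" using ld ak b0 by auto
     then show ?thesis using I d e by (simp add: corr')
    qed
   qed
   have "f' (Suc k - d) = 1"
    using I k ak b0 by (auto simp: f'_def shift_def)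
   moreover have "\<forall>i\<le>N. Suc k - d < i --> f' i = 0"
    using I k ak b0 by (auto simp: f'_def shift_def)
   moreover have "\<forall>i\<le>N. Suc k < i + (Suc k - d) --> f i = 0" using I ak by auto
   moreover have "\<forall>l. l + 1 < Suc k - d --> corr s N f l = 0" using I by auto
   ultimately show ?thesis using True f0 e ak by (auto simp: massey_inv_def)
  next
   case False
   then have a0: "a = 0" and bk: "b = 2 * d - Suc k" "Suc k \<le> 2 * d" by (auto simp: a_def b_def)
   have d: "0 < d" using bk by simp
   have dk: "d \<le> k" using I by simp
   have f0: "corr s N f' l = 0" if l: "l + d < Suc k" for l
   proof (cases "l + d < k")
    case True
    then have "corr s N f (l + a) = 0" "corr s N g (l + b) = 0" using I a0 bk d by auto
    then show ?thesis by (simp add: corr')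
   next
    case False
    then have l: "l + a = k - d" "l + b = d - 1" using l a0 bk dk by auto
    show ?thesis unfolding corr' l using I d e by simp
   qed
   have "f' d = 1"
   proof -
    have "shift b g d = 0" using I k bk dk by (auto simp: shift_def)
    then show ?thesis using I a0 by (simp add: f'_def shift_def)
   qed
   moreover have "f' i = 0" if "i \<le> N" "d < i" for i
   proof -
    have "shift b g i = 0" using I that bk dk by (auto simp: shift_def)
    then show ?thesis using I a0 that by (simp add: f'_def shift_def)
   qed
   ultimately show ?thesis using False f0 I by (auto simp: massey_inv_def)
  qed
qed

definition npoly :: "nat => (nat => 'a::comm_ring_1) => 'a poly" where
  "npoly N f = (\<Sum>i\<le>N. monom (f i) i)"

lemma coeff_npoly: "coeff (npoly N f) i = (if i \<le> N then f i else 0)"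
  by (auto simp: npoly_def coeff_sum if_distrib cong: if_cong)

abbreviation linprod :: "'a::comm_ring_1 set => 'a poly" where
  "linprod A \<equiv> (\<Prod>a\<in>A. [:- a, 1:])"

lemma linprod_props:
  fixes A :: "'a::idom set"
  assumes "finite A"
  shows "degree (linprod A) = card A" "lead_coeff (linprod A) = 1" "linprod A ~= 0"
   "poly (linprod A) x = 0 \<longleftrightarrow> x \<in> A"
proof -
  show nz: "linprod A ~= 0" using assms by simp
  show "degree (linprod A) = card A" using degree_prod_eq_sum_degree[of A "\<lambda>a. [:- a, 1:]"] by simp
  show "lead_coeff (linprod A) = 1" by (simp add: lead_coeff_prod)
  show "poly (linprod A) x = 0 \<longleftrightarrow> x \<in> A" using assms by (auto simp: poly_prod)
qed

lemma sum_moments: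
  fixes q :: "'a::comm_ring_1 poly"
  assumes "degree q \<le> n"
  shows "(\<Sum>i\<le>n. coeff q i * (\<Sum>a\<in>A. w a * a ^ (l + i))) = (\<Sum>a\<in>A. w a * a ^ l * poly q a)"
proof -
  have "(\<Sum>i\<le>n. coeff q i * (\<Sum>a\<in>A. w a * a ^ (l + i))) = (\<Sum>i\<le>n. \<Sum>a\<in>A. w a * a ^ l * (coeff q i * a ^ i))"
   by (simp add: sum_distrib_left power_add mult_ac)
  also have "\<dots> = (\<Sum>a\<in>A. w a * a ^ l * (\<Sum>i\<le>n. coeff q i * a ^ i))"
   by (subst sum.swap) (simp add: sum_distrib_left)
  also have "(\<lambda>a. \<Sum>i\<le>n. coeff q i * a ^ i) = poly q"
   unfolding poly_altdef using assms
   by (intro ext sum.mono_neutral_right) (auto simp: coeff_eq_0)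
  finally show ?thesis .
qed

text \<open>Combining the moment equations with the coefficients of the product of X - a over the
  points other than b leaves c(b) times a nonzero value.\<close>

lemma vandermonde:
  fixes A :: "'a::field set"
  assumes A: "finite A" and z: "\<And>l. l < card A ==> (\<Sum>a\<in>A. c a * a ^ l) = 0" and b: "b \<in> A"
  shows "c b = 0"
proof -
  let ?q = "linprod (A - {b})"
  have card: "card A = Suc (card (A - {b}))" using A b by (rule card.remove)
  have "0 = (\<Sum>i\<le>card (A - {b}). coeff ?q i * (\<Sum>a\<in>A. c a * a ^ (0 + i)))" using z card by simp
  also have "\<dots> = (\<Sum>a\<in>A. c a * a ^ 0 * poly ?q a)"
   by (rule sum_moments) (use A in \<open>simp add: linprod_props\<close>)
  also have "\<dots> = c b * poly ?q b + (\<Sum>a\<in>A - {b}. c a * poly ?q a)"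
   using A b by (simp add: sum.remove)
  also have "(\<Sum>a\<in>A - {b}. c a * poly ?q a) = 0"
   using A by (intro sum.neutral) (auto simp: linprod_props)
  finally have "c b * poly ?q b = 0" by simp
  moreover have "poly ?q b ~= 0" using A by (simp add: linprod_props)
  ultimately show ?thesis by simp
qed

lemma linprod_dvd:
  fixes f :: "'a::field poly"
  assumes "finite A" "\<And>a. a \<in> A ==> poly f a = 0"
  shows "linprod A dvd f"
  using assms
proof (induction A arbitrary: f rule: finite_induct)
  case (insert b A)
  then obtain g where g: "f = linprod A * g" by (meson insertI2 dvdE)
  have "poly (linprod A) b ~= 0" using insert by (simp add: linprod_props)
  moreover have "poly f b = 0" using insert.prems by simp
  ultimately have "poly g b = 0" unfolding g by simp
  then obtain h where "g = [:- b, 1:] * h" by (auto simp: poly_eq_0_iff_dvd)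
  then have "f = linprod (insert b A) * h" using insert.hyps g by (simp add: mult_ac del: mult_pCons_left mult_pCons_right)
  then show ?case by simp
qed simp

lemma monic_eq_linprod:
  fixes f :: "'a::field poly"
  assumes A: "finite A" "\<And>a. a \<in> A ==> poly f a = 0" and f: "lead_coeff f = 1" "degree f \<le> card A"
  shows "f = linprod A"
proof -
  obtain g where g: "f = linprod A * g" using linprod_dvd[OF A] by (rule dvdE)
  have "f ~= 0" using f by auto
  then have "degree f = card A + degree g" using g A by (simp add: degree_mult_eq linprod_props)
  then have "degree g = 0" using f by simp
  then obtain c where c: "g = [:c:]" by (rule degree_eq_zeroE)
  have "c = 1" using f(1) lead_coeff_mult[of "linprod A" g] linprod_props(2)[OF A(1)] unfolding g c by simp
  then show ?thesis using g c by simp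
qed

text \<open>Let \<Lambda> be the product of the X - a. Were d larger than its degree, the operators
  \<Lambda> and g applied together would give 0 in one order of summation and \<delta> in the other.
  So d is at most \<open>card A\<close>. Then f annihilates enough positions for a Vandermonde
  argument to make every a a root of f, and f is monic.\<close>

theorem massey_final:
  fixes s :: "nat => 'a::field"
  assumes A: "finite A" "2 * card A \<le> N" and w: "\<And>a. a \<in> A ==> w a ~= 0"
   and s: "\<And>l. l < N ==> s l = (\<Sum>a\<in>A. w a * a ^ l)"
   and inv: "massey_inv s N N d f g \<delta>"
  shows "d = card A \<and> npoly N f = linprod A"
proof -
  note I = inv[unfolded massey_inv_def]
  let ?n = "card A" and ?\<Lambda> = "linprod A"
  have "d \<le> ?n"
  proof (rule ccontr)
   assume "\<not> d \<le> ?n"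
   then have d: "?n < d" "0 < d" by auto
   \<comment> \<open>All moments used here have index below N, because nonzero coefficients of g
     occur only up to N - d.\<close>
   let ?X = "\<Sum>j\<le>N. g j * (\<Sum>i\<le>?n. coeff ?\<Lambda> i * s (d - 1 - ?n + i + j))"
   have "?X = 0"
   proof (rule sum.neutral, rule)
    fix j assume j: "j \<in> {..N}"
    show "g j * (\<Sum>i\<le>?n. coeff ?\<Lambda> i * s (d - 1 - ?n + i + j)) = 0"
    proof (cases "g j = 0")
     case False
     then have jd: "j + d \<le> N" using I j by (meson atMost_iff not_le)
     have "(\<Sum>i\<le>?n. coeff ?\<Lambda> i * s (d - 1 - ?n + i + j))
     = (\<Sum>i\<le>?n. coeff ?\<Lambda> i * (\<Sum>a\<in>A. w a * a ^ ((d - 1 - ?n + j) + i)))"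
     using d jd by (intro sum.cong) (auto simp: s add_ac)
     also have "\<dots> = (\<Sum>a\<in>A. w a * a ^ (d - 1 - ?n + j) * poly ?\<Lambda> a)"
     using A by (intro sum_moments) (simp add: linprod_props)
     also have "\<dots> = 0" using A by (intro sum.neutral) (auto simp: linprod_props)
     finally show ?thesis by simp
    qed simp
   qed
   also have "?X = (\<Sum>i\<le>?n. coeff ?\<Lambda> i * corr s N g (d - 1 - ?n + i))"
    unfolding corr_def sum_distrib_left by (subst sum.swap) (simp add: mult_ac add_ac)
   also have "\<dots> = coeff ?\<Lambda> ?n * corr s N g (d - 1 - ?n + ?n)
     + (\<Sum>i<?n. coeff ?\<Lambda> i * corr s N g (d - 1 - ?n + i))"
    by (simp add: lessThan_Suc_atMost[symmetric])
   also have "(\<Sum>i<?n. coeff ?\<Lambda> i * corr s N g (d - 1 - ?n + i)) = 0"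
    using I d by (intro sum.neutral) auto
   also have "coeff ?\<Lambda> ?n = 1" using linprod_props[OF A(1)] by simp
   also have "d - 1 - ?n + ?n = d - 1" using d by simp
   finally have "corr s N g (d - 1) = 0" by simp
   moreover have "corr s N g (d - 1) = \<delta>" "\<delta> ~= 0" using I d(2) by blast+
   ultimately show False by simp
  qed
  have dN: "d \<le> N" using I by simp
  let ?f = "npoly N f"
  have deg: "degree ?f = d"
  proof (rule antisym)
   show "degree ?f \<le> d" using I by (intro degree_le) (auto simp: coeff_npoly)
   show "d \<le> degree ?f" using I dN by (intro le_degree) (auto simp: coeff_npoly)
  qed
  have "w b * poly ?f b = 0" if b: "b \<in> A" for b
  proof (rule vandermonde[OF A(1) _ b])
   fix l assume l: "l < ?n"
   then have "0 = corr s N f l" using I A(2) \<open>d \<le> ?n\<close> by simp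
   also have "\<dots> = (\<Sum>i\<le>d. coeff ?f i * s (l + i))"
    unfolding corr_def using I dN by (intro sum.mono_neutral_cong_right) (auto simp: coeff_npoly)
   also have "\<dots> = (\<Sum>i\<le>d. coeff ?f i * (\<Sum>a\<in>A. w a * a ^ (l + i)))"
    using l A(2) \<open>d \<le> ?n\<close> by (intro sum.cong) (auto simp: s)
   also have "\<dots> = (\<Sum>a\<in>A. w a * a ^ l * poly ?f a)" using deg by (intro sum_moments) simp
   finally show "(\<Sum>a\<in>A. w a * poly ?f a * a ^ l) = 0" by (simp add: mult_ac)
  qed
  then have root: "poly ?f b = 0" if "b \<in> A" for b using w that by fastforce
  have "?f = linprod A"
   using A root deg \<open>d \<le> ?n\<close> I dN by (intro monic_eq_linprod) (auto simp: coeff_npoly)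
  then show ?thesis using deg linprod_props(1)[OF A(1)] by simp
qed

section \<open>Field cells as residues, and Massey's algorithm as a program\<close>

definition fe :: "state => nat list => 'a::prime_card mod_ring" where
  "fe \<sigma> a = of_int (fmem \<sigma> a)"

lemma of_int_mod [simp]: "(of_int (x mod int CARD('a)) :: 'a::prime_card mod_ring) = of_int x"
  using of_int_mod_CHAR[of x, where 'a = "'a mod_ring"] by simp

lemma of_int_eq_0_iff_dvd: "(of_int x :: 'a::prime_card mod_ring) = 0 \<longleftrightarrow> int CARD('a) dvd x"
proof -
  let ?n = "nat (x mod int CARD('a))"
  have p: "0 < CARD('a)" using prime_gt_0_nat[OF prime_card] .
  then have nn: "0 \<le> x mod int CARD('a)" "x mod int CARD('a) < int CARD('a)" by simp_all
  have "(of_int x :: 'a mod_ring) = of_int (x mod int CARD('a))" by simp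
  also have "\<dots> = of_nat ?n" by (rule of_nat_nat[OF nn(1), symmetric])
  finally have eq: "(of_int x :: 'a mod_ring) = of_nat ?n" .
  show ?thesis
  proof (cases "?n = 0")
   case True
   then show ?thesis unfolding eq using nn by (simp add: dvd_eq_mod_eq_0)
  next
   case False
   have "?n < CARD('a)" using nn by (simp add: nat_less_iff)
   then have "(of_nat ?n :: 'a mod_ring) ~= 0" using False by (intro of_nat_neq_0) simp_all
   moreover have "\<not> int CARD('a) dvd x" using False by (simp add: dvd_eq_mod_eq_0)
   ultimately show ?thesis unfolding eq by blast
  qed
qed

lemma of_int_eq_iff_cong:
  "(of_int x :: 'a::prime_card mod_ring) = of_int y \<longleftrightarrow> [x = y] (mod int CARD('a))"
  using of_int_eq_0_iff_dvd[of "x - y", where 'a = 'a] by (simp add: cong_iff_dvd_diff)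

text \<open>The inverse of zero is 0 on both sides, so machine division is field division without a
  side condition.\<close>

lemma of_int_inverse:
  "(of_int (modular_inverse (int CARD('a)) b) :: 'a::prime_card mod_ring) = inverse (of_int b)"
proof (cases "int CARD('a) dvd b")
  case True
  then have "\<not> coprime (int CARD('a)) b" using prime_card_int[where 'a = 'a]
   by (metis coprime_absorb_left not_prime_unit)
  then show ?thesis using True of_int_eq_0_iff_dvd[of b, where 'a = 'a]
   by (simp add: modular_inverse_def coprime_commute)
next
  case False
  then have "coprime b (int CARD('a))"
   using prime_card_int[where 'a = 'a] by (meson coprime_commute prime_imp_coprime)
  then have "cong (modular_inverse (int CARD('a)) b * b) 1 (int CARD('a))" by (rule cong_modular_inverse2)
  then have "(of_int (modular_inverse (int CARD('a)) b * b) :: 'a mod_ring) = of_int 1"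
   by (simp only: of_int_eq_iff_cong)
  moreover have "(of_int b :: 'a mod_ring) ~= 0" using False of_int_eq_0_iff_dvd[of b, where 'a = 'a] by simp
  ultimately show ?thesis by (simp add: field_simps)
qed

lemma of_int_fop [simp]:
  "(of_int (fop_val CARD('a) FAdd x y) :: 'a::prime_card mod_ring) = of_int x + of_int y"
  "(of_int (fop_val CARD('a) FSub x y) :: 'a::prime_card mod_ring) = of_int x - of_int y"
  "(of_int (fop_val CARD('a) FMul x y) :: 'a::prime_card mod_ring) = of_int x * of_int y"
  "(of_int (fop_val CARD('a) FDiv x y) :: 'a::prime_card mod_ring) = of_int x / of_int y"
  by (simp_all add: fop_val.simps of_int_inverse divide_inverse)

declare fop_val.simps [simp del]

lemma fe_simps [simp]:
  "fe (set_reg r v \<sigma>) = fe \<sigma>" "fe (set_word l v \<sigma>) = fe \<sigma>" "fe (set_int l v' \<sigma>) = fe \<sigma>"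
  "fe (set_felt l v' \<sigma>) = (fe \<sigma>)(addr \<sigma> l := of_int v')"
  "of_int (fval \<sigma> l) = fe \<sigma> (addr \<sigma> l)" "of_int (fmem \<sigma> a) = fe \<sigma> a"
  by (auto simp: fe_def fval_def fun_eq_iff)

lemma addr_simps [simp]: "addr \<sigma> [] = []" "addr \<sigma> (x # l) = atom_val \<sigma> x # addr \<sigma> l"
  by (simp_all add: addr_def)

lemma canon_inj:
  assumes "canon CARD('a) \<sigma>"
  shows "fmem \<sigma> a = fmem \<sigma> b \<longleftrightarrow> (fe \<sigma> a :: 'a::prime_card mod_ring) = fe \<sigma> b"
proof -
  have "fmem \<sigma> a mod int CARD('a) = fmem \<sigma> a" "fmem \<sigma> b mod int CARD('a) = fmem \<sigma> b"
   using assms unfolding canon_def by (auto intro!: mod_pos_pos_trivial)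
  then show ?thesis unfolding fe_def of_int_eq_iff_cong cong_def by simp
qed

lemma FEq_iff:
  assumes "canon CARD('a) \<sigma>"
  shows "cond_val (FEq a b) \<sigma> \<longleftrightarrow> (fe \<sigma> (addr \<sigma> a) :: 'a::prime_card mod_ring) = fe \<sigma> (addr \<sigma> b)"
  using canon_inj[OF assms] by (simp add: fval_def)

lemma agree_regs: "agree c \<sigma> s ==> r \<notin> written wr_r c ==> regs s r = regs \<sigma> r"
  by (simp add: agree_def)
lemma agree_wmem: "agree c \<sigma> s ==> n \<notin> written wr_w c ==> wmem s (n # as) = wmem \<sigma> (n # as)"
  by (simp add: agree_def)
lemma agree_zmem: "agree c \<sigma> s ==> n \<notin> written wr_z c ==> zmem s (n # as) = zmem \<sigma> (n # as)"
  by (simp add: agree_def)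
lemma agree_fmem: "agree c \<sigma> s ==> n \<notin> written wr_f c ==> fmem s (n # as) = fmem \<sigma> (n # as)"
  by (simp add: agree_def)
lemma agree_fe: "agree c \<sigma> s ==> n \<notin> written wr_f c ==> fe s (n # as) = fe \<sigma> (n # as)"
  by (simp only: agree_fmem fe_def not_False_eq_True)


lemma tags_Const [simp]: "tags (Const n # l) = {n}" by (simp add: tags_def)

lemma trm_Do_Seq:
  assumes "zfree_instr i" "trm p W c (instr_step p W i \<sigma>) T Z B Q"
  shows "trm p W (Seq (Do i) c) \<sigma> (Suc T) Z B Q"
proof -
  have "trm p W (Seq (Do i) c) \<sigma> (steps (Do i) + T) (0 + Z) B Q"
  proof (rule trm_Seq, rule trm_ev0)
   show "zfree (Do i)" using assms(1) by simp
   show "trm p W c (ev p W (Do i) \<sigma>) T Z B Q" using assms(2) by (simp only: ev.simps)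
  qed simp
  then show ?thesis by simp
qed

lemma trm_Seq':
  assumes "0 < p" "canon p \<sigma>" "trm p W c \<sigma> T1 Z1 B Q1"
   and "\<And>s. Q1 s ==> agree c \<sigma> s ==> canon p s ==> trm p W d s T2 Z2 B Q"
  shows "trm p W (Seq c d) \<sigma> (T1 + T2) (Z1 + Z2) B Q"
proof (rule trm_Seq, rule trm_mono[OF trm_strengthen[OF assms(3,1,2)]])
  show "trm p W d s T2 Z2 B Q" if "Q1 s \<and> agree c \<sigma> s \<and> canon p s" for s
   using that assms(4) by blast
qed (rule order_refl)+

notation Seq (infixr ";;" 60)

abbreviation wset :: "nat => atom => com" where "wset r a \<equiv> Do (WOp r WAdd a (Const 0))"
abbreviation wadd :: "nat => atom => atom => com" where "wadd r a b \<equiv> Do (WOp r WAdd a b)"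
abbreviation wsub :: "nat => atom => atom => com" where "wsub r a b \<equiv> Do (WOp r WSub a b)"
abbreviation wmul :: "nat => atom => atom => com" where "wmul r a b \<equiv> Do (WOp r WMul a b)"
abbreviation fadd :: "loc => loc => loc => com" where "fadd d a b \<equiv> Do (FOp d FAdd a b)"
abbreviation fsub :: "loc => loc => loc => com" where "fsub d a b \<equiv> Do (FOp d FSub a b)"
abbreviation fmul :: "loc => loc => loc => com" where "fmul d a b \<equiv> Do (FOp d FMul a b)"
abbreviation fdiv :: "loc => loc => loc => com" where "fdiv d a b \<equiv> Do (FOp d FDiv a b)"
abbreviation fset :: "loc => atom => com" where "fset d a \<equiv> Do (FofW d a)"
abbreviation fcopy :: "loc => loc => com" where "fcopy d a \<equiv> fadd d a [Const 0]"
abbreviation skip :: com where "skip \<equiv> wset 10 (Const 0)"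

text \<open>Memory plan: f, g and the next f are in \<open>[11, i]\<close>, \<open>[12, i]\<close>
  and \<open>[13, i]\<close>, the discrepancy in \<open>[14]\<close>, \<delta> in
  \<open>[15]\<close>; registers 3, 4, 5 hold d, N + 1 and k. Registers 8 and 9 receive the
  truncated differences \<open>a\<close> and \<open>b\<close> of \<open>massey_step\<close>.\<close>

definition massey_update :: com where
  "massey_update =
   fdiv [Const 18] [Const 14] [Const 15] ;;
   wadd 7 (Reg 5) (Const 1) ;; wmul 10 (Reg 3) (Const 2) ;;
   wsub 8 (Reg 7) (Reg 10) ;; wsub 9 (Reg 10) (Reg 7)"

text \<open>A third array is filled because the old f is still needed, both for its shifted reading
  and as the possible next g.\<close>

definition massey_comb :: com where
  "massey_comb =
   fset [Const 13, Reg 6] (Const 0) ;;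
   If (WLess (Reg 6) (Reg 8)) skip
    (wsub 10 (Reg 6) (Reg 8) ;; fcopy [Const 13, Reg 6] [Const 11, Reg 10]) ;;
   If (WLess (Reg 6) (Reg 9)) skip
    (wsub 10 (Reg 6) (Reg 9) ;; fmul [Const 17] [Const 18] [Const 12, Reg 10] ;;
     fsub [Const 13, Reg 6] [Const 13, Reg 6] [Const 17])"

definition massey_swap :: com where
  "massey_swap =
   If (WLess (Const 0) (Reg 8))
    (For 6 (Reg 4) (fcopy [Const 12, Reg 6] [Const 11, Reg 6]) ;;
     fcopy [Const 15] [Const 14] ;; wsub 3 (Reg 7) (Reg 3)) skip"

definition massey_disc :: com where
  "massey_disc =
   wsub 7 (Reg 5) (Reg 3) ;; fset [Const 14] (Const 0) ;;
   For 6 (Reg 4)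
    (wadd 10 (Reg 7) (Reg 6) ;; fmul [Const 17] [Const 11, Reg 6] [Const 10, Reg 10] ;;
     fadd [Const 14] [Const 14] [Const 17])"

definition massey_body :: com where
  "massey_body = massey_disc ;;
   If (FEq [Const 14] [Const 0]) skip
    (massey_update ;; For 6 (Reg 4) massey_comb ;; massey_swap ;;
     For 6 (Reg 4) (fcopy [Const 11, Reg 6] [Const 13, Reg 6]))"

definition massey_start :: com where
  "massey_start = wadd 4 (Reg 2) (Const 1) ;;
   For 6 (Reg 4) (fset [Const 11, Reg 6] (Const 0) ;; fset [Const 12, Reg 6] (Const 0)) ;;
   fset [Const 11, Const 0] (Const 1) ;; fset [Const 15] (Const 1) ;; wset 3 (Const 0)"

text \<open>Input: moments in field cells \<open>[10, l]\<close>, their number in register 2. Output: the connection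
  polynomial in \<open>[11, i]\<close>, its degree in register 3. Field cell \<open>[0]\<close> is never written and holds zero.\<close>

definition massey :: com where "massey = massey_start ;; For 5 (Reg 2) massey_body"

lemmas massey_defs = massey_update_def massey_comb_def massey_swap_def massey_disc_def massey_body_def
  massey_start_def massey_def

lemma p_pos: "0 < CARD('a::prime_card)" using prime_gt_0_nat[OF prime_card] .

lemma trm_For0:
  assumes "n < W" "canon CARD('a::prime_card) \<sigma>" "r \<notin> written wr_r c"
   and "atom_val \<sigma> hi = n" "hi ~= Reg r" "\<And>h. hi = Reg h ==> h \<notin> written wr_r c"
   and "I 0 (set_reg r 0 \<sigma>)" "loopfree c" "zfree c"
   and "\<And>i s. i < n ==> agree (For r hi c) \<sigma> s ==> canon CARD('a) s ==> regs s r = i ==> I i s ==>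
    I (Suc i) (set_reg r (Suc i) (ev CARD('a) W c s))"
  shows "trm CARD('a) W (For r hi c) \<sigma> (2 + n * (steps c + 2)) 0 B
   (\<lambda>s. I n s \<and> agree (For r hi c) \<sigma> s \<and> canon CARD('a) s \<and> regs s r = n)"
proof -
  have "trm CARD('a) W (For r hi c) \<sigma> (2 + n * (steps c + 2)) (n * 0) B
   (\<lambda>s. I n s \<and> agree (For r hi c) \<sigma> s \<and> canon CARD('a) s \<and> regs s r = n)"
   by (rule trm_For[where I = I]) (use assms p_pos in \<open>auto intro!: trm_ev0\<close>)
  then show ?thesis by simp
qed

context
  fixes W N :: nat
  assumes W: "4 * N + 8 < W"
begin

lemma trm_massey_disc:
  assumes "canon CARD('a::prime_card) \<sigma>" "regs \<sigma> 4 = Suc N" "regs \<sigma> 5 = k" "k < N" "regs \<sigma> 3 = d" "d \<le> k"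
  shows "trm CARD('a) W massey_disc \<sigma> (4 + (N + 1) * 5) 0 B
   (\<lambda>s. fe s [14] = corr (\<lambda>l. fe \<sigma> [10, l]) N (\<lambda>i. fe \<sigma> [11, i] :: 'a mod_ring) (k - d))"
proof -
  let ?body = "wadd 10 (Reg 7) (Reg 6) ;; fmul [Const 17] [Const 11, Reg 6] [Const 10, Reg 10] ;;
     fadd [Const 14] [Const 14] [Const 17]"
  let ?I = "\<lambda>j s. fe s [14] = (\<Sum>i<j. fe \<sigma> [11, i] * (fe \<sigma> [10, k - d + i] :: 'a mod_ring))"
  define s0 where "s0 = set_felt [Const 14] 0 (set_reg 7 (k - d) \<sigma>)"
  have cs: "canon CARD('a) s0" using assms(1) p_pos[where 'a = 'a] by (auto simp: canon_def s0_def)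
  have 1: "trm CARD('a) W (For 6 (Reg 4) ?body) s0 (2 + (Suc N) * (steps ?body + 2)) 0 B
   (\<lambda>s. ?I (Suc N) s \<and> agree (For 6 (Reg 4) ?body) s0 s \<and> canon CARD('a) s \<and> regs s 6 = Suc N)"
  proof (rule trm_For0[where I = ?I, OF _ cs])
   fix i s assume i: "i < Suc N" and ag: "agree (For 6 (Reg 4) ?body) s0 s" and r: "regs s 6 = i"
    and IH: "?I i s"
   have "regs s 7 = k - d" using agree_regs[OF ag, of 7] assms W by (simp add: s0_def)
   moreover have "fe s [11, j] = (fe \<sigma> [11, j] :: 'a mod_ring)" "fe s [10, j] = (fe \<sigma> [10, j] :: 'a mod_ring)" for j
    using agree_fe[OF ag, of 11 "[j]"] agree_fe[OF ag, of 10 "[j]"] by (simp_all add: s0_def)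
   ultimately show "?I (Suc i) (set_reg 6 (Suc i) (ev CARD('a) W ?body s))"
    using r i IH assms W by simp
  qed (use assms W in \<open>auto simp: s0_def\<close>)
  have 2: "instr_step CARD('a) W (FofW [Const 14] (Const 0)) (instr_step CARD('a) W (WOp 7 WSub (Reg 5) (Reg 3)) \<sigma>) = s0"
   using assms W by (simp add: s0_def)
  have "trm CARD('a) W massey_disc \<sigma> (Suc (Suc (2 + (Suc N) * (steps ?body + 2)))) 0 B
   (\<lambda>s. fe s [14] = corr (\<lambda>l. fe \<sigma> [10, l]) N (\<lambda>i. fe \<sigma> [11, i] :: 'a mod_ring) (k - d))"
   unfolding massey_disc_def
   by (intro trm_Do_Seq, simp, simp, unfold 2, rule trm_mono[OF 1]) (auto simp: corr_def lessThan_Suc_atMost)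
  then show ?thesis by (rule trm_mono) simp_all
qed

lemma trm_massey_body:
  fixes \<sigma> :: state
  defines "F \<equiv> fe :: state => nat list => 'a::prime_card mod_ring"
  assumes c: "canon CARD('a) \<sigma>" and r: "regs \<sigma> 4 = Suc N" "regs \<sigma> 5 = k" "k < N" and z: "F \<sigma> [0] = 0"
   and inv: "massey_inv (\<lambda>l. F \<sigma> [10, l]) N k (regs \<sigma> 3) (\<lambda>i. F \<sigma> [11, i]) (\<lambda>i. F \<sigma> [12, i]) (F \<sigma> [15])"
  shows "trm CARD('a) W massey_body \<sigma> (60 * (N + 1)) 0 B (\<lambda>s.
   massey_inv (\<lambda>l. F \<sigma> [10, l]) N (Suc k) (regs s 3) (\<lambda>i. F s [11, i]) (\<lambda>i. F s [12, i]) (F s [15]))"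
proof -
  define d where "d = regs \<sigma> 3"
  define f where "f = (\<lambda>i. F \<sigma> [11, i])"
  define g where "g = (\<lambda>i. F \<sigma> [12, i])"
  define \<delta> where "\<delta> = F \<sigma> [15]"
  define m where "m = (\<lambda>l. F \<sigma> [10, l])"
  define e where "e = corr m N f (k - d)"
  define a b where "a = Suc k - 2 * d" and "b = 2 * d - Suc k"
  have inv': "massey_inv m N k d f g \<delta>" using inv by (simp add: m_def d_def f_def g_def \<delta>_def)
  then have dk: "d \<le> k" by (simp add: massey_inv_def)
  note simps = F_def[symmetric]
  let ?Q = "\<lambda>s. massey_inv m N (Suc k) (regs s 3) (\<lambda>i. F s [11, i]) (\<lambda>i. F s [12, i]) (F s [15])"
  have "trm CARD('a) W massey_body \<sigma> ((4 + (N + 1) * 5) + Suc (50 * (N + 1))) (0 + 0) B ?Q"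
   unfolding massey_body_def
  proof (rule trm_Seq'[OF p_pos c trm_massey_disc[OF c r(1-3) d_def[symmetric] dk, where B = B]])
   fix s assume disc: "fe s [14] = corr (\<lambda>l. fe \<sigma> [10, l]) N (\<lambda>i. fe \<sigma> [11, i] :: 'a mod_ring) (k - d)"
    and ag: "agree massey_disc \<sigma> s" and cs: "canon CARD('a) s"
   have e: "F s [14] = e" using disc by (simp add: e_def m_def f_def F_def)
   have rs: "regs s 3 = d" "regs s 4 = Suc N" "regs s 5 = k"
    using agree_regs[OF ag, of 3] agree_regs[OF ag, of 4] agree_regs[OF ag, of 5] r d_def
    by (simp_all add: massey_disc_def)
   have fs: "F s [11, i] = f i" "F s [12, i] = g i" "F s [15] = \<delta>" "F s [0] = 0" for i
    using agree_fe[OF ag, of 11 "[i]", where 'a = 'a] agree_fe[OF ag, of 12 "[i]", where 'a = 'a]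
     agree_fe[OF ag, of 15 "[]", where 'a = 'a] agree_fe[OF ag, of 0 "[]", where 'a = 'a] z
    by (simp_all add: massey_disc_def F_def f_def g_def \<delta>_def)
   show "trm CARD('a) W (If (FEq [Const 14] [Const 0]) skip
    (massey_update ;; For 6 (Reg 4) massey_comb ;; massey_swap ;;
     For 6 (Reg 4) (fcopy [Const 11, Reg 6] [Const 13, Reg 6]))) s (Suc (50 * (N + 1))) 0 B ?Q"
   proof (rule trm_If)
    assume "cond_val (FEq [Const 14] [Const 0]) s"
    then have "e = 0" using FEq_iff[OF cs, of "[Const 14]" "[Const 0]"] e fs(4) by (simp add: F_def)
    then have *: "massey_inv m N (Suc k) d f g \<delta>" using massey_step_0[OF inv'] by (simp add: e_def)
    show "trm CARD('a) W skip s (50 * (N + 1)) 0 B ?Q"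
     by (rule trm_mono[OF trm_ev0[where Q = ?Q and B = B]]) (use * rs fs in \<open>simp_all add: F_def\<close>)
   next
    assume "\<not> cond_val (FEq [Const 14] [Const 0]) s"
    then have "e ~= 0" using FEq_iff[OF cs, of "[Const 14]" "[Const 0]"] e fs(4) by (simp add: F_def)
    define h where "h = (\<lambda>i. shift a f i - e / \<delta> * shift b g i)"
    have step: "massey_inv m N (Suc k) (if 0 < a then Suc k - d else d) h (if 0 < a then f else g) (if 0 < a then e else \<delta>)"
     using massey_step[OF inv' r(3) e_def[symmetric] \<open>e ~= 0\<close>] unfolding h_def a_def b_def .
    have upd: "trm CARD('a) W massey_update s (steps massey_update) 0 B
     (\<lambda>s. regs s 7 = Suc k \<and> regs s 8 = a \<and> regs s 9 = b \<and> F s [18] = e / \<delta>)"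
     by (rule trm_ev0) (use rs fs e W r(3) dk in \<open>simp_all add: massey_update_def a_def b_def F_def mult_2 mult_2_right\<close>)
    show "trm CARD('a) W (massey_update ;; For 6 (Reg 4) massey_comb ;; massey_swap ;;
     For 6 (Reg 4) (fcopy [Const 11, Reg 6] [Const 13, Reg 6])) s (50 * (N + 1)) 0 B ?Q"
    proof (rule trm_mono[OF trm_Seq'[OF p_pos cs upd]])
     fix s1 assume s1: "regs s1 7 = Suc k \<and> regs s1 8 = a \<and> regs s1 9 = b \<and> F s1 [18] = e / \<delta>"
     and ag1: "agree massey_update s s1" and c1: "canon CARD('a) s1"
     have r1: "regs s1 3 = d" "regs s1 4 = Suc N" "regs s1 5 = k"
     using agree_regs[OF ag1, of 3] agree_regs[OF ag1, of 4] agree_regs[OF ag1, of 5] rs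
     by (simp_all add: massey_update_def)
     have f1: "F s1 [11, i] = f i" "F s1 [12, i] = g i" "F s1 [15] = \<delta>" "F s1 [0] = 0" "F s1 [14] = e" for i
     using agree_fe[OF ag1, of 11 "[i]", where 'a = 'a] agree_fe[OF ag1, of 12 "[i]", where 'a = 'a]
     agree_fe[OF ag1, of 15 "[]", where 'a = 'a] agree_fe[OF ag1, of 0 "[]", where 'a = 'a]
     agree_fe[OF ag1, of 14 "[]", where 'a = 'a] fs e
     by (simp_all add: massey_update_def F_def)
     have comb: "trm CARD('a) W (For 6 (Reg 4) massey_comb) s1 (2 + Suc N * (steps massey_comb + 2)) 0 B
     (\<lambda>s. (\<forall>i<Suc N. F s [13, i] = h i) \<and> agree (For 6 (Reg 4) massey_comb) s1 s \<and> canon CARD('a) s \<and> regs s 6 = Suc N)"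
     proof (rule trm_For0[where I = "\<lambda>j s. \<forall>i<j. F s [13, i] = h i", OF _ c1])
     fix j t assume j: "j < Suc N" and ag: "agree (For 6 (Reg 4) massey_comb) s1 t" and rt: "regs t 6 = j"
     and IH: "\<forall>i<j. F t [13, i] = h i"
     have rt': "regs t 8 = a" "regs t 9 = b"
     using agree_regs[OF ag, of 8] agree_regs[OF ag, of 9] s1 by (simp_all add: massey_comb_def)
     have ft: "F t [11, i] = f i" "F t [12, i] = g i" "F t [18] = e / \<delta>" "F t [0] = 0" for i
     using agree_fe[OF ag, of 11 "[i]", where 'a = 'a] agree_fe[OF ag, of 12 "[i]", where 'a = 'a]
     agree_fe[OF ag, of 18 "[]", where 'a = 'a] agree_fe[OF ag, of 0 "[]", where 'a = 'a] f1 s1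
     by (simp_all add: massey_comb_def F_def)
     show "\<forall>i<Suc j. F (set_reg 6 (Suc j) (ev CARD('a) W massey_comb t)) [13, i] = h i"
     using IH rt rt' ft W j
     by (auto simp: massey_comb_def F_def h_def shift_def less_Suc_eq)
     qed (use r1 W in \<open>auto simp: massey_comb_def\<close>)
     show "trm CARD('a) W (For 6 (Reg 4) massey_comb ;; massey_swap ;;
     For 6 (Reg 4) (fcopy [Const 11, Reg 6] [Const 13, Reg 6])) s1
     ((2 + Suc N * (steps massey_comb + 2)) + ((Suc (2 + Suc N * 3 + 2)) + (2 + Suc N * 3))) (0 + (0 + 0)) B ?Q"
     proof (rule trm_Seq'[OF p_pos c1 comb], elim conjE)
     fix s2 assume h2: "\<forall>i<Suc N. F s2 [13, i] = h i" and ag2: "agree (For 6 (Reg 4) massey_comb) s1 s2"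
     and c2: "canon CARD('a) s2"
     have r2: "regs s2 3 = d" "regs s2 4 = Suc N" "regs s2 5 = k" "regs s2 7 = Suc k" "regs s2 8 = a"
     using agree_regs[OF ag2, of 3] agree_regs[OF ag2, of 4] agree_regs[OF ag2, of 5] r1
     agree_regs[OF ag2, of 7] agree_regs[OF ag2, of 8] s1
     by (simp_all add: massey_comb_def)
     have f2: "F s2 [11, i] = f i" "F s2 [12, i] = g i" "F s2 [15] = \<delta>" "F s2 [0] = 0" "F s2 [14] = e" for i
     using agree_fe[OF ag2, of 11 "[i]", where 'a = 'a] agree_fe[OF ag2, of 12 "[i]", where 'a = 'a]
     agree_fe[OF ag2, of 15 "[]", where 'a = 'a] agree_fe[OF ag2, of 0 "[]", where 'a = 'a]
     agree_fe[OF ag2, of 14 "[]", where 'a = 'a] f1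
     by (simp_all add: massey_comb_def F_def)
     let ?Q3 = "\<lambda>s. regs s 3 = (if 0 < a then Suc k - d else d) \<and> F s [15] = (if 0 < a then e else \<delta>) \<and>
     (\<forall>i<Suc N. F s [12, i] = (if 0 < a then f i else g i))"
     have swap: "trm CARD('a) W massey_swap s2 (Suc (2 + Suc N * 3 + 2)) 0 B ?Q3"
     unfolding massey_swap_def
     proof (rule trm_If)
     assume "cond_val (WLess (Const 0) (Reg 8)) s2"
     then have a: "0 < a" using r2 by simp
     have cp: "trm CARD('a) W (For 6 (Reg 4) (fcopy [Const 12, Reg 6] [Const 11, Reg 6])) s2 (2 + Suc N * (steps (fcopy [Const 12, Reg 6] [Const 11, Reg 6]) + 2)) 0 B
     (\<lambda>s. (\<forall>i<Suc N. F s [12, i] = f i) \<and> agree (For 6 (Reg 4) (fcopy [Const 12, Reg 6] [Const 11, Reg 6])) s2 s \<and> canon CARD('a) s \<and> regs s 6 = Suc N)"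
     proof (rule trm_For0[where I = "\<lambda>j s. \<forall>i<j. F s [12, i] = f i", OF _ c2])
     fix j t assume j: "j < Suc N" and ag: "agree (For 6 (Reg 4) (fcopy [Const 12, Reg 6] [Const 11, Reg 6])) s2 t"
     and rt: "regs t 6 = j" and IH: "\<forall>i<j. F t [12, i] = f i"
     have "F t [11, i] = f i" "F t [0] = 0" for i
     using agree_fe[OF ag, of 11 "[i]", where 'a = 'a] agree_fe[OF ag, of 0 "[]", where 'a = 'a] f2
     by (simp_all add: F_def)
     then show "\<forall>i<Suc j. F (set_reg 6 (Suc j) (ev CARD('a) W (fcopy [Const 12, Reg 6] [Const 11, Reg 6]) t)) [12, i] = f i"
     using IH rt by (auto simp: F_def less_Suc_eq)
     qed (use r2 W in auto)
     show "trm CARD('a) W (For 6 (Reg 4) (fcopy [Const 12, Reg 6] [Const 11, Reg 6]) ;;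
     fcopy [Const 15] [Const 14] ;; wsub 3 (Reg 7) (Reg 3)) s2 (2 + Suc N * 3 + 2) 0 B ?Q3"
     proof (rule trm_mono[OF trm_Seq'[OF p_pos c2 cp]], elim conjE)
     fix s3 assume g3: "\<forall>i<Suc N. F s3 [12, i] = f i" and ag3: "agree (For 6 (Reg 4) (fcopy [Const 12, Reg 6] [Const 11, Reg 6])) s2 s3"
     have "regs s3 3 = d" "regs s3 7 = Suc k" "F s3 [14] = e" "F s3 [0] = 0"
     using agree_regs[OF ag3, of 3] agree_regs[OF ag3, of 7] agree_fe[OF ag3, of 14 "[]", where 'a = 'a]
     agree_fe[OF ag3, of 0 "[]", where 'a = 'a] r2 f2 by (simp_all add: F_def)
     then show "trm CARD('a) W (fcopy [Const 15] [Const 14] ;; wsub 3 (Reg 7) (Reg 3)) s3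
     (steps (fcopy [Const 15] [Const 14] ;; wsub 3 (Reg 7) (Reg 3))) 0 B ?Q3"
     by (intro trm_ev0) (use g3 a W r(3) in \<open>auto simp: F_def\<close>)
     qed simp_all
     next
     assume "\<not> cond_val (WLess (Const 0) (Reg 8)) s2"
     then have a: "a = 0" using r2 by simp
     show "trm CARD('a) W skip s2 (2 + Suc N * 3 + 2) 0 B ?Q3"
     by (rule trm_mono[OF trm_ev0[where Q = ?Q3 and B = B]]) (use a r2 f2 in \<open>simp_all add: F_def\<close>)
     qed simp
     show "trm CARD('a) W (massey_swap ;; For 6 (Reg 4) (fcopy [Const 11, Reg 6] [Const 13, Reg 6])) s2
     ((Suc (2 + Suc N * 3 + 2)) + (2 + Suc N * 3)) (0 + 0) B ?Q"
     proof (rule trm_Seq'[OF p_pos c2 swap], elim conjE)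
     fix s3 assume r3: "regs s3 3 = (if 0 < a then Suc k - d else d)" and d3: "F s3 [15] = (if 0 < a then e else \<delta>)"
     and g3: "\<forall>i<Suc N. F s3 [12, i] = (if 0 < a then f i else g i)"
     and ag3: "agree massey_swap s2 s3" and c3: "canon CARD('a) s3"
     have f3: "F s3 [13, i] = F s2 [13, i]" "F s3 [0] = 0" "regs s3 4 = Suc N" for i
     using agree_fe[OF ag3, of 13 "[i]", where 'a = 'a] agree_fe[OF ag3, of 0 "[]", where 'a = 'a]
     agree_regs[OF ag3, of 4] r2 f2 by (simp_all add: massey_swap_def F_def)
     have "trm CARD('a) W (For 6 (Reg 4) (fcopy [Const 11, Reg 6] [Const 13, Reg 6])) s3 (2 + Suc N * (steps (fcopy [Const 11, Reg 6] [Const 13, Reg 6]) + 2)) 0 B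
     (\<lambda>s. (\<forall>i<Suc N. F s [11, i] = h i) \<and> agree (For 6 (Reg 4) (fcopy [Const 11, Reg 6] [Const 13, Reg 6])) s3 s \<and> canon CARD('a) s \<and> regs s 6 = Suc N)"
     proof (rule trm_For0[where I = "\<lambda>j s. \<forall>i<j. F s [11, i] = h i", OF _ c3])
     fix j t assume j: "j < Suc N" and ag: "agree (For 6 (Reg 4) (fcopy [Const 11, Reg 6] [Const 13, Reg 6])) s3 t"
     and rt: "regs t 6 = j" and IH: "\<forall>i<j. F t [11, i] = h i"
     have "F t [13, i] = F s2 [13, i]" "F t [0] = 0" for i
     using agree_fe[OF ag, of 13 "[i]", where 'a = 'a] agree_fe[OF ag, of 0 "[]", where 'a = 'a] f3
     by (simp_all add: F_def)
     then show "\<forall>i<Suc j. F (set_reg 6 (Suc j) (ev CARD('a) W (fcopy [Const 11, Reg 6] [Const 13, Reg 6]) t)) [11, i] = h i"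
     using IH rt h2 j by (auto simp: F_def less_Suc_eq)
     qed (use f3 W in auto)
     then show "trm CARD('a) W (For 6 (Reg 4) (fcopy [Const 11, Reg 6] [Const 13, Reg 6])) s3 (2 + Suc N * 3) 0 B ?Q"
     proof (rule trm_mono, goal_cases)
     case (4 s)
     then have ag: "agree (For 6 (Reg 4) (fcopy [Const 11, Reg 6] [Const 13, Reg 6])) s3 s"
     and hs: "\<forall>i<Suc N. F s [11, i] = h i" by blast+
     have "regs s 3 = regs s3 3" "F s [15] = F s3 [15]" "F s [12, i] = F s3 [12, i]" for i
     using agree_regs[OF ag, of 3] agree_fe[OF ag, of 15 "[]", where 'a = 'a]
     agree_fe[OF ag, of 12 "[i]", where 'a = 'a] by (simp_all add: F_def)
     then show ?case
     using massey_inv_cong[OF step, of "\<lambda>i. F s [11, i]" "\<lambda>i. F s [12, i]"] hs r3 d3 g3 r(3)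
     by (auto simp: less_Suc_eq_le)
     qed simp_all
     qed
     qed
    qed (simp_all add: massey_update_def massey_comb_def)
   qed simp
  qed
  then have "trm CARD('a) W massey_body \<sigma> (60 * (N + 1)) 0 B ?Q" by (rule trm_mono) simp_all
  then show ?thesis unfolding m_def .
qed

text \<open>The cost is quadratic because each of N rounds does linear work. The condition on W
  fixed by the context keeps all word arithmetic on indices from wrapping around.\<close>

theorem trm_massey:
  fixes \<sigma> :: state
  defines "F \<equiv> fe :: state => nat list => 'a::prime_card mod_ring"
  assumes c: "canon CARD('a) \<sigma>" and r: "regs \<sigma> 2 = N" and z: "F \<sigma> [0] = 0"
  shows "trm CARD('a) W massey \<sigma> (80 * (N + 1) ^ 2) 0 B (\<lambda>s.
   \<exists>g \<delta>. massey_inv (\<lambda>l. F \<sigma> [10, l]) N N (regs s 3) (\<lambda>i. F s [11, i]) g \<delta>)"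
proof -
  let ?clear = "fset [Const 11, Reg 6] (Const 0) ;; fset [Const 12, Reg 6] (Const 0)"
  let ?init = "fset [Const 11, Const 0] (Const 1) ;; fset [Const 15] (Const 1) ;; wset 3 (Const 0)"
  let ?st = "\<lambda>s. regs s 3 = 0 \<and> regs s 4 = Suc N \<and> F s [15] = 1 \<and> (\<forall>i<Suc N. F s [11, i] = (if i = 0 then 1 else 0)) \<and>
    (\<forall>i<Suc N. F s [12, i] = 0)"
  have start: "trm CARD('a) W massey_start \<sigma> (Suc ((2 + Suc N * 4) + 3)) (0 + 0) B ?st"
   unfolding massey_start_def
  proof (rule trm_Do_Seq)
   define s0 where "s0 = instr_step CARD('a) W (WOp 4 WAdd (Reg 2) (Const 1)) \<sigma>"
   have c0: "canon CARD('a) s0" using c by (simp add: s0_def canon_def)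
   have r0: "regs s0 4 = Suc N" using r W by (simp add: s0_def)
   let ?I = "\<lambda>j s. \<forall>i<j. F s [11, i] = 0 \<and> F s [12, i] = 0"
   have "trm CARD('a) W (For 6 (Reg 4) ?clear) s0 (2 + Suc N * (steps ?clear + 2)) 0 B
     (\<lambda>s. ?I (Suc N) s \<and> agree (For 6 (Reg 4) ?clear) s0 s \<and> canon CARD('a) s \<and> regs s 6 = Suc N)"
    by (rule trm_For0[where I = ?I, OF _ c0]) (use r0 W in \<open>auto simp: F_def less_Suc_eq\<close>)
   then have "trm CARD('a) W (For 6 (Reg 4) ?clear) s0 (2 + Suc N * 4) 0 B
     (\<lambda>s. ?I (Suc N) s \<and> agree (For 6 (Reg 4) ?clear) s0 s)" by (rule trm_mono) simp_all
   then show "trm CARD('a) W (For 6 (Reg 4) ?clear ;; ?init) s0 ((2 + Suc N * 4) + 3) (0 + 0) B ?st"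
   proof (rule trm_Seq'[OF p_pos c0], elim conjE)
    fix s assume I: "?I (Suc N) s" and ag: "agree (For 6 (Reg 4) ?clear) s0 s"
    have "regs s 4 = Suc N" using agree_regs[OF ag, of 4] r0 by simp
    then show "trm CARD('a) W ?init s 3 0 B ?st"
     by (intro trm_mono[OF trm_ev0[where Q = ?st and B = B]]) (use I W in \<open>auto simp: F_def\<close>)
   qed
  qed simp
  let ?I = "\<lambda>k s. massey_inv (\<lambda>l. F \<sigma> [10, l]) N k (regs s 3) (\<lambda>i. F s [11, i]) (\<lambda>i. F s [12, i]) (F s [15])"
  have "trm CARD('a) W massey \<sigma> ((Suc ((2 + Suc N * 4) + 3)) + (2 + N * (60 * (N + 1) + 2))) ((0 + 0) + N * 0) B
    (\<lambda>s. ?I N s \<and> agree (For 5 (Reg 2) massey_body) s s \<or> ?I N s)"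
   unfolding massey_def
  proof (rule trm_Seq'[OF p_pos c start], elim conjE)
   fix s assume s: "regs s 3 = 0" "regs s 4 = Suc N" "F s [15] = 1" "\<forall>i<Suc N. F s [11, i] = (if i = 0 then 1 else 0)"
    "\<forall>i<Suc N. F s [12, i] = 0" and ag: "agree massey_start \<sigma> s" and cs: "canon CARD('a) s"
   have s': "regs s 2 = N" "F s [0] = 0" "F s [10, l] = F \<sigma> [10, l]" for l
    using agree_regs[OF ag, of 2] agree_fe[OF ag, of 0 "[]", where 'a = 'a]
     agree_fe[OF ag, of 10 "[l]", where 'a = 'a] r z by (simp_all add: massey_start_def F_def)
   have "trm CARD('a) W (For 5 (Reg 2) massey_body) s (2 + N * (60 * (N + 1) + 2)) (N * 0) B
    (\<lambda>t. ?I N t \<and> agree (For 5 (Reg 2) massey_body) s t \<and> canon CARD('a) t \<and> regs t 5 = N)"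
   proof (rule trm_For[where I = ?I])
    show "?I 0 (set_reg 5 0 s)"
     using massey_inv_cong[OF massey_init[of "\<lambda>l. F \<sigma> [10, l]" N], of "\<lambda>i. F s [11, i]" "\<lambda>i. F s [12, i]"] s
     by (simp add: F_def)
   next
    fix k t assume k: "k < N" and ag': "agree (For 5 (Reg 2) massey_body) s t" and ct: "canon CARD('a) t"
     and rt: "regs t 5 = k" and I: "?I k t"
    have t: "regs t 4 = Suc N" "F t [0] = 0" "F t [10, l] = F \<sigma> [10, l]" for l
     using agree_regs[OF ag', of 4] agree_fe[OF ag', of 0 "[]", where 'a = 'a]
     agree_fe[OF ag', of 10 "[l]", where 'a = 'a] s s' by (simp_all add: massey_defs F_def)
    have I': "massey_inv (\<lambda>l. F t [10, l]) N k (regs t 3) (\<lambda>i. F t [11, i]) (\<lambda>i. F t [12, i]) (F t [15])"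
     using I by (simp only: t)
    from trm_massey_body[OF ct t(1) rt k t(2)[unfolded F_def] I'[unfolded F_def], of B]
    show "trm CARD('a) W massey_body t (60 * (N + 1)) 0 B
     (\<lambda>s'. agree massey_body t s' --> regs s' 5 = k --> ?I (Suc k) (set_reg 5 (Suc k) s'))"
     by (rule trm_mono) (simp_all add: F_def[symmetric] t(3), simp add: F_def)
   qed (use s s' W cs p_pos in \<open>auto simp: massey_defs\<close>)
   then show "trm CARD('a) W (For 5 (Reg 2) massey_body) s (2 + N * (60 * (N + 1) + 2)) (N * 0) B
    (\<lambda>s. ?I N s \<and> agree (For 5 (Reg 2) massey_body) s s \<or> ?I N s)" by (rule trm_mono) auto
  qed
  then show ?thesis by (rule trm_mono) (auto simp: power2_eq_square algebra_simps)
qed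

end

text \<open>The last conjunct frames the untouched cells of the target array itself.
  \<open>agree\<close> cannot give this, as it works by tag, and all factors share the tag
  20.\<close>

lemma trm_fcopy:
  assumes c: "canon CARD('a::prime_card) \<sigma>" and h: "regs \<sigma> h = n" "n < W" "h ~= 6"
   and t: "t ~= u" "t ~= 0" "Reg 6 \<notin> set dl" "Reg 6 \<notin> set sl" and z: "fe \<sigma> [0] = (0 :: 'a mod_ring)"
  shows "trm CARD('a) W (For 6 (Reg h) (fcopy (Const t # dl @ [Reg 6]) (Const u # sl @ [Reg 6]))) \<sigma> (2 + n * 3) 0 B
   (\<lambda>s. (\<forall>i<n. fe s (t # addr \<sigma> dl @ [i]) = (fe \<sigma> (u # addr \<sigma> sl @ [i]) :: 'a mod_ring)) \<and>
     (\<forall>a. (\<forall>i<n. a ~= t # addr \<sigma> dl @ [i]) --> fe s a = (fe \<sigma> a :: 'a mod_ring)))"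
proof -
  let ?b = "fcopy (Const t # dl @ [Reg 6]) (Const u # sl @ [Reg 6])"
  let ?I = "\<lambda>j s. (\<forall>i<j. fe s (t # addr \<sigma> dl @ [i]) = (fe \<sigma> (u # addr \<sigma> sl @ [i]) :: 'a mod_ring)) \<and>
     (\<forall>a. (\<forall>i<j. a ~= t # addr \<sigma> dl @ [i]) --> fe s a = (fe \<sigma> a :: 'a mod_ring))"
  have "trm CARD('a) W (For 6 (Reg h) ?b) \<sigma> (2 + n * (steps ?b + 2)) 0 B
   (\<lambda>s. ?I n s \<and> agree (For 6 (Reg h) ?b) \<sigma> s \<and> canon CARD('a) s \<and> regs s 6 = n)"
  proof (rule trm_For0[where I = ?I, OF h(2) c])
   fix j s assume ag: "agree (For 6 (Reg h) ?b) \<sigma> s" and r: "regs s 6 = j" and I: "?I j s"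
   have ad: "addr s (l @ [Reg 6]) = addr \<sigma> l @ [j]" if "Reg 6 \<notin> set l" for l
   proof -
    have "atom_val s x = atom_val \<sigma> x" if "x \<in> set l" for x
    proof (cases x)
     case (Reg q)
     then have "q ~= 6" using that \<open>Reg 6 \<notin> set l\<close> by auto
     then show ?thesis using agree_regs[OF ag, of q] Reg by simp
    qed simp
    then show ?thesis using r by (simp add: addr_def)
   qed
   have src: "fe s (u # addr \<sigma> sl @ [j]) = (fe \<sigma> (u # addr \<sigma> sl @ [j]) :: 'a mod_ring)"
    using I t(1) by simp
   have z': "fe s [0] = (0 :: 'a mod_ring)" using I t(2) z by simp
   have "fe (set_reg 6 (Suc j) (ev CARD('a) W ?b s)) =
    (fe s)(t # addr \<sigma> dl @ [j] := (fe \<sigma> (u # addr \<sigma> sl @ [j]) :: 'a mod_ring))"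
    using src z' ad t(3,4) by simp
   then show "?I (Suc j) (set_reg 6 (Suc j) (ev CARD('a) W ?b s))"
    using I by (auto simp: less_Suc_eq)
  qed (use h in auto)
  then show ?thesis by (rule trm_mono) simp_all
qed

lemma trm_fclear:
  assumes c: "canon CARD('a::prime_card) \<sigma>" and h: "regs \<sigma> h = n" "n < W" "h ~= 6"
  shows "trm CARD('a) W (For 6 (Reg h) (fset [Const t, Reg 6] (Const 0))) \<sigma> (2 + n * 3) 0 B
   (\<lambda>s. (\<forall>i<n. fe s [t, i] = (0 :: 'a mod_ring)) \<and>
     (\<forall>a. (\<forall>i<n. a ~= [t, i]) --> fe s a = (fe \<sigma> a :: 'a mod_ring)))"
proof -
  let ?b = "fset [Const t, Reg 6] (Const 0)"
  let ?I = "\<lambda>j s. (\<forall>i<j. fe s [t, i] = (0 :: 'a mod_ring)) \<and>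
     (\<forall>a. (\<forall>i<j. a ~= [t, i]) --> fe s a = (fe \<sigma> a :: 'a mod_ring))"
  have "trm CARD('a) W (For 6 (Reg h) ?b) \<sigma> (2 + n * (steps ?b + 2)) 0 B
   (\<lambda>s. ?I n s \<and> agree (For 6 (Reg h) ?b) \<sigma> s \<and> canon CARD('a) s \<and> regs s 6 = n)"
  proof (rule trm_For0[where I = ?I, OF h(2) c])
   fix j s assume r: "regs s 6 = j" and I: "?I j s"
   have "fe (set_reg 6 (Suc j) (ev CARD('a) W ?b s)) = (fe s)([t, j] := (0 :: 'a mod_ring))"
    using r by simp
   then show "?I (Suc j) (set_reg 6 (Suc j) (ev CARD('a) W ?b s))"
    using I by (auto simp: less_Suc_eq)
  qed (use h in auto)
  then show ?thesis by (rule trm_mono) simp_all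
qed

section \<open>Multiplication modulo a split polynomial\<close>

text \<open>A residue modulo a split polynomial is described only by its values at the roots.
  Congruences between polynomials are thereby replaced by equations in the field.\<close>

definition evp :: "(nat => 'a::comm_ring_1) => nat => 'a => 'a" where
  "evp f n x = (\<Sum>i<n. f i * x ^ i)"

text \<open>\<open>r (Suc i)\<close> is coefficient i of the accumulator, so \<open>r n\<close> is
  its top coefficient. Multiplication by X pushes it to X^n, and at a root of the modulus x^n equals
  -G(x).\<close>

lemma horner_step:
  fixes x :: "'a::comm_ring_1"
  assumes n: "0 < n" and G: "evp G n x + x ^ n = 0" and r0: "r 0 = 0"
  shows "evp (\<lambda>i. r i + (u * b i - r n * G i)) n x = x * evp (\<lambda>i. r (Suc i)) n x + u * evp b n x"
proof -
  obtain k where k: "n = Suc k" using n by (cases n) auto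
  have "evp (\<lambda>i. r i + (u * b i - r n * G i)) n x = evp r n x + u * evp b n x - r n * evp G n x"
   unfolding evp_def by (simp add: algebra_simps sum.distrib sum_subtractf sum_distrib_left)
  also have "evp r n x = (\<Sum>i<k. r (Suc i) * x ^ Suc i)"
   unfolding evp_def k sum.lessThan_Suc_shift by (simp add: r0)
  also have "\<dots> = x * (evp (\<lambda>i. r (Suc i)) n x - r n * x ^ k)"
   unfolding evp_def k by (simp add: algebra_simps sum_distrib_left)
  also have "evp G n x = - (x ^ n)" using G by (simp add: eq_neg_iff_add_eq_0)
  finally show ?thesis by (simp add: k algebra_simps)
qed

text \<open>Cell n - j is computed from cell n - j - 1, with j increasing: going downwards, the
  shift in place reads every cell before overwriting it.\<close>

definition mulmod_inner :: "nat => nat => com" where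
  "mulmod_inner ta tb =
   wsub 8 (Reg 20) (Reg 6) ;; wsub 9 (Reg 8) (Const 1) ;;
   fmul [Const 17] [Const 14] [Const 21, Reg 9] ;;
   fmul [Const 18] [Const ta, Reg 7] [Const tb, Reg 9] ;;
   fsub [Const 18] [Const 18] [Const 17] ;;
   fadd [Const 24, Reg 8] [Const 24, Reg 9] [Const 18]"

definition mulmod_body :: "nat => nat => com" where
  "mulmod_body ta tb =
   wsub 7 (Reg 20) (Reg 5) ;; wsub 7 (Reg 7) (Const 1) ;; fcopy [Const 14] [Const 24, Reg 20] ;;
   For 6 (Reg 20) (mulmod_inner ta tb)"

text \<open>Multiplies the residue \<open>[ta, \<cdot>]\<close> by \<open>[tb, \<cdot>]\<close> modulo the monic polynomial \<open>[21, \<cdot>]\<close> whose degree is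
  in register 20, by Horner's scheme. The accumulator \<open>[24, \<cdot>]\<close> is stored with offset 1, so that
  the shift reads the zero cell \<open>[24, 0]\<close>.\<close>

definition mulmod :: "nat => nat => com" where
  "mulmod ta tb =
   wadd 21 (Reg 20) (Const 1) ;; For 6 (Reg 21) (fset [Const 24, Reg 6] (Const 0)) ;;
   For 5 (Reg 20) (mulmod_body ta tb) ;;
   For 6 (Reg 20) (wadd 8 (Reg 6) (Const 1) ;; fcopy [Const ta, Reg 6] [Const 24, Reg 8])"

lemmas mulmod_defs = mulmod_inner_def mulmod_body_def mulmod_def

context
  fixes W n ta tb :: nat
  assumes W: "4 * n + 8 < W" and n: "0 < n"
   and tab: "ta \<notin> {0, 14, 17, 18, 21, 24}" "tb \<notin> {0, 14, 17, 18, 21, 24}"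
begin

lemma trm_mulmod_body:
  fixes \<sigma> :: state
  defines "F \<equiv> fe :: state => nat list => 'a::prime_card mod_ring"
  assumes c: "canon CARD('a) \<sigma>" and r: "regs \<sigma> 20 = n" "regs \<sigma> 5 = k" "k < n" and z: "F \<sigma> [0] = 0"
  shows "trm CARD('a) W (mulmod_body ta tb) \<sigma> (3 + (2 + n * 8)) 0 B
   (\<lambda>s. F s [24, 0] = F \<sigma> [24, 0] \<and> (\<forall>i<n. F s [24, Suc i] =
    F \<sigma> [24, i] + (F \<sigma> [ta, n - 1 - k] * F \<sigma> [tb, i] - F \<sigma> [24, n] * F \<sigma> [21, i])))"
proof -
  let ?pre = "[WOp 7 WSub (Reg 20) (Reg 5), WOp 7 WSub (Reg 7) (Const 1), FOp [Const 14] FAdd [Const 24, Reg 20] [Const 0]]"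
  define s0 where "s0 = instr_step CARD('a) W (?pre ! 2) (instr_step CARD('a) W (?pre ! 1) (instr_step CARD('a) W (?pre ! 0) \<sigma>))"
  have r0: "regs s0 20 = n" "regs s0 7 = n - 1 - k" using r W by (simp_all add: s0_def)
  have f0: "F s0 [14] = F \<sigma> [24, n]" "h ~= 14 ==> F s0 (h # as) = F \<sigma> (h # as)" for h as
   using r z by (simp_all add: s0_def F_def)
  have fop: "0 \<le> fop_val CARD('a) FAdd x y \<and> fop_val CARD('a) FAdd x y < int CARD('a)" for x y
   using p_pos[where 'a = 'a] by (simp add: fop_val.simps)
  have c0: "canon CARD('a) s0" using c fop by (auto simp: s0_def canon_def)
  define v where "v i = F \<sigma> [24, i] + (F \<sigma> [ta, n - 1 - k] * F \<sigma> [tb, i] - F \<sigma> [24, n] * F \<sigma> [21, i])" for i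
  let ?b = "mulmod_inner ta tb"
  let ?I = "\<lambda>j s. \<forall>i\<le>n. F s [24, i] = (if n - j < i then v (i - 1) else F \<sigma> [24, i])"
  have st: "steps ?b = 6" by (simp add: mulmod_inner_def)
  have "trm CARD('a) W (For 6 (Reg 20) ?b) s0 (2 + n * (steps ?b + 2)) 0 B
   (\<lambda>s. ?I n s \<and> agree (For 6 (Reg 20) ?b) s0 s \<and> canon CARD('a) s \<and> regs s 6 = n)"
  proof (rule trm_For0[where I = ?I, OF _ c0])
   fix j s assume j: "j < n" and ag: "agree (For 6 (Reg 20) ?b) s0 s" and rj: "regs s 6 = j" and I: "?I j s"
   have rs: "regs s 20 = n" "regs s 7 = n - 1 - k"
    using agree_regs[OF ag, of 20] agree_regs[OF ag, of 7] r0 by (simp_all add: mulmod_inner_def)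
   have fs: "F s [14] = F \<sigma> [24, n]" "F s [21, i] = F \<sigma> [21, i]" "F s [ta, i] = F \<sigma> [ta, i]" "F s [tb, i] = F \<sigma> [tb, i]" for i
    using agree_fe[OF ag, of 14 "[]", where 'a = 'a] agree_fe[OF ag, of 21 "[i]", where 'a = 'a]
     agree_fe[OF ag, of ta "[i]", where 'a = 'a] agree_fe[OF ag, of tb "[i]", where 'a = 'a] f0 tab
    by (simp_all add: mulmod_inner_def F_def)
   have "\<not> n - j < n - j - 1" by linarith
   then have "F s [24, n - j - 1] = F \<sigma> [24, n - j - 1]" using I[rule_format, of "n - j - 1"] by simp
   then have "F (set_reg 6 (Suc j) (ev CARD('a) W ?b s)) [24, i] = (if i = n - j then v (n - j - 1) else F s [24, i])" for i
    using rs rj fs tab W j by (simp add: mulmod_inner_def F_def v_def)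
   then show "?I (Suc j) (set_reg 6 (Suc j) (ev CARD('a) W ?b s))" using I j by auto
  qed (use r0 W f0(2)[of 24] in \<open>auto simp: mulmod_inner_def F_def\<close>)
  then have "trm CARD('a) W (For 6 (Reg 20) ?b) s0 (2 + n * 8) 0 B
   (\<lambda>s. F s [24, 0] = F \<sigma> [24, 0] \<and> (\<forall>i<n. F s [24, Suc i] = v i))"
   by (rule trm_mono) (auto simp: st)
  then have "trm CARD('a) W (mulmod_body ta tb) \<sigma> (Suc (Suc (Suc (2 + n * 8)))) 0 B
   (\<lambda>s. F s [24, 0] = F \<sigma> [24, 0] \<and> (\<forall>i<n. F s [24, Suc i] = v i))"
   unfolding mulmod_body_def by (intro trm_Do_Seq) (simp_all add: s0_def)
  then show ?thesis unfolding v_def by (rule trm_mono) simp_all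
qed

text \<open>\<open>ta = tb\<close> is allowed, since the product is copied back only after the last
  use of both factors; squaring relies on this.\<close>

theorem trm_mulmod:
  fixes \<sigma> :: state
  defines "F \<equiv> fe :: state => nat list => 'a::prime_card mod_ring"
  assumes c: "canon CARD('a) \<sigma>" and r: "regs \<sigma> 20 = n" and z: "F \<sigma> [0] = 0"
   and G: "\<And>x. x \<in> A ==> evp (\<lambda>i. F \<sigma> [21, i]) n x + x ^ n = 0"
  shows "trm CARD('a) W (mulmod ta tb) \<sigma> (30 * (n + 1) ^ 2) 0 B
   (\<lambda>s. \<forall>x\<in>A. evp (\<lambda>i. F s [ta, i]) n x = evp (\<lambda>i. F \<sigma> [ta, i]) n x * evp (\<lambda>i. F \<sigma> [tb, i]) n x)"
proof -
  define s0 where "s0 = instr_step CARD('a) W (WOp 21 WAdd (Reg 20) (Const 1)) \<sigma>"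
  have r0: "regs s0 20 = n" "regs s0 21 = Suc n" using r W by (simp_all add: s0_def)
  have f0: "F s0 = F \<sigma>" by (simp add: s0_def F_def)
  have c0: "canon CARD('a) s0" using c by (simp add: s0_def canon_def)
  have cl0: "Suc n < W" and ne: "(21::nat) ~= 6" using W by simp_all
  \<comment> \<open>The value at x of the polynomial formed by the top k coefficients of the first
    factor, which is what Horner's scheme has consumed after k rounds.\<close>
  let ?P = "\<lambda>k x. \<Sum>j<k. F \<sigma> [ta, n - k + j] * x ^ j"
  let ?b = "evp (\<lambda>i. F \<sigma> [tb, i]) n"
  let ?Q = "\<lambda>s. \<forall>x\<in>A. evp (\<lambda>i. F s [ta, i]) n x = evp (\<lambda>i. F \<sigma> [ta, i]) n x * ?b x"
  let ?cl = "For 6 (Reg 21) (fset [Const 24, Reg 6] (Const 0))"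
  let ?out = "wadd 8 (Reg 6) (Const 1) ;; fcopy [Const ta, Reg 6] [Const 24, Reg 8]"
  have "trm CARD('a) W (?cl ;; For 5 (Reg 20) (mulmod_body ta tb) ;; For 6 (Reg 20) ?out) s0
   ((2 + Suc n * 3) + ((2 + n * ((3 + (2 + n * 8)) + 2)) + (2 + n * 4))) (0 + (n * 0 + 0)) B ?Q"
  proof (rule trm_Seq'[OF p_pos c0 trm_fclear[OF c0 r0(2) cl0 ne, of 24 B]])
   fix s1 assume cl: "(\<forall>i<Suc n. fe s1 [24, i] = (0 :: 'a mod_ring)) \<and>
     (\<forall>a. (\<forall>i<Suc n. a ~= [24, i]) --> fe s1 a = (fe s0 a :: 'a mod_ring))"
    and ag1: "agree ?cl s0 s1" and c1: "canon CARD('a) s1"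
   have r1: "regs s1 20 = n" using agree_regs[OF ag1, of 20] r0 by simp
   have f1: "F s1 [24, i] = 0" if "i \<le> n" for i using cl that by (simp add: F_def)
   have f1': "F s1 (h # as) = F \<sigma> (h # as)" if "h ~= 24" for h as using cl that f0 by (simp add: F_def)
   let ?I = "\<lambda>k s. F s [24, 0] = 0 \<and> (\<forall>x\<in>A. evp (\<lambda>i. F s [24, Suc i]) n x = ?P k x * ?b x)"
   have loop: "trm CARD('a) W (For 5 (Reg 20) (mulmod_body ta tb)) s1 (2 + n * ((3 + (2 + n * 8)) + 2)) (n * 0) B
    (\<lambda>s. ?I n s \<and> agree (For 5 (Reg 20) (mulmod_body ta tb)) s1 s \<and> canon CARD('a) s \<and> regs s 5 = n)"
   proof (rule trm_For[where I = ?I])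
    show "?I 0 (set_reg 5 0 s1)" using f1 by (simp add: F_def evp_def)
   next
    fix k s assume k: "k < n" and ag: "agree (For 5 (Reg 20) (mulmod_body ta tb)) s1 s" and cs: "canon CARD('a) s"
     and rk: "regs s 5 = k" and I: "?I k s"
    have rs: "regs s 20 = n" using agree_regs[OF ag, of 20] r1 by (simp add: mulmod_defs)
    have fs: "F s [0] = 0" "F s [21, i] = F \<sigma> [21, i]" "F s [ta, i] = F \<sigma> [ta, i]" "F s [tb, i] = F \<sigma> [tb, i]" for i
     using agree_fe[OF ag, of 0 "[]", where 'a = 'a] agree_fe[OF ag, of 21 "[i]", where 'a = 'a] z
     agree_fe[OF ag, of ta "[i]", where 'a = 'a] agree_fe[OF ag, of tb "[i]", where 'a = 'a] f1' tab
     by (simp_all add: mulmod_defs F_def)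
    from trm_mulmod_body[OF cs rs rk k fs(1)[unfolded F_def], of B, folded F_def]
    show "trm CARD('a) W (mulmod_body ta tb) s (3 + (2 + n * 8)) 0 B
     (\<lambda>s'. agree (mulmod_body ta tb) s s' --> regs s' 5 = k --> ?I (Suc k) (set_reg 5 (Suc k) s'))"
    proof (rule trm_mono, goal_cases)
     case (4 s')
     have "evp (\<lambda>i. F s' [24, Suc i]) n x = ?P (Suc k) x * ?b x" if x: "x \<in> A" for x
     proof -
     have "evp (\<lambda>i. F s' [24, Suc i]) n x
     = evp (\<lambda>i. F s [24, i] + (F \<sigma> [ta, n - 1 - k] * F \<sigma> [tb, i] - F s [24, n] * F \<sigma> [21, i])) n x"
     using 4 fs by (simp add: evp_def)
     also have "\<dots> = x * evp (\<lambda>i. F s [24, Suc i]) n x + F \<sigma> [ta, n - 1 - k] * ?b x"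
     by (rule horner_step[where r = "\<lambda>i. F s [24, i]"]) (use n G[OF x] I in auto)
     also have "\<dots> = (F \<sigma> [ta, n - Suc k] + x * ?P k x) * ?b x"
     using I x by (simp add: algebra_simps)
     also have "F \<sigma> [ta, n - Suc k] + x * ?P k x = ?P (Suc k) x"
     unfolding sum.lessThan_Suc_shift using k
     by (simp add: sum_distrib_left mult_ac Suc_diff_Suc)
     finally show ?thesis .
     qed
     then show ?case using 4 I by (simp add: F_def)
    qed auto
   qed (use W r1 c1 p_pos in \<open>auto simp: mulmod_defs\<close>)
   show "trm CARD('a) W (For 5 (Reg 20) (mulmod_body ta tb) ;; For 6 (Reg 20) ?out) s1
    ((2 + n * ((3 + (2 + n * 8)) + 2)) + (2 + n * 4)) (n * 0 + 0) B ?Q"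
   proof (rule trm_Seq'[OF p_pos c1 loop], elim conjE)
    fix s2 assume I: "\<forall>x\<in>A. evp (\<lambda>i. F s2 [24, Suc i]) n x = ?P n x * ?b x"
     and ag2: "agree (For 5 (Reg 20) (mulmod_body ta tb)) s1 s2" and c2: "canon CARD('a) s2"
    have r2: "regs s2 20 = n" "F s2 [0] = 0"
     using agree_regs[OF ag2, of 20] agree_fe[OF ag2, of 0 "[]", where 'a = 'a] r1 f1'[of 0] z
     by (simp_all add: mulmod_defs F_def)
    let ?J = "\<lambda>j s. \<forall>i<j. F s [ta, i] = F s2 [24, Suc i]"
    have "trm CARD('a) W (For 6 (Reg 20) ?out) s2 (2 + n * (steps ?out + 2)) 0 B
     (\<lambda>s. ?J n s \<and> agree (For 6 (Reg 20) ?out) s2 s \<and> canon CARD('a) s \<and> regs s 6 = n)"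
    proof (rule trm_For0[where I = ?J, OF _ c2])
     fix j t assume j: "j < n" and ag: "agree (For 6 (Reg 20) ?out) s2 t" and rj: "regs t 6 = j" and J: "?J j t"
     have "F t [24, i] = F s2 [24, i]" "F t [0] = 0" for i
     using agree_fe[OF ag, of 24 "[i]", where 'a = 'a] agree_fe[OF ag, of 0 "[]", where 'a = 'a] tab r2 by (simp_all add: F_def)
     then show "?J (Suc j) (set_reg 6 (Suc j) (ev CARD('a) W ?out t))"
     using J rj j W tab by (auto simp: F_def less_Suc_eq)
    qed (use r2 W in auto)
    then show "trm CARD('a) W (For 6 (Reg 20) ?out) s2 (2 + n * 4) 0 B ?Q"
    proof (rule trm_mono, goal_cases)
     case (4 s)
     then have "evp (\<lambda>i. F s [ta, i]) n x = evp (\<lambda>i. F s2 [24, Suc i]) n x" for x by (simp add: evp_def)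
     then show ?case using I by (simp add: evp_def)
    qed simp_all
   qed
  qed
  then have "trm CARD('a) W (mulmod ta tb) \<sigma>
   (Suc ((2 + Suc n * 3) + ((2 + n * ((3 + (2 + n * 8)) + 2)) + (2 + n * 4)))) (0 + (n * 0 + 0)) B ?Q"
   unfolding mulmod_def by (intro trm_Do_Seq) (simp_all add: s0_def)
  then show ?thesis by (rule trm_mono) (auto simp: power2_eq_square algebra_simps)
qed

end

fun bits :: "nat => nat" where
  "bits e = (if e = 0 then 0 else Suc (bits (e div 2)))"

declare bits.simps [simp del]

lemma bits_le: "0 < e ==> 2 ^ bits e \<le> 2 * e"
proof (induction e rule: bits.induct)
  case (1 e)
  show ?case
  proof (cases "e div 2 = 0")
   case True
   then have "e = 1" using 1 by auto
   then show ?thesis by (simp add: bits.simps)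
  next
   case False
   then have "2 ^ bits (e div 2) \<le> 2 * (e div 2)" using 1 by simp
   then show ?thesis using 1(2) by (subst bits.simps) simp
  qed
qed

definition powmod_body :: com where
  "powmod_body =
   Do (WOp 8 WMod (Reg 22) (Const 2)) ;;
   If (WEq (Reg 8) (Const 1)) (mulmod 23 22) skip ;;
   mulmod 22 22 ;; Do (WOp 22 WDiv (Reg 22) (Const 2))"

definition powmod :: com where
  "powmod = While (WLess (Const 0) (Reg 22)) powmod_body"

text \<open>Binary powering: at every root, the accumulator times the base raised to the remaining
  exponent stays constant. Each round halves the exponent, so its bit length serves as the
  potential.\<close>

theorem trm_powmod:
  fixes \<sigma> :: state
  defines "F \<equiv> fe :: state => nat list => 'a::prime_card mod_ring"
  assumes W: "4 * n + 8 < W" and n: "0 < n"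
   and c: "canon CARD('a) \<sigma>" and r: "regs \<sigma> 20 = n" "regs \<sigma> 22 = e" "e < W" and z: "F \<sigma> [0] = 0"
   and G: "\<And>x. x \<in> A ==> evp (\<lambda>i. F \<sigma> [21, i]) n x + x ^ n = 0"
  shows "trm CARD('a) W powmod \<sigma> (Suc (bits e * (70 * (n + 1) ^ 2))) 0 B
   (\<lambda>s. \<forall>x\<in>A. evp (\<lambda>i. F s [23, i]) n x = evp (\<lambda>i. F \<sigma> [23, i]) n x * evp (\<lambda>i. F \<sigma> [22, i]) n x ^ e)"
proof -
  let ?acc = "\<lambda>s. evp (\<lambda>i. F s [23, i]) n" and ?base = "\<lambda>s. evp (\<lambda>i. F s [22, i]) n"
  let ?I = "\<lambda>s. agree powmod \<sigma> s \<and> canon CARD('a) s \<and> regs s 22 \<le> e \<and>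
   (\<forall>x\<in>A. ?acc s x * ?base s x ^ regs s 22 = ?acc \<sigma> x * ?base \<sigma> x ^ e)"
  have "trm CARD('a) W (While (WLess (Const 0) (Reg 22)) powmod_body) \<sigma> (Suc (bits (regs \<sigma> 22) * (70 * (n + 1) ^ 2))) 0 B
   (\<lambda>s. ?I s \<and> \<not> cond_val (WLess (Const 0) (Reg 22)) s)"
  proof (rule trm_While[where I = ?I and \<Psi> = "\<lambda>s. bits (regs s 22) * (70 * (n + 1) ^ 2)" and \<Phi> = "\<lambda>_. 0"])
   show "?I \<sigma>" using c r by (simp add: agree_refl)
   fix s assume I: "?I s" and b: "cond_val (WLess (Const 0) (Reg 22)) s"
   then have ag: "agree powmod \<sigma> s" and cs: "canon CARD('a) s" and q: "0 < regs s 22" "regs s 22 \<le> e" by simp_all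
   have rs: "regs s 20 = n" using agree_regs[OF ag, of 20] r by (simp add: powmod_def powmod_body_def mulmod_defs)
   have fs: "F s [0] = 0" "F s [21, i] = F \<sigma> [21, i]" for i
    using agree_fe[OF ag, of 0 "[]", where 'a = 'a] agree_fe[OF ag, of 21 "[i]", where 'a = 'a] z
    by (simp_all add: powmod_def powmod_body_def mulmod_defs F_def)
   define s0 where "s0 = instr_step CARD('a) W (WOp 8 WMod (Reg 22) (Const 2)) s"
   have c0: "canon CARD('a) s0" using cs by (simp add: s0_def canon_def)
   have F0: "F s0 = F s" by (simp add: s0_def F_def)
   have r0: "regs s0 20 = n" "regs s0 22 = regs s 22" "regs s0 8 = regs s 22 mod 2"
    using rs W q by (simp_all add: s0_def)
   have G0: "evp (\<lambda>i. F s0 [21, i]) n x + x ^ n = 0" if "x \<in> A" for x using G[OF that] fs F0 by simp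
   let ?h = "regs s 22"
   let ?Q1 = "\<lambda>t. (\<forall>x\<in>A. ?acc t x = ?acc s x * (if odd ?h then ?base s x else 1)) \<and>
    (\<forall>i. F t [22, i] = F s [22, i]) \<and> (\<forall>i. F t [21, i] = F \<sigma> [21, i]) \<and> F t [0] = 0 \<and> regs t 20 = n \<and> regs t 22 = ?h"
   have first: "trm CARD('a) W (If (WEq (Reg 8) (Const 1)) (mulmod 23 22) skip) s0 (Suc (30 * (n + 1) ^ 2)) 0 B ?Q1"
   proof (rule trm_If)
    assume "cond_val (WEq (Reg 8) (Const 1)) s0"
    then have odd: "odd ?h" using r0 by (simp add: odd_iff_mod_2_eq_one)
    from trm_mulmod[OF W n _ _ c0 r0(1) _ G0[unfolded F_def], of 23 22 A B, folded F_def]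
    have "trm CARD('a) W (mulmod 23 22) s0 (30 * (n + 1) ^ 2) 0 B
     (\<lambda>t. \<forall>x\<in>A. ?acc t x = ?acc s0 x * ?base s0 x)" using fs F0 by simp
    then show "trm CARD('a) W (mulmod 23 22) s0 (30 * (n + 1) ^ 2) 0 B ?Q1"
    proof (rule trm_mono, goal_cases)
     case (4 t)
     then have ag: "agree (mulmod 23 22) s0 t" by simp
     have "F t [22, i] = F s [22, i]" "F t [21, i] = F \<sigma> [21, i]" "F t [0] = 0" for i
     using agree_fe[OF ag, of 22 "[i]", where 'a = 'a] agree_fe[OF ag, of 21 "[i]", where 'a = 'a]
     agree_fe[OF ag, of 0 "[]", where 'a = 'a] fs F0 by (simp_all add: mulmod_defs F_def)
     moreover have "regs t 20 = n" "regs t 22 = ?h"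
     using agree_regs[OF ag, of 20] agree_regs[OF ag, of 22] r0 by (simp_all add: mulmod_defs)
     ultimately show ?case using 4 odd F0 by simp
    qed simp_all
   next
    assume "\<not> cond_val (WEq (Reg 8) (Const 1)) s0"
    then have "even ?h" using r0 by (simp add: even_iff_mod_2_eq_zero)
    then show "trm CARD('a) W skip s0 (30 * (n + 1) ^ 2) 0 B ?Q1"
     by (intro trm_mono[OF trm_ev0[where Q = ?Q1 and B = B]]) (use r0 fs F0 in \<open>simp_all add: F_def\<close>)
   qed simp
   have "trm CARD('a) W (If (WEq (Reg 8) (Const 1)) (mulmod 23 22) skip ;;
    mulmod 22 22 ;; Do (WOp 22 WDiv (Reg 22) (Const 2))) s0 (Suc (30 * (n + 1) ^ 2) + (30 * (n + 1) ^ 2 + 1)) (0 + (0 + 0)) B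
    (\<lambda>t. agree powmod_body s t --> canon CARD('a) t --> ?I t \<and> regs t 22 = ?h div 2)"
   proof (rule trm_Seq'[OF p_pos c0 first], elim conjE)
    fix s1 assume acc1: "\<forall>x\<in>A. ?acc s1 x = ?acc s x * (if odd ?h then ?base s x else 1)"
     and f1: "\<forall>i. F s1 [22, i] = F s [22, i]" "\<forall>i. F s1 [21, i] = F \<sigma> [21, i]" "F s1 [0] = 0"
     and r1: "regs s1 20 = n" "regs s1 22 = ?h" and c1: "canon CARD('a) s1"
    have G1: "evp (\<lambda>i. F s1 [21, i]) n x + x ^ n = 0" if "x \<in> A" for x using G[OF that] f1 by simp
    from trm_mulmod[OF W n _ _ c1 r1(1) _ G1[unfolded F_def], of 22 22 A B, folded F_def]
    have m2: "trm CARD('a) W (mulmod 22 22) s1 (30 * (n + 1) ^ 2) 0 B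
     (\<lambda>t. \<forall>x\<in>A. ?base t x = ?base s x * ?base s x)" using f1 by simp
    show "trm CARD('a) W (mulmod 22 22 ;; Do (WOp 22 WDiv (Reg 22) (Const 2))) s1 (30 * (n + 1) ^ 2 + 1) (0 + 0) B
     (\<lambda>t. agree powmod_body s t --> canon CARD('a) t --> ?I t \<and> regs t 22 = ?h div 2)"
    proof (rule trm_Seq'[OF p_pos c1 m2])
     fix s2 assume base2: "\<forall>x\<in>A. ?base s2 x = ?base s x * ?base s x" and ag2: "agree (mulmod 22 22) s1 s2"
     have f2: "F s2 [23, i] = F s1 [23, i]" for i
     using agree_fe[OF ag2, of 23 "[i]", where 'a = 'a] by (simp add: mulmod_defs F_def)
     have r2: "regs s2 22 = ?h" using agree_regs[OF ag2, of 22] r1 by (simp add: mulmod_defs)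
     have key: "?acc s2 x * ?base s2 x ^ (?h div 2) = ?acc \<sigma> x * ?base \<sigma> x ^ e" if x: "x \<in> A" for x
     proof -
     have "?acc s2 x * ?base s2 x ^ (?h div 2) = ?acc s x * ((if odd ?h then ?base s x else 1) * (?base s x ^ (2 * (?h div 2))))"
     using acc1 base2 f2 x by (simp add: power_mult power2_eq_square mult.assoc)
     also have "(if odd ?h then ?base s x else 1) * (?base s x ^ (2 * (?h div 2))) = ?base s x ^ ?h"
     by (cases "odd ?h") (auto elim!: oddE evenE)
     finally show ?thesis using I x by simp
     qed
     have agp: "agree powmod \<sigma> t" if "agree powmod_body s t" for t
     using agree_trans[OF ag agree_mono[OF that, of powmod]] by (simp add: powmod_def)
     show "trm CARD('a) W (Do (WOp 22 WDiv (Reg 22) (Const 2))) s2 1 0 B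
     (\<lambda>t. agree powmod_body s t --> canon CARD('a) t --> ?I t \<and> regs t 22 = ?h div 2)"
     by (intro trm_mono[OF trm_ev0[where B = B and Q = "\<lambda>t. regs t 22 = ?h div 2 \<and> F t = F s2"]])
     (use r2 q r W key agp in \<open>auto simp: F_def\<close>)
    qed
   qed
   then have "trm CARD('a) W powmod_body s (Suc (Suc (30 * (n + 1) ^ 2) + (30 * (n + 1) ^ 2 + 1))) (0 + (0 + 0)) B
    (\<lambda>t. agree powmod_body s t --> canon CARD('a) t --> ?I t \<and> regs t 22 = ?h div 2)"
    unfolding powmod_body_def by (intro trm_Do_Seq) (simp_all add: s0_def)
   from trm_strengthen[OF this p_pos cs]
   have "trm CARD('a) W powmod_body s (70 * (n + 1) ^ 2 - 1) 0 B (\<lambda>s'. ?I s' \<and>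
     (70 * (n + 1) ^ 2 - 1) + 1 + bits (regs s' 22) * (70 * (n + 1) ^ 2) \<le> bits (regs s 22) * (70 * (n + 1) ^ 2) \<and> 0 + 0 \<le> (0::nat))"
   proof (rule trm_mono, goal_cases)
    case (4 t)
    have bt: "bits (regs s 22) = Suc (bits (regs s 22 div 2))" using q by (subst bits.simps) simp
    from 4 have I': "?I t" and rt: "regs t 22 = regs s 22 div 2" by blast+
    have "(70 * (n + 1) ^ 2 - 1) + 1 + bits (regs t 22) * (70 * (n + 1) ^ 2) \<le> bits (regs s 22) * (70 * (n + 1) ^ 2)"
     unfolding bt rt by simp
    with I' show ?case by simp
   qed (auto simp: power2_eq_square)
   then show "\<exists>T Z. trm CARD('a) W powmod_body s T Z B (\<lambda>s'. ?I s' \<and>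
     T + 1 + bits (regs s' 22) * (70 * (n + 1) ^ 2) \<le> bits (regs s 22) * (70 * (n + 1) ^ 2) \<and> Z + 0 \<le> 0)" by blast
  qed simp
  then show ?thesis unfolding r(2) powmod_def[symmetric] by (rule trm_mono) auto
qed

section \<open>Splitting one factor\<close>

definition isfac :: "(nat => 'a::field) => 'a set => bool" where
  "isfac g A \<longleftrightarrow> finite A \<and> (\<forall>i\<le>card A. g i = coeff (linprod A) i)"

lemma isfac_root:
  assumes "isfac g A" "a \<in> A"
  shows "evp g (card A) a + a ^ card A = 0"
proof -
  have A: "finite A" using assms by (simp add: isfac_def)
  have "0 = poly (linprod A) a" using linprod_props(4)[OF A, of a] assms by simp
  also have "\<dots> = (\<Sum>i\<le>card A. coeff (linprod A) i * a ^ i)"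
   by (simp add: poly_altdef linprod_props(1)[OF A])
  also have "\<dots> = (\<Sum>i<card A. coeff (linprod A) i * a ^ i) + a ^ card A"
   using linprod_props(1,2)[OF A] by (simp add: lessThan_Suc_atMost[symmetric])
  also have "(\<Sum>i<card A. coeff (linprod A) i * a ^ i) = evp g (card A) a"
   using assms(1) unfolding evp_def isfac_def by (intro sum.cong) auto
  finally show ?thesis by simp
qed

lemma isfac_npoly:
  assumes "finite A" "card A \<le> N" "npoly N f = linprod A" "\<And>i. i \<le> card A ==> g i = f i"
  shows "isfac g A"
proof -
  have "f i = coeff (linprod A) i" if "i \<le> card A" for i
   using coeff_npoly[of N f i] assms(2,3) that by simp
  then show ?thesis using assms by (simp add: isfac_def)
qed

text \<open>The functional reading off the leading coefficient of the interpolation polynomial has nonzero weights.\<close>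

definition lagw :: "'a::field set => 'a => 'a" where
  "lagw A a = inverse (poly (linprod (A - {a})) a)"

lemma lagw_neq_0: "finite A ==> lagw A a ~= 0"
  by (simp add: lagw_def linprod_props)

text \<open>The sum is the coefficient of X^(n - 1), with n = \<open>card A\<close>, in the
  polynomial that interpolates a^l on A, and for l < n that polynomial is X^l.\<close>

lemma lagw_moments:
  fixes A :: "'a::field set"
  assumes A: "finite A" and l: "l < card A"
  shows "(\<Sum>a\<in>A. lagw A a * a ^ l) = (if Suc l = card A then 1 else 0)"
proof -
  define q where "q = (\<Sum>a\<in>A. Polynomial.smult (lagw A a * a ^ l) (linprod (A - {a})))"
  have cd: "card (A - {a}) = card A - 1" if "a \<in> A" for a using A that by simp
  have dq: "degree q \<le> card A - 1"
   unfolding q_def using A cd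
   by (intro degree_sum_le) (auto intro!: order_trans[OF degree_smult_le] simp: linprod_props)
  have val: "poly q b = b ^ l" if b: "b \<in> A" for b
  proof -
   have "poly q b = (\<Sum>a\<in>A. lagw A a * a ^ l * poly (linprod (A - {a})) b)"
    by (simp add: q_def poly_sum)
   also have "\<dots> = lagw A b * b ^ l * poly (linprod (A - {b})) b +
     (\<Sum>a\<in>A - {b}. lagw A a * a ^ l * poly (linprod (A - {a})) b)"
    using A b by (simp add: sum.remove)
   also have "(\<Sum>a\<in>A - {b}. lagw A a * a ^ l * poly (linprod (A - {a})) b) = 0"
    using A b by (intro sum.neutral) (auto simp: linprod_props)
   also have "lagw A b * b ^ l * poly (linprod (A - {b})) b = b ^ l"
    using A by (simp add: lagw_def linprod_props)
   finally show ?thesis by simp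
  qed
  have "q - monom 1 l = 0"
  proof (rule ccontr)
   assume nz: "q - monom 1 l ~= 0"
   have "linprod A dvd q - monom 1 l" using A by (rule linprod_dvd) (simp add: val poly_monom)
   then have "card A \<le> degree (q - monom 1 l)" using nz A dvd_imp_degree_le[of "linprod A"] by (simp add: linprod_props)
   also have "\<dots> \<le> card A - 1" using dq l by (intro degree_diff_le) (auto simp: degree_monom_eq)
   finally show False using l by simp
  qed
  then have "coeff q (card A - 1) = (if Suc l = card A then 1 else 0)" using l by auto
  moreover have "coeff q (card A - 1) = (\<Sum>a\<in>A. lagw A a * a ^ l)"
   unfolding q_def coeff_sum
  proof (intro sum.cong refl)
   fix a assume a: "a \<in> A"
   have "coeff (linprod (A - {a})) (card A - 1) = 1"
    using linprod_props(1,2)[of "A - {a}"] A cd[OF a] by simp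
   then show "coeff (Polynomial.smult (lagw A a * a ^ l) (linprod (A - {a}))) (card A - 1) = lagw A a * a ^ l" by simp
  qed
  ultimately show ?thesis by simp
qed

lemma lagw_recurrence:
  assumes "isfac g A"
  shows "(\<Sum>a\<in>A. lagw A a * a ^ (l + card A)) = - (\<Sum>i<card A. g i * (\<Sum>a\<in>A. lagw A a * a ^ (l + i)))"
proof -
  have "(\<Sum>i<card A. g i * (\<Sum>a\<in>A. lagw A a * a ^ (l + i))) = (\<Sum>a\<in>A. lagw A a * a ^ l * evp g (card A) a)"
   unfolding evp_def sum_distrib_left
   by (subst sum.swap) (simp add: power_add mult_ac)
  also have "\<dots> = (\<Sum>a\<in>A. - (lagw A a * a ^ (l + card A)))"
  proof (intro sum.cong refl)
   fix a assume "a \<in> A"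
   then have "evp g (card A) a = - (a ^ card A)" using isfac_root[OF assms] by (simp add: eq_neg_iff_add_eq_0)
   then show "lagw A a * a ^ l * evp g (card A) a = - (lagw A a * a ^ (l + card A))" by (simp add: power_add)
  qed
  finally show ?thesis by (simp add: sum_negf)
qed

text \<open>Neither the weights nor the roots have to be known: the moments start with 0, ..., 0, 1
  and continue by the recurrence that the factor itself defines.\<close>

lemma lagw_sequence:
  assumes fac: "isfac g A"
   and y: "\<And>l. l < N ==> y l = (if l < card A then (if Suc l = card A then 1 else 0) else - (\<Sum>i<card A. g i * y (l - card A + i)))"
   and l: "l < N"
  shows "y l = (\<Sum>a\<in>A. lagw A a * a ^ l)"
  using l
proof (induction l rule: less_induct)
  case (less l)
  show ?case
  proof (cases "l < card A")
   case True
   then show ?thesis using y[OF less.prems] lagw_moments[of A l] fac by (simp add: isfac_def)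
  next
   case False
   have "y l = - (\<Sum>i<card A. g i * y (l - card A + i))" using y[OF less.prems] False by simp
   also have "\<dots> = - (\<Sum>i<card A. g i * (\<Sum>a\<in>A. lagw A a * a ^ (l - card A + i)))"
    using less False by (intro arg_cong[where f = uminus] sum.cong refl) auto
   also have "\<dots> = (\<Sum>a\<in>A. lagw A a * a ^ l)"
    using lagw_recurrence[OF fac, of "l - card A"] False by simp
   finally show ?thesis .
  qed
qed

definition split_copy :: com where
  "split_copy = For 6 (Reg 21) (fcopy [Const 21, Reg 6] [Const 20, Reg 30, Reg 6])"

definition split_load :: com where
  "split_load = Do (WLoad 20 [Const 1, Reg 30]) ;; Do (WLoad 23 [Const 2, Reg 30]) ;; wadd 21 (Reg 20) (Const 1) ;;
   split_copy ;;
   For 6 (Reg 20) (fset [Const 22, Reg 6] (Const 0)) ;; For 6 (Reg 20) (fset [Const 23, Reg 6] (Const 0)) ;;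
   fset [Const 22, Const 0] (Reg 23) ;; fset [Const 22, Const 1] (Const 1) ;; fset [Const 23, Const 0] (Const 1) ;;
   wsub 22 (Reg 0) (Const 1) ;; Do (WOp 22 WDiv (Reg 22) (Const 2))"

definition lag_sum :: com where
  "lag_sum = wadd 8 (Reg 7) (Reg 6) ;; fmul [Const 17] [Const 21, Reg 6] [Const 25, Reg 8] ;;
   fsub [Const 25, Reg 5] [Const 25, Reg 5] [Const 17]"

definition lag_body :: com where
  "lag_body = fset [Const 25, Reg 5] (Const 0) ;;
   If (WLess (Reg 5) (Reg 20))
    (wadd 7 (Reg 5) (Const 1) ;; If (WEq (Reg 7) (Reg 20)) (fset [Const 25, Reg 5] (Const 1)) skip)
    (wsub 7 (Reg 5) (Reg 20) ;; For 6 (Reg 20) lag_sum)"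

text \<open>3n moments are enough: 2n positions for Massey's algorithm, each reaching up to n - 1
  further when multiplied by a residue.\<close>

definition lag :: com where
  "lag = wmul 24 (Reg 20) (Const 3) ;; For 5 (Reg 24) lag_body"

text \<open>Let h be the residue of X + t raised to (p - 1)/2; at the roots its values are 0, 1 and
  -1. Then (h + 1) h is nonzero exactly where h = 1, and h - 1 exactly elsewhere, so these two
  residues mark the two future factors.\<close>

definition split_comb :: com where
  "split_comb = For 6 (Reg 20) (fcopy [Const 22, Reg 6] [Const 23, Reg 6]) ;;
   fset [Const 17] (Const 1) ;; fadd [Const 22, Const 0] [Const 22, Const 0] [Const 17] ;;
   mulmod 22 23 ;;
   fset [Const 17] (Const 1) ;; fsub [Const 23, Const 0] [Const 23, Const 0] [Const 17] ;;
   wmul 2 (Reg 20) (Const 2)"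

definition mom_sum :: "nat => com" where
  "mom_sum tg = wadd 7 (Reg 5) (Reg 6) ;; fmul [Const 17] [Const tg, Reg 6] [Const 25, Reg 7] ;;
   fadd [Const 10, Reg 5] [Const 10, Reg 5] [Const 17]"

text \<open>These are the moments of the weights lagw(a) v(a), where v is the residue in
  \<open>[tg, i]\<close>. Their support consists of the roots at which v is nonzero, so running
  Massey's algorithm on them does the work of a gcd computation.\<close>

definition mom :: "nat => com" where
  "mom tg = For 5 (Reg 2) (fset [Const 10, Reg 5] (Const 0) ;; For 6 (Reg 20) (mom_sum tg))"

lemmas split_defs = split_copy_def split_load_def lag_sum_def lag_body_def lag_def split_comb_def mom_sum_def mom_def

lemma evp_cong: "(\<And>i. i < n ==> f i = g i) ==> evp f n x = evp g n x"
  by (simp add: evp_def)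

lemma evp_upd_0: "0 < n ==> evp (f(0 := c)) n x = evp f n x + (c - f 0)"
proof -
  assume "0 < n"
  then obtain k where "n = Suc k" by (cases n) auto
  then show ?thesis by (simp add: evp_def sum.lessThan_Suc_shift del: sum.lessThan_Suc)
qed

context
  fixes W n :: nat
  assumes W: "16 * n + 16 < W" and n: "0 < n"
begin

lemma trm_lag:
  fixes \<sigma> :: state
  defines "F \<equiv> fe :: state => nat list => 'a::prime_card mod_ring"
  assumes c: "canon CARD('a) \<sigma>" and r: "regs \<sigma> 20 = n" and fac: "isfac (\<lambda>i. F \<sigma> [21, i]) A" and A: "card A = n"
  shows "trm CARD('a) W lag \<sigma> (45 * (n + 1) ^ 2) 0 B
   (\<lambda>s. \<forall>l<3 * n. F s [25, l] = (\<Sum>a\<in>A. lagw A a * a ^ l))"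
proof -
  define s0 where "s0 = instr_step CARD('a) W (WOp 24 WMul (Reg 20) (Const 3)) \<sigma>"
  have r0: "regs s0 20 = n" "regs s0 24 = 3 * n" using r W by (simp_all add: s0_def)
  have c0: "canon CARD('a) s0" using c by (simp add: s0_def canon_def)
  define g where "g = (\<lambda>i. F \<sigma> [21, i])"
  let ?rec = "\<lambda>s l. if l < n then (if Suc l = n then 1 else 0) else - (\<Sum>i<n. g i * F s [25, l - n + i])"
  let ?I = "\<lambda>j s. \<forall>l<j. F s [25, l] = ?rec s l"
  have "trm CARD('a) W (For 5 (Reg 24) lag_body) s0 (2 + 3 * n * ((2 + (3 + n * 5)) + 2)) (3 * n * 0) B
   (\<lambda>s. ?I (3 * n) s \<and> agree (For 5 (Reg 24) lag_body) s0 s \<and> canon CARD('a) s \<and> regs s 5 = 3 * n)"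
  proof (rule trm_For[where I = ?I])
   fix j s assume j: "j < 3 * n" and ag: "agree (For 5 (Reg 24) lag_body) s0 s" and cs: "canon CARD('a) s"
    and rj: "regs s 5 = j" and I: "?I j s"
   have rs: "regs s 20 = n" using agree_regs[OF ag, of 20] r0 by (simp add: split_defs)
   have fs: "F s [21, i] = g i" for i
    using agree_fe[OF ag, of 21 "[i]", where 'a = 'a] by (simp add: split_defs F_def g_def s0_def)
   define s1 where "s1 = instr_step CARD('a) W (FofW [Const 25, Reg 5] (Const 0)) s"
   have c1: "canon CARD('a) s1" using cs p_pos[where 'a = 'a] by (auto simp: s1_def canon_def)
   have r1: "regs s1 20 = n" "regs s1 5 = j" using rs rj by (simp_all add: s1_def)
   have f1: "F s1 = (F s)([25, j] := 0)" using rj by (simp add: s1_def F_def)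
   let ?Q = "\<lambda>t. F t [25, j] = ?rec s j \<and> (\<forall>l<j. F t [25, l] = F s [25, l])"
   have "trm CARD('a) W (If (WLess (Reg 5) (Reg 20))
    (wadd 7 (Reg 5) (Const 1) ;; If (WEq (Reg 7) (Reg 20)) (fset [Const 25, Reg 5] (Const 1)) skip)
    (wsub 7 (Reg 5) (Reg 20) ;; For 6 (Reg 20) lag_sum)) s1 (Suc (3 + n * 5)) 0 B ?Q"
   proof (rule trm_If)
    assume "cond_val (WLess (Reg 5) (Reg 20)) s1"
    then have "j < n" using r1 by simp
    then show "trm CARD('a) W (wadd 7 (Reg 5) (Const 1) ;; If (WEq (Reg 7) (Reg 20)) (fset [Const 25, Reg 5] (Const 1)) skip) s1 (3 + n * 5) 0 B ?Q"
     by (intro trm_mono[OF trm_ev0[where Q = ?Q and B = B]]) (use r1 f1 W in \<open>auto simp: F_def\<close>)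
   next
    assume "\<not> cond_val (WLess (Reg 5) (Reg 20)) s1"
    then have jn: "n \<le> j" using r1 by simp
    define s2 where "s2 = instr_step CARD('a) W (WOp 7 WSub (Reg 5) (Reg 20)) s1"
    have c2: "canon CARD('a) s2" using c1 by (simp add: s2_def canon_def)
    have r2: "regs s2 20 = n" "regs s2 5 = j" "regs s2 7 = j - n" using r1 j W by (simp_all add: s2_def)
    have f2: "F s2 = (F s)([25, j] := 0)" using f1 by (simp add: s2_def F_def)
    let ?J = "\<lambda>k t. F t [25, j] = - (\<Sum>i<k. g i * F s [25, j - n + i]) \<and> (\<forall>l<j. F t [25, l] = F s [25, l])"
    have "trm CARD('a) W (For 6 (Reg 20) lag_sum) s2 (2 + n * (steps lag_sum + 2)) 0 B
     (\<lambda>t. ?J n t \<and> agree (For 6 (Reg 20) lag_sum) s2 t \<and> canon CARD('a) t \<and> regs t 6 = n)"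
    proof (rule trm_For0[where I = ?J, OF _ c2])
     fix k t assume k: "k < n" and ag: "agree (For 6 (Reg 20) lag_sum) s2 t" and rk: "regs t 6 = k" and J: "?J k t"
     have rt: "regs t 7 = j - n" "regs t 5 = j"
     using agree_regs[OF ag, of 7] agree_regs[OF ag, of 5] r2 by (simp_all add: lag_sum_def)
     have ft: "F t [21, i] = g i" for i
     using agree_fe[OF ag, of 21 "[i]", where 'a = 'a] f2 fs by (simp add: lag_sum_def F_def)
     have "j - n + k < j" using k jn by simp
     then have "F t [25, j - n + k] = F s [25, j - n + k]" using J by blast
     then show "?J (Suc k) (set_reg 6 (Suc k) (ev CARD('a) W lag_sum t))"
     using J rk rt ft j k jn W by (simp add: lag_sum_def F_def algebra_simps)
    qed (use r2 f2 W in \<open>auto simp: lag_sum_def F_def\<close>)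
    then have "trm CARD('a) W (For 6 (Reg 20) lag_sum) s2 (2 + n * 5) 0 B ?Q"
     by (rule trm_mono) (use jn in \<open>auto simp: lag_sum_def\<close>)
    then have "trm CARD('a) W (wsub 7 (Reg 5) (Reg 20) ;; For 6 (Reg 20) lag_sum) s1 (Suc (2 + n * 5)) 0 B ?Q"
     unfolding s2_def by (rule trm_Do_Seq[rotated]) simp
    then show "trm CARD('a) W (wsub 7 (Reg 5) (Reg 20) ;; For 6 (Reg 20) lag_sum) s1 (3 + n * 5) 0 B ?Q"
     by (rule trm_mono) simp_all
   qed simp
   then have "trm CARD('a) W lag_body s (Suc (Suc (3 + n * 5))) 0 B ?Q"
    unfolding lag_body_def by (intro trm_Do_Seq) (simp_all add: s1_def)
   then show "trm CARD('a) W lag_body s (2 + (3 + n * 5)) 0 B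
    (\<lambda>s'. agree lag_body s s' --> regs s' 5 = j --> ?I (Suc j) (set_reg 5 (Suc j) s'))"
   proof (rule trm_mono, goal_cases)
    case (4 t)
    then have old: "F t [25, l] = F s [25, l]" if "l < j" for l using that by blast
    \<comment> \<open>The recurrence at l reads only cells below l, so writing cell j does not
      disturb it.\<close>
    have "?rec t l = ?rec s l" if "l \<le> j" for l
     using old that n by (auto intro!: sum.cong)
    then have "F t [25, l] = ?rec t l" if "l < Suc j" for l
     using 4 I old that by (cases "l = j") auto
    then show ?case by (simp add: F_def)
   qed simp_all
  qed (use r0 c0 W p_pos in \<open>auto simp: split_defs\<close>)
  then have "trm CARD('a) W lag \<sigma> (Suc (2 + 3 * n * ((2 + (3 + n * 5)) + 2))) (3 * n * 0) B (\<lambda>s. ?I (3 * n) s)"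
   unfolding lag_def
   by (intro trm_Do_Seq) (simp, rule trm_mono, unfold s0_def, assumption, simp_all)
  then show ?thesis
  proof (rule trm_mono, goal_cases)
   case (4 s)
   have "F s [25, l] = (\<Sum>a\<in>A. lagw A a * a ^ l)" if "l < 3 * n" for l
    by (rule lagw_sequence[OF fac[folded g_def], where N = "3 * n" and y = "\<lambda>l. F s [25, l]"])
     (use 4 that A in auto)
   then show ?case by blast
  qed (auto simp: power2_eq_square algebra_simps)
qed

lemma trm_mom:
  fixes \<sigma> :: state
  defines "F \<equiv> fe :: state => nat list => 'a::prime_card mod_ring"
  assumes tg: "tg \<notin> {10, 17}" and c: "canon CARD('a) \<sigma>" and r: "regs \<sigma> 20 = n" "regs \<sigma> 2 = 2 * n"
   and y: "\<And>l. l < 3 * n ==> F \<sigma> [25, l] = (\<Sum>a\<in>A. w a * a ^ l)"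
  shows "trm CARD('a) W (mom tg) \<sigma> (20 * (n + 1) ^ 2) 0 B
   (\<lambda>s. \<forall>l<2 * n. F s [10, l] = (\<Sum>a\<in>A. w a * evp (\<lambda>i. F \<sigma> [tg, i]) n a * a ^ l))"
proof -
  let ?body = "fset [Const 10, Reg 5] (Const 0) ;; For 6 (Reg 20) (mom_sum tg)"
  let ?v = "\<lambda>l. \<Sum>i<n. F \<sigma> [tg, i] * F \<sigma> [25, l + i]"
  let ?I = "\<lambda>j s. \<forall>l<j. F s [10, l] = ?v l"
  have "trm CARD('a) W (For 5 (Reg 2) ?body) \<sigma> (2 + 2 * n * ((3 + n * 5) + 2)) (2 * n * 0) B
   (\<lambda>s. ?I (2 * n) s \<and> agree (For 5 (Reg 2) ?body) \<sigma> s \<and> canon CARD('a) s \<and> regs s 5 = 2 * n)"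
  proof (rule trm_For[where I = ?I])
   fix j s assume j: "j < 2 * n" and ag: "agree (For 5 (Reg 2) ?body) \<sigma> s" and cs: "canon CARD('a) s"
    and rj: "regs s 5 = j" and I: "?I j s"
   have rs: "regs s 20 = n" using agree_regs[OF ag, of 20] r by (simp add: mom_sum_def)
   have fs: "F s [25, i] = F \<sigma> [25, i]" "F s [tg, i] = F \<sigma> [tg, i]" for i
    using agree_fe[OF ag, of 25 "[i]", where 'a = 'a] agree_fe[OF ag, of tg "[i]", where 'a = 'a] tg
    by (simp_all add: mom_sum_def F_def)
   define s1 where "s1 = instr_step CARD('a) W (FofW [Const 10, Reg 5] (Const 0)) s"
   have c1: "canon CARD('a) s1" using cs p_pos[where 'a = 'a] by (auto simp: s1_def canon_def)
   have r1: "regs s1 20 = n" "regs s1 5 = j" using rs rj by (simp_all add: s1_def)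
   have f1: "F s1 = (F s)([10, j] := 0)" using rj by (simp add: s1_def F_def)
   let ?J = "\<lambda>k t. F t [10, j] = (\<Sum>i<k. F \<sigma> [tg, i] * F \<sigma> [25, j + i]) \<and> (\<forall>l<j. F t [10, l] = F s [10, l])"
   have "trm CARD('a) W (For 6 (Reg 20) (mom_sum tg)) s1 (2 + n * (steps (mom_sum tg) + 2)) 0 B
    (\<lambda>t. ?J n t \<and> agree (For 6 (Reg 20) (mom_sum tg)) s1 t \<and> canon CARD('a) t \<and> regs t 6 = n)"
   proof (rule trm_For0[where I = ?J, OF _ c1])
    fix k t assume k: "k < n" and ag: "agree (For 6 (Reg 20) (mom_sum tg)) s1 t" and rk: "regs t 6 = k" and J: "?J k t"
    have rt: "regs t 5 = j" using agree_regs[OF ag, of 5] r1 by (simp add: mom_sum_def)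
    have ft: "F t [25, i] = F \<sigma> [25, i]" "F t [tg, i] = F \<sigma> [tg, i]" for i
     using agree_fe[OF ag, of 25 "[i]", where 'a = 'a] agree_fe[OF ag, of tg "[i]", where 'a = 'a] tg fs f1
     by (simp_all add: mom_sum_def F_def)
    show "?J (Suc k) (set_reg 6 (Suc k) (ev CARD('a) W (mom_sum tg) t))"
     using J rk rt ft j k W by (simp add: mom_sum_def F_def)
   qed (use r1 f1 W in \<open>auto simp: mom_sum_def F_def\<close>)
   then have "trm CARD('a) W (For 6 (Reg 20) (mom_sum tg)) s1 (2 + n * 5) 0 B (?J n)"
    by (rule trm_mono) (auto simp: mom_sum_def)
   then have "trm CARD('a) W ?body s (Suc (2 + n * 5)) 0 B (?J n)"
    by (intro trm_Do_Seq) (simp_all add: s1_def)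
   then show "trm CARD('a) W ?body s (3 + n * 5) 0 B
    (\<lambda>s'. agree ?body s s' --> regs s' 5 = j --> ?I (Suc j) (set_reg 5 (Suc j) s'))"
    by (rule trm_mono) (use I in \<open>auto simp: F_def less_Suc_eq\<close>)
  qed (use r c W p_pos in \<open>auto simp: mom_sum_def\<close>)
  then have "trm CARD('a) W (mom tg) \<sigma> (2 + 2 * n * ((3 + n * 5) + 2)) (2 * n * 0) B (?I (2 * n))"
   unfolding mom_def by (rule trm_mono) auto
  then show ?thesis
  proof (rule trm_mono, goal_cases)
   case (4 s)
   have "?v l = (\<Sum>a\<in>A. w a * evp (\<lambda>i. F \<sigma> [tg, i]) n a * a ^ l)" if "l < 2 * n" for l
   proof -
    have "?v l = (\<Sum>i<n. \<Sum>a\<in>A. w a * a ^ l * (F \<sigma> [tg, i] * a ^ i))"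
     using y that by (intro sum.cong) (auto simp: sum_distrib_left power_add mult_ac)
    also have "\<dots> = (\<Sum>a\<in>A. w a * evp (\<lambda>i. F \<sigma> [tg, i]) n a * a ^ l)"
     by (subst sum.swap) (simp add: evp_def sum_distrib_left sum_distrib_right mult_ac)
    finally show ?thesis .
   qed
   then show ?case using 4 by simp
  qed (auto simp: power2_eq_square algebra_simps)
qed

lemma trm_massey_support:
  fixes \<sigma> :: state
  defines "F \<equiv> fe :: state => nat list => 'a::prime_card mod_ring"
  assumes N: "N \<le> 2 * n" and c: "canon CARD('a) \<sigma>" and r: "regs \<sigma> 2 = N" and z: "F \<sigma> [0] = 0" and fin: "finite A"
   and s: "\<And>l. l < N ==> F \<sigma> [10, l] = (\<Sum>a\<in>A. w a * a ^ l)"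
   and card: "2 * card {a \<in> A. w a ~= 0} \<le> N"
  shows "trm CARD('a) W massey \<sigma> (320 * (n + 1) ^ 2) 0 B
   (\<lambda>t. regs t 3 = card {a \<in> A. w a ~= 0} \<and> npoly N (\<lambda>i. F t [11, i]) = linprod {a \<in> A. w a ~= 0})"
proof -
  have W': "4 * N + 8 < W" using W N by simp
  have s': "F \<sigma> [10, l] = (\<Sum>a\<in>{a \<in> A. w a ~= 0}. w a * a ^ l)" if "l < N" for l
   unfolding s[OF that] by (rule sum.mono_neutral_right) (use fin in auto)
  have "80 * (N + 1) ^ 2 \<le> 80 * (2 * (n + 1)) ^ 2" using N by (intro mult_le_mono power_mono) auto
  also have "\<dots> = 320 * (n + 1) ^ 2" by (simp only: power_mult_distrib) simp
  finally have T: "80 * (N + 1) ^ 2 \<le> 320 * (n + 1) ^ 2" .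
  have fin': "finite {a \<in> A. w a ~= 0}" using fin by simp
  show ?thesis
  proof (rule trm_mono[OF trm_massey[OF W' c r z[unfolded F_def], where B = B] T order_refl order_refl])
   fix t assume "\<exists>g \<delta>. massey_inv (\<lambda>l. fe \<sigma> [10, l]) N N (regs t 3) (\<lambda>i. fe t [11, i]) g (\<delta> :: 'a mod_ring)"
   then obtain g \<delta> where inv: "massey_inv (\<lambda>l. F \<sigma> [10, l]) N N (regs t 3) (\<lambda>i. F t [11, i]) g \<delta>"
    unfolding F_def by blast
   show "regs t 3 = card {a \<in> A. w a ~= 0} \<and> npoly N (\<lambda>i. F t [11, i]) = linprod {a \<in> A. w a ~= 0}"
    by (rule massey_final[OF fin' card _ s' inv]) blast+
  qed
qed

end

text \<open>The class found first replaces the current factor; the other one is appended as a new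
  factor, and both continue with the next shift.\<close>

definition split_store :: com where
  "split_store = For 6 (Reg 21) (fcopy [Const 20, Reg 30, Reg 6] [Const 11, Reg 6]) ;;
   Do (WStore [Const 1, Reg 30] (Reg 3)) ;; mom 22 ;; massey ;;
   For 6 (Reg 21) (fcopy [Const 20, Reg 31, Reg 6] [Const 11, Reg 6]) ;;
   Do (WStore [Const 1, Reg 31] (Reg 3)) ;; wadd 8 (Reg 23) (Const 1) ;;
   Do (WStore [Const 2, Reg 31] (Reg 8)) ;; wadd 31 (Reg 31) (Const 1)"

definition split_tail :: com where
  "split_tail = mom 23 ;; massey ;;
   If (WLess (Const 0) (Reg 3)) (If (WLess (Reg 3) (Reg 20)) split_store skip) skip ;;
   wadd 8 (Reg 23) (Const 1) ;; Do (WStore [Const 2, Reg 30] (Reg 8))"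

text \<open>Factor number \<open>j\<close> has coefficients \<open>[20, j, \<cdot>]\<close>, degree \<open>wmem [1, j]\<close> and next shift \<open>wmem [2, j]\<close>.
  One step on the factor in register 30 separates the roots \<open>a\<close> with \<open>(a + t)\<^sup>(\<^sup>p\<^sup>-\<^sup>1\<^sup>)\<^sup>/\<^sup>2 = 1\<close>
  from the others; the number of factors is in register 31.\<close>

definition split :: com where
  "split = split_load ;; powmod ;; lag ;; split_comb ;; wadd 21 (Reg 20) (Const 1) ;; split_tail"

lemmas all_split_defs = split_store_def split_tail_def split_def split_defs powmod_def powmod_body_def
  mulmod_defs massey_defs

definition split_post :: "nat => nat => nat => 'a::prime_card mod_ring set => 'a mod_ring set => state => state => bool" where
  "split_post q nf t A A' \<sigma> s \<longleftrightarrow>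
   (\<forall>j. j ~= q --> j ~= nf --> (\<forall>i. fe s [20, j, i] = (fe \<sigma> [20, j, i] :: 'a mod_ring)) \<and>
     wmem s [1, j] = wmem \<sigma> [1, j] \<and> wmem s [2, j] = wmem \<sigma> [2, j]) \<and>
   wmem s [2, q] = Suc t \<and>
   (if A' = {} \<or> A' = A
    then regs s 31 = nf \<and> isfac (\<lambda>i. fe s [20, q, i]) A \<and> wmem s [1, q] = card A
    else regs s 31 = Suc nf \<and> isfac (\<lambda>i. fe s [20, q, i]) A' \<and> wmem s [1, q] = card A' \<and>
     isfac (\<lambda>i. fe s [20, nf, i]) (A - A') \<and> wmem s [1, nf] = card (A - A') \<and> wmem s [2, nf] = Suc t)"

lemma isfac_cong: "isfac g A ==> (\<And>i. i \<le> card A ==> g' i = g i) ==> isfac g' A"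
  by (simp add: isfac_def)

context
  fixes W n :: nat
  assumes W: "16 * n + 16 < W" and n: "0 < n"
begin

lemma trm_split_load:
  fixes \<sigma> :: state
  defines "F \<equiv> fe :: state => nat list => 'a::prime_card mod_ring"
  assumes n2: "2 \<le> n" and Wp: "CARD('a) < W" and c: "canon CARD('a) \<sigma>" and z: "F \<sigma> [0] = 0"
   and r: "regs \<sigma> 0 = CARD('a)" "regs \<sigma> 30 = q" "wmem \<sigma> [1, q] = n" "wmem \<sigma> [2, q] = t"
  shows "trm CARD('a) W split_load \<sigma> (9 * n + 20) 0 B
   (\<lambda>s. regs s 20 = n \<and> regs s 21 = Suc n \<and> regs s 23 = t \<and> regs s 22 = (CARD('a) - 1) div 2 \<and>
    (\<forall>i\<le>n. F s [21, i] = F \<sigma> [20, q, i]) \<and>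
    (\<forall>a. evp (\<lambda>i. F s [22, i]) n a = a + of_nat t) \<and> (\<forall>a. evp (\<lambda>i. F s [23, i]) n a = 1))"
proof -
  let ?end = "fset [Const 22, Const 0] (Reg 23) ;; fset [Const 22, Const 1] (Const 1) ;; fset [Const 23, Const 0] (Const 1) ;;
   wsub 22 (Reg 0) (Const 1) ;; Do (WOp 22 WDiv (Reg 22) (Const 2))"
  let ?Q = "\<lambda>s. regs s 20 = n \<and> regs s 21 = Suc n \<and> regs s 23 = t \<and> regs s 22 = (CARD('a) - 1) div 2 \<and>
    (\<forall>i\<le>n. F s [21, i] = F \<sigma> [20, q, i]) \<and>
    (\<forall>a. evp (\<lambda>i. F s [22, i]) n a = a + of_nat t) \<and> (\<forall>a. evp (\<lambda>i. F s [23, i]) n a = 1)"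
  define s0 where "s0 = instr_step CARD('a) W (WOp 21 WAdd (Reg 20) (Const 1))
   (instr_step CARD('a) W (WLoad 23 [Const 2, Reg 30]) (instr_step CARD('a) W (WLoad 20 [Const 1, Reg 30]) \<sigma>))"
  have r0: "regs s0 0 = CARD('a)" "regs s0 20 = n" "regs s0 21 = Suc n" "regs s0 23 = t" "regs s0 30 = q"
   using r W by (simp_all add: s0_def)
  have F0: "F s0 = F \<sigma>" by (simp add: s0_def F_def)
  have c0: "canon CARD('a) s0" using c by (simp add: s0_def canon_def)
  have nW: "Suc n < W" "n < W" and ne: "(21::nat) ~= 6" "(20::nat) ~= 6" "(21::nat) ~= 20" "(21::nat) ~= 0"
   using W by simp_all
  have d: "Reg 6 \<notin> set []" "Reg 6 \<notin> set [Reg 30]" by simp_all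
  have cp: "trm CARD('a) W split_copy s0 (2 + Suc n * 3) 0 B (\<lambda>s. \<forall>i<Suc n. F s [21, i] = F \<sigma> [20, q, i])"
   unfolding split_copy_def
   by (rule trm_mono[OF trm_fcopy[OF c0 r0(3) nW(1) ne(1) ne(3) ne(4) d z[unfolded F0[symmetric], unfolded F_def], unfolded append.simps]])
    (use F0 r0 in \<open>auto simp: F_def\<close>)
  have "trm CARD('a) W (split_copy ;;
   For 6 (Reg 20) (fset [Const 22, Reg 6] (Const 0)) ;; For 6 (Reg 20) (fset [Const 23, Reg 6] (Const 0)) ;; ?end) s0
   ((2 + Suc n * 3) + ((2 + n * 3) + ((2 + n * 3) + 5))) (0 + (0 + (0 + 0))) B ?Q"
  proof (rule trm_Seq'[OF p_pos c0 cp])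
   fix s1 assume f1: "\<forall>i<Suc n. F s1 [21, i] = F \<sigma> [20, q, i]" and ag1: "agree split_copy s0 s1" and c1: "canon CARD('a) s1"
   have r1: "regs s1 0 = CARD('a)" "regs s1 20 = n" "regs s1 21 = Suc n" "regs s1 23 = t"
    using agree_regs[OF ag1] r0 by (simp_all add: split_copy_def)
   show "trm CARD('a) W (For 6 (Reg 20) (fset [Const 22, Reg 6] (Const 0)) ;; For 6 (Reg 20) (fset [Const 23, Reg 6] (Const 0)) ;; ?end) s1
   ((2 + n * 3) + ((2 + n * 3) + 5)) (0 + (0 + 0)) B ?Q"
   proof (rule trm_Seq'[OF p_pos c1 trm_fclear[OF c1 r1(2) nW(2) ne(2), of 22 B]], elim conjE)
    fix s2 assume f2: "\<forall>i<n. fe s2 [22, i] = (0 :: 'a mod_ring)" and ag2: "agree (For 6 (Reg 20) (fset [Const 22, Reg 6] (Const 0))) s1 s2"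
     and c2: "canon CARD('a) s2"
    have r2: "regs s2 0 = CARD('a)" "regs s2 20 = n" "regs s2 21 = Suc n" "regs s2 23 = t"
     using agree_regs[OF ag2] r1 by simp_all
    have f2': "F s2 [21, i] = F s1 [21, i]" for i using agree_fe[OF ag2, of 21 "[i]", where 'a = 'a] by (simp add: F_def)
    show "trm CARD('a) W (For 6 (Reg 20) (fset [Const 23, Reg 6] (Const 0)) ;; ?end) s2 ((2 + n * 3) + 5) (0 + 0) B ?Q"
    proof (rule trm_Seq'[OF p_pos c2 trm_fclear[OF c2 r2(2) nW(2) ne(2), of 23 B]], elim conjE)
     fix s3 assume f3: "\<forall>i<n. fe s3 [23, i] = (0 :: 'a mod_ring)" and ag3: "agree (For 6 (Reg 20) (fset [Const 23, Reg 6] (Const 0))) s2 s3"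
     have r3: "regs s3 0 = CARD('a)" "regs s3 20 = n" "regs s3 21 = Suc n" "regs s3 23 = t"
     using agree_regs[OF ag3] r2 by simp_all
     have f3': "F s3 [21, i] = F s1 [21, i]" "F s3 [22, i] = F s2 [22, i]" for i
     using agree_fe[OF ag3, of 21 "[i]", where 'a = 'a] agree_fe[OF ag3, of 22 "[i]", where 'a = 'a] f2' by (simp_all add: F_def)
     define s4 where "s4 = ev CARD('a) W ?end s3"
     \<comment> \<open>X + t fills two cells, so it is a reduced residue only if the degree of the
       factor is at least 2.\<close>
     obtain k where k: "n = Suc (Suc k)" using n2 by (metis add_2_eq_Suc le_Suc_ex)
     have r4: "regs s4 20 = n" "regs s4 21 = Suc n" "regs s4 23 = t" "regs s4 22 = (CARD('a) - 1) div 2"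
     using r3 Wp by (simp_all add: s4_def)
     have g4: "F s4 [21, i] = F \<sigma> [20, q, i]" if "i \<le> n" for i using f1 f3' that by (simp add: s4_def F_def)
     have b4: "F s4 [22, i] = (if i = 0 then of_nat t else if i = 1 then 1 else 0)" if "i < n" for i
     using f3' f2 r3 that by (simp add: s4_def F_def)
     have a4: "F s4 [23, i] = (if i = 0 then 1 else 0)" if "i < n" for i
     using f3 that by (simp add: s4_def F_def)
     have "evp (\<lambda>i. F s4 [22, i]) n a = a + of_nat t" "evp (\<lambda>i. F s4 [23, i]) n a = 1" for a
     proof -
     have "evp (\<lambda>i. F s4 [22, i]) n a = evp (\<lambda>i. if i = 0 then of_nat t else if i = 1 then 1 else 0) n a"
     using b4 by (rule evp_cong)
     also have "\<dots> = a + of_nat t" unfolding evp_def k sum.lessThan_Suc_shift by simp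
     finally show "evp (\<lambda>i. F s4 [22, i]) n a = a + of_nat t" .
     have "evp (\<lambda>i. F s4 [23, i]) n a = evp (\<lambda>i. if i = 0 then 1 else 0) n a"
     using a4 by (rule evp_cong)
     also have "\<dots> = 1" unfolding evp_def k sum.lessThan_Suc_shift by simp
     finally show "evp (\<lambda>i. F s4 [23, i]) n a = 1" .
     qed
     then have "?Q s4" using r4 g4 by blast
     then show "trm CARD('a) W ?end s3 5 0 B ?Q"
     by (intro trm_mono[OF trm_ev0[where Q = ?Q and B = B]]) (simp_all only: s4_def[symmetric], simp_all)
    qed
   qed
  qed
  then have "trm CARD('a) W split_load \<sigma> (Suc (Suc (Suc ((2 + Suc n * 3) + ((2 + n * 3) + ((2 + n * 3) + 5)))))) (0 + (0 + (0 + 0))) B ?Q"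
   unfolding split_load_def s0_def by (intro trm_Do_Seq) simp_all
  then show ?thesis by (rule trm_mono) simp_all
qed

lemma trm_split_comb:
  fixes \<sigma> :: state
  defines "F \<equiv> fe :: state => nat list => 'a::prime_card mod_ring"
  assumes c: "canon CARD('a) \<sigma>" and z: "F \<sigma> [0] = 0" and r: "regs \<sigma> 20 = n"
   and G: "\<And>x. x \<in> A ==> evp (\<lambda>i. F \<sigma> [21, i]) n x + x ^ n = 0"
  defines "h \<equiv> evp (\<lambda>i. F \<sigma> [23, i]) n"
  shows "trm CARD('a) W split_comb \<sigma> (45 * (n + 1) ^ 2) 0 B
   (\<lambda>s. regs s 2 = 2 * n \<and> (\<forall>a\<in>A. evp (\<lambda>i. F s [22, i]) n a = (h a + 1) * h a \<and> evp (\<lambda>i. F s [23, i]) n a = h a - 1))"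
proof -
  let ?one = "fset [Const 17] (Const 1)"
  let ?end = "?one ;; fsub [Const 23, Const 0] [Const 23, Const 0] [Const 17] ;; wmul 2 (Reg 20) (Const 2)"
  let ?cp = "For 6 (Reg 20) (fcopy [Const 22, Reg 6] [Const 23, Reg 6])"
  let ?Q = "\<lambda>s. regs s 2 = 2 * n \<and> (\<forall>a\<in>A. evp (\<lambda>i. F s [22, i]) n a = (h a + 1) * h a \<and> evp (\<lambda>i. F s [23, i]) n a = h a - 1)"
  have nW: "n < W" and ne: "(20::nat) ~= 6" "(22::nat) ~= 23" "(22::nat) ~= 0" using W by simp_all
  have d: "Reg 6 \<notin> set []" by simp
  have cp: "trm CARD('a) W ?cp \<sigma> (2 + n * 3) 0 B (\<lambda>s. \<forall>i<n. F s [22, i] = F \<sigma> [23, i])"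
   by (rule trm_mono[OF trm_fcopy[OF c r nW ne(1) ne(2) ne(3) d d z[unfolded F_def], unfolded append.simps]])
    (auto simp: F_def)
  have "trm CARD('a) W (?cp ;; ?one ;; fadd [Const 22, Const 0] [Const 22, Const 0] [Const 17] ;; mulmod 22 23 ;; ?end) \<sigma>
   ((2 + n * 3) + Suc (Suc (30 * (n + 1) ^ 2 + 3))) (0 + (0 + 0)) B ?Q"
  proof (rule trm_Seq'[OF p_pos c cp])
   fix s1 assume f1: "\<forall>i<n. F s1 [22, i] = F \<sigma> [23, i]" and ag1: "agree ?cp \<sigma> s1" and c1: "canon CARD('a) s1"
   define s2 where "s2 = instr_step CARD('a) W (FOp [Const 22, Const 0] FAdd [Const 22, Const 0] [Const 17])
    (instr_step CARD('a) W (FofW [Const 17] (Const 1)) s1)"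
   have fop: "0 \<le> fop_val CARD('a) FAdd x y \<and> fop_val CARD('a) FAdd x y < int CARD('a)" for x y
    using p_pos[where 'a = 'a] by (simp add: fop_val.simps)
   have "0 \<le> int 1 mod int CARD('a) \<and> int 1 mod int CARD('a) < int CARD('a)"
    by (intro conjI pos_mod_sign pos_mod_bound) (use p_pos[where 'a = 'a] in simp_all)
   then have c2: "canon CARD('a) s2" using c1 fop by (auto simp: s2_def canon_def)
   have r2: "regs s2 20 = n" using agree_regs[OF ag1, of 20] r by (simp add: s2_def)
   have f2: "F s2 [0] = 0" "F s2 [21, i] = F \<sigma> [21, i]" "F s2 [23, i] = F \<sigma> [23, i]" for i
    using agree_fe[OF ag1, of 0 "[]", where 'a = 'a] agree_fe[OF ag1, of 21 "[i]", where 'a = 'a]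
     agree_fe[OF ag1, of 23 "[i]", where 'a = 'a] z by (simp_all add: s2_def F_def)
   have "(\<lambda>i. F s2 [22, i]) = (\<lambda>i. F s1 [22, i])(0 := F s1 [22, 0] + 1)" by (auto simp: s2_def F_def fun_eq_iff)
   then have e22: "evp (\<lambda>i. F s2 [22, i]) n a = h a + 1" for a
    using evp_upd_0[OF n, of "\<lambda>i. F s1 [22, i]" "F s1 [22, 0] + 1" a] f1 evp_cong[of n "\<lambda>i. F s1 [22, i]" "\<lambda>i. F \<sigma> [23, i]" a]
    by (simp add: h_def)
   have e23: "evp (\<lambda>i. F s2 [23, i]) n a = h a" for a using f2 by (simp add: h_def)
   have G2: "evp (\<lambda>i. F s2 [21, i]) n x + x ^ n = 0" if "x \<in> A" for x using G[OF that] f2 by simp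
   have W4: "4 * n + 8 < W" using W by simp
   from trm_mulmod[OF W4 n _ _ c2 r2 f2(1)[unfolded F_def] G2[unfolded F_def], of 22 23 A B, folded F_def]
   have mm: "trm CARD('a) W (mulmod 22 23) s2 (30 * (n + 1) ^ 2) 0 B (\<lambda>t. \<forall>x\<in>A. evp (\<lambda>i. F t [22, i]) n x = (h x + 1) * h x)"
    by (simp add: e22 e23)
   have "trm CARD('a) W (mulmod 22 23 ;; ?end) s2 (30 * (n + 1) ^ 2 + 3) (0 + 0) B ?Q"
   proof (rule trm_Seq'[OF p_pos c2 mm])
    fix s3 assume e3: "\<forall>x\<in>A. evp (\<lambda>i. F s3 [22, i]) n x = (h x + 1) * h x" and ag3: "agree (mulmod 22 23) s2 s3"
    have r3: "regs s3 20 = n" and f3: "F s3 [23, i] = F s2 [23, i]" for i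
     using agree_regs[OF ag3, of 20] agree_fe[OF ag3, of 23 "[i]", where 'a = 'a] r2 by (simp_all add: mulmod_defs F_def)
    define s4 where "s4 = ev CARD('a) W ?end s3"
    have r4: "regs s4 2 = 2 * n" using r3 W by (simp add: s4_def)
    have e4: "F s4 [22, i] = F s3 [22, i]" for i by (simp add: s4_def F_def)
    have "(\<lambda>i. F s4 [23, i]) = (\<lambda>i. F s3 [23, i])(0 := F s3 [23, 0] - 1)" by (auto simp: s4_def F_def fun_eq_iff)
    then have "evp (\<lambda>i. F s4 [23, i]) n a = h a - 1" for a
     using evp_upd_0[OF n, of "\<lambda>i. F s3 [23, i]" "F s3 [23, 0] - 1" a] f3 e23[of a] by simp
    then have "?Q s4" using r4 e4 e3 by simp
    then show "trm CARD('a) W ?end s3 3 0 B ?Q"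
     by (intro trm_mono[OF trm_ev0[where Q = ?Q and B = B]]) (simp_all only: s4_def[symmetric], simp_all)
   qed
   then have "trm CARD('a) W (?one ;; fadd [Const 22, Const 0] [Const 22, Const 0] [Const 17] ;; mulmod 22 23 ;; ?end) s1
    (Suc (Suc (30 * (n + 1) ^ 2 + 3))) (0 + 0) B ?Q"
    unfolding s2_def by (intro trm_Do_Seq) simp_all
   then show "trm CARD('a) W (?one ;; fadd [Const 22, Const 0] [Const 22, Const 0] [Const 17] ;; mulmod 22 23 ;; ?end) s1
    (Suc (Suc (30 * (n + 1) ^ 2 + 3))) (0 + 0) B ?Q" .
  qed
  then show ?thesis unfolding split_comb_def by (rule trm_mono) (auto simp: power2_eq_square algebra_simps)
qed

text \<open>The degree returned by the first run of Massey's algorithm decides: if it is 0 or n, the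
  shift did not split the factor and only the shift counter advances. Otherwise a second run
  produces the complementary factor, which replaces a polynomial division.\<close>

lemma trm_split_tail:
  fixes \<sigma> :: state and A :: "'a::prime_card mod_ring set"
  defines "F \<equiv> fe :: state => nat list => 'a mod_ring"
  assumes c: "canon CARD('a) \<sigma>" and z: "F \<sigma> [0] = 0" and A: "finite A" "card A = n"
   and r: "regs \<sigma> 20 = n" "regs \<sigma> 21 = Suc n" "regs \<sigma> 23 = t" "regs \<sigma> 30 = q" "regs \<sigma> 31 = nf" "regs \<sigma> 2 = 2 * n"
   and bd: "q ~= nf" "Suc nf < W" "Suc t < W"
   and y: "\<And>l. l < 3 * n ==> F \<sigma> [25, l] = (\<Sum>a\<in>A. lagw A a * a ^ l)"
   and A1: "A1 = {a \<in> A. evp (\<lambda>i. F \<sigma> [23, i]) n a ~= 0}" and A2: "A - A1 = {a \<in> A. evp (\<lambda>i. F \<sigma> [22, i]) n a ~= 0}"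
   and fac: "isfac (\<lambda>i. F \<sigma> [20, q, i]) A" and dg: "wmem \<sigma> [1, q] = n"
  shows "trm CARD('a) W split_tail \<sigma> (720 * (n + 1) ^ 2) 0 B (split_post q nf t A A1 \<sigma>)"
proof -
  let ?T = "(n + 1) ^ 2"
  let ?end = "wadd 8 (Reg 23) (Const 1) ;; Do (WStore [Const 2, Reg 30] (Reg 8))"
  let ?cq = "For 6 (Reg 21) (fcopy [Const 20, Reg 30, Reg 6] [Const 11, Reg 6])"
  let ?cn = "For 6 (Reg 21) (fcopy [Const 20, Reg 31, Reg 6] [Const 11, Reg 6])"
  have nW: "Suc n < W" and ne: "(21::nat) ~= 6" "(20::nat) ~= 11" "(20::nat) ~= 0" using W by simp_all
  have d: "Reg 6 \<notin> set []" "Reg 6 \<notin> set [Reg 30]" "Reg 6 \<notin> set [Reg 31]" by simp_all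
  have sub: "A1 \<subseteq> A" using A1 by auto
  have cA1: "card A1 \<le> n" "card (A - A1) \<le> n" using A sub by (auto intro!: card_mono)
  \<comment> \<open>The Lagrange weights never vanish, so they do not change a support.\<close>
  have lw: "{a \<in> A. lagw A a * v a ~= 0} = {a \<in> A. v a ~= 0}" for v using A(1) lagw_neq_0[of A] by auto
  have cong2: "2 * card {a \<in> A. v a ~= 0} \<le> 2 * n" for v :: "'a mod_ring => 'a mod_ring"
   using A by (auto intro!: card_mono)
  have tg: "(23::nat) \<notin> {10, 17}" "(22::nat) \<notin> {10, 17}" by simp_all
  note mom1 = trm_mom[OF W n tg(1) c r(1) r(6) y[unfolded F_def], of B, folded F_def]
  have "trm CARD('a) W split_tail \<sigma> (20 * ?T + (320 * ?T + (Suc (Suc (20 * ?T + 320 * ?T + 6 * n + 20)) + 2))) (0 + (0 + (0 + 0))) B (split_post q nf t A A1 \<sigma>)"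
   unfolding split_tail_def
  proof (rule trm_Seq'[OF p_pos c mom1])
   fix s1 assume m1: "\<forall>l<2 * n. F s1 [10, l] = (\<Sum>a\<in>A. lagw A a * evp (\<lambda>i. F \<sigma> [23, i]) n a * a ^ l)"
    and ag1: "agree (mom 23) \<sigma> s1" and c1: "canon CARD('a) s1"
   have r1: "regs s1 20 = n" "regs s1 21 = Suc n" "regs s1 23 = t" "regs s1 30 = q" "regs s1 31 = nf" "regs s1 2 = 2 * n"
    using agree_regs[OF ag1] r by (simp_all add: split_defs)
   have f1: "F s1 [0] = 0" "F s1 [25, i] = F \<sigma> [25, i]" "F s1 [22, i] = F \<sigma> [22, i]" "F s1 (20 # as) = F \<sigma> (20 # as)" for i as
    using agree_fe[OF ag1, of 0 "[]", where 'a = 'a] agree_fe[OF ag1, of 25 "[i]", where 'a = 'a]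
     agree_fe[OF ag1, of 22 "[i]", where 'a = 'a] agree_fe[OF ag1, of 20 as, where 'a = 'a] z by (simp_all add: split_defs F_def)
   have w1: "wmem s1 (k # as) = wmem \<sigma> (k # as)" for k as using agree_wmem[OF ag1] by (simp add: split_defs)
   have m1': "F s1 [10, l] = (\<Sum>a\<in>A. (lagw A a * evp (\<lambda>i. F \<sigma> [23, i]) n a) * a ^ l)" if "l < 2 * n" for l
    using m1 that by blast
   have c2n: "2 * card A1 \<le> 2 * n" using cA1 by simp
   have ms1: "trm CARD('a) W massey s1 (320 * ?T) 0 B (\<lambda>s. regs s 3 = card A1 \<and> npoly (2 * n) (\<lambda>i. F s [11, i]) = linprod A1)"
    by (rule trm_massey_support[OF W n order_refl c1 r1(6) f1(1)[unfolded F_def] A(1), where w = "\<lambda>a. lagw A a * evp (\<lambda>i. F \<sigma> [23, i]) n a",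
     folded F_def, unfolded lw, folded A1, OF _ c2n]) (use m1' in blast)
   show "trm CARD('a) W (massey ;; If (WLess (Const 0) (Reg 3)) (If (WLess (Reg 3) (Reg 20)) split_store skip) skip ;; ?end) s1
    (320 * ?T + (Suc (Suc (20 * ?T + 320 * ?T + 6 * n + 20)) + 2)) (0 + (0 + 0)) B (split_post q nf t A A1 \<sigma>)"
   proof (rule trm_Seq'[OF p_pos c1 ms1], elim conjE)
    fix s2 assume d2: "regs s2 3 = card A1" and p2: "npoly (2 * n) (\<lambda>i. F s2 [11, i]) = linprod A1"
     and ag2: "agree massey s1 s2" and c2: "canon CARD('a) s2"
    have r2: "regs s2 20 = n" "regs s2 21 = Suc n" "regs s2 23 = t" "regs s2 30 = q" "regs s2 31 = nf" "regs s2 2 = 2 * n"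
     using agree_regs[OF ag2] r1 by (simp_all add: massey_defs)
    have f2: "F s2 [0] = 0" "F s2 [25, i] = F \<sigma> [25, i]" "F s2 [22, i] = F \<sigma> [22, i]" "F s2 (20 # as) = F \<sigma> (20 # as)" for i as
     using agree_fe[OF ag2, of 0 "[]", where 'a = 'a] agree_fe[OF ag2, of 25 "[i]", where 'a = 'a]
     agree_fe[OF ag2, of 22 "[i]", where 'a = 'a] agree_fe[OF ag2, of 20 as, where 'a = 'a] f1 by (simp_all add: massey_defs F_def)
    have w2: "wmem s2 (k # as) = wmem \<sigma> (k # as)" for k as using agree_wmem[OF ag2] w1 by (simp add: massey_defs)
    let ?R = "\<lambda>s. (\<forall>j. j ~= q --> j ~= nf --> (\<forall>i. F s [20, j, i] = F \<sigma> [20, j, i]) \<and>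
     wmem s [1, j] = wmem \<sigma> [1, j] \<and> wmem s [2, j] = wmem \<sigma> [2, j]) \<and> regs s 30 = q \<and> regs s 23 = t \<and>
     (if A1 = {} \<or> A1 = A
     then regs s 31 = nf \<and> isfac (\<lambda>i. F s [20, q, i]) A \<and> wmem s [1, q] = card A
     else regs s 31 = Suc nf \<and> isfac (\<lambda>i. F s [20, q, i]) A1 \<and> wmem s [1, q] = card A1 \<and>
     isfac (\<lambda>i. F s [20, nf, i]) (A - A1) \<and> wmem s [1, nf] = card (A - A1) \<and> wmem s [2, nf] = Suc t)"
    have skip: "trm CARD('a) W skip s2 k 0 B ?R" if "A1 = {} \<or> A1 = A" "1 \<le> k" for k
     using that by (intro trm_mono[OF trm_ev0[where Q = ?R and B = B]])
     (use r2 f2 w2 fac dg A in \<open>simp_all add: F_def\<close>)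
    have store: "trm CARD('a) W split_store s2 (20 * ?T + 320 * ?T + 6 * n + 20) 0 B ?R" if ne1: "A1 ~= {}" "A1 ~= A"
    proof -
     have cq: "trm CARD('a) W ?cq s2 (2 + Suc n * 3) 0 B (\<lambda>s. (\<forall>i<Suc n. F s [20, q, i] = F s2 [11, i]) \<and>
     (\<forall>a. (\<forall>i<Suc n. a ~= [20, q, i]) --> F s a = F s2 a))"
     by (rule trm_mono[OF trm_fcopy[OF c2 r2(2) nW ne(1) ne(2) ne(3) d(2) d(1) f2(1)[unfolded F_def], unfolded append.simps]])
     (use r2 in \<open>auto simp: F_def\<close>)
     have "trm CARD('a) W split_store s2 ((2 + Suc n * 3) + Suc (20 * ?T + (320 * ?T + ((2 + Suc n * 3) + 4)))) (0 + (0 + (0 + (0 + 0)))) B ?R"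
     unfolding split_store_def
     proof (rule trm_Seq'[OF p_pos c2 cq], elim conjE)
     fix s3 assume q3: "\<forall>i<Suc n. F s3 [20, q, i] = F s2 [11, i]" and o3: "\<forall>a. (\<forall>i<Suc n. a ~= [20, q, i]) --> F s3 a = F s2 a"
     and ag3: "agree ?cq s2 s3" and c3: "canon CARD('a) s3"
     define s4 where "s4 = instr_step CARD('a) W (WStore [Const 1, Reg 30] (Reg 3)) s3"
     have c4: "canon CARD('a) s4" using c3 by (simp add: s4_def canon_def)
     have r3: "regs s3 3 = card A1" using agree_regs[OF ag3, of 3] d2 by simp
     have r4: "regs s4 20 = n" "regs s4 21 = Suc n" "regs s4 23 = t" "regs s4 30 = q" "regs s4 31 = nf" "regs s4 2 = 2 * n"
     using agree_regs[OF ag3] r2 by (simp_all add: s4_def)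
     have F4: "F s4 = F s3" by (simp add: s4_def F_def)
     have w4: "wmem s4 [1, q] = card A1" "\<And>as. as ~= [1, q] ==> wmem s4 as = wmem s3 as"
     using r3 agree_regs[OF ag3, of 30] r2 cA1 W by (simp_all add: s4_def)
     have w3: "wmem s3 (k # as) = wmem \<sigma> (k # as)" for k as using agree_wmem[OF ag3] w2 by simp
     have f4: "F s4 [0] = 0" "F s4 [25, i] = F \<sigma> [25, i]" "F s4 [22, i] = F \<sigma> [22, i]" for i
     using o3 f2 F4 by simp_all
     have y4: "F s4 [25, l] = (\<Sum>a\<in>A. lagw A a * a ^ l)" if "l < 3 * n" for l using y[OF that] f4 by simp
     note mom2 = trm_mom[OF W n tg(2) c4 r4(1) r4(6) y4[unfolded F_def], of B, folded F_def]
     have "trm CARD('a) W (mom 22 ;; massey ;; ?cn ;; Do (WStore [Const 1, Reg 31] (Reg 3)) ;; wadd 8 (Reg 23) (Const 1) ;;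
     Do (WStore [Const 2, Reg 31] (Reg 8)) ;; wadd 31 (Reg 31) (Const 1)) s4
     (20 * ?T + (320 * ?T + ((2 + Suc n * 3) + 4))) (0 + (0 + (0 + 0))) B ?R"
     proof (rule trm_Seq'[OF p_pos c4 mom2])
     fix s5 assume m5: "\<forall>l<2 * n. F s5 [10, l] = (\<Sum>a\<in>A. lagw A a * evp (\<lambda>i. F s4 [22, i]) n a * a ^ l)"
     and ag5: "agree (mom 22) s4 s5" and c5: "canon CARD('a) s5"
     have r5: "regs s5 20 = n" "regs s5 21 = Suc n" "regs s5 23 = t" "regs s5 30 = q" "regs s5 31 = nf" "regs s5 2 = 2 * n"
     using agree_regs[OF ag5] r4 by (simp_all add: split_defs)
     have f5: "F s5 [0] = 0" "F s5 (20 # as) = F s3 (20 # as)" for as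
     using agree_fe[OF ag5, of 0 "[]", where 'a = 'a] agree_fe[OF ag5, of 20 as, where 'a = 'a] f4 F4
     by (simp_all add: split_defs F_def)
     have w5: "wmem s5 (k # as) = wmem s4 (k # as)" for k as using agree_wmem[OF ag5] by (simp add: split_defs)
     have m5': "F s5 [10, l] = (\<Sum>a\<in>A. (lagw A a * evp (\<lambda>i. F \<sigma> [22, i]) n a) * a ^ l)" if "l < 2 * n" for l
     using m5 that f4 by simp
     have c5n: "2 * card (A - A1) \<le> 2 * n" using cA1 by simp
     have ms5: "trm CARD('a) W massey s5 (320 * ?T) 0 B (\<lambda>s. regs s 3 = card (A - A1) \<and> npoly (2 * n) (\<lambda>i. F s [11, i]) = linprod (A - A1))"
     by (rule trm_massey_support[OF W n order_refl c5 r5(6) f5(1)[unfolded F_def] A(1), where w = "\<lambda>a. lagw A a * evp (\<lambda>i. F \<sigma> [22, i]) n a",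
     folded F_def, unfolded lw, folded A2, OF _ c5n]) (use m5' in blast)
     show "trm CARD('a) W (massey ;; ?cn ;; Do (WStore [Const 1, Reg 31] (Reg 3)) ;; wadd 8 (Reg 23) (Const 1) ;;
     Do (WStore [Const 2, Reg 31] (Reg 8)) ;; wadd 31 (Reg 31) (Const 1)) s5
     (320 * ?T + ((2 + Suc n * 3) + 4)) (0 + (0 + 0)) B ?R"
     proof (rule trm_Seq'[OF p_pos c5 ms5], elim conjE)
     fix s6 assume d6: "regs s6 3 = card (A - A1)" and p6: "npoly (2 * n) (\<lambda>i. F s6 [11, i]) = linprod (A - A1)"
     and ag6: "agree massey s5 s6" and c6: "canon CARD('a) s6"
     have r6: "regs s6 20 = n" "regs s6 21 = Suc n" "regs s6 23 = t" "regs s6 30 = q" "regs s6 31 = nf"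
     using agree_regs[OF ag6] r5 by (simp_all add: massey_defs)
     have f6: "F s6 [0] = 0" "F s6 (20 # as) = F s3 (20 # as)" for as
     using agree_fe[OF ag6, of 0 "[]", where 'a = 'a] agree_fe[OF ag6, of 20 as, where 'a = 'a] f5
     by (simp_all add: massey_defs F_def)
     have w6: "wmem s6 (k # as) = wmem s4 (k # as)" for k as using agree_wmem[OF ag6] w5 by (simp add: massey_defs)
     have cn: "trm CARD('a) W ?cn s6 (2 + Suc n * 3) 0 B (\<lambda>s. (\<forall>i<Suc n. F s [20, nf, i] = F s6 [11, i]) \<and>
     (\<forall>a. (\<forall>i<Suc n. a ~= [20, nf, i]) --> F s a = F s6 a))"
     by (rule trm_mono[OF trm_fcopy[OF c6 r6(2) nW ne(1) ne(2) ne(3) d(3) d(1) f6(1)[unfolded F_def], unfolded append.simps]])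
     (use r6 in \<open>auto simp: F_def\<close>)
     let ?fin = "Do (WStore [Const 1, Reg 31] (Reg 3)) ;; wadd 8 (Reg 23) (Const 1) ;;
     Do (WStore [Const 2, Reg 31] (Reg 8)) ;; wadd 31 (Reg 31) (Const 1)"
     show "trm CARD('a) W (?cn ;; ?fin) s6 ((2 + Suc n * 3) + 4) (0 + 0) B ?R"
     proof (rule trm_Seq'[OF p_pos c6 cn], elim conjE)
     fix s7 assume q7: "\<forall>i<Suc n. F s7 [20, nf, i] = F s6 [11, i]" and o7: "\<forall>a. (\<forall>i<Suc n. a ~= [20, nf, i]) --> F s7 a = F s6 a"
     and ag7: "agree ?cn s6 s7"
     have r7: "regs s7 23 = t" "regs s7 30 = q" "regs s7 31 = nf" "regs s7 3 = card (A - A1)"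
     using agree_regs[OF ag7] r6 d6 by simp_all
     have w7: "wmem s7 (k # as) = wmem s4 (k # as)" for k as using agree_wmem[OF ag7] w6 by simp
     define s8 where "s8 = ev CARD('a) W ?fin s7"
     have F8: "F s8 = F s7" by (simp add: s8_def F_def)
     have r8: "regs s8 30 = q" "regs s8 23 = t" "regs s8 31 = Suc nf"
     using r7 bd by (simp_all add: s8_def)
     have w8: "wmem s8 = (wmem s7)([1, nf] := card (A - A1), [2, nf] := Suc t)"
     using r7 bd cA1 W by (simp add: s8_def)
     have other: "F s8 [20, j, i] = F \<sigma> [20, j, i]" if "j ~= q" "j ~= nf" for j i
     using that o7 o3 f6 f2 F8 by simp
     have "F s8 [20, q, i] = F s2 [11, i]" if "i \<le> n" for i
     using that o7 f6 q3 bd F8 by (simp add: less_Suc_eq_le)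
     then have fq: "isfac (\<lambda>i. F s8 [20, q, i]) A1"
     using isfac_npoly[OF _ _ p2] finite_subset[OF sub A(1)] cA1 by simp
     have "F s8 [20, nf, i] = F s6 [11, i]" if "i \<le> n" for i
     using that q7 F8 by (simp add: less_Suc_eq_le)
     then have fn: "isfac (\<lambda>i. F s8 [20, nf, i]) (A - A1)"
     using isfac_npoly[OF _ _ p6] A(1) cA1 by simp
     have wq: "wmem s8 [1, q] = card A1" using w8 w7 w4 bd by simp
     have wo: "wmem s8 [k, j] = wmem \<sigma> [k, j]" if "j ~= q" "j ~= nf" for k j
     using w8 w7 w4(2) w3 that by simp
     have wn: "wmem s8 [1, nf] = card (A - A1)" "wmem s8 [2, nf] = Suc t" using w8 by simp_all
     have nc: "\<not> (A1 = {} \<or> A1 = A)" using ne1 by blast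
     have "?R s8" unfolding if_not_P[OF nc]
     by (intro conjI allI impI) ((rule other wo, assumption, assumption) | rule r8 fq wq fn wn)+
     then have R8: "?R (ev CARD('a) W ?fin s7)" unfolding s8_def .
     have "trm CARD('a) W ?fin s7 (steps ?fin) 0 B ?R" 
     by (rule trm_ev0[where Q = ?R, OF _ _ R8]) simp_all
     then show "trm CARD('a) W ?fin s7 4 0 B ?R" by (rule trm_mono) (assumption | simp)+
     qed
     qed
     qed
     then show "trm CARD('a) W (Do (WStore [Const 1, Reg 30] (Reg 3)) ;; mom 22 ;; massey ;; ?cn ;; Do (WStore [Const 1, Reg 31] (Reg 3)) ;; wadd 8 (Reg 23) (Const 1) ;;
     Do (WStore [Const 2, Reg 31] (Reg 8)) ;; wadd 31 (Reg 31) (Const 1)) s3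
     (Suc (20 * ?T + (320 * ?T + ((2 + Suc n * 3) + 4)))) (0 + (0 + (0 + 0))) B ?R"
     unfolding s4_def by (rule trm_Do_Seq[rotated]) simp
     qed
     then show ?thesis by (rule trm_mono) (assumption | simp)+
    qed
    have mid: "trm CARD('a) W (If (WLess (Const 0) (Reg 3)) (If (WLess (Reg 3) (Reg 20)) split_store skip) skip) s2
     (Suc (Suc (20 * ?T + 320 * ?T + 6 * n + 20))) 0 B ?R"
    proof (rule trm_If)
     assume "cond_val (WLess (Const 0) (Reg 3)) s2"
     then have ne1: "A1 ~= {}" using d2 by auto
     show "trm CARD('a) W (If (WLess (Reg 3) (Reg 20)) split_store skip) s2 (Suc (20 * ?T + 320 * ?T + 6 * n + 20)) 0 B ?R"
     proof (rule trm_If)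
     assume "cond_val (WLess (Reg 3) (Reg 20)) s2"
     then have "A1 ~= A" using d2 r2 A by auto
     with ne1 show "trm CARD('a) W split_store s2 (20 * ?T + 320 * ?T + 6 * n + 20) 0 B ?R" by (rule store)
     next
     assume "\<not> cond_val (WLess (Reg 3) (Reg 20)) s2"
     then have "card A \<le> card A1" using d2 r2 A by simp
     then have "A1 = A" using A sub by (intro card_seteq) auto
     then show "trm CARD('a) W skip s2 (20 * ?T + 320 * ?T + 6 * n + 20) 0 B ?R" by (intro skip) auto
     qed simp
    next
     assume "\<not> cond_val (WLess (Const 0) (Reg 3)) s2"
     then have "A1 = {}" using d2 finite_subset[OF sub A(1)] by simp
     then show "trm CARD('a) W skip s2 (Suc (20 * ?T + 320 * ?T + 6 * n + 20)) 0 B ?R" by (intro skip) auto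
    qed simp
    show "trm CARD('a) W (If (WLess (Const 0) (Reg 3)) (If (WLess (Reg 3) (Reg 20)) split_store skip) skip ;; ?end) s2
     (Suc (Suc (20 * ?T + 320 * ?T + 6 * n + 20)) + 2) (0 + 0) B (split_post q nf t A A1 \<sigma>)"
    proof (rule trm_Seq'[OF p_pos c2 mid])
     fix s9 assume R: "?R s9"
     define s10 where "s10 = ev CARD('a) W ?end s9"
     have "F s10 = F s9" by (simp add: s10_def F_def)
     moreover have "wmem s10 = (wmem s9)([2, q] := Suc t)" "regs s10 = (regs s9)(8 := Suc t)"
     using R bd by (simp_all add: s10_def)
     ultimately have "split_post q nf t A A1 \<sigma> s10"
     using R bd(1) unfolding split_post_def F_def[symmetric] by (cases "A1 = {} \<or> A1 = A") (simp_all del: One_nat_def)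
     then show "trm CARD('a) W ?end s9 2 0 B (split_post q nf t A A1 \<sigma>)"
     by (intro trm_mono[OF trm_ev0[where Q = "split_post q nf t A A1 \<sigma>" and B = B]]) (simp_all only: s10_def[symmetric], simp_all)
    qed
   qed
  qed
  then show ?thesis by (rule trm_mono) (auto simp: power2_eq_square algebra_simps)
qed

lemma trm_split:
  fixes \<sigma> :: state and A :: "'a::prime_card mod_ring set"
  defines "F \<equiv> fe :: state => nat list => 'a mod_ring"
  assumes n2: "2 \<le> n" and Wp: "CARD('a) < W" and odd: "odd CARD('a)"
   and c: "canon CARD('a) \<sigma>" and z: "F \<sigma> [0] = 0"
   and r: "regs \<sigma> 0 = CARD('a)" "regs \<sigma> 30 = q" "regs \<sigma> 31 = nf" "wmem \<sigma> [1, q] = n" "wmem \<sigma> [2, q] = t"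
   and bd: "q ~= nf" "Suc nf < W" "Suc t < W"
   and fac: "isfac (\<lambda>i. F \<sigma> [20, q, i]) A" and A: "card A = n"
  defines "e \<equiv> (CARD('a) - 1) div 2"
  shows "trm CARD('a) W split \<sigma> (70 * (bits e + 13) * (n + 1) ^ 2) 0 B
   (split_post q nf t A {a \<in> A. (a + of_nat t) ^ e ~= 1} \<sigma>)"
proof -
  let ?T = "(n + 1) ^ 2"
  have finA: "finite A" using fac by (simp add: isfac_def)
  have W4: "4 * n + 8 < W" using W by simp
  have eW: "e < W" using Wp by (simp add: e_def)
  let ?P = "split_post q nf t A {a \<in> A. (a + of_nat t) ^ e ~= 1} \<sigma>"
  note ld = trm_split_load[OF n2 Wp c z[unfolded F_def] r(1,2,4,5), of B, folded F_def e_def]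
  have "trm CARD('a) W split \<sigma> ((9 * n + 20) + (Suc (bits e * (70 * ?T)) + (45 * ?T + (45 * ?T + Suc (720 * ?T)))))
    (0 + (0 + (0 + (0 + 0)))) B ?P"
   unfolding split_def
  proof (rule trm_Seq'[OF p_pos c ld], elim conjE)
   fix s1 assume d1: "regs s1 20 = n" "regs s1 21 = Suc n" "regs s1 23 = t" "regs s1 22 = e"
    and g1: "\<forall>i\<le>n. F s1 [21, i] = F \<sigma> [20, q, i]"
    and b1: "\<forall>a. evp (\<lambda>i. F s1 [22, i]) n a = a + of_nat t" and a1: "\<forall>a. evp (\<lambda>i. F s1 [23, i]) n a = 1"
    and ag1: "agree split_load \<sigma> s1" and c1: "canon CARD('a) s1"
   have r1: "regs s1 30 = q" "regs s1 31 = nf" using agree_regs[OF ag1] r by (simp_all add: all_split_defs)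
   have f1: "F s1 [0] = 0" "F s1 (20 # as) = F \<sigma> (20 # as)" for as
    using agree_fe[OF ag1, of 0 "[]", where 'a = 'a] agree_fe[OF ag1, of 20 as, where 'a = 'a] z by (simp_all add: all_split_defs F_def)
   have w1: "wmem s1 (k # as) = wmem \<sigma> (k # as)" for k as using agree_wmem[OF ag1] by (simp add: all_split_defs)
   have fac1: "isfac (\<lambda>i. F s1 [21, i]) A" by (rule isfac_cong[OF fac]) (use g1 A in simp)
   have G1: "evp (\<lambda>i. F s1 [21, i]) n x + x ^ n = 0" if "x \<in> A" for x using isfac_root[OF fac1 that] A by simp
   have pm: "trm CARD('a) W powmod s1 (Suc (bits e * (70 * ?T))) 0 B
     (\<lambda>s. \<forall>x\<in>A. evp (\<lambda>i. F s [23, i]) n x = (x + of_nat t) ^ e)"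
    by (rule trm_mono[OF trm_powmod[where A = A and B = B, OF W4 n c1 d1(1,4) eW f1(1)[unfolded F_def]]])
     (use G1 a1 b1 in \<open>simp_all add: F_def\<close>)
   show "trm CARD('a) W (powmod ;; lag ;; split_comb ;; wadd 21 (Reg 20) (Const 1) ;; split_tail) s1
    (Suc (bits e * (70 * ?T)) + (45 * ?T + (45 * ?T + Suc (720 * ?T)))) (0 + (0 + (0 + 0))) B ?P"
   proof (rule trm_Seq'[OF p_pos c1 pm])
    fix s2 assume h2: "\<forall>x\<in>A. evp (\<lambda>i. F s2 [23, i]) n x = (x + of_nat t) ^ e"
     and ag2: "agree powmod s1 s2" and c2: "canon CARD('a) s2"
    have r2: "regs s2 20 = n" "regs s2 23 = t" "regs s2 30 = q" "regs s2 31 = nf"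
     using agree_regs[OF ag2] r1 d1 by (simp_all add: all_split_defs)
    have f2: "F s2 [0] = 0" "F s2 (20 # as) = F \<sigma> (20 # as)" "F s2 [21, i] = F s1 [21, i]" for as i
     using agree_fe[OF ag2, of 0 "[]", where 'a = 'a] agree_fe[OF ag2, of 20 as, where 'a = 'a]
     agree_fe[OF ag2, of 21 "[i]", where 'a = 'a] f1 by (simp_all add: all_split_defs F_def)
    have w2: "wmem s2 (k # as) = wmem \<sigma> (k # as)" for k as using agree_wmem[OF ag2] w1 by (simp add: all_split_defs)
    have fac2: "isfac (\<lambda>i. F s2 [21, i]) A" by (rule isfac_cong[OF fac1]) (use f2 in simp)
    note lg = trm_lag[OF W n c2 r2(1) fac2[unfolded F_def] A, of B, folded F_def]
    show "trm CARD('a) W (lag ;; split_comb ;; wadd 21 (Reg 20) (Const 1) ;; split_tail) s2 (45 * ?T + (45 * ?T + Suc (720 * ?T))) (0 + (0 + 0)) B ?P"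
    proof (rule trm_Seq'[OF p_pos c2 lg])
     fix s3 assume y3: "\<forall>l<3 * n. F s3 [25, l] = (\<Sum>a\<in>A. lagw A a * a ^ l)"
     and ag3: "agree lag s2 s3" and c3: "canon CARD('a) s3"
     have r3: "regs s3 20 = n" "regs s3 23 = t" "regs s3 30 = q" "regs s3 31 = nf"
     using agree_regs[OF ag3] r2 by (simp_all add: all_split_defs)
     have f3: "F s3 [0] = 0" "F s3 (20 # as) = F \<sigma> (20 # as)" "F s3 [21, i] = F s1 [21, i]" "F s3 [23, i] = F s2 [23, i]" for as i
     using agree_fe[OF ag3, of 0 "[]", where 'a = 'a] agree_fe[OF ag3, of 20 as, where 'a = 'a]
     agree_fe[OF ag3, of 21 "[i]", where 'a = 'a] agree_fe[OF ag3, of 23 "[i]", where 'a = 'a] f2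
     by (simp_all add: all_split_defs F_def)
     have w3: "wmem s3 (k # as) = wmem \<sigma> (k # as)" for k as using agree_wmem[OF ag3] w2 by (simp add: all_split_defs)
     have G3: "evp (\<lambda>i. F s3 [21, i]) n x + x ^ n = 0" if "x \<in> A" for x using G1[OF that] f3 by simp
     have cb: "trm CARD('a) W split_comb s3 (45 * ?T) 0 B (\<lambda>s. regs s 2 = 2 * n \<and>
     (\<forall>a\<in>A. evp (\<lambda>i. F s [22, i]) n a = (evp (\<lambda>i. F s3 [23, i]) n a + 1) * evp (\<lambda>i. F s3 [23, i]) n a \<and>
     evp (\<lambda>i. F s [23, i]) n a = evp (\<lambda>i. F s3 [23, i]) n a - 1))"
     unfolding F_def by (rule trm_split_comb[OF c3 f3(1)[unfolded F_def] r3(1)]) (use G3 in \<open>simp add: F_def\<close>)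
     show "trm CARD('a) W (split_comb ;; wadd 21 (Reg 20) (Const 1) ;; split_tail) s3 (45 * ?T + Suc (720 * ?T)) (0 + 0) B ?P"
     proof (rule trm_Seq'[OF p_pos c3 cb], elim conjE)
     fix s4 assume d4: "regs s4 2 = 2 * n"
     and e4: "\<forall>a\<in>A. evp (\<lambda>i. F s4 [22, i]) n a = (evp (\<lambda>i. F s3 [23, i]) n a + 1) * evp (\<lambda>i. F s3 [23, i]) n a \<and>
     evp (\<lambda>i. F s4 [23, i]) n a = evp (\<lambda>i. F s3 [23, i]) n a - 1"
     and ag4: "agree split_comb s3 s4" and c4: "canon CARD('a) s4"
     have r4: "regs s4 20 = n" "regs s4 23 = t" "regs s4 30 = q" "regs s4 31 = nf"
     using agree_regs[OF ag4] r3 by (simp_all add: all_split_defs)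
     define s5 where "s5 = instr_step CARD('a) W (WOp 21 WAdd (Reg 20) (Const 1)) s4"
     have c5: "canon CARD('a) s5" using c4 by (simp add: s5_def canon_def)
     have r5: "regs s5 20 = n" "regs s5 21 = Suc n" "regs s5 23 = t" "regs s5 30 = q" "regs s5 31 = nf" "regs s5 2 = 2 * n"
     using r4 d4 W by (simp_all add: s5_def)
     have F5: "F s5 = F s4" and W5: "wmem s5 = wmem s4" by (simp_all add: s5_def F_def)
     have f4: "F s4 [0] = 0" "F s4 (20 # as) = F \<sigma> (20 # as)" "F s4 [25, i] = F s3 [25, i]" for as i
     using agree_fe[OF ag4, of 0 "[]", where 'a = 'a] agree_fe[OF ag4, of 20 as, where 'a = 'a]
     agree_fe[OF ag4, of 25 "[i]", where 'a = 'a] f3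
     by (simp_all add: all_split_defs F_def)
     have w4: "wmem s4 (k # as) = wmem \<sigma> (k # as)" for k as using agree_wmem[OF ag4] w3 by (simp add: all_split_defs)
     have h: "evp (\<lambda>i. F s3 [23, i]) n a = (a + of_nat t) ^ e" if "a \<in> A" for a
     using h2 that f3 by simp
     have y4: "F s5 [25, l] = (\<Sum>a\<in>A. lagw A a * a ^ l)" if "l < 3 * n" for l using y3 that f4 F5 by simp
     have S1: "{a \<in> A. (a + of_nat t) ^ e ~= 1} = {a \<in> A. evp (\<lambda>i. F s5 [23, i]) n a ~= 0}"
     using e4 h F5 by auto
     have two: "(1::'a mod_ring) + 1 ~= 0" using two_neq_0[OF odd] by simp
     have e0: "0 < e" using prime_gt_1_nat[OF prime_card[where 'a = 'a]] odd unfolding e_def by (auto elim!: oddE)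
     \<comment> \<open>The half power is 0, 1 or -1, and 1 + 1 is not 0 because p is odd.\<close>
     have key: "(a + of_nat t) ^ e = 1 \<longleftrightarrow> ((a + of_nat t) ^ e + 1) * (a + of_nat t) ^ e ~= 0" for a :: "'a mod_ring"
     using power_half_cases[OF odd, of "a + of_nat t"] two e0 unfolding e_def[symmetric] by (cases "a + of_nat t = 0") (auto simp: zero_power)
     have S2: "A - {a \<in> A. (a + of_nat t) ^ e ~= 1} = {a \<in> A. evp (\<lambda>i. F s5 [22, i]) n a ~= 0}"
     using e4 h F5 key by auto
     have fac4: "isfac (\<lambda>i. F s5 [20, q, i]) A" using fac f4(2) F5 by simp
     have dg4: "wmem s5 [1, q] = n" using w4 r W5 by simp
     have fe5: "fe s5 (20 # as) = (fe \<sigma> (20 # as) :: 'a mod_ring)" and we5: "wmem s5 (k # as) = wmem \<sigma> (k # as)" for k as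
     using f4(2) w4 F5 W5 unfolding F_def by simp_all
     have tr: "split_post q nf t A A' \<sigma> s" if "split_post q nf t A A' s5 s" for A' :: "'a mod_ring set" and s
     using that unfolding split_post_def fe5 we5 .
     have z5: "F s5 [0] = 0" using f4(1) F5 by simp
     from trm_split_tail[OF c5 z5[unfolded F_def] finA A r5 bd y4[unfolded F_def] S1[unfolded F_def]
     S2[unfolded F_def] fac4[unfolded F_def] dg4, of B]
     have "trm CARD('a) W split_tail s5 (720 * ?T) 0 B ?P" by (rule trm_mono) (use tr in simp_all)
     then show "trm CARD('a) W (wadd 21 (Reg 20) (Const 1) ;; split_tail) s4 (Suc (720 * ?T)) 0 B ?P"
     unfolding s5_def by (rule trm_Do_Seq[rotated]) simp
     qed
    qed
   qed
  qed
  then show ?thesis by (rule trm_mono) (auto simp: power2_eq_square algebra_simps)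
qed

end

section \<open>Amortised cost of splitting into linear factors\<close>

definition facs :: "nat => nat => nat => nat => 'a::prime_card mod_ring set => (nat => 'a mod_ring set) =>
   (nat => nat => 'a mod_ring) => (nat => nat) => (nat => nat) => bool" where
  "facs K q0 q nf A As g w1 w2 \<longleftrightarrow> q0 \<le> q \<and> q \<le> nf \<and>
   (\<forall>j\<in>{q0..<nf}. isfac (g j) (As j) \<and> w1 j = card (As j) \<and> As j ~= {} \<and> w2 j \<le> Suc K \<and>
     (\<forall>a\<in>As j. \<forall>b\<in>As j. \<forall>u<w2 j. inseparable a b u)) \<and>
   (\<forall>j\<in>{q0..<q}. card (As j) = 1) \<and>
   (\<forall>i\<in>{q0..<nf}. \<forall>j\<in>{q0..<nf}. i ~= j --> As i \<inter> As j = {}) \<and>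
   (\<Union>j\<in>{q0..<nf}. As j) = A"

text \<open>A factor of degree n pays about n^2 for each shift it may still meet. Counters reach at
  most K + 1, so K + 2 leaves one unit for stepping over the factor once it is linear.\<close>

definition pot :: "nat => nat => nat => nat => (nat => nat) => (nat => nat) => nat" where
  "pot E K q nf w1 w2 = (\<Sum>j = q..<nf. E * (w1 j)\<^sup>2 * (K + 2 - w2 j))"

lemma facs_card:
  assumes "facs K q0 q nf A As g w1 w2"
  shows "nf \<le> q0 + card A" "finite A" "j \<in> {q0..<nf} ==> As j \<subseteq> A"
proof -
  have fin: "finite (As j)" "As j ~= {}" if "j \<in> {q0..<nf}" for j using assms that by (auto simp: facs_def isfac_def)
  have U: "(\<Union>j\<in>{q0..<nf}. As j) = A" using assms by (simp add: facs_def)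
  show "finite A" unfolding U[symmetric] using fin by blast
  show "j \<in> {q0..<nf} ==> As j \<subseteq> A" using U by blast
  have "card A = (\<Sum>j\<in>{q0..<nf}. card (As j))" unfolding U[symmetric]
   by (rule card_UN_disjoint) (use assms fin in \<open>simp_all add: facs_def\<close>)
  also have "\<dots> \<ge> (\<Sum>j\<in>{q0..<nf}. 1)" by (rule sum_mono) (use fin in \<open>simp add: Suc_leI card_gt_0_iff\<close>)
  finally show "nf \<le> q0 + card A" by simp
qed

lemma facs_advance:
  assumes f: "facs K q0 q nf A As g w1 w2" and q: "q < nf" "w1 q \<le> 1"
  shows "facs K q0 (Suc q) nf A As g w1 w2" "pot E K (Suc q) nf w1 w2 + E \<le> pot E K q nf w1 w2"
proof -
  have m: "q \<in> {q0..<nf}" using f q by (simp add: facs_def)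
  then have c: "w1 q = card (As q)" "As q ~= {}" "finite (As q)" and w2: "w2 q \<le> Suc K"
   using f by (auto simp: facs_def isfac_def)
  have "card (As q) ~= 0" using c by simp
  then have c1: "card (As q) = 1" using q c(1) by linarith
  have "{q0..<Suc q} = insert q {q0..<q}" using m by auto
  then show "facs K q0 (Suc q) nf A As g w1 w2" using f q c1 by (simp add: facs_def)
  have "K + 2 - w2 q = Suc (Suc K - w2 q)" using w2 by simp
  then have "E \<le> E * (w1 q)\<^sup>2 * (K + 2 - w2 q)" using c1 c(1) by simp
  then show "pot E K (Suc q) nf w1 w2 + E \<le> pot E K q nf w1 w2"
   unfolding pot_def by (simp add: sum.atLeast_Suc_lessThan[OF q(1)])
qed

lemma inseparable_classes:
  fixes A1 :: "'a::prime_card mod_ring set"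
  assumes "\<And>a b u. a \<in> A ==> b \<in> A ==> u < t ==> inseparable a b u"
   and "A1 = {a \<in> A. (a + of_nat t) ^ ((CARD('a) - 1) div 2) ~= 1}"
   and "C = A1 \<or> C = A - A1" "a \<in> C" "b \<in> C" "u < Suc t"
  shows "inseparable a b u"
proof (cases "u = t")
  case True
  then show ?thesis using assms(2-5) by (auto simp: inseparable_def)
next
  case False
  then show ?thesis using assms by (intro assms(1)) auto
qed

text \<open>Both classes inherit the agreement at earlier shifts and agree at the present one by
  construction. The squares of the two new degrees add up to at most the square of the old one and
  the counter grows by one, which releases E times the squared degree of potential.\<close>

lemma facs_split:
  fixes A :: "'a::prime_card mod_ring set"
  assumes f: "facs K q0 q nf A As g w1 w2" and q: "q < nf" and t: "w2 q \<le> K"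
   and A1: "A1 = {a \<in> As q. (a + of_nat (w2 q)) ^ ((CARD('a) - 1) div 2) ~= 1}"
   and same: "\<And>j. j ~= q ==> j ~= nf ==> g' j = g j \<and> w1' j = w1 j \<and> w2' j = w2 j"
   and w2': "w2' q = Suc (w2 q)"
   and post: "if A1 = {} \<or> A1 = As q
    then nf' = nf \<and> isfac (g' q) (As q) \<and> w1' q = card (As q)
    else nf' = Suc nf \<and> isfac (g' q) A1 \<and> w1' q = card A1 \<and>
     isfac (g' nf) (As q - A1) \<and> w1' nf = card (As q - A1) \<and> w2' nf = Suc (w2 q)"
  shows "\<exists>As'. facs K q0 q nf' A As' g' w1' w2'" "pot E K q nf' w1' w2' + E * (w1 q)\<^sup>2 \<le> pot E K q nf w1 w2"
proof -
  have m: "q \<in> {q0..<nf}" using f q by (simp add: facs_def)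
  then have c: "w1 q = card (As q)" "As q ~= {}" "finite (As q)"
   using f by (auto simp: facs_def isfac_def)
  have sub: "A1 \<subseteq> As q" using A1 by auto
  have pq: "pot E K q nf w1 w2 = E * (w1 q)\<^sup>2 * (K + 2 - w2 q) + pot E K (Suc q) nf w1 w2"
   unfolding pot_def by (simp add: sum.atLeast_Suc_lessThan[OF q])
  have pS: "pot E K (Suc q) nf w1' w2' = pot E K (Suc q) nf w1 w2"
   unfolding pot_def by (intro sum.cong) (use same in auto)
  have pq': "pot E K q nf w1' w2' = E * (w1' q)\<^sup>2 * (K + 1 - w2 q) + pot E K (Suc q) nf w1 w2"
   unfolding pS[symmetric] unfolding pot_def by (simp add: sum.atLeast_Suc_lessThan[OF q] w2')
  define k where "k = K + 1 - w2 q"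
  have k: "K + 2 - w2 q = Suc k" "K + 1 - w2 q = k" using t by (simp_all add: k_def)
  have old: "isfac (g j) (As j) \<and> w1 j = card (As j) \<and> As j ~= {} \<and> w2 j \<le> Suc K \<and>
     (\<forall>a\<in>As j. \<forall>b\<in>As j. \<forall>u<w2 j. inseparable a b u)" if "j \<in> {q0..<nf}" for j
   using f that unfolding facs_def by blast
  have ins: "inseparable a b u" if "a \<in> As q" "b \<in> As q" "u < w2 q" for a b u
   using old[OF m] that by blast
  have cl: "inseparable a b u" if C: "C = A1 \<or> C = As q - A1" "a \<in> C" "b \<in> C" "u < Suc (w2 q)" for C a b u
   by (rule inseparable_classes[OF _ A1 C]) (rule ins)
  have one: "\<forall>j\<in>{q0..<q}. card (As j) = 1" using f by (simp add: facs_def)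
  have dis: "As i \<inter> As j = {}" if "i \<in> {q0..<nf}" "j \<in> {q0..<nf}" "i ~= j" for i j
   using f that unfolding facs_def by blast
  have U: "(\<Union>j\<in>{q0..<nf}. As j) = A" and le: "q0 \<le> q" "q \<le> nf" using f by (simp_all add: facs_def)
  have "(\<exists>As'. facs K q0 q nf' A As' g' w1' w2') \<and> pot E K q nf' w1' w2' + E * (w1 q)\<^sup>2 \<le> pot E K q nf w1 w2"
  proof (cases "A1 = {} \<or> A1 = As q")
   case True
   have n: "nf' = nf" "isfac (g' q) (As q)" "w1' q = card (As q)" using post True by simp_all
   have C: "As q = A1 \<or> As q = As q - A1" using True by auto
   have "isfac (g' j) (As j) \<and> w1' j = card (As j) \<and> As j ~= {} \<and> w2' j \<le> Suc K \<and>
     (\<forall>a\<in>As j. \<forall>b\<in>As j. \<forall>u<w2' j. inseparable a b u)" if "j \<in> {q0..<nf}" for j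
   proof (cases "j = q")
    case True
    then show ?thesis using n c w2' t cl[OF C] by simp
   next
    case False
    then show ?thesis using same[of j] old[OF that] that by simp
   qed
   then have "facs K q0 q nf A As g' w1' w2'" unfolding facs_def using le one dis U by blast
   moreover have "pot E K q nf w1' w2' + E * (w1 q)\<^sup>2 \<le> pot E K q nf w1 w2"
    unfolding pq pq' k n(3) c(1) by simp
   ultimately show ?thesis unfolding n(1) by blast
  next
   case False
   define A2 where "A2 = As q - A1"
   have n: "nf' = Suc nf" "isfac (g' q) A1" "w1' q = card A1" "isfac (g' nf) A2" "w1' nf = card A2" "w2' nf = Suc (w2 q)"
    using post False by (simp_all add: A2_def)
   have ne: "A1 ~= {}" "A2 ~= {}" using False sub by (auto simp: A2_def)
   define As' where "As' = As(q := A1, nf := A2)"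
   have As': "As' q = A1" "As' nf = A2" "\<And>j. j ~= q ==> j ~= nf ==> As' j = As j" using q by (simp_all add: As'_def)
   have fc: "isfac (g' j) (As' j) \<and> w1' j = card (As' j) \<and> As' j ~= {} \<and> w2' j \<le> Suc K \<and>
     (\<forall>a\<in>As' j. \<forall>b\<in>As' j. \<forall>u<w2' j. inseparable a b u)" if j: "j \<in> {q0..<Suc nf}" for j
   proof -
    consider "j = q" | "j = nf" | "j ~= q" "j ~= nf" by blast
    then show ?thesis
    proof cases
     case 1
     have "inseparable a b u" if "a \<in> A1" "b \<in> A1" "u < Suc (w2 q)" for a b u
     by (rule cl[of A1]) (use that in simp_all)
     then show ?thesis using 1 As' n ne w2' t by simp
    next
     case 2
     have "inseparable a b u" if "a \<in> A2" "b \<in> A2" "u < Suc (w2 q)" for a b u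
     by (rule cl[of A2]) (use that A2_def in simp_all)
     then show ?thesis using 2 As' n ne t by simp
    next
     case 3
     then have "j \<in> {q0..<nf}" using j by simp
     from old[OF this] show ?thesis using same[OF 3] As'(3)[OF 3] by simp
    qed
   qed
   have sub': "As' j \<subseteq> As (if j = nf then q else j)" for j using As' sub by (cases "j = q"; cases "j = nf") (auto simp: A2_def)
   have dis': "As' i \<inter> As' j = {}" if i: "i \<in> {q0..<Suc nf}" "j \<in> {q0..<Suc nf}" "i ~= j" for i j
   proof (cases "{i, j} = {q, nf}")
    case True
    then show ?thesis using As' by (auto simp: doubleton_eq_iff A2_def)
   next
    case False
    have "As (if i = nf then q else i) \<inter> As (if j = nf then q else j) = {}"
     by (rule dis) (use i m False in auto)
    then show ?thesis using sub'[of i] sub'[of j] by blast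
   qed
   have U': "(\<Union>j\<in>{q0..<Suc nf}. As' j) = A"
   proof
    show "(\<Union>j\<in>{q0..<Suc nf}. As' j) \<subseteq> A"
    proof
     fix x assume "x \<in> (\<Union>j\<in>{q0..<Suc nf}. As' j)"
     then obtain j where j: "j \<in> {q0..<Suc nf}" "x \<in> As' j" by blast
     have "x \<in> As (if j = nf then q else j)" using sub'[of j] j(2) by blast
     moreover have "(if j = nf then q else j) \<in> {q0..<nf}" using j(1) m by auto
     ultimately show "x \<in> A" using U by blast
    qed
    show "A \<subseteq> (\<Union>j\<in>{q0..<Suc nf}. As' j)"
    proof
     fix x assume "x \<in> A"
     then obtain j where j: "j \<in> {q0..<nf}" "x \<in> As j" using U by blast
     then have "x \<in> As' j \<or> j = q \<and> x \<in> As' nf" using As' by (cases "j = q") (auto simp: A2_def)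
     moreover have "nf \<in> {q0..<Suc nf}" "j \<in> {q0..<Suc nf}" using j m by auto
     ultimately show "x \<in> (\<Union>j\<in>{q0..<Suc nf}. As' j)" by blast
    qed
   qed
   have "\<forall>j\<in>{q0..<q}. card (As' j) = 1" using one As'(3) q by simp
   then have "facs K q0 q (Suc nf) A As' g' w1' w2'" unfolding facs_def using fc dis' U' le by auto
   moreover have "pot E K q (Suc nf) w1' w2' + E * (w1 q)\<^sup>2 \<le> pot E K q nf w1 w2"
   proof -
    have "card A1 + card A2 = card (As q)" unfolding A2_def using c(3) sub
     by (metis card_Diff_subset card_mono finite_subset le_add_diff_inverse)
    then have "(card A1)\<^sup>2 + (card A2)\<^sup>2 \<le> (w1 q)\<^sup>2" unfolding c(1) by (metis power2_sum le_add1)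
    then have "E * k * ((card A1)\<^sup>2 + (card A2)\<^sup>2) \<le> E * k * (w1 q)\<^sup>2" by (rule mult_left_mono) simp
    moreover have "pot E K q (Suc nf) w1' w2' = pot E K q nf w1' w2' + E * (w1' nf)\<^sup>2 * (K + 1 - w2 q)"
     unfolding pot_def using q by (simp add: n(6))
    ultimately show ?thesis unfolding pq pq' k n(3,5) by (simp add: algebra_simps)
   qed
   ultimately show ?thesis unfolding n(1) by blast
  qed
  then show "\<exists>As'. facs K q0 q nf' A As' g' w1' w2'" "pot E K q nf' w1' w2' + E * (w1 q)\<^sup>2 \<le> pot E K q nf w1 w2"
   by blast+
qed

text \<open>The constant coefficient of X - a is -a, which is why roots are read as
  \<open>- g j 0\<close>. The root sets are disjoint singletons covering A, so reading them off is a
  bijection.\<close>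

lemma facs_finished:
  fixes A :: "'a::prime_card mod_ring set"
  assumes f: "facs K q0 nf nf A As g w1 w2"
  shows "nf = q0 + card A" "bij_betw (\<lambda>j. - g j 0) {q0..<nf} A"
proof -
  have U: "(\<Union>j\<in>{q0..<nf}. As j) = A" and le: "q0 \<le> nf" using f by (simp_all add: facs_def)
  have sing: "As j = {- g j 0}" if "j \<in> {q0..<nf}" for j
  proof -
   have "card (As j) = 1" "isfac (g j) (As j)" using f that by (simp_all add: facs_def)
   then obtain a where a: "As j = {a}" by (auto simp: card_1_singleton_iff)
   then show ?thesis using \<open>isfac (g j) (As j)\<close> by (simp add: isfac_def)
  qed
  have "inj_on (\<lambda>j. - g j 0) {q0..<nf}"
  proof (rule inj_onI)
   fix i j assume ij: "i \<in> {q0..<nf}" "j \<in> {q0..<nf}" "- g i 0 = - g j 0"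
   then have "As i = As j" "As i ~= {}" using sing by simp_all
   moreover have "i ~= j ==> As i \<inter> As j = {}" using f ij(1,2) unfolding facs_def by blast
   ultimately show "i = j" by auto
  qed
  moreover have "(\<lambda>j. - g j 0) ` {q0..<nf} = A" unfolding U[symmetric] using sing by auto
  ultimately show b: "bij_betw (\<lambda>j. - g j 0) {q0..<nf} A" by (simp add: bij_betw_def)
  show "nf = q0 + card A" using bij_betw_same_card[OF b] le by simp
qed

definition split_loop :: com where
  "split_loop = While (WLess (Reg 30) (Reg 31))
   (Do (WLoad 20 [Const 1, Reg 30]) ;; If (WLess (Const 1) (Reg 20)) split (wadd 30 (Reg 30) (Const 1)))"

text \<open>Roots that share a factor agree at every shift below its counter. Since K bounds the
  first separating shift of any two elements, a nonlinear factor cannot have a counter above K. The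
  cost is the potential at the start.\<close>

lemma trm_split_loop:
  fixes \<sigma> :: state and A :: "'a::prime_card mod_ring set"
  defines "F \<equiv> fe :: state => nat list => 'a mod_ring"
  assumes W: "16 * (q0 + card A) + 16 < W" and Wp: "CARD('a) < W" and odd: "odd CARD('a)"
   and K: "\<And>a b :: 'a mod_ring. a ~= b ==> \<exists>t\<le>K. t < CARD('a) \<and> \<not> inseparable a b t"
   and c: "canon CARD('a) \<sigma>" and z: "F \<sigma> [0] = 0"
   and r: "regs \<sigma> 0 = CARD('a)" "regs \<sigma> 30 = q0" "regs \<sigma> 31 = Suc q0" "wmem \<sigma> [1, q0] = card A" "wmem \<sigma> [2, q0] = 0"
   and fac: "isfac (\<lambda>i. F \<sigma> [20, q0, i]) A" and A: "A ~= {}"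
  defines "E \<equiv> 280 * (bits ((CARD('a) - 1) div 2) + 13) + 4"
  shows "trm CARD('a) W split_loop \<sigma> (Suc (E * (card A)\<^sup>2 * (K + 2))) 0 B
   (\<lambda>s. regs s 31 = q0 + card A \<and> bij_betw (\<lambda>j. - F s [20, j, 0]) {q0..<q0 + card A} A \<and>
    (\<forall>j<q0. \<forall>i. F s [20, j, i] = F \<sigma> [20, j, i]))"
proof -
  let ?g = "\<lambda>s j i. F s [20, j, i]" and ?w = "\<lambda>k s j. wmem s [k, j]"
  let ?body = "Do (WLoad 20 [Const 1, Reg 30]) ;; If (WLess (Const 1) (Reg 20)) split (wadd 30 (Reg 30) (Const 1))"
  let ?I = "\<lambda>s. agree ?body \<sigma> s \<and> canon CARD('a) s \<and> (\<forall>j<q0. \<forall>i. F s [20, j, i] = F \<sigma> [20, j, i]) \<and>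
   (\<exists>As. facs K q0 (regs s 30) (regs s 31) A As (?g s) (?w 1 s) (?w 2 s))"
  let ?\<Psi> = "\<lambda>s. pot E K (regs s 30) (regs s 31) (?w 1 s) (?w 2 s)"
  have I0: "?I \<sigma>"
   using c r fac A by (auto simp: agree_refl facs_def isfac_def intro!: exI[of _ "\<lambda>_. A"])
  have "trm CARD('a) W (While (WLess (Reg 30) (Reg 31)) ?body) \<sigma> (Suc (?\<Psi> \<sigma>)) 0 B (\<lambda>s. ?I s \<and> \<not> cond_val (WLess (Reg 30) (Reg 31)) s)"
  proof (rule trm_While[where I = ?I and \<Psi> = ?\<Psi> and \<Phi> = "\<lambda>_. 0", OF _ I0])
   fix s assume I: "?I s" and b: "cond_val (WLess (Reg 30) (Reg 31)) s"
   let ?q = "regs s 30" and ?nf = "regs s 31"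
   have q: "?q < ?nf" using b by simp
   obtain As where f: "facs K q0 ?q ?nf A As (?g s) (?w 1 s) (?w 2 s)" using I by blast
   have ag: "agree ?body \<sigma> s" and cs: "canon CARD('a) s" and below: "\<forall>j<q0. \<forall>i. F s [20, j, i] = F \<sigma> [20, j, i]" using I by blast+
   have q0: "q0 \<le> ?q" using f by (simp add: facs_def)
   have zs: "F s [0] = 0" using agree_fe[OF ag, of 0 "[]", where 'a = 'a] z by (simp add: all_split_defs F_def)
   have r0: "regs s 0 = CARD('a)" using agree_regs[OF ag, of 0] r(1) by (simp add: all_split_defs)
   have nf: "?nf \<le> q0 + card A" using facs_card(1)[OF f] .
   have m: "?q \<in> {q0..<?nf}" using q q0 by simp
   have fq: "isfac (?g s ?q) (As ?q)" "wmem s [1, ?q] = card (As ?q)" "As ?q ~= {}"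
    and ins: "\<And>a b u. a \<in> As ?q ==> b \<in> As ?q ==> u < wmem s [2, ?q] ==> inseparable a b u"
    using f m unfolding facs_def by blast+
   define n where "n = card (As ?q)"
   have "n \<le> card A" unfolding n_def using facs_card[OF f] m by (simp add: card_mono)
   then have Wn: "16 * n + 16 < W" using W by simp
   define s1 where "s1 = instr_step CARD('a) W (WLoad 20 [Const 1, Reg 30]) s"
   have r1: "regs s1 20 = n" "regs s1 0 = CARD('a)" "regs s1 30 = ?q" "regs s1 31 = ?nf" using fq r0 by (simp_all add: s1_def n_def)
   have F1: "F s1 = F s" and w1: "wmem s1 = wmem s" by (simp_all add: s1_def F_def)
   have c1: "canon CARD('a) s1" using cs by (simp add: s1_def canon_def)
   have agI: "agree ?body \<sigma> s'" if "agree ?body s s'" for s' using agree_trans[OF ag that] .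
   show "\<exists>T Z. trm CARD('a) W ?body s T Z B (\<lambda>s'. ?I s' \<and> T + 1 + ?\<Psi> s' \<le> ?\<Psi> s \<and> Z + 0 \<le> 0)"
   proof (cases "1 < n")
    case True
    let ?t = "wmem s [2, ?q]"
    let ?A1 = "{a \<in> As ?q. (a + of_nat ?t) ^ ((CARD('a) - 1) div 2) ~= 1}"
    have n: "0 < n" "2 \<le> n" using True by simp_all
    obtain a b where ab: "a \<in> As ?q" "b \<in> As ?q" "a ~= b"
     using True unfolding n_def by (metis card_le_Suc0_iff_eq card.infinite not_less One_nat_def zero_le_one)
    then obtain t0 where t0: "t0 \<le> K" "t0 < CARD('a)" "\<not> inseparable a b t0" using K by blast
    then have "?t \<le> t0" using ins[OF ab(1,2)] by (meson not_less)
    then have t: "?t \<le> K" "Suc ?t < W" using t0 Wp by linarith+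
    have bd: "?q ~= ?nf" "Suc ?nf < W" using q nf W by simp_all
    let ?T = "70 * (bits ((CARD('a) - 1) div 2) + 13) * (n + 1) ^ 2"
    have ww: "wmem s1 [1, ?q] = n" "wmem s1 [2, ?q] = ?t" using w1 fq(2) by (simp_all add: n_def)
    have z1: "F s1 [0] = 0" using zs F1 by simp
    have fac1: "isfac (\<lambda>i. F s1 [20, ?q, i]) (As ?q)" using fq(1) F1 by simp
    have sp: "trm CARD('a) W split s1 ?T 0 B (split_post ?q ?nf ?t (As ?q) ?A1 s1)"
     by (rule trm_split[OF Wn n(1) n(2) Wp odd c1 z1[unfolded F_def] r1(2,3,4) ww bd t(2) fac1[unfolded F_def] n_def[symmetric]])
    have "trm CARD('a) W (If (WLess (Const 1) (Reg 20)) split (wadd 30 (Reg 30) (Const 1))) s1 (Suc ?T) 0 B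
     (split_post ?q ?nf ?t (As ?q) ?A1 s1 )"
     by (rule trm_If) (use sp True r1 in simp_all)
    then have "trm CARD('a) W (If (WLess (Const 1) (Reg 20)) split (wadd 30 (Reg 30) (Const 1))) s1 (Suc ?T) 0 B
     (\<lambda>s'. (split_post ?q ?nf ?t (As ?q) ?A1 s1 s') \<and> regs s' 30 = ?q \<and> canon CARD('a) s')"
     using sp True r1 by (intro trm_If trm_mono[OF trm_strengthen[OF sp p_pos c1]])
     (simp_all add: agree_def all_split_defs)
    then have "trm CARD('a) W ?body s (Suc (Suc ?T)) 0 B
     (\<lambda>s'. (split_post ?q ?nf ?t (As ?q) ?A1 s1 s') \<and> regs s' 30 = ?q \<and> canon CARD('a) s')"
     unfolding s1_def by (rule trm_Do_Seq[rotated]) simp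
    then have "trm CARD('a) W ?body s (Suc (Suc ?T)) 0 B (\<lambda>s'. ?I s' \<and> Suc (Suc ?T) + 1 + ?\<Psi> s' \<le> ?\<Psi> s \<and> 0 + 0 \<le> (0::nat))"
    proof (rule trm_mono, goal_cases)
     case (4 s')
     then have sp': "split_post ?q ?nf ?t (As ?q) ?A1 s1 s'" and r': "regs s' 30 = ?q" and c': "canon CARD('a) s'" and ag': "agree ?body s s'"
     by blast+
     have same: "?g s' j = ?g s j \<and> ?w 1 s' j = ?w 1 s j \<and> ?w 2 s' j = ?w 2 s j" if "j ~= ?q" "j ~= ?nf" for j
     using sp' that unfolding split_post_def w1 F_def[symmetric] F1 by auto
     have w2': "?w 2 s' ?q = Suc ?t" using sp' unfolding split_post_def by blast
     have post: "if ?A1 = {} \<or> ?A1 = As ?q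
     then regs s' 31 = ?nf \<and> isfac (?g s' ?q) (As ?q) \<and> ?w 1 s' ?q = card (As ?q)
     else regs s' 31 = Suc ?nf \<and> isfac (?g s' ?q) ?A1 \<and> ?w 1 s' ?q = card ?A1 \<and>
     isfac (?g s' ?nf) (As ?q - ?A1) \<and> ?w 1 s' ?nf = card (As ?q - ?A1) \<and> ?w 2 s' ?nf = Suc ?t"
     using sp' unfolding split_post_def F_def[symmetric] by blast
     note fs = facs_split[OF f q t(1) refl same w2' post]
     \<comment> \<open>This factor 4 turns the 70 in the cost of \<open>split\<close> into the 280
       of \<open>E\<close>; the summand 4 of \<open>E\<close> covers the loop overhead.\<close>
     have "(n + 1)\<^sup>2 \<le> (2 * n)\<^sup>2" by (rule power_mono) (use n in simp_all)
     then have "(n + 1)\<^sup>2 \<le> 4 * n\<^sup>2" by (simp add: power_mult_distrib)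
     then have "70 * (bits ((CARD('a) - 1) div 2) + 13) * (n + 1)\<^sup>2 \<le> 70 * (bits ((CARD('a) - 1) div 2) + 13) * (4 * n\<^sup>2)"
     by (rule mult_left_mono) simp
     moreover have "1 \<le> n\<^sup>2" using n by simp
     ultimately have "?T + 3 \<le> E * n\<^sup>2" unfolding E_def by (simp add: algebra_simps)
     moreover have "?\<Psi> s' + E * n\<^sup>2 \<le> ?\<Psi> s" using fs(2)[of E] fq(2) r' by (simp add: n_def)
     moreover have "\<forall>j<q0. \<forall>i. F s' [20, j, i] = F \<sigma> [20, j, i]"
     proof (intro allI impI)
     fix j i assume "j < q0"
     then show "F s' [20, j, i] = F \<sigma> [20, j, i]" using same[of j] below q0 q by (auto dest: fun_cong)
     qed
     ultimately show ?case using agI[OF ag'] c' fs(1) unfolding r' by auto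
    qed simp_all
    then show ?thesis by blast
   next
    case False
    then have wq: "wmem s [1, ?q] \<le> 1" using fq(2) by (simp add: n_def)
    note fa = facs_advance[OF f q wq]
    define s2 where "s2 = set_reg 30 (Suc ?q) s1"
    have r2: "regs s2 30 = Suc ?q" "regs s2 31 = ?nf" using r1 by (simp_all add: s2_def)
    have F2: "F s2 = F s" and w2: "wmem s2 = wmem s" using F1 w1 by (simp_all add: s2_def F_def)
    have ev: "ev CARD('a) W (wadd 30 (Reg 30) (Const 1)) s1 = s2" using r1 q nf W by (simp add: s2_def)
    have "trm CARD('a) W (wadd 30 (Reg 30) (Const 1)) s1 1 0 B (\<lambda>s'. s' = s2)"
     using trm_ev0[of "wadd 30 (Reg 30) (Const 1)" "\<lambda>s'. s' = s2" "CARD('a)" W s1 B] ev by simp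
    then have "trm CARD('a) W (If (WLess (Const 1) (Reg 20)) split (wadd 30 (Reg 30) (Const 1))) s1 (Suc 1) 0 B (\<lambda>s'. s' = s2)"
     by (intro trm_If) (use False r1 in simp_all)
    then have "trm CARD('a) W ?body s (Suc (Suc 1)) 0 B (\<lambda>s'. s' = s2)"
     unfolding s1_def by (rule trm_Do_Seq[rotated]) simp
    then have "trm CARD('a) W ?body s 3 0 B (\<lambda>s'. ?I s' \<and> 3 + 1 + ?\<Psi> s' \<le> ?\<Psi> s \<and> 0 + 0 \<le> (0::nat))"
    proof (rule trm_mono, goal_cases)
     case (4 s')
     have "canon CARD('a) s2" using c1 by (simp add: s2_def canon_def)
     moreover have "\<exists>As. facs K q0 (regs s2 30) (regs s2 31) A As (?g s2) (?w 1 s2) (?w 2 s2)"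
     using fa(1) unfolding r2 F2 w2 by blast
     moreover have "3 + 1 + ?\<Psi> s2 \<le> ?\<Psi> s" using fa(2)[of E] unfolding r2 w2 by (simp add: E_def)
     moreover have "\<forall>j<q0. \<forall>i. F s2 [20, j, i] = F \<sigma> [20, j, i]" using below F2 by simp
     ultimately show ?case using 4 agI by blast
    qed simp_all
    then show ?thesis by blast
   qed
  qed simp
  then show ?thesis unfolding split_loop_def
  proof (rule trm_mono, goal_cases)
   case 1
   then show ?case using r by (simp add: pot_def)
  next
   case (4 s)
   then obtain As where f: "facs K q0 (regs s 30) (regs s 31) A As (?g s) (?w 1 s) (?w 2 s)" by blast
   have "regs s 30 = regs s 31" using f 4 by (simp add: facs_def)
   note ff = facs_finished[OF f[unfolded this]]
   show ?case using ff 4 by simp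
  qed simp_all
qed

section \<open>Known and new roots of one round\<close>

definition diff_step :: com where
  "diff_step = wadd 7 (Reg 5) (Const 1) ;; fmul [Const 17] [Const 14] [Const 10, Reg 5] ;;
   fsub [Const 10, Reg 5] [Const 10, Reg 7] [Const 17]"

text \<open>Replacing the moments \<open>s\<^sub>l\<close> by \<open>s\<^sub>l\<^sub>+\<^sub>1 - a s\<^sub>l\<close> multiplies the weights by \<open>b - a\<close>; this removes the
  known roots from the support at the price of one moment each.\<close>

definition diff :: com where
  "diff = For 38 (Reg 31) (fsub [Const 14] [Const 0] [Const 20, Reg 38, Const 0] ;; For 5 (Reg 1) diff_step)"

text \<open>As in the modular multiplication, coefficients are rewritten from the top down so that
  the old lower neighbour is still available.\<close>

definition master_step :: com where
  "master_step = wsub 7 (Reg 1) (Reg 5) ;; wsub 8 (Reg 7) (Const 1) ;; fmul [Const 17] [Const 14] [Const 26, Reg 7] ;;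
   fsub [Const 26, Reg 7] [Const 26, Reg 8] [Const 17]"

definition master_body :: com where
  "master_body = fsub [Const 14] [Const 0] [Const 20, Reg 38, Const 0] ;; For 5 (Reg 1) master_step ;;
   fmul [Const 17] [Const 14] [Const 26, Const 0] ;; fsub [Const 26, Const 0] [Const 0] [Const 17]"

definition master :: com where
  "master = wadd 21 (Reg 1) (Const 1) ;; For 6 (Reg 21) (fset [Const 26, Reg 6] (Const 0)) ;;
   fset [Const 26, Const 0] (Const 1) ;; For 38 (Reg 31) master_body"

definition newroots :: com where
  "newroots = wset 30 (Reg 31) ;; wadd 21 (Reg 1) (Const 1) ;;
   For 6 (Reg 21) (fcopy [Const 20, Reg 30, Reg 6] [Const 11, Reg 6]) ;;
   Do (WStore [Const 1, Reg 30] (Reg 3)) ;; Do (WStore [Const 2, Reg 30] (Const 0)) ;;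
   wadd 31 (Reg 31) (Const 1) ;; split_loop"

definition findroots :: com where
  "findroots = wsub 2 (Reg 1) (Reg 31) ;; massey ;; If (WLess (Const 0) (Reg 3)) newroots skip"

definition roots :: com where "roots = diff ;; findroots ;; master"

lemmas root_defs = diff_step_def diff_def master_step_def master_body_def master_def newroots_def findroots_def
  roots_def split_loop_def all_split_defs

context
  fixes W m :: nat
  assumes W: "32 * m + 32 < W" and m: "0 < m"
begin

text \<open>Each known root adds one factor to the weights and shortens the usable moments by one,
  so after t roots the invariant covers m - t positions. The stored constant coefficient is the
  negated root, which explains the plus sign in the product.\<close>

lemma trm_diff:
  fixes \<sigma> :: state
  defines "F \<equiv> fe :: state => nat list => 'a::prime_card mod_ring"
  assumes c: "canon CARD('a) \<sigma>" and z: "F \<sigma> [0] = 0" and r: "regs \<sigma> 1 = m" "regs \<sigma> 31 = nf" and nf: "nf \<le> m"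
   and s: "\<And>l. l < m ==> F \<sigma> [10, l] = (\<Sum>b\<in>A. w b * b ^ l)"
  shows "trm CARD('a) W diff \<sigma> (10 * (m + 1) ^ 2) 0 B
   (\<lambda>s. \<forall>l<m - nf. F s [10, l] = (\<Sum>b\<in>A. w b * (\<Prod>j<nf. b + F \<sigma> [20, j, 0]) * b ^ l))"
proof -
  let ?body = "fsub [Const 14] [Const 0] [Const 20, Reg 38, Const 0] ;; For 5 (Reg 1) diff_step"
  let ?I = "\<lambda>t s. \<forall>l<m - t. F s [10, l] = (\<Sum>b\<in>A. w b * (\<Prod>j<t. b + F \<sigma> [20, j, 0]) * b ^ l)"
  have "trm CARD('a) W (For 38 (Reg 31) ?body) \<sigma> (2 + nf * ((3 + m * 5) + 2)) (nf * 0) B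
   (\<lambda>s. ?I nf s \<and> agree (For 38 (Reg 31) ?body) \<sigma> s \<and> canon CARD('a) s \<and> regs s 38 = nf)"
  proof (rule trm_For[where I = ?I])
   fix t s assume t: "t < nf" and ag: "agree (For 38 (Reg 31) ?body) \<sigma> s" and cs: "canon CARD('a) s"
    and rt: "regs s 38 = t" and I: "?I t s"
   have rs: "regs s 1 = m" using agree_regs[OF ag, of 1] r by (simp add: diff_step_def)
   have fs: "F s [20, i, j] = F \<sigma> [20, i, j]" "F s [0] = 0" for i j
    using agree_fe[OF ag, of 20 "[i, j]", where 'a = 'a] agree_fe[OF ag, of 0 "[]", where 'a = 'a] z
    by (simp_all add: diff_step_def F_def)
   define s1 where "s1 = instr_step CARD('a) W (FOp [Const 14] FSub [Const 0] [Const 20, Reg 38, Const 0]) s"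
   have fop: "0 \<le> fop_val CARD('a) FSub x y \<and> fop_val CARD('a) FSub x y < int CARD('a)" for x y
    using p_pos[where 'a = 'a] by (simp add: fop_val.simps)
   have c1: "canon CARD('a) s1" using cs fop by (auto simp: s1_def canon_def)
   have r1: "regs s1 1 = m" using rs by (simp add: s1_def)
   define a where "a = - F \<sigma> [20, t, 0]"
   have f1: "F s1 = (F s)([14] := a)" using rt fs by (simp add: s1_def F_def a_def)
   let ?J = "\<lambda>k u. (\<forall>l<k. F u [10, l] = F s [10, Suc l] - a * F s [10, l]) \<and> (\<forall>l\<ge>k. F u [10, l] = F s [10, l])"
   have "trm CARD('a) W (For 5 (Reg 1) diff_step) s1 (2 + m * (steps diff_step + 2)) 0 B
    (\<lambda>u. ?J m u \<and> agree (For 5 (Reg 1) diff_step) s1 u \<and> canon CARD('a) u \<and> regs u 5 = m)"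
   proof (rule trm_For0[where I = ?J, OF _ c1])
    fix k u assume k: "k < m" and ag: "agree (For 5 (Reg 1) diff_step) s1 u" and rk: "regs u 5 = k" and J: "?J k u"
    have fu: "F u [14] = a" using agree_fe[OF ag, of 14 "[]", where 'a = 'a] f1 by (simp add: diff_step_def F_def)
    show "?J (Suc k) (set_reg 5 (Suc k) (ev CARD('a) W diff_step u))"
     using J rk fu k W by (auto simp: diff_step_def F_def less_Suc_eq)
   qed (use r1 f1 W in \<open>auto simp: diff_step_def F_def\<close>)
   then have "trm CARD('a) W (For 5 (Reg 1) diff_step) s1 (2 + m * 5) 0 B (?J m)"
    by (rule trm_mono) (auto simp: diff_step_def)
   then have "trm CARD('a) W ?body s (Suc (2 + m * 5)) 0 B (?J m)"
    by (intro trm_Do_Seq) (simp_all add: s1_def)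
   then show "trm CARD('a) W ?body s (3 + m * 5) 0 B
    (\<lambda>s'. agree ?body s s' --> regs s' 38 = t --> ?I (Suc t) (set_reg 38 (Suc t) s'))"
   proof (rule trm_mono, goal_cases)
    case (4 s')
    have "F s' [10, l] = (\<Sum>b\<in>A. w b * (\<Prod>j<Suc t. b + F \<sigma> [20, j, 0]) * b ^ l)" if l: "l < m - Suc t" for l
    proof -
     have "F s' [10, l] = F s [10, Suc l] - a * F s [10, l]" using 4 l by simp
     also have "\<dots> = (\<Sum>b\<in>A. w b * (\<Prod>j<t. b + F \<sigma> [20, j, 0]) * b ^ Suc l)
     - a * (\<Sum>b\<in>A. w b * (\<Prod>j<t. b + F \<sigma> [20, j, 0]) * b ^ l)"
     proof -
     have "Suc l < m - t" "l < m - t" using l by simp_all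
     then show ?thesis using I by simp
     qed
     also have "\<dots> = (\<Sum>b\<in>A. w b * (\<Prod>j<Suc t. b + F \<sigma> [20, j, 0]) * b ^ l)"
     unfolding sum_distrib_left sum_subtractf[symmetric]
     by (intro sum.cong refl) (simp add: a_def algebra_simps)
     finally show ?thesis .
    qed
    then show ?case by (simp add: F_def)
   qed simp_all
  qed (use r c W nf s p_pos in \<open>auto simp: diff_step_def F_def\<close>)
  then have "trm CARD('a) W diff \<sigma> (2 + nf * ((3 + m * 5) + 2)) (nf * 0) B (?I nf)"
   unfolding diff_def by (rule trm_mono) auto
  then show ?thesis
  proof (rule trm_mono, goal_cases)
   case 1
   have "nf * ((3 + m * 5) + 2) \<le> m * ((3 + m * 5) + 2)" using nf by (rule mult_right_mono) simp
   then show ?case by (simp add: power2_eq_square algebra_simps)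
  qed (auto simp: power2_eq_square algebra_simps)
qed

lemma coeff_linear_mult: "coeff ([:- a, 1:] * P) i = (if i = 0 then 0 else coeff P (i - 1)) - a * coeff (P :: 'a::comm_ring_1 poly) i"
  by (cases i) (simp_all add: mult_pCons_left)

lemma trm_master:
  fixes \<sigma> :: state
  defines "F \<equiv> fe :: state => nat list => 'a::prime_card mod_ring"
  assumes c: "canon CARD('a) \<sigma>" and z: "F \<sigma> [0] = 0" and r: "regs \<sigma> 1 = m" "regs \<sigma> 31 = nf" and nf: "nf \<le> m"
  shows "trm CARD('a) W master \<sigma> (20 * (m + 1) ^ 2) 0 B
   (\<lambda>s. \<forall>i\<le>m. F s [26, i] = coeff (\<Prod>j<nf. [:F \<sigma> [20, j, 0], 1:]) i)"
proof -
  let ?I = "\<lambda>t s. \<forall>i\<le>m. F s [26, i] = coeff (\<Prod>j<t. [:F \<sigma> [20, j, 0], 1:]) i"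
  let ?cl = "For 6 (Reg 21) (fset [Const 26, Reg 6] (Const 0))"
  define s0 where "s0 = instr_step CARD('a) W (WOp 21 WAdd (Reg 1) (Const 1)) \<sigma>"
  have r0: "regs s0 1 = m" "regs s0 21 = Suc m" "regs s0 31 = nf" using r W by (simp_all add: s0_def)
  have c0: "canon CARD('a) s0" using c by (simp add: s0_def canon_def)
  have F0: "F s0 = F \<sigma>" by (simp add: s0_def F_def)
  have mW: "Suc m < W" and ne: "(21::nat) ~= 6" using W by simp_all
  have "trm CARD('a) W (?cl ;; fset [Const 26, Const 0] (Const 1) ;; For 38 (Reg 31) master_body) s0
    ((2 + Suc m * 3) + Suc (2 + nf * ((5 + m * 6) + 2))) (0 + nf * 0) B (?I nf)"
  proof (rule trm_Seq'[OF p_pos c0 trm_fclear[OF c0 r0(2) mW ne, of 26 B]], elim conjE)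
   fix s2 assume f2: "\<forall>i<Suc m. fe s2 [26, i] = (0 :: 'a mod_ring)" and ag2: "agree ?cl s0 s2" and c2: "canon CARD('a) s2"
   define s3 where "s3 = instr_step CARD('a) W (FofW [Const 26, Const 0] (Const 1)) s2"
   have r3: "regs s3 1 = m" "regs s3 31 = nf" using agree_regs[OF ag2] r0 by (simp_all add: s3_def)
   have "0 \<le> int 1 mod int CARD('a) \<and> int 1 mod int CARD('a) < int CARD('a)"
    by (intro conjI pos_mod_sign pos_mod_bound) (use p_pos[where 'a = 'a] in simp_all)
   then have c3: "canon CARD('a) s3" using c2 by (auto simp: s3_def canon_def)
   have f3: "F s3 [0] = 0" "F s3 (20 # as) = F \<sigma> (20 # as)" for as
    using agree_fe[OF ag2, of 0 "[]", where 'a = 'a] agree_fe[OF ag2, of 20 as, where 'a = 'a] z F0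
    by (simp_all add: s3_def F_def)
   have I3: "?I 0 s3" using f2 by (auto simp: s3_def F_def coeff_1)
   have "trm CARD('a) W (For 38 (Reg 31) master_body) s3 (2 + nf * ((5 + m * 6) + 2)) (nf * 0) B
    (\<lambda>s. ?I nf s \<and> agree (For 38 (Reg 31) master_body) s3 s \<and> canon CARD('a) s \<and> regs s 38 = nf)"
   proof (rule trm_For[where I = ?I])
    fix t s assume t: "t < nf" and ag: "agree (For 38 (Reg 31) master_body) s3 s" and cs: "canon CARD('a) s"
     and rt: "regs s 38 = t" and I: "?I t s"
    have rs: "regs s 1 = m" using agree_regs[OF ag, of 1] r3 by (simp add: root_defs)
    have fs: "F s (20 # as) = F \<sigma> (20 # as)" "F s [0] = 0" for as
     using agree_fe[OF ag, of 20 as, where 'a = 'a] agree_fe[OF ag, of 0 "[]", where 'a = 'a] f3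
     by (simp_all add: master_body_def master_step_def F_def)
    define s1 where "s1 = instr_step CARD('a) W (FOp [Const 14] FSub [Const 0] [Const 20, Reg 38, Const 0]) s"
    have fop: "0 \<le> fop_val CARD('a) FSub x y \<and> fop_val CARD('a) FSub x y < int CARD('a)" for x y
     using p_pos[where 'a = 'a] by (simp add: fop_val.simps)
    have c1: "canon CARD('a) s1" using cs fop by (auto simp: s1_def canon_def)
    have r1: "regs s1 1 = m" using rs by (simp add: s1_def)
    define a where "a = - F \<sigma> [20, t, 0]"
    have f1: "F s1 = (F s)([14] := a)" using rt fs by (simp add: s1_def F_def a_def)
    let ?J = "\<lambda>k u. (\<forall>i. m - k < i --> i \<le> m --> F u [26, i] = F s [26, i - 1] - a * F s [26, i]) \<and>
     (\<forall>i\<le>m - k. F u [26, i] = F s [26, i])"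
    have "trm CARD('a) W (For 5 (Reg 1) master_step) s1 (2 + m * (steps master_step + 2)) 0 B
     (\<lambda>u. ?J m u \<and> agree (For 5 (Reg 1) master_step) s1 u \<and> canon CARD('a) u \<and> regs u 5 = m)"
    proof (rule trm_For0[where I = ?J, OF _ c1])
     fix k u assume k: "k < m" and ag: "agree (For 5 (Reg 1) master_step) s1 u" and rk: "regs u 5 = k" and J: "?J k u"
     have fu: "F u [14] = a" using agree_fe[OF ag, of 14 "[]", where 'a = 'a] f1 by (simp add: master_step_def F_def)
     have ru: "regs u 1 = m" using agree_regs[OF ag, of 1] r1 by (simp add: master_step_def)
     define q where "q = m - Suc k"
     have q: "m - k = Suc q" "m - Suc k = q" "Suc q < W" "q < W" using k W by (simp_all add: q_def)
     define u' where "u' = set_reg 5 (Suc k) (ev CARD('a) W master_step u)"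
     have u': "F u' [26, i] = (if i = Suc q then F u [26, q] - a * F u [26, Suc q] else F u [26, i])" for i
     using rk ru fu q by (simp add: u'_def master_step_def F_def)
     have "?J (Suc k) u'"
     proof (intro conjI allI impI)
     fix i assume "i \<le> m - Suc k"
     then show "F u' [26, i] = F s [26, i]" using u' J q by simp
     next
     fix i assume i: "m - Suc k < i" "i \<le> m"
     show "F u' [26, i] = F s [26, i - 1] - a * F s [26, i]"
     proof (cases "i = Suc q")
     case True
     then show ?thesis using u' J q by simp
     next
     case False
     then have "m - k < i" using i q by simp
     then show ?thesis using u' J False i by simp
     qed
     qed
     then show "?J (Suc k) (set_reg 5 (Suc k) (ev CARD('a) W master_step u))" unfolding u'_def .
    qed (use r1 f1 W in \<open>auto simp: master_step_def F_def\<close>)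
    then have lp: "trm CARD('a) W (For 5 (Reg 1) master_step) s1 (2 + m * 6) 0 B (?J m)"
     by (rule trm_mono) (auto simp: master_step_def)
    let ?end = "fmul [Const 17] [Const 14] [Const 26, Const 0] ;; fsub [Const 26, Const 0] [Const 0] [Const 17]"
    let ?Q = "\<lambda>s'. ?I (Suc t) s'"
    have "trm CARD('a) W (For 5 (Reg 1) master_step ;; ?end) s1 ((2 + m * 6) + 2) (0 + 0) B ?Q"
    proof (rule trm_Seq'[OF p_pos c1 lp])
     fix u assume J: "?J m u" and ag: "agree (For 5 (Reg 1) master_step) s1 u"
     have fu: "F u [14] = a" "F u [0] = 0" using agree_fe[OF ag, of 14 "[]", where 'a = 'a] agree_fe[OF ag, of 0 "[]", where 'a = 'a]
     f1 fs by (simp_all add: master_step_def F_def)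
     define u' where "u' = ev CARD('a) W ?end u"
     have u': "F u' [26, i] = (if i = 0 then - a * F u [26, 0] else F u [26, i])" for i
     using fu by (simp add: u'_def F_def)
     have "F u' [26, i] = coeff (\<Prod>j<Suc t. [:F \<sigma> [20, j, 0], 1:]) i" if "i \<le> m" for i
     proof -
     have "F u' [26, i] = (if i = 0 then 0 else F s [26, i - 1]) - a * F s [26, i]"
     using u' J that by simp
     also have "\<dots> = coeff ([:- a, 1:] * (\<Prod>j<t. [:F \<sigma> [20, j, 0], 1:])) i"
     unfolding coeff_linear_mult using I that by simp
     also have "[:- a, 1:] * (\<Prod>j<t. [:F \<sigma> [20, j, 0], 1:]) = (\<Prod>j<Suc t. [:F \<sigma> [20, j, 0], 1:])"
     by (simp only: prod.lessThan_Suc mult.commute a_def minus_minus)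
     finally show ?thesis .
     qed
     then have R: "?Q (ev CARD('a) W ?end u)" unfolding u'_def by blast
     have "trm CARD('a) W ?end u (steps ?end) 0 B ?Q" by (rule trm_ev0[where Q = ?Q, OF _ _ R]) simp_all
     then show "trm CARD('a) W ?end u 2 0 B ?Q" by (rule trm_mono) simp_all
    qed
    then have "trm CARD('a) W master_body s (Suc ((2 + m * 6) + 2)) (0 + 0) B ?Q"
     unfolding master_body_def s1_def by (rule trm_Do_Seq[rotated]) simp
    then show "trm CARD('a) W master_body s (5 + m * 6) 0 B
     (\<lambda>s'. agree master_body s s' --> regs s' 38 = t --> ?I (Suc t) (set_reg 38 (Suc t) s'))"
     by (rule trm_mono) (simp_all add: F_def)
   qed (use r3 c3 W nf I3 p_pos in \<open>auto simp: master_body_def master_step_def F_def\<close>)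
   then have "trm CARD('a) W (For 38 (Reg 31) master_body) s3 (2 + nf * ((5 + m * 6) + 2)) (nf * 0) B (?I nf)"
    by (rule trm_mono) auto
   then show "trm CARD('a) W (fset [Const 26, Const 0] (Const 1) ;; For 38 (Reg 31) master_body) s2
     (Suc (2 + nf * ((5 + m * 6) + 2))) (nf * 0) B (?I nf)"
    unfolding s3_def by (rule trm_Do_Seq[rotated]) simp
  qed
  then have "trm CARD('a) W master \<sigma> (Suc ((2 + Suc m * 3) + Suc (2 + nf * ((5 + m * 6) + 2)))) (0 + nf * 0) B (?I nf)"
   unfolding master_def s0_def by (rule trm_Do_Seq[rotated]) simp
  then show ?thesis
  proof (rule trm_mono, goal_cases)
   case 1
   have "nf * ((5 + m * 6) + 2) \<le> m * ((5 + m * 6) + 2)" using nf by (rule mult_right_mono) simp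
   then show ?case by (simp add: power2_eq_square algebra_simps)
  qed simp_all
qed

text \<open>Massey's algorithm sees the m - nf moments left after the known roots are removed, and
  its output is appended as one unsplit factor with number nf. An empty support is skipped, as
  \<open>facs\<close> admits no factor of degree 0.\<close>

lemma trm_findroots:
  fixes \<sigma> :: state
  defines "F \<equiv> fe :: state => nat list => 'a::prime_card mod_ring"
  assumes Wp: "CARD('a) < W" and odd: "odd CARD('a)"
   and K: "\<And>a b :: 'a mod_ring. a ~= b ==> \<exists>t\<le>K. t < CARD('a) \<and> \<not> inseparable a b t"
   and c: "canon CARD('a) \<sigma>" and z: "F \<sigma> [0] = 0" and r: "regs \<sigma> 0 = CARD('a)" "regs \<sigma> 1 = m" "regs \<sigma> 31 = nf" and nf: "nf \<le> m"
   and fin: "finite A" and s: "\<And>l. l < m - nf ==> F \<sigma> [10, l] = (\<Sum>b\<in>A. w b * b ^ l)"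
  defines "S \<equiv> {b \<in> A. w b ~= 0}"
  assumes cS: "2 * card S \<le> m - nf"
  defines "E \<equiv> 280 * (bits ((CARD('a) - 1) div 2) + 13) + 4"
  shows "trm CARD('a) W findroots \<sigma> (340 * (m + 1) ^ 2 + E * (card S)\<^sup>2 * (K + 2)) 0 B
   (\<lambda>s. regs s 31 = nf + card S \<and> bij_betw (\<lambda>j. - F s [20, j, 0]) {nf..<nf + card S} S \<and>
    (\<forall>j<nf. F s [20, j, 0] = F \<sigma> [20, j, 0]))"
proof -
  let ?Q = "\<lambda>s. regs s 31 = nf + card S \<and> bij_betw (\<lambda>j. - F s [20, j, 0]) {nf..<nf + card S} S \<and>
    (\<forall>j<nf. F s [20, j, 0] = F \<sigma> [20, j, 0])"
  let ?C = "E * (card S)\<^sup>2 * (K + 2)"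
  have finS: "finite S" using fin by (simp add: S_def)
  define s0 where "s0 = instr_step CARD('a) W (WOp 2 WSub (Reg 1) (Reg 31)) \<sigma>"
  have r0: "regs s0 0 = CARD('a)" "regs s0 1 = m" "regs s0 2 = m - nf" "regs s0 31 = nf" using r W by (simp_all add: s0_def)
  have c0: "canon CARD('a) s0" using c by (simp add: s0_def canon_def)
  have F0: "F s0 = F \<sigma>" by (simp add: s0_def F_def)
  have z0: "F s0 [0] = 0" using z F0 by simp
  have N: "m - nf \<le> 2 * m" and W': "16 * m + 16 < W" using W by simp_all
  have ms: "trm CARD('a) W massey s0 (320 * (m + 1) ^ 2) 0 B (\<lambda>s. regs s 3 = card S \<and> npoly (m - nf) (\<lambda>i. F s [11, i]) = linprod S)"
   unfolding S_def F_def
   by (rule trm_massey_support[where w = w, OF W' m N c0 r0(3) z0[unfolded F_def] fin]) (use s cS F0 in \<open>simp_all add: F_def S_def\<close>)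
  have "trm CARD('a) W (massey ;; If (WLess (Const 0) (Reg 3)) newroots skip) s0
    (320 * (m + 1) ^ 2 + Suc (3 * m + 12 + ?C)) (0 + 0) B ?Q"
  proof (rule trm_Seq'[OF p_pos c0 ms], elim conjE)
   fix s1 assume d1: "regs s1 3 = card S" and p1: "npoly (m - nf) (\<lambda>i. F s1 [11, i]) = linprod S"
    and ag1: "agree massey s0 s1" and c1: "canon CARD('a) s1"
   have r1: "regs s1 0 = CARD('a)" "regs s1 1 = m" "regs s1 31 = nf" using agree_regs[OF ag1] r0 by (simp_all add: massey_defs)
   have f1: "F s1 [0] = 0" "F s1 (20 # as) = F \<sigma> (20 # as)" for as
    using agree_fe[OF ag1, of 0 "[]", where 'a = 'a] agree_fe[OF ag1, of 20 as, where 'a = 'a] z F0 by (simp_all add: massey_defs F_def)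
   show "trm CARD('a) W (If (WLess (Const 0) (Reg 3)) newroots skip) s1 (Suc (3 * m + 12 + ?C)) 0 B ?Q"
   proof (rule trm_If)
    assume "\<not> cond_val (WLess (Const 0) (Reg 3)) s1"
    then have "S = {}" using d1 finS by simp
    then have R: "?Q (ev CARD('a) W skip s1)" using r1 f1 by (simp add: F_def bij_betw_def)
    have "trm CARD('a) W skip s1 (steps skip) 0 B ?Q" by (rule trm_ev0[where Q = ?Q, OF _ _ R]) simp_all
    then show "trm CARD('a) W skip s1 (3 * m + 12 + ?C) 0 B ?Q" by (rule trm_mono) (assumption | simp)+
   next
    assume "cond_val (WLess (Const 0) (Reg 3)) s1"
    then have S: "S ~= {}" using d1 by auto
    define s2 where "s2 = ev CARD('a) W (wset 30 (Reg 31) ;; wadd 21 (Reg 1) (Const 1)) s1"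
    have r2: "regs s2 0 = CARD('a)" "regs s2 1 = m" "regs s2 31 = nf" "regs s2 30 = nf" "regs s2 21 = Suc m" "regs s2 3 = card S"
     using r1 d1 W nf by (simp_all add: s2_def)
    have F2: "F s2 = F s1" and c2: "canon CARD('a) s2" using c1 by (simp_all add: s2_def F_def canon_def)
    have z2: "F s2 [0] = 0" using f1 F2 by simp
    have mW: "Suc m < W" and ne: "(21::nat) ~= 6" "(20::nat) ~= 11" "(20::nat) ~= 0" using W by simp_all
    have d: "Reg 6 \<notin> set []" "Reg 6 \<notin> set [Reg 30]" by simp_all
    let ?cp = "For 6 (Reg 21) (fcopy [Const 20, Reg 30, Reg 6] [Const 11, Reg 6])"
    let ?st = "Do (WStore [Const 1, Reg 30] (Reg 3)) ;; Do (WStore [Const 2, Reg 30] (Const 0)) ;;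
     wadd 31 (Reg 31) (Const 1) ;; split_loop"
    have cp: "trm CARD('a) W ?cp s2 (2 + Suc m * 3) 0 B (\<lambda>s. (\<forall>i<Suc m. F s [20, nf, i] = F s2 [11, i]) \<and>
     (\<forall>a. (\<forall>i<Suc m. a ~= [20, nf, i]) --> F s a = F s2 a))"
     by (rule trm_mono[OF trm_fcopy[OF c2 r2(5) mW ne(1) ne(2) ne(3) d(2) d(1) z2[unfolded F_def], unfolded append.simps]])
     (use r2 in \<open>auto simp: F_def\<close>)
    have "trm CARD('a) W (?cp ;; ?st) s2 ((2 + Suc m * 3) + Suc (Suc (Suc (Suc ?C)))) (0 + 0) B ?Q"
    proof (rule trm_Seq'[OF p_pos c2 cp], elim conjE)
     fix s3 assume q3: "\<forall>i<Suc m. F s3 [20, nf, i] = F s2 [11, i]" and o3: "\<forall>a. (\<forall>i<Suc m. a ~= [20, nf, i]) --> F s3 a = F s2 a"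
     and ag3: "agree ?cp s2 s3" and c3: "canon CARD('a) s3"
     have r3: "regs s3 0 = CARD('a)" "regs s3 31 = nf" "regs s3 30 = nf" "regs s3 3 = card S"
     using agree_regs[OF ag3] r2 by simp_all
     define s4 where "s4 = instr_step CARD('a) W (WOp 31 WAdd (Reg 31) (Const 1))
     (instr_step CARD('a) W (WStore [Const 2, Reg 30] (Const 0)) (instr_step CARD('a) W (WStore [Const 1, Reg 30] (Reg 3)) s3))"
     have c4: "canon CARD('a) s4" using c3 by (simp add: s4_def canon_def)
     have cSW: "card S < W" "nf + card S \<le> m" using cS W nf by simp_all
     have r4: "regs s4 0 = CARD('a)" "regs s4 30 = nf" "regs s4 31 = Suc nf" "wmem s4 [1, nf] = card S" "wmem s4 [2, nf] = 0"
     using r3 cSW mW nf by (simp_all add: s4_def)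
     have F4: "F s4 = F s3" by (simp add: s4_def F_def)
     have z4: "F s4 [0] = 0" using o3 z2 F4 by simp
     have fac: "isfac (\<lambda>i. F s4 [20, nf, i]) S"
     by (rule isfac_npoly[OF finS _ p1]) (use cS q3 F4 F2 nf in simp_all)
     have W4: "16 * (nf + card S) + 16 < W" using cSW W by simp
     have sl: "trm CARD('a) W split_loop s4 (Suc ?C) 0 B
     (\<lambda>s. regs s 31 = nf + card S \<and> bij_betw (\<lambda>j. - F s [20, j, 0]) {nf..<nf + card S} S \<and>
     (\<forall>j<nf. \<forall>i. F s [20, j, i] = F s4 [20, j, i]))"
     unfolding F_def E_def
     by (rule trm_split_loop[OF W4 Wp odd K c4 z4[unfolded F_def] r4 fac[unfolded F_def] S])
     have "trm CARD('a) W split_loop s4 (Suc ?C) 0 B ?Q"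
     proof (rule trm_mono[OF sl order_refl order_refl order_refl])
     fix s assume h: "regs s 31 = nf + card S \<and> bij_betw (\<lambda>j. - F s [20, j, 0]) {nf..<nf + card S} S \<and>
     (\<forall>j<nf. \<forall>i. F s [20, j, i] = F s4 [20, j, i])"
     have "F s [20, j, 0] = F \<sigma> [20, j, 0]" if "j < nf" for j
     using h that o3 F4 F2 f1(2) by simp
     then show "?Q s" using h by blast
     qed
     then show "trm CARD('a) W ?st s3 (Suc (Suc (Suc (Suc ?C)))) 0 B ?Q"
     unfolding s4_def by (intro trm_Do_Seq) simp_all
    qed
    then have "trm CARD('a) W newroots s1 (Suc (Suc ((2 + Suc m * 3) + Suc (Suc (Suc (Suc ?C)))))) (0 + 0) B ?Q"
     unfolding newroots_def s2_def ev.simps by (intro trm_Do_Seq) simp_all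
    then show "trm CARD('a) W newroots s1 (3 * m + 12 + ?C) 0 B ?Q" by (rule trm_mono) (assumption | simp)+
   qed simp
  qed
  then have "trm CARD('a) W findroots \<sigma> (Suc (320 * (m + 1) ^ 2 + Suc (3 * m + 12 + ?C))) (0 + 0) B ?Q"
   unfolding findroots_def s0_def by (rule trm_Do_Seq[rotated]) simp
  then show ?thesis
  proof (rule trm_mono, goal_cases)
   case 1
   then show ?case using m by (simp add: power2_eq_square algebra_simps)
  qed (assumption | simp)+
qed

end

section \<open>Integer bounds, column indices and the digits of one round\<close>

definition zbd :: "nat => int => bool" where "zbd B v \<longleftrightarrow> \<bar>v\<bar> \<le> int B"

lemma zbd_simps [simp]: "zbd B 0" "zbd B (- v) \<longleftrightarrow> zbd B v" by (simp_all add: zbd_def)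

lemma zgood_Do:
  "zfree_instr i ==> zgood p W B (Do i) \<sigma>"
  "zgood p W B (Do (ZOp d f a b)) \<sigma> \<longleftrightarrow> zbd B (zval \<sigma> a) \<and> zbd B (zval \<sigma> b) \<and> zbd B (zop_val f (zval \<sigma> a) (zval \<sigma> b))"
  "zgood p W B (Do (ZDivPow d a b)) \<sigma> \<longleftrightarrow> (\<exists>e. zval \<sigma> b = int p ^ e) \<and>
   zbd B (zval \<sigma> a) \<and> zbd B (zval \<sigma> b) \<and> zbd B (zval \<sigma> a div zval \<sigma> b)"
  "zgood p W B (Do (ZofW d x)) \<sigma> \<longleftrightarrow> zbd B (int (atom_val \<sigma> x))"
  "zgood p W B (Do (FofZ d a)) \<sigma> \<longleftrightarrow> zbd B (zval \<sigma> a)"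
  "zgood p W B (If (ZEq a b) c c') \<sigma> \<longleftrightarrow> zbd B (zval \<sigma> a) \<and> zbd B (zval \<sigma> b) \<and>
   (if zval \<sigma> a = zval \<sigma> b then zgood p W B c \<sigma> else zgood p W B c' \<sigma>)"
  unfolding zbd_def by (simp, cases i, auto simp: nat_le_iff)

declare zgood.simps(1) [simp del]
declare zgood_Do [simp]

lemma zgood_SeqI: "zgood p W B c \<sigma> ==> zgood p W B d (ev p W c \<sigma>) ==> zgood p W B (c ;; d) \<sigma>"
  by simp

text \<open>Columns are numbered from 1 to p, so the class of 0 is represented by p.\<close>

definition index :: "'a::prime_card mod_ring => nat" where
  "index b = (SOME j. j \<in> {1..CARD('a)} \<and> of_nat j = b)"

lemma index: "index (b :: 'a::prime_card mod_ring) \<in> {1..CARD('a)}" "of_nat (index b) = b"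
proof -
  obtain t where t: "t < CARD('a)" "b = of_nat t" using surj_of_nat_mod_ring by blast
  have "\<exists>j. j \<in> {1..CARD('a)} \<and> of_nat j = b"
  proof (cases "t = 0")
   case True
   then show ?thesis using t p_pos[where 'a = 'a] by (intro exI[of _ "CARD('a)"]) (simp add: Suc_leI of_nat_0_mod_ring_dvd)
  next
   case False
   then show ?thesis using t by (intro exI[of _ t]) simp
  qed
  then have "index b \<in> {1..CARD('a)} \<and> of_nat (index b) = b" unfolding index_def by (rule someI_ex)
  then show "index b \<in> {1..CARD('a)}" "of_nat (index b) = b" by blast+
qed

lemma inj_on_of_nat_Icc: "inj_on (of_nat :: nat => 'a::prime_card mod_ring) {1..CARD('a)}"
proof (rule inj_onI)
  fix i j assume ij: "i \<in> {1..CARD('a)}" "j \<in> {1..CARD('a)}" "(of_nat i :: 'a mod_ring) = of_nat j"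
  have "(of_nat (i - 1) :: 'a mod_ring) = of_nat (j - 1)" using ij by (simp add: of_nat_diff)
  then have "i - 1 = j - 1" using inj_onD[OF inj_of_nat[where 'a = 'a], of "i - 1" "j - 1"] ij by auto
  then show "i = j" using ij by auto
qed

lemma index_of_nat: "j \<in> {1..CARD('a)} ==> index (of_nat j :: 'a::prime_card mod_ring) = j"
  using inj_onD[OF inj_on_of_nat_Icc[where 'a = 'a]] index by blast

lemma bij_of_nat: "bij_betw (of_nat :: nat => 'a::prime_card mod_ring) {1..CARD('a)} UNIV"
  unfolding bij_betw_def using inj_on_of_nat_Icc index by (metis UNIV_eq_I imageI)

definition bal :: "nat => int => int" where
  "bal p v = (if int ((p - 1) div 2) < v mod int p then v mod int p - int p else v mod int p)"

text \<open>Synthetic division of the master polynomial by X - a delivers the coefficients of the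
  quotient Q in \<open>[15]\<close>, highest first. \<open>[40]\<close> accumulates Q applied to the
  moments and \<open>[41]\<close> the value Q(a), so the quotient is never stored.\<close>

definition horner_step :: com where
  "horner_step = wsub 7 (Reg 1) (Reg 5) ;; wsub 8 (Reg 7) (Const 1) ;; fmul [Const 17] [Const 14] [Const 15] ;;
   fadd [Const 15] [Const 26, Reg 7] [Const 17] ;; fmul [Const 17] [Const 15] [Const 28, Reg 8] ;;
   fadd [Const 40] [Const 40] [Const 17] ;; fmul [Const 17] [Const 41] [Const 14] ;; fadd [Const 41] [Const 17] [Const 15]"

definition horner :: com where
  "horner = fsub [Const 14] [Const 0] [Const 20, Reg 38, Const 0] ;; fset [Const 15] (Const 0) ;; fset [Const 40] (Const 0) ;;
   fset [Const 41] (Const 0) ;; For 5 (Reg 1) horner_step"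

text \<open>A root equal to 0 belongs to column p, while its machine residue is 0; the conditional
  repairs this.\<close>

definition digit_index :: com where
  "digit_index = Do (WofF 39 [Const 14]) ;; If (WEq (Reg 39) (Const 0)) (wset 39 (Reg 0)) skip ;;
   Do (WStore [Const 3, Reg 38] (Reg 39))"

text \<open>The weight at a root is k_j times the residual coordinate, and k_j modulo p is read off
  the first row of the matrix. A residue becomes an integer by way of a word, and register 41 holds
  the threshold (p - 1)/2 for balancing.\<close>

definition digit_value :: com where
  "digit_value = Do (FofZ [Const 42] [Const 0, Const 1, Reg 39]) ;; fdiv [Const 43] [Const 40] [Const 41] ;;
   fdiv [Const 43] [Const 43] [Const 42] ;; Do (WofF 40 [Const 43]) ;; Do (ZofW [Const 5] (Reg 40)) ;;
   If (WLess (Reg 41) (Reg 40)) (Do (ZOp [Const 5] ZSub [Const 5] [Const 3])) skip"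

text \<open>The negated digit is kept in \<open>[6, u]\<close>, because the update of the
  measurements only adds products.\<close>

definition digit_add :: com where
  "digit_add = Do (ZOp [Const 6, Reg 38] ZSub [Const 4] [Const 5]) ;; Do (ZOp [Const 7] ZMul [Const 8] [Const 5]) ;;
   Do (ZOp [Const 2, Reg 39] ZAdd [Const 2, Reg 39] [Const 7])"

definition digits :: com where
  "digits = For 38 (Reg 31) (horner ;; digit_index ;; digit_value ;; digit_add)"

lemmas digit_defs = horner_step_def horner_def digit_index_def digit_value_def digit_add_def digits_def

context
  fixes W m :: nat
  assumes W: "32 * m + 32 < W" and m: "0 < m"
begin

text \<open>The factor introduced by \<open>diff\<close> vanishes exactly at the known roots, so the
  remaining support is R without them. With c new roots, 2 (nf + c) <= m gives 2 c <= m - nf: a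
  removed root costs one moment, but two had been reserved for it.\<close>

theorem trm_roots:
  fixes \<sigma> :: state
  defines "F \<equiv> fe :: state => nat list => 'a::prime_card mod_ring"
  assumes Wp: "CARD('a) < W" and odd: "odd CARD('a)"
   and K: "\<And>a b :: 'a mod_ring. a ~= b ==> \<exists>t\<le>K. t < CARD('a) \<and> \<not> inseparable a b t"
   and c: "canon CARD('a) \<sigma>" and z: "F \<sigma> [0] = 0" and r: "regs \<sigma> 0 = CARD('a)" "regs \<sigma> 1 = m" "regs \<sigma> 31 = nf"
   and s: "\<And>l. l < m ==> F \<sigma> [10, l] = (\<Sum>b\<in>UNIV. w b * b ^ l)"
   and inj: "inj_on (\<lambda>j. - F \<sigma> [20, j, 0]) {..<nf}"
  defines "R \<equiv> (\<lambda>j. - F \<sigma> [20, j, 0]) ` {..<nf} \<union> {b. w b ~= 0}"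
  assumes cR: "2 * card R \<le> m"
  defines "E \<equiv> 280 * (bits ((CARD('a) - 1) div 2) + 13) + 4"
  shows "trm CARD('a) W roots \<sigma> (370 * (m + 1) ^ 2 + E * (card R - nf)\<^sup>2 * (K + 2)) 0 B
   (\<lambda>s. regs s 31 = card R \<and> bij_betw (\<lambda>j. - F s [20, j, 0]) {..<card R} R \<and> nf \<le> card R \<and>
    (\<forall>i\<le>m. F s [26, i] = coeff (linprod R) i))"
proof -
  let ?R0 = "(\<lambda>j. - F \<sigma> [20, j, 0]) ` {..<nf}"
  let ?w = "\<lambda>b. w b * (\<Prod>j<nf. b + F \<sigma> [20, j, 0])"
  let ?S = "{b \<in> UNIV. ?w b ~= 0}"
  let ?Q = "\<lambda>s. regs s 31 = card R \<and> bij_betw (\<lambda>j. - F s [20, j, 0]) {..<card R} R \<and> nf \<le> card R \<and>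
    (\<forall>i\<le>m. F s [26, i] = coeff (linprod R) i)"
  have Z: "(\<Prod>j<nf. b + F \<sigma> [20, j, 0]) = 0 \<longleftrightarrow> b \<in> ?R0" for b by (auto simp: add_eq_0_iff2 image_iff)
  have "b \<in> ?S \<longleftrightarrow> b \<in> R - ?R0" for b
   unfolding R_def Un_iff Diff_iff mem_Collect_eq mult_eq_0_iff Z by blast
  then have S: "?S = R - ?R0" by blast
  have c0: "card ?R0 = nf" using card_image[OF inj] by simp
  have R0: "?R0 \<subseteq> R" by (auto simp: R_def)
  have cR': "card R = nf + card ?S" unfolding S using card_Diff_subset[OF _ R0] card_mono[OF _ R0] c0 by simp
  have nf: "nf \<le> m" and cS: "2 * card ?S \<le> m - nf" and nf': "card R \<le> m" using cR cR' by linarith+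
  note df = trm_diff[OF W m c z[unfolded F_def] r(2,3) nf s[unfolded F_def], of B, folded F_def]
  have "trm CARD('a) W (diff ;; findroots ;; master) \<sigma>
    (10 * (m + 1) ^ 2 + ((340 * (m + 1) ^ 2 + E * (card ?S)\<^sup>2 * (K + 2)) + 20 * (m + 1) ^ 2)) (0 + (0 + 0)) B ?Q"
  proof (rule trm_Seq'[OF p_pos c df])
   fix s1 assume s1: "\<forall>l<m - nf. F s1 [10, l] = (\<Sum>b\<in>UNIV. ?w b * b ^ l)" and ag1: "agree diff \<sigma> s1" and c1: "canon CARD('a) s1"
   have r1: "regs s1 0 = CARD('a)" "regs s1 1 = m" "regs s1 31 = nf" using agree_regs[OF ag1] r by (simp_all add: diff_def diff_step_def)
   have f1: "F s1 [0] = 0" "F s1 (20 # as) = F \<sigma> (20 # as)" for as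
    using agree_fe[OF ag1, of 0 "[]", where 'a = 'a] agree_fe[OF ag1, of 20 as, where 'a = 'a] z
    by (simp_all add: diff_def diff_step_def F_def)
   have fr: "trm CARD('a) W findroots s1 (340 * (m + 1) ^ 2 + E * (card ?S)\<^sup>2 * (K + 2)) 0 B
    (\<lambda>s. regs s 31 = nf + card ?S \<and> bij_betw (\<lambda>j. - F s [20, j, 0]) {nf..<nf + card ?S} ?S \<and>
    (\<forall>j<nf. F s [20, j, 0] = F s1 [20, j, 0]))"
    unfolding E_def F_def
    by (rule trm_findroots[OF W m Wp odd K c1 f1(1)[unfolded F_def] r1 nf]) (use s1 cS in \<open>simp_all add: F_def\<close>)
   show "trm CARD('a) W (findroots ;; master) s1 ((340 * (m + 1) ^ 2 + E * (card ?S)\<^sup>2 * (K + 2)) + 20 * (m + 1) ^ 2) (0 + 0) B ?Q"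
   proof (rule trm_Seq'[OF p_pos c1 fr], elim conjE)
    fix s2 assume nf2: "regs s2 31 = nf + card ?S" and b2: "bij_betw (\<lambda>j. - F s2 [20, j, 0]) {nf..<nf + card ?S} ?S"
     and o2: "\<forall>j<nf. F s2 [20, j, 0] = F s1 [20, j, 0]" and ag2: "agree findroots s1 s2" and c2: "canon CARD('a) s2"
    have r2: "regs s2 1 = m" "regs s2 31 = card R" using agree_regs[OF ag2, of 1] r1 nf2 cR' by (simp_all add: root_defs)
    have z2: "F s2 [0] = 0" using agree_fe[OF ag2, of 0 "[]", where 'a = 'a] f1 by (simp add: root_defs F_def)
    have "bij_betw (\<lambda>j. - F s2 [20, j, 0]) {..<nf} ?R0"
     using o2 f1 inj by (auto simp: bij_betw_def inj_on_def image_iff)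
    from bij_betw_combine[OF this b2] have "bij_betw (\<lambda>j. - F s2 [20, j, 0]) ({..<nf} \<union> {nf..<nf + card ?S}) (?R0 \<union> ?S)"
     unfolding S by auto
    moreover have "{..<nf} \<union> {nf..<nf + card ?S} = {..<card R}" unfolding cR' by auto
    moreover have "?R0 \<union> ?S = R" unfolding S using R0 by auto
    ultimately have bR: "bij_betw (\<lambda>j. - F s2 [20, j, 0]) {..<card R} R" by simp
    have P: "(\<Prod>j<card R. [:F s2 [20, j, 0], 1:]) = linprod R"
     using prod.reindex_bij_betw[OF bR, of "\<lambda>a. [:- a, 1:]"] by simp
    show "trm CARD('a) W master s2 (20 * (m + 1) ^ 2) 0 B ?Q"
    proof (rule trm_mono[OF trm_master[OF W m c2 z2[unfolded F_def] r2 nf', folded F_def] order_refl order_refl order_refl])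
     fix s assume ag: "agree master s2 s" and h: "\<forall>i\<le>m. F s [26, i] = coeff (\<Prod>j<card R. [:F s2 [20, j, 0], 1:]) i"
     have "regs s 31 = card R" using agree_regs[OF ag, of 31] r2 by (simp add: master_def master_body_def master_step_def)
     moreover have "F s [20, j, 0] = F s2 [20, j, 0]" for j using agree_fe[OF ag, of 20 "[j, 0]", where 'a = 'a]
     by (simp add: master_def master_body_def master_step_def F_def)
     ultimately show "?Q s" using bR h cR' unfolding P by simp
    qed
   qed
  qed
  then have "trm CARD('a) W roots \<sigma> (10 * (m + 1) ^ 2 + ((340 * (m + 1) ^ 2 + E * (card ?S)\<^sup>2 * (K + 2)) + 20 * (m + 1) ^ 2)) (0 + (0 + 0)) B ?Q"
   unfolding roots_def .
  moreover have "card R - nf = card ?S" using cR' by simp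
  ultimately show ?thesis by (elim trm_mono) simp_all
qed

text \<open>Q vanishes on R except at a. Applying it to the moments therefore leaves w(a) Q(a), and
  division by Q(a) gives the weight. This solves the transposed Vandermonde system with O(m)
  operations per unknown.\<close>

lemma trm_horner:
  fixes \<sigma> :: state
  defines "F \<equiv> fe :: state => nat list => 'a::prime_card mod_ring"
  assumes c: "canon CARD('a) \<sigma>" and z: "F \<sigma> [0] = 0" and r: "regs \<sigma> 1 = m" "regs \<sigma> 38 = t"
   and a: "a = - F \<sigma> [20, t, 0]" "a \<in> R" and R: "card R \<le> m"
   and P: "\<And>i. i \<le> m ==> F \<sigma> [26, i] = coeff (linprod R) i"
   and s: "\<And>l. l < m ==> F \<sigma> [28, l] = (\<Sum>b\<in>UNIV. w b * b ^ l)" and w: "\<And>b. b \<notin> R ==> w b = 0"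
  shows "trm CARD('a) W horner \<sigma> (6 + m * 10) 0 B (\<lambda>s. F s [14] = a \<and> F s [40] / F s [41] = w a)"
proof -
  define Q where "Q = linprod (R - {a})"
  have PQ: "linprod R = [:- a, 1:] * Q" unfolding Q_def using a(2) by (simp add: prod.remove)
  have fR: "finite (R - {a})" by simp
  have "card R > 0" using a(2) by (auto simp: card_gt_0_iff)
  then have dQ: "degree Q < m" unfolding Q_def linprod_props(1)[OF fR] using R a(2) by simp
  \<comment> \<open>Comparing coefficients in P = (X - a) Q, with P = \<open>linprod R\<close>,
    gives the recurrence of synthetic division.\<close>
  have cQ: "coeff Q l = coeff (linprod R) (Suc l) + a * coeff Q (Suc l)" for l
   unfolding PQ coeff_linear_mult by simp
  define s0 where "s0 = instr_step CARD('a) W (FofW [Const 41] (Const 0)) (instr_step CARD('a) W (FofW [Const 40] (Const 0))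
   (instr_step CARD('a) W (FofW [Const 15] (Const 0)) (instr_step CARD('a) W (FOp [Const 14] FSub [Const 0] [Const 20, Reg 38, Const 0]) \<sigma>)))"
  have fop: "0 \<le> fop_val CARD('a) FSub x y \<and> fop_val CARD('a) FSub x y < int CARD('a)" for x y
   using p_pos[where 'a = 'a] by (simp add: fop_val.simps)
  have c0: "canon CARD('a) s0" using c fop p_pos[where 'a = 'a] by (auto simp: s0_def canon_def)
  have r0: "regs s0 1 = m" using r by (simp add: s0_def)
  have f0: "F s0 = (F \<sigma>)([14] := a, [15] := 0, [40] := 0, [41] := 0)" using r z a by (simp add: s0_def F_def)
  let ?J = "\<lambda>k u. F u [15] = coeff Q (m - k) \<and> F u [40] = (\<Sum>l = m - k..<m. coeff Q l * F \<sigma> [28, l]) \<and>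
   F u [41] = (\<Sum>l = m - k..<m. coeff Q l * a ^ (l - (m - k)))"
  have "trm CARD('a) W (For 5 (Reg 1) horner_step) s0 (2 + m * (steps horner_step + 2)) 0 B
   (\<lambda>u. ?J m u \<and> agree (For 5 (Reg 1) horner_step) s0 u \<and> canon CARD('a) u \<and> regs u 5 = m)"
  proof (rule trm_For0[where I = ?J, OF _ c0])
   fix k u assume k: "k < m" and ag: "agree (For 5 (Reg 1) horner_step) s0 u" and rk: "regs u 5 = k" and J: "?J k u"
   have ru: "regs u 1 = m" using agree_regs[OF ag, of 1] r0 by (simp add: horner_step_def)
   have fu: "F u [14] = a" "F u [26, i] = F \<sigma> [26, i]" "F u [28, i] = F \<sigma> [28, i]" for i
    using agree_fe[OF ag, of 14 "[]", where 'a = 'a] agree_fe[OF ag, of 26 "[i]", where 'a = 'a]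
     agree_fe[OF ag, of 28 "[i]", where 'a = 'a] f0 by (simp_all add: horner_step_def F_def)
   define q where "q = m - Suc k"
   have q: "m - k = Suc q" "m - Suc k = q" "Suc q < W" "q < W" "q < m" using k W by (simp_all add: q_def)
   define u' where "u' = set_reg 5 (Suc k) (ev CARD('a) W horner_step u)"
   have u': "F u' [15] = F u [26, Suc q] + a * F u [15]" "F u' [40] = F u [40] + (F u [26, Suc q] + a * F u [15]) * F u [28, q]"
    "F u' [41] = F u [41] * a + (F u [26, Suc q] + a * F u [15])"
    using rk ru fu q by (simp_all add: u'_def horner_step_def F_def)
   have v: "F \<sigma> [26, Suc q] + a * F u [15] = coeff Q q" unfolding cQ[of q] using J P[of "Suc q"] q by simp
   have "F u' [40] = (\<Sum>l = q..<m. coeff Q l * F \<sigma> [28, l])"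
    using J q(1,5) unfolding u' fu v by (simp add: sum.atLeast_Suc_lessThan[OF q(5)])
   moreover have "F u' [41] = (\<Sum>l = q..<m. coeff Q l * a ^ (l - q))"
   proof -
    have "(\<Sum>l = Suc q..<m. coeff Q l * a ^ (l - Suc q)) * a = (\<Sum>l = Suc q..<m. coeff Q l * a ^ (l - q))"
     unfolding sum_distrib_right
    proof (rule sum.cong[OF refl])
     fix l assume "l \<in> {Suc q..<m}"
     then have "l - q = Suc (l - Suc q)" by auto
     then show "coeff Q l * a ^ (l - Suc q) * a = coeff Q l * a ^ (l - q)" by simp
    qed
    then show ?thesis using J q(1,5) unfolding u' fu v by (simp add: sum.atLeast_Suc_lessThan[OF q(5)])
   qed
   ultimately have "?J (Suc k) u'" unfolding u'(1) fu v q(2) by blast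
   then show "?J (Suc k) (set_reg 5 (Suc k) (ev CARD('a) W horner_step u))" unfolding u'_def .
  qed (use r0 f0 W dQ in \<open>auto simp: horner_step_def F_def coeff_eq_0\<close>)
  then have "trm CARD('a) W (For 5 (Reg 1) horner_step) s0 (2 + m * 10) 0 B (\<lambda>s. F s [14] = a \<and> F s [40] / F s [41] = w a)"
  proof (rule trm_mono, goal_cases)
   case (4 u)
   then have J: "?J m u" and ag: "agree (For 5 (Reg 1) horner_step) s0 u" by blast+
   have pQ: "poly Q x = (\<Sum>l<m. coeff Q l * x ^ l)" for x
    unfolding poly_altdef by (rule sum.mono_neutral_left) (use dQ in \<open>auto simp: coeff_eq_0\<close>)
   have Q0: "poly Q b = 0 \<longleftrightarrow> b \<in> R - {a}" for b unfolding Q_def by (rule linprod_props(4)[OF fR])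
   have den: "F u [41] = poly Q a" unfolding pQ using J by (simp add: atLeast0LessThan)
   have "F u [40] = (\<Sum>l<m. coeff Q l * (\<Sum>b\<in>UNIV. w b * b ^ l))" using J s by (simp add: atLeast0LessThan)
   also have "\<dots> = (\<Sum>l<m. \<Sum>b\<in>UNIV. w b * (coeff Q l * b ^ l))" by (simp add: sum_distrib_left mult_ac)
   also have "\<dots> = (\<Sum>b\<in>UNIV. w b * poly Q b)" unfolding pQ sum_distrib_left by (rule sum.swap)
   also have "\<dots> = (\<Sum>b\<in>{a}. w b * poly Q b)" by (rule sum.mono_neutral_right) (use Q0 w in auto)
   finally have "F u [40] = w a * F u [41]" using den by simp
   moreover have "F u [41] ~= 0" unfolding den using Q0 by simp
   moreover have "F u [14] = a" using agree_fe[OF ag, of 14 "[]", where 'a = 'a] f0 by (simp add: horner_step_def F_def)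
   ultimately show ?case by simp
  qed (simp_all add: horner_step_def)
  then have "trm CARD('a) W horner \<sigma> (Suc (Suc (Suc (Suc (2 + m * 10))))) 0 B (\<lambda>s. F s [14] = a \<and> F s [40] / F s [41] = w a)"
   unfolding horner_def s0_def by (intro trm_Do_Seq) simp_all
  then show ?thesis by (rule trm_mono) simp_all
qed

lemma nat_fmem:
  assumes "canon CARD('a) \<sigma>" "(fe \<sigma> a :: 'a::prime_card mod_ring) = of_int v"
  shows "fmem \<sigma> a = v mod int CARD('a)"
proof -
  have "[fmem \<sigma> a = v] (mod int CARD('a))" using assms(2) unfolding fe_def by (simp only: of_int_eq_iff_cong)
  moreover have "fmem \<sigma> a mod int CARD('a) = fmem \<sigma> a" using assms(1) by (simp add: canon_def)
  ultimately show ?thesis by (simp add: cong_def)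
qed

text \<open>\<rho> will be the residual vector of the current round and P the power of p reached so
  far. R may contain columns whose residual is 0 modulo p, since roots of earlier rounds are kept;
  their digit is simply 0.\<close>

theorem trm_digits:
  fixes \<sigma> :: state and R :: "'a::prime_card mod_ring set" and \<rho> k :: "nat => int"
  defines "F \<equiv> fe :: state => nat list => 'a mod_ring" and "p \<equiv> CARD('a)"
  assumes Wp: "p < W" and c: "canon p \<sigma>" and z: "F \<sigma> [0] = 0"
   and r: "regs \<sigma> 0 = p" "regs \<sigma> 1 = m" "regs \<sigma> 31 = card R" "regs \<sigma> 41 = (p - 1) div 2"
   and zm: "zmem \<sigma> [3] = int p" "zmem \<sigma> [4] = 0" "zmem \<sigma> [8] = P"
   and \<Phi>: "\<And>j. j \<in> {1..p} ==> [zmem \<sigma> [0, 1, j] = k j] (mod int p)" and k: "\<And>j. j \<in> {1..p} ==> 1 \<le> k j \<and> k j < int p"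
   and bij: "bij_betw (\<lambda>j. - F \<sigma> [20, j, 0]) {..<card R} R" and R: "card R \<le> m"
   and Pc: "\<And>i. i \<le> m ==> F \<sigma> [26, i] = coeff (linprod R) i"
   and s: "\<And>l. l < m ==> F \<sigma> [28, l] = (\<Sum>b\<in>UNIV. of_int (k (index b) * \<rho> (index b)) * b ^ l)"
   and w: "\<And>b. b \<notin> R ==> (of_int (\<rho> (index b)) :: 'a mod_ring) = 0"
   and B: "p \<le> B" "zbd B P" "\<And>j. j \<in> {1..p} ==> zbd B (zmem \<sigma> [0, 1, j]) \<and> zbd B (P * bal p (\<rho> j)) \<and>
    zbd B (zmem \<sigma> [2, j]) \<and> zbd B (zmem \<sigma> [2, j] + P * bal p (\<rho> j))"
  shows "trm p W digits \<sigma> (30 * (m + 1) ^ 2) (20 * m) B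
   (\<lambda>s. (\<forall>u<card R. wmem s [3, u] = index (- F \<sigma> [20, u, 0]) \<and> zmem s [6, u] = - bal p (\<rho> (index (- F \<sigma> [20, u, 0])))) \<and>
    (\<forall>j\<in>{1..p}. zmem s [2, j] = zmem \<sigma> [2, j] + P * bal p (\<rho> j)))"
proof -
  let ?c = "\<lambda>u. - F \<sigma> [20, u, 0]"
  let ?tail = "digit_index ;; digit_value ;; digit_add"
  let ?body = "horner ;; ?tail"
  let ?I = "\<lambda>t s. (\<forall>u<t. wmem s [3, u] = index (?c u) \<and> zmem s [6, u] = - bal p (\<rho> (index (?c u)))) \<and>
    (\<forall>j\<in>{1..p}. zmem s [2, j] = zmem \<sigma> [2, j] + (if j \<in> (\<lambda>u. index (?c u)) ` {..<t} then P * bal p (\<rho> j) else 0))"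
  have pp: "0 < p" using p_pos[where 'a = 'a] by (simp add: p_def)
  have RW: "card R < W" using R W by simp
  have "trm p W (For 38 (Reg 31) ?body) \<sigma> (2 + card R * ((6 + m * 10 + 14) + 2)) (card R * 14) B
   (\<lambda>s. ?I (card R) s \<and> agree (For 38 (Reg 31) ?body) \<sigma> s \<and> canon p s \<and> regs s 38 = card R)"
  proof (rule trm_For[where I = ?I, OF RW pp c])
   fix t s1 assume t: "t < card R" and ag: "agree (For 38 (Reg 31) ?body) \<sigma> s1" and c1: "canon p s1"
    and rt: "regs s1 38 = t" and I: "?I t s1"
   let ?j = "index (?c t)" and ?a = "?c t"
   have r1: "regs s1 0 = p" "regs s1 1 = m" "regs s1 41 = (p - 1) div 2" using agree_regs[OF ag] r by (simp_all add: digit_defs)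
   have f1: "F s1 [0] = 0" "F s1 (20 # as) = F \<sigma> (20 # as)" "F s1 (26 # as) = F \<sigma> (26 # as)" "F s1 (28 # as) = F \<sigma> (28 # as)" for as
    using agree_fe[OF ag, of 0 "[]", where 'a = 'a] agree_fe[OF ag, of 20 as, where 'a = 'a]
     agree_fe[OF ag, of 26 as, where 'a = 'a] agree_fe[OF ag, of 28 as, where 'a = 'a] z by (simp_all add: digit_defs F_def)
   have z1: "zmem s1 [3] = int p" "zmem s1 [4] = 0" "zmem s1 [8] = P" "zmem s1 [0, 1, j] = zmem \<sigma> [0, 1, j]" for j
    using agree_zmem[OF ag] zm by (simp_all add: digit_defs)
   have aR: "?a \<in> R" using bij t by (auto simp: bij_betw_def)
   have w0: "(of_int (k (index b) * \<rho> (index b)) :: 'a mod_ring) = 0" if "b \<notin> R" for b using w[OF that] by simp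
   have hn: "trm p W horner s1 (6 + m * 10) 0 B (\<lambda>s. F s [14] = ?a \<and> F s [40] / F s [41] = of_int (k ?j * \<rho> ?j))"
    unfolding F_def p_def
    by (rule trm_horner[OF c1[unfolded p_def] f1(1)[unfolded F_def] r1(2) rt _ aR[unfolded F_def] R]) (use f1 Pc s w0 in \<open>simp_all add: F_def\<close>)
   have "trm p W ?body s1 (6 + m * 10 + 14) (0 + 14) B (\<lambda>s'. agree ?body s1 s' --> regs s' 38 = t --> ?I (Suc t) (set_reg 38 (Suc t) s'))"
   proof (rule trm_Seq'[OF pp c1 hn], elim conjE)
    fix s2 assume a2: "F s2 [14] = ?a" and w2: "F s2 [40] / F s2 [41] = of_int (k ?j * \<rho> ?j)"
     and ag2: "agree horner s1 s2" and c2: "canon p s2"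
    have r2: "regs s2 0 = p" "regs s2 38 = t" "regs s2 41 = (p - 1) div 2" using agree_regs[OF ag2] r1 rt by (simp_all add: digit_defs)
    have zm2: "zmem s2 (i # as) = zmem s1 (i # as)" "wmem s2 (i # as) = wmem s1 (i # as)" for i as
     using agree_zmem[OF ag2] agree_wmem[OF ag2] by (simp_all add: digit_defs)
    have j: "?j \<in> {1..p}" "of_nat ?j = ?a" using index[of ?a] by (simp_all add: p_def)
    have "fmem s2 [14] = int ?j mod int p"
     unfolding p_def by (rule nat_fmem[OF c2[unfolded p_def]]) (use a2 j in \<open>simp add: F_def\<close>)
    then have n14: "nat (fmem s2 [14]) = ?j mod p" by (simp add: nat_mod_distrib)
    define s3 where "s3 = ev p W digit_index s2"
    have r3: "regs s3 39 = ?j" "regs s3 38 = t" "regs s3 41 = (p - 1) div 2"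
    proof -
     have lt: "?j mod p < W" using pp Wp by (meson mod_less_divisor less_trans)
     show "regs s3 39 = ?j"
     proof (cases "?j = p")
     case True
     then show ?thesis using n14 r2 Wp by (simp add: s3_def digit_index_def fval_def)
     next
     case False
     then have "?j mod p = ?j" "?j ~= 0" using j(1) by simp_all
     then show ?thesis using n14 lt by (simp add: s3_def digit_index_def fval_def)
     qed
     show "regs s3 38 = t" "regs s3 41 = (p - 1) div 2" using r2 by (simp_all add: s3_def digit_index_def)
    qed
    have w3: "wmem s3 = (wmem s2)([3, t] := ?j)"
    proof -
     have "wmem s3 = (wmem s2)([3, t] := regs s3 39 mod W)" using r2 by (simp add: s3_def digit_index_def)
     then show ?thesis using r3 j(1) Wp by simp
    qed
    have F3: "F s3 = F s2" "fmem s3 = fmem s2" and zm3: "zmem s3 = zmem s2" by (simp_all add: s3_def digit_index_def F_def)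
    have zg2: "zgood p W B digit_index s2" by (rule zgood_zfree) (simp_all add: digit_index_def)
    define s4 where "s4 = ev p W (Do (FofZ [Const 42] [Const 0, Const 1, Reg 39]) ;; fdiv [Const 43] [Const 40] [Const 41] ;;
     fdiv [Const 43] [Const 43] [Const 42]) s3"
    have "F s4 [43] = F s3 [40] / F s3 [41] / of_int (zmem s3 [0, 1, ?j])"
     using r3 by (simp add: s4_def F_def p_def zval_def)
    also have "(of_int (zmem s3 [0, 1, ?j]) :: 'a mod_ring) = of_int (k ?j)"
     unfolding of_int_eq_iff_cong using \<Phi>[OF j(1)] zm3 zm2 z1 by (simp add: p_def)
    also have "F s3 [40] / F s3 [41] / of_int (k ?j) = of_int (\<rho> ?j)"
    proof -
     have "\<not> int p dvd k ?j" using k[OF j(1)] zdvd_not_zless[of "k ?j" "int p"] by auto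
     then have "(of_int (k ?j) :: 'a mod_ring) ~= 0" unfolding of_int_eq_0_iff_dvd p_def .
     then show ?thesis using w2 F3 by simp
    qed
    finally have e43: "F s4 [43] = of_int (\<rho> ?j)" .
    have fp: "0 \<le> fop_val p f x y \<and> fop_val p f x y < int p" for f x y using pp by (cases f) (auto simp: fop_val.simps)
    have c3: "canon p s3" using c2 F3 by (simp add: canon_def)
    have c4: "canon p s4" using c3 fp pp by (auto simp: s4_def canon_def)
    define v where "v = \<rho> ?j mod int p"
    define h where "h = (p - 1) div 2"
    have m43: "fmem s4 [43] = v"
     unfolding p_def v_def by (rule nat_fmem[OF c4[unfolded p_def]]) (use e43 in \<open>simp add: F_def\<close>)
    have r4: "regs s4 = regs s3" "wmem s4 = wmem s3" "zmem s4 = zmem s3" by (simp_all add: s4_def)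
    have bnd: "0 \<le> v" "v < int p" using pp by (simp_all add: v_def)
    then have n43: "nat v mod W = nat v" "int (nat v) = v" using Wp by simp_all
    have ci: "(h < nat v) = (int h < v)" by (rule zless_nat_eq_int_zless)
    have z43: "zmem s3 [3] = int p" "regs s3 41 = h" using zm3 zm2 z1 r3 by (simp_all add: h_def)
    define d where "d = bal p (\<rho> ?j)"
    have d: "d = (if int h < v then v - int p else v)" by (simp add: d_def bal_def v_def h_def)
    let ?d = d
    define s5 where "s5 = ev p W digit_value s3"
    let ?dv = "Do (WofF 40 [Const 43]) ;; Do (ZofW [Const 5] (Reg 40)) ;;
     If (WLess (Reg 41) (Reg 40)) (Do (ZOp [Const 5] ZSub [Const 5] [Const 3])) skip"
    have s5': "s5 = ev p W ?dv s4"
     by (simp add: s5_def s4_def digit_value_def)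
    have z5: "zmem s5 = (zmem s3)([5] := ?d)"
     unfolding s5' d using bnd by (simp add: fval_def zval_def m43 n43 ci z43 r4)
    have r5: "regs s5 39 = ?j" "regs s5 38 = t" "wmem s5 = wmem s3" using r3 r4 by (simp_all add: s5')
    have vB: "zbd B v" "zbd B (v - int p)" "zbd B (int p)" using bnd B(1) unfolding zbd_def by linarith+
    have zg3: "zgood p W B digit_value s3"
    proof -
     have dv: "zgood p W B ?dv s4" using vB bnd by (simp add: fval_def zval_def m43 n43 z43 r4)
     have "zbd B (zmem s3 [0, 1, ?j])" using B(3)[OF j(1)] zm3 zm2 z1 by simp
     then have a: "zgood p W B (Do (FofZ [Const 42] [Const 0, Const 1, Reg 39])) s3" by (simp add: zval_def r3)
     have e: "ev p W (fdiv [Const 43] [Const 43] [Const 42]) (ev p W (fdiv [Const 43] [Const 40] [Const 41])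
     (ev p W (Do (FofZ [Const 42] [Const 0, Const 1, Reg 39])) s3)) = s4"
     by (simp only: s4_def ev.simps)
     show ?thesis unfolding digit_value_def
     by (rule zgood_SeqI[OF a], rule zgood_SeqI, rule zgood_zfree, simp, simp, rule zgood_SeqI, rule zgood_zfree,
     simp, simp, unfold e, rule dv)
    qed
    have dB: "zbd B ?d" using vB by (cases "int h < v") (simp_all only: d if_True if_False)
    have z2j: "zmem s3 [2, ?j] = zmem \<sigma> [2, ?j]"
    proof -
     \<comment> \<open>Distinct roots have distinct columns, so the output cell of this column has
       not yet been changed in the present round.\<close>
     have "?j \<notin> (\<lambda>u. index (?c u)) ` {..<t}"
     proof
     assume "?j \<in> (\<lambda>u. index (?c u)) ` {..<t}"
     then obtain u where u: "u < t" "?j = index (?c u)" by blast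
     have "(of_nat ?j :: 'a mod_ring) = of_nat (index (?c u))" by (rule arg_cong[OF u(2)])
     then have eq: "?c t = ?c u" by (simp only: index(2))
     have "inj_on ?c {..<card R}" using bij by (rule bij_betw_imp_inj_on)
     from inj_onD[OF this eq] have "t = u" using u(1) t by simp
     then show False using u(1) by simp
     qed
     then have "zmem s1 [2, ?j] = zmem \<sigma> [2, ?j]" using conjunct2[OF I, THEN bspec, OF j(1)] by (simp only: if_False add_0_right)
     then show ?thesis using zm3 zm2 by simp
    qed
    note b3 = B(3)[OF j(1), folded d_def, THEN conjunct2]
    have B3: "zbd B (P * d)" "zbd B (zmem \<sigma> [2, ?j])" "zbd B (zmem \<sigma> [2, ?j] + P * d)"
     by (rule b3[THEN conjunct1], rule b3[THEN conjunct2, THEN conjunct1], rule b3[THEN conjunct2, THEN conjunct2])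
    have z3: "zmem s3 [4] = 0" "zmem s3 [8] = P" using zm3 zm2 z1 by simp_all
    define s6 where "s6 = ev p W digit_add s5"
    have zg5: "zgood p W B digit_add s5"
     using dB B(2) B3 by (simp add: digit_add_def zval_def z5 r5 z3 z2j)
    have z6: "zmem s6 = (zmem s3)([5] := ?d, [6, t] := - ?d, [7] := P * ?d, [2, ?j] := zmem \<sigma> [2, ?j] + P * ?d)"
     unfolding s6_def digit_add_def by (simp add: zval_def z5 r5 z3 z2j)
    have w6: "wmem s6 = wmem s3" using r5 by (simp add: s6_def digit_add_def)
    have I6: "?I (Suc t) (set_reg 38 (Suc t) s6)"
    proof (intro conjI allI impI ballI)
     fix u assume u: "u < Suc t"
     show "wmem (set_reg 38 (Suc t) s6) [3, u] = index (?c u)"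
     using conjunct1[OF I, THEN spec, of u] u by (cases "u = t") (simp_all add: w6 w3 zm2)
     show "zmem (set_reg 38 (Suc t) s6) [6, u] = - bal p (\<rho> (index (?c u)))"
     using conjunct1[OF I, THEN spec, of u] u by (cases "u = t") (simp_all add: z6 zm3 zm2 d_def)
    next
     fix i assume i: "i \<in> {1..p}"
     have "zmem s1 [2, i] = zmem \<sigma> [2, i] + (if i \<in> (\<lambda>u. index (?c u)) ` {..<t} then P * bal p (\<rho> i) else 0)"
     using conjunct2[OF I] i by blast
     then show "zmem (set_reg 38 (Suc t) s6) [2, i] = zmem \<sigma> [2, i] +
     (if i \<in> (\<lambda>u. index (?c u)) ` {..<Suc t} then P * bal p (\<rho> i) else 0)"
     unfolding lessThan_Suc image_insert by (cases "i = ?j") (simp_all add: z6 zm3 zm2 d_def)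
    qed
    have ev: "ev p W ?tail s2 = s6" by (simp only: s6_def s5_def s3_def ev.simps)
    have zg: "zgood p W B ?tail s2"
     by (rule zgood_SeqI[OF zg2], rule zgood_SeqI, fold s3_def, rule zg3, fold s5_def, rule zg5)
    have "trm p W ?tail s2 (steps ?tail) (steps ?tail) B (\<lambda>s'. ?I (Suc t) (set_reg 38 (Suc t) s'))"
     by (rule trm_ev[where Q = "\<lambda>s'. ?I (Suc t) (set_reg 38 (Suc t) s')", OF _ zg])
     (simp add: digit_defs, unfold ev, rule I6)
    moreover have "steps ?tail \<le> 14" by (simp add: digit_defs)
    ultimately show "trm p W ?tail s2 14 14 B (\<lambda>s'. agree ?body s1 s' --> regs s' 38 = t --> ?I (Suc t) (set_reg 38 (Suc t) s'))"
     by (elim trm_mono) (assumption | rule order_refl | intro impI)+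
   qed
   then show "trm p W ?body s1 (6 + m * 10 + 14) 14 B (\<lambda>s'. agree ?body s1 s' --> regs s' 38 = t --> ?I (Suc t) (set_reg 38 (Suc t) s'))"
    by (simp only: add_0)
  qed (use r in \<open>simp_all add: digit_defs\<close>)
  then show ?thesis unfolding digits_def
  proof (rule trm_mono, goal_cases)
   case 1
   have "card R * ((6 + m * 10 + 14) + 2) \<le> m * ((6 + m * 10 + 14) + 2)" using R by (rule mult_right_mono) simp
   then show ?case by (simp add: power2_eq_square algebra_simps)
  next
   case 2
   then show ?case using R by simp
  next
   case (4 s)
   have I4: "?I (card R) s" using conjunct1[OF 4(2)] .
   have "zmem s [2, j] = zmem \<sigma> [2, j] + P * bal p (\<rho> j)" if j: "j \<in> {1..p}" for j
   proof (cases "j \<in> (\<lambda>u. index (?c u)) ` {..<card R}")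
    case True
    then show ?thesis using conjunct2[OF I4, THEN bspec, OF j] by (simp only: if_True)
   next
    \<comment> \<open>A column outside R has a residual divisible by p and hence the digit 0, so
      leaving its cell alone is correct.\<close>
    case False
    let ?b = "of_nat j :: 'a mod_ring"
    have ib: "index ?b = j" using index_of_nat j by (simp add: p_def)
    have "?b \<notin> R"
    proof
     assume "?b \<in> R"
     then have "?b \<in> ?c ` {..<card R}" by (simp only: bij_betw_imp_surj_on[OF bij])
     then obtain u where u: "?b = ?c u" "u \<in> {..<card R}" by (rule imageE)
     have "j \<in> (\<lambda>u. index (?c u)) ` {..<card R}" by (rule image_eqI[where f = "\<lambda>u. index (?c u)" and x = u, OF ib[unfolded u(1), symmetric] u(2)])
     then show False using False by contradiction
    qed
    from w[OF this] have "int p dvd \<rho> j" unfolding ib p_def by (simp only: of_int_eq_0_iff_dvd)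
    then have "bal p (\<rho> j) = 0" by (simp add: bal_def)
    then show ?thesis using conjunct2[OF I4, THEN bspec, OF j] False by (simp only: if_False mult_zero_right)
   qed
   then have fin: "\<forall>j\<in>{1..p}. zmem s [2, j] = zmem \<sigma> [2, j] + P * bal p (\<rho> j)" by (rule ballI)
   show ?case by (rule conjI[OF conjunct1[OF I4] fin])
  qed simp
qed

end

section \<open>Updating the residual measurements\<close>

definition reduce_step :: com where
  "reduce_step = Do (FofZ [Const 28, Reg 5] [Const 1, Reg 5]) ;; Do (FofZ [Const 10, Reg 5] [Const 1, Reg 5])"

definition reduce :: com where "reduce = For 5 (Reg 1) reduce_step"

definition scan_step :: com where
  "scan_step = If (ZEq [Const 1, Reg 5] [Const 4]) skip (wset 35 (Const 1))"

text \<open>The outcome of the integer comparisons is put into a register, so that the guard of the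
  main loop is a word test, as \<open>trm_While\<close> requires.\<close>

definition scan :: com where "scan = wset 35 (Const 0) ;; For 5 (Reg 1) scan_step"

text \<open>The new residual is \<open>(y + \<Sum> v) div p\<close>; the quotients and the remainders of the products \<open>v\<close> are summed
  separately, the latter as words, so that no intermediate integer exceeds the allowed size.\<close>

definition update_step :: com where
  "update_step = Do (WLoad 43 [Const 3, Reg 6]) ;; Do (ZOp [Const 7] ZMul [Const 0, Reg 7, Reg 43] [Const 6, Reg 6]) ;;
   Do (FofZ [Const 14] [Const 7]) ;; Do (WofF 44 [Const 14]) ;; wadd 42 (Reg 42) (Reg 44) ;;
   Do (ZDivPow [Const 7] [Const 7] [Const 3]) ;; Do (ZOp [Const 9] ZAdd [Const 9] [Const 7])"

definition update_start :: com where
  "update_start = Do (FofZ [Const 14] [Const 1, Reg 5]) ;; Do (WofF 42 [Const 14]) ;;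
   Do (ZDivPow [Const 9] [Const 1, Reg 5] [Const 3]) ;; wadd 7 (Reg 5) (Const 1)"

definition update_end :: com where
  "update_end = Do (WOp 42 WDiv (Reg 42) (Reg 0)) ;; Do (ZofW [Const 7] (Reg 42)) ;;
   Do (ZOp [Const 1, Reg 5] ZAdd [Const 9] [Const 7])"

definition update :: com where
  "update = For 5 (Reg 1) (update_start ;; For 6 (Reg 31) update_step ;; update_end)"

lemmas update_defs = update_step_def update_start_def update_end_def update_def

lemma abs_div_le: "\<bar>v div b\<bar> \<le> \<bar>v\<bar>" if "0 < b" for v b :: int
proof (cases "0 \<le> v")
  case True
  then have "v div b \<le> v div 1" "0 \<le> v div b" using that by (intro zdiv_mono2, auto simp: pos_imp_zdiv_nonneg_iff)
  then show ?thesis using True by simp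
next
  case False
  then have "v div 1 \<le> v div b" "v div b < 0" using that by (intro zdiv_mono2_neg, auto simp: pos_imp_zdiv_neg_iff)
  then show ?thesis using False by simp
qed

lemma zbd_div: "0 < b ==> zbd B v ==> zbd B (v div b)"
  unfolding zbd_def using abs_div_le order_trans by blast

lemma div_sum_split:
  fixes b y :: int
  assumes "0 < b"
  shows "(y + (\<Sum>u<n. v u)) div b = (y div b + (\<Sum>u<n. v u div b)) + (y mod b + (\<Sum>u<n. v u mod b)) div b"
proof -
  have "(\<Sum>u<n. v u) = (\<Sum>u<n. b * (v u div b) + v u mod b)" by simp
  also have "\<dots> = b * (\<Sum>u<n. v u div b) + (\<Sum>u<n. v u mod b)" by (simp only: sum.distrib sum_distrib_left)
  finally have "y + (\<Sum>u<n. v u) = (y mod b + (\<Sum>u<n. v u mod b)) + b * (y div b + (\<Sum>u<n. v u div b))"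
   using mult_div_mod_eq[of b y] by (simp add: distrib_left)
  then show ?thesis using assms by (simp only: div_mult_self2[OF less_imp_neq[OF assms, symmetric]])
qed

lemma sum_mod_bounds:
  fixes b y :: int
  assumes "0 < b"
  shows "0 \<le> y mod b + (\<Sum>u<n. v u mod b)" "y mod b + (\<Sum>u<n. v u mod b) < (int n + 1) * b"
proof -
  have r: "0 \<le> v mod b" "v mod b < b" for v using assms by simp_all
  show "0 \<le> y mod b + (\<Sum>u<n. v u mod b)" using r by (intro add_nonneg_nonneg sum_nonneg)
  have "(\<Sum>u<n. v u mod b) \<le> (\<Sum>u<n. b)" using r by (intro sum_mono less_imp_le)
  then show "y mod b + (\<Sum>u<n. v u mod b) < (int n + 1) * b" using r(2)[of y] by (simp add: distrib_right)
qed

context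
  fixes W m :: nat
  assumes W: "32 * m + 32 < W" and m: "0 < m"
begin

lemma trm_reduce:
  fixes \<sigma> :: state
  defines "F \<equiv> fe :: state => nat list => 'a::prime_card mod_ring"
  assumes c: "canon CARD('a) \<sigma>" and r: "regs \<sigma> 1 = m" and B: "\<And>l. l < m ==> zbd B (zmem \<sigma> [1, l])"
  shows "trm CARD('a) W reduce \<sigma> (2 + m * 4) (m * 2) B
   (\<lambda>s. \<forall>l<m. F s [28, l] = of_int (zmem \<sigma> [1, l]) \<and> F s [10, l] = of_int (zmem \<sigma> [1, l]))"
proof -
  let ?I = "\<lambda>t s. \<forall>l<t. F s [28, l] = of_int (zmem \<sigma> [1, l]) \<and> F s [10, l] = of_int (zmem \<sigma> [1, l])"
  have mW: "m < W" using W by simp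
  have "trm CARD('a) W (For 5 (Reg 1) reduce_step) \<sigma> (2 + m * (2 + 2)) (m * 2) B
   (\<lambda>s. ?I m s \<and> agree (For 5 (Reg 1) reduce_step) \<sigma> s \<and> canon CARD('a) s \<and> regs s 5 = m)"
  proof (rule trm_For[where I = ?I, OF mW p_pos c])
   fix t s assume t: "t < m" and ag: "agree (For 5 (Reg 1) reduce_step) \<sigma> s" and rt: "regs s 5 = t" and I: "?I t s"
   have zs: "zmem s [1, t] = zmem \<sigma> [1, t]" using agree_zmem[OF ag] by (simp add: reduce_step_def)
   define s' where "s' = ev CARD('a) W reduce_step s"
   have F': "F s' = (F s)([28, t] := of_int (zmem \<sigma> [1, t]), [10, t] := of_int (zmem \<sigma> [1, t]))"
    by (simp add: s'_def reduce_step_def F_def rt zs zval_def del: One_nat_def)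
   have "?I (Suc t) (set_reg 5 (Suc t) s')"
   proof (intro allI impI)
    fix l assume "l < Suc t"
    then show "F (set_reg 5 (Suc t) s') [28, l] = of_int (zmem \<sigma> [1, l]) \<and> F (set_reg 5 (Suc t) s') [10, l] = of_int (zmem \<sigma> [1, l])"
     using I[THEN spec, of l] F' by (cases "l = t") (simp_all add: F_def)
   qed
   then have Q: "?I (Suc t) (set_reg 5 (Suc t) (ev CARD('a) W reduce_step s))" unfolding s'_def .
   have zg: "zgood CARD('a) W B reduce_step s" using B[OF t] by (simp add: reduce_step_def rt zval_def zs del: One_nat_def)
   have "trm CARD('a) W reduce_step s (steps reduce_step) (steps reduce_step) B (\<lambda>s'. ?I (Suc t) (set_reg 5 (Suc t) s'))"
    by (rule trm_ev[where Q = "\<lambda>s'. ?I (Suc t) (set_reg 5 (Suc t) s')", OF _ zg Q]) (simp add: reduce_step_def)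
   moreover have "steps reduce_step \<le> 2" by (simp add: reduce_step_def)
   ultimately show "trm CARD('a) W reduce_step s 2 2 B (\<lambda>s'. agree reduce_step s s' --> regs s' 5 = t --> ?I (Suc t) (set_reg 5 (Suc t) s'))"
    by (elim trm_mono) (assumption | rule order_refl | intro impI)+
  qed (use r in \<open>simp_all add: reduce_step_def\<close>)
  then show ?thesis unfolding reduce_def by (elim trm_mono) (rule order_refl | (elim conjE, assumption) | simp)+
qed

lemma trm_scan:
  fixes \<sigma> :: state
  assumes p: "0 < p" and c: "canon p \<sigma>" and r: "regs \<sigma> 1 = m" and z: "zmem \<sigma> [4] = 0"
   and B: "\<And>l. l < m ==> zbd B (zmem \<sigma> [1, l])"
  shows "trm p W scan \<sigma> (3 + m * 4) (m * 2) B (\<lambda>s. regs s 35 = 0 \<longleftrightarrow> (\<forall>l<m. zmem \<sigma> [1, l] = 0))"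
proof -
  let ?I = "\<lambda>t s. regs s 35 = 0 \<longleftrightarrow> (\<forall>l<t. zmem \<sigma> [1, l] = 0)"
  have mW: "m < W" using W by simp
  define s0 where "s0 = instr_step p W (WOp 35 WAdd (Const 0) (Const 0)) \<sigma>"
  have c0: "canon p s0" using c by (simp add: s0_def canon_def)
  have r0: "regs s0 1 = m" "regs s0 35 = 0" "zmem s0 = zmem \<sigma>" using r by (simp_all add: s0_def)
  have "trm p W (For 5 (Reg 1) scan_step) s0 (2 + m * (2 + 2)) (m * 2) B
   (\<lambda>s. ?I m s \<and> agree (For 5 (Reg 1) scan_step) s0 s \<and> canon p s \<and> regs s 5 = m)"
  proof (rule trm_For[where I = ?I, OF mW p c0])
   fix t s assume t: "t < m" and ag: "agree (For 5 (Reg 1) scan_step) s0 s" and rt: "regs s 5 = t" and I: "?I t s"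
   have zs: "zmem s [1, t] = zmem \<sigma> [1, t]" "zmem s [4] = 0" using agree_zmem[OF ag] r0 z by (simp_all add: scan_step_def)
   have Q: "?I (Suc t) (set_reg 5 (Suc t) (ev p W scan_step s))"
   proof (cases "zmem \<sigma> [1, t] = 0")
    case True
    have "regs (set_reg 5 (Suc t) (ev p W scan_step s)) 35 = regs s 35"
     using True zs by (simp add: scan_step_def zval_def rt)
    then show ?thesis using I True by (simp only: less_Suc_eq) blast
   next
    case False
    have "regs (set_reg 5 (Suc t) (ev p W scan_step s)) 35 = 1"
     using False zs W by (simp add: scan_step_def zval_def rt)
    then show ?thesis using False by auto
   qed
   have zg: "zgood p W B scan_step s" using B[OF t] unfolding scan_step_def zgood_Do(6)
    by (simp add: rt zval_def zs del: One_nat_def)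
   have "trm p W scan_step s (steps scan_step) (steps scan_step) B (\<lambda>s'. ?I (Suc t) (set_reg 5 (Suc t) s'))"
    by (rule trm_ev[where Q = "\<lambda>s'. ?I (Suc t) (set_reg 5 (Suc t) s')", OF _ zg Q]) (simp add: scan_step_def)
   moreover have "steps scan_step \<le> 2" by (simp add: scan_step_def)
   ultimately show "trm p W scan_step s 2 2 B (\<lambda>s'. agree scan_step s s' --> regs s' 5 = t --> ?I (Suc t) (set_reg 5 (Suc t) s'))"
    by (elim trm_mono) (assumption | rule order_refl | intro impI)+
  qed (use r0 in \<open>simp_all add: scan_step_def\<close>)
  then have "trm p W (For 5 (Reg 1) scan_step) s0 (2 + m * 4) (m * 2) B (?I m)"
   by (elim trm_mono) (rule order_refl | (elim conjE, assumption) | simp)+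
  then have "trm p W scan \<sigma> (Suc (2 + m * 4)) (m * 2) B (?I m)"
   unfolding scan_def s0_def by (rule trm_Do_Seq[rotated]) simp
  then show ?thesis by (elim trm_mono) (assumption | rule order_refl | simp)+
qed

text \<open>\<open>(m + 2) * p < W\<close> keeps the sum of up to m + 1 remainders inside one word.
  \<open>Bl\<close>, \<open>Bu\<close> and \<open>Bt\<close> supply the bounds on what arises per
  row: old and new residuals, matrix entries and single products, and partial sums of
  quotients.\<close>

theorem trm_update:
  fixes \<sigma> :: state
  assumes p: "0 < p" and c: "canon p \<sigma>" and Wp: "(m + 2) * p < W"
   and r: "regs \<sigma> 0 = p" "regs \<sigma> 1 = m" "regs \<sigma> 31 = n" and n: "n \<le> m" and z: "zmem \<sigma> [3] = int p"
  defines "v \<equiv> \<lambda>l u. zmem \<sigma> [0, Suc l, wmem \<sigma> [3, u]] * zmem \<sigma> [6, u]"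
  assumes B: "zbd B (int p)" "zbd B (int (n + 1))" "\<And>u. u < n ==> zbd B (zmem \<sigma> [6, u])"
   and Bl: "\<And>l. l < m ==> zbd B (zmem \<sigma> [1, l]) \<and> zbd B ((zmem \<sigma> [1, l] + (\<Sum>u<n. v l u)) div int p)"
   and Bu: "\<And>l u. l < m ==> u < n ==> zbd B (zmem \<sigma> [0, Suc l, wmem \<sigma> [3, u]]) \<and> zbd B (v l u)"
   and Bt: "\<And>l t. l < m ==> t \<le> n ==> zbd B (zmem \<sigma> [1, l] div int p + (\<Sum>u<t. v l u div int p))"
  shows "trm p W update \<sigma> (20 * (m + 1) ^ 2) (20 * (m + 1) ^ 2) B
   (\<lambda>s. \<forall>l<m. zmem s [1, l] = (zmem \<sigma> [1, l] + (\<Sum>u<n. v l u)) div int p)"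
proof -
  let ?y = "\<lambda>l. zmem \<sigma> [1, l]"
  let ?lp = "For 6 (Reg 31) update_step"
  let ?body = "update_start ;; ?lp ;; update_end"
  let ?new = "\<lambda>l. (?y l + (\<Sum>u<n. v l u)) div int p"
  let ?I = "\<lambda>t s. (\<forall>l<t. zmem s [1, l] = ?new l) \<and> (\<forall>l\<ge>t. zmem s [1, l] = ?y l)"
  have ip: "0 < int p" using p by simp
  have ex: "\<exists>e. int p = int p ^ e" by (rule exI[of _ 1]) simp
  have mW: "m < W" "n < W" using W n by simp_all
  have words1: "nat (?y l mod int p + (\<Sum>u<t. v l u mod int p)) < (t + 1) * p" for l t
  proof -
   have "?y l mod int p + (\<Sum>u<t. v l u mod int p) < int ((t + 1) * p)"
    using sum_mod_bounds(2)[OF ip, of "?y l" "v l" t] by (simp add: algebra_simps)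
   then show ?thesis using sum_mod_bounds(1)[OF ip, of "?y l" "v l" t] by (simp only: nat_less_iff)
  qed
  have words2: "0 \<le> ?y l mod int p + (\<Sum>u<t. v l u mod int p)" for l t
   by (rule sum_mod_bounds(1)[OF ip])
  have wordsW: "nat (?y l mod int p + (\<Sum>u<t. v l u mod int p)) < W" if "t \<le> n" for l t
  proof -
   have "(t + 1) * p \<le> (m + 2) * p" using that n by (intro mult_right_mono) simp_all
   then show ?thesis using words1[of l t] Wp by linarith
  qed
  have "trm p W (For 5 (Reg 1) ?body) \<sigma> (2 + m * ((4 + ((2 + n * 9) + 3)) + 2)) (m * (4 + (n * 7 + 3))) B
   (\<lambda>s. ?I m s \<and> agree (For 5 (Reg 1) ?body) \<sigma> s \<and> canon p s \<and> regs s 5 = m)"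
  proof (rule trm_For[where I = ?I, OF mW(1) p c])
   fix l s assume l: "l < m" and ag: "agree (For 5 (Reg 1) ?body) \<sigma> s" and cs: "canon p s" and rl: "regs s 5 = l" and I: "?I l s"
   have rs: "regs s 0 = p" "regs s 31 = n" using agree_regs[OF ag] r by (simp_all add: update_defs)
   have zs: "zmem s [3] = int p" "zmem s (0 # as) = zmem \<sigma> (0 # as)" "zmem s (6 # as) = zmem \<sigma> (6 # as)"
    "wmem s (3 # as) = wmem \<sigma> (3 # as)" for as
    using agree_zmem[OF ag] agree_wmem[OF ag] z by (simp_all add: update_defs)
   have yl: "zmem s [1, l] = ?y l" using I by blast
   have lW: "Suc l < W" using l W by simp
   define s1 where "s1 = ev p W update_start s"
   have z1: "zmem s1 = (zmem s)([9] := ?y l div int p)" by (simp add: s1_def update_start_def rl yl zs(1) zval_def del: One_nat_def)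
   have w1: "wmem s1 = wmem s" by (simp add: s1_def update_start_def)
   have r1: "regs s1 7 = Suc l" "regs s1 42 = nat (?y l mod int p)" "regs s1 0 = p" "regs s1 31 = n" "regs s1 5 = l"
    using wordsW[of 0 l] lW by (simp_all add: s1_def update_start_def rl yl[unfolded One_nat_def] rs zval_def fval_def)
   have zg1: "zgood p W B update_start s"
    using Bl[OF l] zbd_div[OF ip, of B "?y l"] B(1) ex by (simp add: update_start_def rl yl zs(1) zval_def del: One_nat_def)
   have st: "steps update_start \<le> 4" by (simp add: update_start_def)
   have "trm p W update_start s (steps update_start) (steps update_start) B (\<lambda>s'. s' = s1)"
    by (rule trm_ev[where Q = "\<lambda>s'. s' = s1", OF _ zg1]) (simp_all only: s1_def, simp add: update_start_def)
   then have start: "trm p W update_start s 4 4 B (\<lambda>s'. s' = s1)"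
    by (rule trm_mono[OF _ st st order_refl])
   let ?J = "\<lambda>t s'. zmem s' [9] = ?y l div int p + (\<Sum>u<t. v l u div int p) \<and>
    regs s' 42 = nat (?y l mod int p + (\<Sum>u<t. v l u mod int p))"
   have "trm p W ?body s (4 + ((2 + n * 9) + 3)) (4 + (n * 7 + 3)) B (\<lambda>s'. ?I (Suc l) (set_reg 5 (Suc l) s'))"
   proof (rule trm_Seq'[OF p cs start])
    fix s1' assume "s1' = s1" and c1': "canon p s1'"
    then have c1: "canon p s1" by simp
    have "trm p W ?lp s1 (2 + n * (7 + 2)) (n * 7) B (\<lambda>s'. ?J n s' \<and> agree ?lp s1 s' \<and> canon p s' \<and> regs s' 6 = n)"
    proof (rule trm_For[where I = ?J, OF mW(2) p c1])
     fix t s2 assume t: "t < n" and ag2: "agree ?lp s1 s2" and rt: "regs s2 6 = t" and J: "?J t s2"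
     have r2: "regs s2 7 = Suc l" using agree_regs[OF ag2, of 7] r1 by (simp add: update_step_def)
     have zs2: "zmem s2 [3] = int p" "zmem s2 (0 # as) = zmem \<sigma> (0 # as)" "zmem s2 (6 # as) = zmem \<sigma> (6 # as)"
     "wmem s2 (3 # as) = wmem \<sigma> (3 # as)" for as
     using agree_zmem[OF ag2] agree_wmem[OF ag2] z1 zs w1 by (simp_all add: update_step_def)
     have vt: "zmem \<sigma> [0, Suc l, wmem \<sigma> [3, t]] * zmem \<sigma> [6, t] = v l t" by (simp add: v_def)
     have m0: "0 \<le> v l t mod int p" using ip by simp
     have nn: "nat (?y l mod int p + (\<Sum>u<t. v l u mod int p)) + nat (v l t mod int p)
     = nat (?y l mod int p + (\<Sum>u<Suc t. v l u mod int p))"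
     unfolding sum.lessThan_Suc add.assoc[symmetric] by (rule nat_add_distrib[OF words2 m0, symmetric])
     have tW: "nat (v l t mod int p) mod W = nat (v l t mod int p)"
     using wordsW[of "Suc t" l] nn t by (intro mod_less) linarith
     have sW: "nat (?y l mod int p + (\<Sum>u<Suc t. v l u mod int p)) mod W = nat (?y l mod int p + (\<Sum>u<Suc t. v l u mod int p))"
     using wordsW[of "Suc t" l] t by (intro mod_less) simp
     define s3 where "s3 = ev p W update_step s2"
     have z3: "zmem s3 [9] = zmem s2 [9] + v l t div int p"
     by (simp add: s3_def update_step_def rt r2 zs2 zval_def vt)
     have r3: "regs s3 42 = (regs s2 42 + nat (v l t mod int p)) mod W"
     by (simp add: s3_def update_step_def rt r2 zs2 zval_def fval_def vt tW)
     have "regs s3 42 = nat (?y l mod int p + (\<Sum>u<Suc t. v l u mod int p))"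
     unfolding r3 conjunct2[OF J] nn by (rule sW)
     moreover have "zmem s3 [9] = ?y l div int p + (\<Sum>u<Suc t. v l u div int p)"
     unfolding z3 conjunct1[OF J] by simp
     ultimately have Q: "?J (Suc t) (set_reg 6 (Suc t) (ev p W update_step s2))" by (simp add: s3_def)
     have bt: "zbd B (?y l div int p + (\<Sum>u<t. v l u div int p))" "zbd B (?y l div int p + (\<Sum>u<t. v l u div int p) + v l t div int p)"
     using Bt[OF l, of t] Bt[OF l, of "Suc t"] t by (simp_all add: add.assoc)
     have b: "zbd B (zmem \<sigma> [0, Suc l, wmem \<sigma> [3, t]])" "zbd B (v l t)" using Bu[OF l t] by blast+
     have zg: "zgood p W B update_step s2"
     using bt b B(1) B(3)[OF t] zbd_div[OF ip b(2)] ex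
     by (simp add: update_step_def rt r2 zs2 zval_def vt conjunct1[OF J])
     have st: "steps update_step \<le> 7" by (simp add: update_step_def)
     have "trm p W update_step s2 (steps update_step) (steps update_step) B (\<lambda>s'. ?J (Suc t) (set_reg 6 (Suc t) s'))"
     by (rule trm_ev[where Q = "\<lambda>s'. ?J (Suc t) (set_reg 6 (Suc t) s')", OF _ zg Q]) (simp add: update_step_def)
     then show "trm p W update_step s2 7 7 B (\<lambda>s'. agree update_step s2 s' --> regs s' 6 = t --> ?J (Suc t) (set_reg 6 (Suc t) s'))"
     by (rule trm_mono[OF _ st st order_refl]) (intro impI)
    qed (use r1 z1 in \<open>simp_all add: update_step_def\<close>)
    then have lp: "trm p W ?lp s1 (2 + n * 9) (n * 7) B (?J n)"
     by (elim trm_mono) (rule order_refl | (elim conjE, assumption) | simp)+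
    have "trm p W (?lp ;; update_end) s1 ((2 + n * 9) + 3) (n * 7 + 3) B (\<lambda>s'. ?I (Suc l) (set_reg 5 (Suc l) s'))"
    proof (rule trm_Seq'[OF p c1 lp])
     fix s4 assume J: "?J n s4" and ag4: "agree ?lp s1 s4"
     have r4: "regs s4 0 = p" "regs s4 5 = l" using agree_regs[OF ag4] r1 by (simp_all add: update_step_def)
     have z4: "zmem s4 (1 # as) = zmem s (1 # as)" for as using agree_zmem[OF ag4] z1 by (simp add: update_step_def)
     define w where "w = nat (?y l mod int p + (\<Sum>u<n. v l u mod int p))"
     have w: "w < W" "int w = ?y l mod int p + (\<Sum>u<n. v l u mod int p)" "w < (n + 1) * p"
     unfolding w_def using wordsW[of n l] words1[of l n] words2[of l n] by (simp_all only: order_refl nat_0_le)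
     \<comment> \<open>The n + 1 remainders contribute a carry of at most n.\<close>
     have dw: "w div p < n + 1" using w(3) by (simp add: less_mult_imp_div_less)
     have dW: "w div p mod W = w div p" using w(1) div_le_dividend[of w p] by (intro mod_less) linarith
     have r42: "regs s4 42 = w" unfolding w_def by (rule conjunct2[OF J])
     have new: "?y l div int p + (\<Sum>u<n. v l u div int p) + int (w div p) = ?new l"
     unfolding zdiv_int w(2) by (rule div_sum_split[OF ip, symmetric])
     define s5 where "s5 = ev p W update_end s4"
     have z5: "zmem s5 = (zmem s4)([7] := int (w div p), [1, l] := ?new l)"
     by (simp add: s5_def update_end_def r4 r42 dW zval_def conjunct1[OF J] new del: One_nat_def)
     have Q: "?I (Suc l) (set_reg 5 (Suc l) (ev p W update_end s4))"
     unfolding s5_def[symmetric]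
     proof (intro conjI allI impI)
     fix i assume "i < Suc l"
     then show "zmem (set_reg 5 (Suc l) s5) [1, i] = ?new i"
     using conjunct1[OF I, THEN spec, of i] by (cases "i = l") (simp_all add: z5 z4 del: One_nat_def)
     next
     fix i assume "Suc l \<le> i"
     then show "zmem (set_reg 5 (Suc l) s5) [1, i] = ?y i"
     using conjunct2[OF I, THEN spec, of i] by (simp add: z5 z4 del: One_nat_def)
     qed
     have "zbd B (int (w div p))" using B(2) dw unfolding zbd_def by linarith
     then have zg: "zgood p W B update_end s4"
     using Bl[OF l] Bt[OF l, of n] by (simp add: update_end_def r4 r42 dW zval_def conjunct1[OF J] new del: One_nat_def)
     have st: "steps update_end \<le> 3" by (simp add: update_end_def)
     have "trm p W update_end s4 (steps update_end) (steps update_end) B (\<lambda>s'. ?I (Suc l) (set_reg 5 (Suc l) s'))"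
     by (rule trm_ev[where Q = "\<lambda>s'. ?I (Suc l) (set_reg 5 (Suc l) s')", OF _ zg Q]) (simp add: update_end_def)
     then show "trm p W update_end s4 3 3 B (\<lambda>s'. ?I (Suc l) (set_reg 5 (Suc l) s'))"
     by (rule trm_mono[OF _ st st order_refl])
    qed
    then show "trm p W (?lp ;; update_end) s1' ((2 + n * 9) + 3) (n * 7 + 3) B (\<lambda>s'. ?I (Suc l) (set_reg 5 (Suc l) s'))"
     unfolding \<open>s1' = s1\<close> .
   qed
   then show "trm p W ?body s (4 + ((2 + n * 9) + 3)) (4 + (n * 7 + 3)) B
    (\<lambda>s'. agree ?body s s' --> regs s' 5 = l --> ?I (Suc l) (set_reg 5 (Suc l) s'))"
    by (rule trm_mono[OF _ order_refl order_refl order_refl]) (intro impI)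
  qed (use r in \<open>simp_all add: update_defs\<close>)
  then show ?thesis unfolding update_def
  proof (rule trm_mono, goal_cases)
   case 1
   have "m * ((4 + ((2 + n * 9) + 3)) + 2) \<le> m * ((4 + ((2 + m * 9) + 3)) + 2)" using n by (intro mult_le_mono) simp_all
   then show ?case by (elim order_trans[OF add_left_mono]) (simp add: power2_eq_square algebra_simps)
  next
   case 2
   have "m * (4 + (n * 7 + 3)) \<le> m * (4 + (m * 7 + 3))" using n by (intro mult_le_mono) simp_all
   then show ?case by (elim order_trans) (simp add: power2_eq_square algebra_simps)
  next
   case (4 s)
   then show ?case by blast
  qed simp
qed

end

section \<open>Balanced digits\<close>

text \<open>For odd p the balanced remainder is the representative of least absolute value. Unlike
  the ordinary remainder, it lets negative numbers run down to 0 as well.\<close>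

lemma bal_props:
  assumes "odd p"
  shows "int p dvd v - bal p v" "2 * \<bar>bal p v\<bar> \<le> int p - 1" "\<bar>bal p v\<bar> \<le> \<bar>v\<bar>"
proof -
  obtain h where h: "p = 2 * h + 1" using assms by (auto elim: oddE)
  define c where "c = v mod int p"
  have c: "0 \<le> c" "c < int p" using h by (simp_all add: c_def)
  have b: "bal p v = (if int h < c then c - int p else c)" using h by (simp add: bal_def c_def)
  have p: "int p = 2 * int h + 1" using h by simp
  have "int p dvd v - c" by (simp add: c_def)
  moreover have "v - (c - int p) = (v - c) + int p" by simp
  then have "int p dvd v - c ==> int p dvd v - (c - int p)" by (simp only: dvd_add[OF _ dvd_refl])
  ultimately show "int p dvd v - bal p v" unfolding b by simp
  have h2: "\<bar>bal p v\<bar> \<le> int h" unfolding b using c p by auto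
  then show "2 * \<bar>bal p v\<bar> \<le> int p - 1" using p by linarith
  show "\<bar>bal p v\<bar> \<le> \<bar>v\<bar>"
  proof (cases "\<bar>v\<bar> \<le> int h")
   case True
   show ?thesis
   proof (cases "0 \<le> v")
    case True
    then have "c = v" using \<open>\<bar>v\<bar> \<le> int h\<close> p by (simp add: c_def)
    then show ?thesis unfolding b using \<open>\<bar>v\<bar> \<le> int h\<close> True by simp
   next
    case False
    have "c = (v + int p) mod int p" by (simp add: c_def)
    also have "\<dots> = v + int p" using \<open>\<bar>v\<bar> \<le> int h\<close> False p by (intro mod_pos_pos_trivial) linarith+
    finally show ?thesis unfolding b using \<open>\<bar>v\<bar> \<le> int h\<close> False p by simp
   qed
  next
   case False
   then show ?thesis using h2 by linarith
  qed
qed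

fun res :: "nat => int => nat => int" where
  "res p v 0 = v"
| "res p v (Suc i) = (res p v i - bal p (res p v i)) div int p"

declare res.simps(2) [simp del]

definition acc :: "nat => int => nat => int" where
  "acc p v i = v - int p ^ i * res p v i"

context
  fixes p :: nat
  assumes podd: "odd p" and p3: "3 \<le> p"
begin

lemma res_Suc: "int p * res p v (Suc i) = res p v i - bal p (res p v i)"
  using bal_props(1)[OF podd, of "res p v i"] by (simp add: res.simps(2))

lemma res_0 [simp]: "res p 0 i = 0"
proof (induction i)
  case (Suc i)
  have "bal p 0 = 0" by (simp add: bal_def)
  then have "int p * res p 0 (Suc i) = 0" using res_Suc[of 0 i] Suc by simp
  then show ?case using p3 by simp
qed simp

text \<open>From 2 |digit| <= p - 1 it follows that 2 |r| - 1 is at least divided by p in each step;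
  this quantity contracts without an additive error, which |r| itself does not.\<close>

lemma res_bound: "int p ^ i * (2 * \<bar>res p v i\<bar> - 1) \<le> 2 * \<bar>v\<bar> - 1"
proof (induction i)
  case (Suc i)
  let ?r = "res p v i" and ?r' = "res p v (Suc i)"
  have "int p * \<bar>?r'\<bar> = \<bar>int p * ?r'\<bar>" by (simp add: abs_mult)
  also have "\<dots> = \<bar>?r - bal p ?r\<bar>" by (simp only: res_Suc)
  also have "\<dots> \<le> \<bar>?r\<bar> + \<bar>bal p ?r\<bar>" by (rule abs_triangle_ineq4)
  finally have "int p * (2 * \<bar>?r'\<bar> - 1) \<le> 2 * \<bar>?r\<bar> - 1"
   using bal_props(2)[OF podd, of ?r] by (simp add: right_diff_distrib)
  then have "int p ^ i * (int p * (2 * \<bar>?r'\<bar> - 1)) \<le> int p ^ i * (2 * \<bar>?r\<bar> - 1)" by (rule mult_left_mono) simp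
  then show ?case using Suc by (simp add: mult.assoc mult.left_commute)
qed simp

lemma res_bounds:
  "res p v i ~= 0 ==> int p ^ i \<le> 2 * \<bar>v\<bar> - 1" "\<bar>res p v i\<bar> \<le> \<bar>v\<bar>" "int p ^ i * \<bar>res p v i\<bar> \<le> 2 * \<bar>v\<bar>"
proof -
  have p1: "1 \<le> int p ^ i" using p3 by simp
  show 1: "int p ^ i \<le> 2 * \<bar>v\<bar> - 1" if "res p v i ~= 0"
  proof -
   have "int p ^ i * 1 \<le> int p ^ i * (2 * \<bar>res p v i\<bar> - 1)" using that by (intro mult_left_mono) simp_all
   then show ?thesis using res_bound[of i v] by linarith
  qed
  show "\<bar>res p v i\<bar> \<le> \<bar>v\<bar>"
  proof (cases "res p v i = 0")
   case False
   then have "1 * (2 * \<bar>res p v i\<bar> - 1) \<le> int p ^ i * (2 * \<bar>res p v i\<bar> - 1)" using p1 by (intro mult_right_mono) simp_all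
   from order_trans[OF this res_bound] show ?thesis by simp
  qed simp
  show "int p ^ i * \<bar>res p v i\<bar> \<le> 2 * \<bar>v\<bar>"
  proof (cases "res p v i = 0")
   case False
   have "2 * (int p ^ i * \<bar>res p v i\<bar>) = int p ^ i * (2 * \<bar>res p v i\<bar> - 1) + int p ^ i" by (simp add: right_diff_distrib)
   then show ?thesis using res_bound[of i v] 1[OF False] by linarith
  qed simp
qed

lemma acc_simps:
  "acc p v 0 = 0" "acc p v (Suc i) = acc p v i + int p ^ i * bal p (res p v i)" "res p v i = 0 ==> acc p v i = v"
proof -
  have "int p ^ Suc i * res p v (Suc i) = int p ^ i * (int p * res p v (Suc i))" by simp
  also have "\<dots> = int p ^ i * res p v i - int p ^ i * bal p (res p v i)" unfolding res_Suc by (rule right_diff_distrib)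
  finally show "acc p v (Suc i) = acc p v i + int p ^ i * bal p (res p v i)" by (simp add: acc_def)
qed (simp_all add: acc_def)

text \<open>Both numbers are at most 3 |v|, and p is at least 3; this is how the limit M p on the
  integers is met.\<close>

lemma digit_bounds:
  assumes "\<bar>v\<bar> \<le> M"
  shows "\<bar>acc p v i\<bar> \<le> M * int p" "\<bar>int p ^ i * bal p (res p v i)\<bar> \<le> M * int p"
proof -
  have M: "3 * \<bar>v\<bar> \<le> M * int p"
  proof -
   have "\<bar>v\<bar> * 3 \<le> M * int p" using assms p3 by (intro mult_mono) simp_all
   then show ?thesis by simp
  qed
  have "\<bar>int p ^ i * res p v i\<bar> \<le> 2 * \<bar>v\<bar>" using res_bounds(3)[where v = v and i = i] by (simp add: abs_mult)
  then show "\<bar>acc p v i\<bar> \<le> M * int p" using M unfolding acc_def by linarith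
  have "\<bar>int p ^ i * bal p (res p v i)\<bar> \<le> int p ^ i * \<bar>res p v i\<bar>"
   unfolding abs_mult by (intro mult_mono) (simp_all add: bal_props(3)[OF podd])
  then show "\<bar>int p ^ i * bal p (res p v i)\<bar> \<le> M * int p" using res_bounds(3)[where v = v and i = i] M by linarith
qed

end

section \<open>Residual measurements\<close>

lemma sum_index:
  "(\<Sum>b\<in>(UNIV :: 'a::prime_card mod_ring set). g (index b) b) = (\<Sum>j = 1..CARD('a). g j (of_nat j))"
proof -
  have "(\<Sum>j = 1..CARD('a). g j (of_nat j)) = (\<Sum>j = 1..CARD('a). g (index (of_nat j :: 'a mod_ring)) (of_nat j))"
   by (rule sum.cong) (simp_all add: index_of_nat)
  also have "\<dots> = (\<Sum>b\<in>(UNIV :: 'a mod_ring set). g (index b) b)"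
   by (rule sum.reindex_bij_betw[OF bij_of_nat, of "\<lambda>b. g (index b) b"])
  finally show ?thesis ..
qed

context
  fixes m :: nat and k :: "nat => int" and \<Phi> :: "nat => nat => int" and ty :: "'a::prime_card itself"
  assumes k: "\<forall>j\<in>{1..CARD('a)}. 1 \<le> k j \<and> k j < int CARD('a)"
   and \<Phi>: "admissible_matrix CARD('a) m k \<Phi>"
begin

lemma of_int_measurement:
  assumes "l < m"
  shows "(of_int (measurement CARD('a) \<Phi> r l) :: 'a mod_ring) = (\<Sum>b\<in>UNIV. of_int (k (index b) * r (index b)) * b ^ l)"
proof -
  have key: "(of_int (\<Phi> (l + 1) j * r j) :: 'a mod_ring) = of_int (k j * r j) * of_nat j ^ l" if "j \<in> {1..CARD('a)}" for j
  proof -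
   have "l + 1 \<in> {1..m}" using assms by simp
   then have "[\<Phi> (l + 1) j = k j * int j ^ (l + 1 - 1)] (mod int CARD('a))"
    using \<Phi> that unfolding admissible_matrix_def by blast
   then have "(of_int (\<Phi> (l + 1) j) :: 'a mod_ring) = of_int (k j * int j ^ l)" unfolding of_int_eq_iff_cong by simp
   then have "(of_int (\<Phi> (l + 1) j * r j) :: 'a mod_ring) = of_int (k j * int j ^ l) * of_int (r j)" by (simp only: of_int_mult)
   also have "\<dots> = of_int (k j * r j) * of_nat j ^ l" by simp
   finally show ?thesis .
  qed
  show ?thesis unfolding measurement_def of_int_sum sum_index[of "\<lambda>i b. of_int (k i * r i) * b ^ l"]
   by (rule sum.cong[OF refl key])
qed

lemma k_neq_0: "j \<in> {1..CARD('a)} ==> (of_int (k j) :: 'a mod_ring) ~= 0"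
proof -
  assume "j \<in> {1..CARD('a)}"
  then have "1 \<le> k j" "k j < int CARD('a)" using k by blast+
  then show ?thesis unfolding of_int_eq_0_iff_dvd using zdvd_not_zless[of "k j" "int CARD('a)"] by simp
qed

lemma dvd_of_measurement_0:
  assumes "\<forall>l<m. measurement CARD('a) \<Phi> r l = 0" and "card {j \<in> {1..CARD('a)}. r j ~= 0} \<le> m" and j: "j \<in> {1..CARD('a)}"
  shows "int CARD('a) dvd r j"
proof (rule ccontr)
  assume nd: "\<not> int CARD('a) dvd r j"
  let ?w = "\<lambda>b :: 'a mod_ring. of_int (k (index b) * r (index b)) :: 'a mod_ring"
  let ?A = "{b. ?w b ~= 0}"
  have "?A \<subseteq> of_nat ` {j \<in> {1..CARD('a)}. r j ~= 0}"
  proof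
   fix b assume "b \<in> ?A"
   then have "r (index b) ~= 0" by auto
   then show "b \<in> of_nat ` {j \<in> {1..CARD('a)}. r j ~= 0}" using index[of b] by (intro image_eqI[of _ _ "index b"]) simp_all
  qed
  then have "card ?A \<le> card {j \<in> {1..CARD('a)}. r j ~= 0}" by (rule surj_card_le[rotated]) simp
  then have cA: "card ?A \<le> m" using assms(2) by simp
  have "(\<Sum>b\<in>?A. ?w b * b ^ l) = 0" if "l < m" for l
  proof -
   have "(\<Sum>b\<in>?A. ?w b * b ^ l) = (\<Sum>b\<in>UNIV. ?w b * b ^ l)" by (rule sum.mono_neutral_left) auto
   then show ?thesis using of_int_measurement[OF that, of r] assms(1) that by simp
  qed
  then have "\<And>l. l < card ?A ==> (\<Sum>b\<in>?A. ?w b * b ^ l) = 0" using cA by simp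
  moreover have jA: "of_nat j \<in> ?A"
   using nd k_neq_0[OF j] by (simp add: index_of_nat[OF j] of_int_eq_0_iff_dvd)
  ultimately have "?w (of_nat j) = 0" by (intro vandermonde[of ?A ?w]) simp_all
  then show False using jA by simp
qed

text \<open>Modulo p the measurements are m moments over at most m points, so a Vandermonde argument
  makes every coordinate divisible by p. The vector divided by p satisfies the same assumptions, so
  every power of p divides each coordinate. This justifies stopping as soon as all residual
  measurements vanish.\<close>

lemma measurement_0:
  assumes "\<forall>l<m. measurement CARD('a) \<Phi> r l = 0" and "card {j \<in> {1..CARD('a)}. r j ~= 0} \<le> m" and "j \<in> {1..CARD('a)}"
  shows "r j = 0"
proof -
  let ?p = "int CARD('a)"
  have p1: "1 < ?p" using prime_gt_1_nat[OF prime_card[where 'a = 'a]] by simp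
  have "?p ^ n dvd r j" for n using assms
  proof (induction n arbitrary: r)
   case (Suc n)
   have d: "?p dvd r j" if "j \<in> {1..CARD('a)}" for j using dvd_of_measurement_0[OF Suc.prems(1,2) that] .
   define r' where "r' j = r j div ?p" for j
   have r': "r j = ?p * r' j" if "j \<in> {1..CARD('a)}" for j using d[OF that] by (simp add: r'_def)
   have "measurement CARD('a) \<Phi> r l = ?p * measurement CARD('a) \<Phi> r' l" for l
    unfolding measurement_def sum_distrib_left by (rule sum.cong) (simp_all add: r')
   then have "\<forall>l<m. measurement CARD('a) \<Phi> r' l = 0" using Suc.prems(1) p1 by auto
   moreover have "{j \<in> {1..CARD('a)}. r' j ~= 0} = {j \<in> {1..CARD('a)}. r j ~= 0}" using r' p1 by auto
   ultimately have "?p ^ n dvd r' j" using Suc.IH[of r'] Suc.prems(2,3) by simp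
   then show ?case using r'[OF Suc.prems(3)] by simp
  qed simp
  then have d: "?p ^ nat \<bar>r j\<bar> dvd r j" .
  have lt: "\<bar>r j\<bar> < ?p ^ nat \<bar>r j\<bar>"
  proof -
   have "nat \<bar>r j\<bar> < 2 ^ nat \<bar>r j\<bar>" by (rule less_exp)
   also have "\<dots> \<le> CARD('a) ^ nat \<bar>r j\<bar>" using p1 by (intro power_mono) simp_all
   finally show ?thesis by (simp add: nat_less_iff)
  qed
  show ?thesis
  proof (rule ccontr)
   assume "r j ~= 0"
   from dvd_imp_le_int[OF this d] show False using lt by simp
  qed
qed

end

lemma measurement_step:
  assumes "odd p" "3 \<le> p"
  shows "measurement p \<Phi> (\<lambda>j. res p (x j) i) l + (\<Sum>j = 1..p. \<Phi> (l + 1) j * - bal p (res p (x j) i))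
   = int p * measurement p \<Phi> (\<lambda>j. res p (x j) (Suc i)) l"
  unfolding measurement_def sum_distrib_left sum.distrib[symmetric]
proof (rule sum.cong[OF refl])
  fix j
  have "int p * (\<Phi> (l + 1) j * res p (x j) (Suc i)) = \<Phi> (l + 1) j * (int p * res p (x j) (Suc i))" by simp
  then show "\<Phi> (l + 1) j * res p (x j) i + \<Phi> (l + 1) j * - bal p (res p (x j) i) = int p * (\<Phi> (l + 1) j * res p (x j) (Suc i))"
   unfolding res_Suc[OF assms] by (simp add: algebra_simps)
qed

lemma abs_real_div_le: "0 < b ==> \<bar>real_of_int (v div b)\<bar> \<le> \<bar>real_of_int v\<bar> / real_of_int b + 1"
proof -
  assume b: "0 < b"
  have e: "v div b = \<lfloor>real_of_int v / real_of_int b\<rfloor>" by (simp add: floor_divide_of_int_eq)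
  have "real_of_int (v div b) \<le> real_of_int v / real_of_int b" "real_of_int v / real_of_int b < real_of_int (v div b) + 1"
   unfolding e by linarith+
  moreover have "\<bar>real_of_int v / real_of_int b\<bar> = \<bar>real_of_int v\<bar> / real_of_int b" using b by simp
  ultimately show ?thesis by linarith
qed

context
  fixes p m :: nat and \<Phi> :: "nat => nat => int" and x :: "nat => int" and \<kappa> Y :: real
  assumes podd: "odd p" and p3: "3 \<le> p" and m2: "2 \<le> m"
   and \<kappa>: "\<And>l j. l < m ==> j \<in> {1..p} ==> \<bar>real_of_int (\<Phi> (l + 1) j)\<bar> \<le> \<kappa>" "1.7 \<le> \<kappa>"
   and Y: "\<And>l. l < m ==> \<bar>real_of_int (measurement p \<Phi> x l)\<bar> \<le> Y" "0 \<le> Y"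
   and s: "2 * card {j \<in> {1..p}. x j ~= 0} \<le> m"
begin

lemma product_bound:
  assumes "l < m" "j \<in> {1..p}"
  shows "\<bar>real_of_int (\<Phi> (l + 1) j * - bal p v)\<bar> \<le> \<kappa> * ((real p - 1) / 2)"
proof -
  have "2 * real_of_int \<bar>bal p v\<bar> \<le> real_of_int (int p - 1)" using bal_props(2)[OF podd, of v] by linarith
  then have "\<bar>real_of_int (bal p v)\<bar> \<le> (real p - 1) / 2" by simp
  then show ?thesis using \<kappa>(1)[OF assms] \<kappa>(2) unfolding of_int_mult abs_mult of_int_minus abs_minus_cancel by (intro mult_mono) simp_all
qed

text \<open>The new residual is (y + t) / p with |t| at most (m/2) \<kappa> (p - 1)/2, and m
  \<kappa> / 4 is exactly the fixed point of this contraction.\<close>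

lemma residual_bound: "l < m ==> \<bar>real_of_int (measurement p \<Phi> (\<lambda>j. res p (x j) i) l)\<bar> \<le> Y + m * \<kappa> / 4"
proof (induction i)
  case 0
  have "0 \<le> m * \<kappa> / 4" using \<kappa>(2) by simp
  then show ?case using Y(1)[OF 0] by simp
next
  case (Suc i)
  let ?S = "{j \<in> {1..p}. x j ~= 0}"
  let ?y = "measurement p \<Phi> (\<lambda>j. res p (x j) i) l" and ?y' = "measurement p \<Phi> (\<lambda>j. res p (x j) (Suc i)) l"
  let ?t = "\<Sum>j = 1..p. \<Phi> (l + 1) j * - bal p (res p (x j) i)"
  have b0: "bal p (res p 0 i) = 0" unfolding res_0[OF podd p3] by (simp add: bal_def)
  have "?t = (\<Sum>j\<in>?S. \<Phi> (l + 1) j * - bal p (res p (x j) i))"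
   by (rule sum.mono_neutral_right) (use b0 in auto)
  then have "\<bar>real_of_int ?t\<bar> \<le> (\<Sum>j\<in>?S. \<bar>real_of_int (\<Phi> (l + 1) j * - bal p (res p (x j) i))\<bar>)"
   by (simp only: of_int_sum sum_abs)
  also have "\<dots> \<le> (\<Sum>j\<in>?S. \<kappa> * ((real p - 1) / 2))" by (rule sum_mono) (use product_bound[OF Suc.prems] in blast)
  also have "\<dots> = real (card ?S) * (\<kappa> * ((real p - 1) / 2))" by simp
  also have "\<dots> \<le> (real m / 2) * (\<kappa> * ((real p - 1) / 2))" using s \<kappa>(2) p3 by (intro mult_right_mono) simp_all
  finally have t: "\<bar>real_of_int ?t\<bar> \<le> (m * \<kappa> / 4) * (real p - 1)" by simp
  have "int p * ?y' = ?y + ?t" using measurement_step[OF podd p3, where \<Phi> = \<Phi> and x = x and i = i and l = l] by simp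
  then have "real_of_int (int p * ?y') = real_of_int (?y + ?t)" by (rule arg_cong)
  then have e: "real p * real_of_int ?y' = real_of_int ?y + real_of_int ?t" by (simp only: of_int_add of_int_mult of_int_of_nat_eq)
  have "real p * \<bar>real_of_int ?y'\<bar> = \<bar>real p * real_of_int ?y'\<bar>" by (simp add: abs_mult)
  also have "\<dots> = \<bar>real_of_int ?y + real_of_int ?t\<bar>" by (simp only: e)
  also have "\<dots> \<le> (Y + m * \<kappa> / 4) + (m * \<kappa> / 4) * (real p - 1)" using Suc.IH[OF Suc.prems] t by linarith
  also have "\<dots> = Y + real p * (m * \<kappa> / 4)" by (simp add: algebra_simps)
  also have "\<dots> \<le> real p * Y + real p * (m * \<kappa> / 4)" using Y(2) p3 mult_right_mono[of 1 "real p" Y] by simp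
  finally have "real p * \<bar>real_of_int ?y'\<bar> \<le> real p * (Y + m * \<kappa> / 4)" by (simp add: distrib_left)
  then show ?case using p3 by simp
qed

text \<open>Rounding costs at most 1 for each floor, that is 1 + m/2 in total. The slack between a
  third of the residual bound plus m \<kappa> / 4 and the allowed Y + m \<kappa> absorbs this once m
  is at least 2 and \<kappa> at least 1.7, a rational just below the square root of 3.\<close>

lemma partial_sum_bound:
  assumes l: "l < m" and t: "2 * t \<le> m" and j: "\<And>u. u < t ==> j u \<in> {1..p}"
  shows "\<bar>real_of_int (measurement p \<Phi> (\<lambda>j. res p (x j) i) l div int p + (\<Sum>u<t. (\<Phi> (l + 1) (j u) * - bal p (r u)) div int p))\<bar> \<le> Y + m * \<kappa>"
proof -
  let ?y = "measurement p \<Phi> (\<lambda>j. res p (x j) i) l" and ?v = "\<lambda>u. \<Phi> (l + 1) (j u) * - bal p (r u)"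
  have p: "0 < int p" "3 \<le> real p" using p3 by simp_all
  have 1: "\<bar>real_of_int (?y div int p)\<bar> \<le> (Y + m * \<kappa> / 4) / 3 + 1"
  proof -
   have "0 \<le> Y + m * \<kappa> / 4" using Y(2) \<kappa>(2) by simp
   then have "\<bar>real_of_int ?y\<bar> / real p \<le> (Y + m * \<kappa> / 4) / 3" using residual_bound[OF l] p by (intro frac_le) simp_all
   moreover have "\<bar>real_of_int (?y div int p)\<bar> \<le> \<bar>real_of_int ?y\<bar> / real p + 1"
    using abs_real_div_le[OF p(1), of ?y] by (simp only: of_int_of_nat_eq)
   ultimately show ?thesis by linarith
  qed
  have 2: "\<bar>real_of_int (?v u div int p)\<bar> \<le> \<kappa> / 2 + 1" if "u < t" for u
  proof -
   have "\<bar>real_of_int (?v u)\<bar> / real p \<le> \<kappa> * ((real p - 1) / 2) / real p"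
    using product_bound[OF l j[OF that]] p by (intro divide_right_mono) simp_all
   also have "\<dots> \<le> \<kappa> / 2" using p \<kappa>(2) by (simp add: field_simps)
   finally have "\<bar>real_of_int (?v u)\<bar> / real p \<le> \<kappa> / 2" .
   moreover have "\<bar>real_of_int (?v u div int p)\<bar> \<le> \<bar>real_of_int (?v u)\<bar> / real p + 1"
    using abs_real_div_le[OF p(1), of "?v u"] by (simp only: of_int_of_nat_eq)
   ultimately show ?thesis by linarith
  qed
  have "\<bar>real_of_int (\<Sum>u<t. ?v u div int p)\<bar> \<le> (\<Sum>u<t. \<bar>real_of_int (?v u div int p)\<bar>)" by (simp only: of_int_sum sum_abs)
  also have "\<dots> \<le> (\<Sum>u<t. \<kappa> / 2 + 1)" by (rule sum_mono) (use 2 in simp)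
  also have "\<dots> \<le> (real m / 2) * (\<kappa> / 2 + 1)" using t \<kappa>(2) by (simp add: mult_right_mono)
  finally have 3: "\<bar>real_of_int (\<Sum>u<t. ?v u div int p)\<bar> \<le> m * \<kappa> / 4 + m / 2" by (simp add: algebra_simps)
  have "real m * 1.7 \<le> m * \<kappa>" using \<kappa>(2) by (intro mult_left_mono) simp_all
  moreover have "2 \<le> real m" using m2 by simp
  moreover have "real m * 1.7 \<le> z ==> 2 \<le> real m ==> (Y + z / 4) / 3 + 1 + (z / 4 + m / 2) \<le> Y + z" for z
   using Y(2) by (simp add: add_divide_distrib)
  ultimately have "(Y + m * \<kappa> / 4) / 3 + 1 + (m * \<kappa> / 4 + m / 2) \<le> Y + m * \<kappa>" by blast
  then show ?thesis using 1 3 unfolding of_int_add by linarith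
qed

end

section \<open>The main loop\<close>

text \<open>The power in \<open>[8]\<close> is raised only if a residual is left: after the last
  round the next power of p could exceed M p.\<close>

definition main_body :: com where
  "main_body = reduce ;; roots ;; digits ;; update ;; scan ;;
   If (WLess (Const 0) (Reg 35)) (Do (ZOp [Const 8] ZMul [Const 8] [Const 3])) skip"

text \<open>\<open>[3]\<close> holds p as divisor and \<open>[8]\<close> the current power;
  \<open>[4]\<close> stays 0 for comparisons and negation. Register 41 holds (p - 1)/2, and register
  31 counts the roots, which survive from round to round.\<close>

definition main_init :: com where
  "main_init = Do (ZofW [Const 3] (Reg 0)) ;; Do (ZofW [Const 8] (Const 1)) ;; wsub 41 (Reg 0) (Const 1) ;;
   Do (WOp 41 WDiv (Reg 41) (Const 2)) ;; wset 31 (Const 0)"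

definition main :: com where
  "main = main_init ;; scan ;; While (WLess (Const 0) (Reg 35)) main_body"


text \<open>The part of the memory that the rounds only read.\<close>

definition base :: "'a::prime_card itself => nat => (nat => nat => int) => state => bool" where
  "base ty m \<Phi> s \<longleftrightarrow> canon CARD('a) s \<and> fe s [0] = (0 :: 'a mod_ring) \<and> regs s 0 = CARD('a) \<and> regs s 1 = m \<and>
   regs s 41 = (CARD('a) - 1) div 2 \<and> zmem s [3] = int CARD('a) \<and> zmem s [4] = 0 \<and>
   (\<forall>i\<in>{1..m}. \<forall>j\<in>{1..CARD('a)}. zmem s [0, i, j] = \<Phi> i j)"

lemma base_agree:
  assumes "base (TYPE('a::prime_card)) m \<Phi> s" "agree c s s'" "canon CARD('a) s'"
   and "0 \<notin> written wr_r c" "1 \<notin> written wr_r c" "41 \<notin> written wr_r c" "0 \<notin> written wr_f c"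
   and "0 \<notin> written wr_z c" "3 \<notin> written wr_z c" "4 \<notin> written wr_z c"
  shows "base (TYPE('a)) m \<Phi> s'"
  using assms(1,3) agree_regs[OF assms(2) assms(4)] agree_regs[OF assms(2) assms(5)] agree_regs[OF assms(2) assms(6)]
   agree_fe[OF assms(2) assms(7), of "[]", where 'a = 'a] agree_zmem[OF assms(2) assms(8)]
   agree_zmem[OF assms(2) assms(9)] agree_zmem[OF assms(2) assms(10)]
  unfolding base_def by (simp del: One_nat_def)

text \<open>All stored roots lie in the support of x, so their number stays within m/2 over all
  rounds. \<open>[8]\<close> is specified only while another round will use it, because it is not
  raised after the last one.\<close>

definition main_inv :: "'a::prime_card itself => nat => (nat => nat => int) => (nat => int) => nat => state => bool" where
  "main_inv ty m \<Phi> x i s \<longleftrightarrow> base ty m \<Phi> s \<and> inj_on (\<lambda>j. - fe s [20, j, 0] :: 'a mod_ring) {..<regs s 31} \<and>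
   (\<lambda>j. - fe s [20, j, 0]) ` {..<regs s 31} \<subseteq> (of_nat ` {j \<in> {1..CARD('a)}. x j ~= 0} :: 'a mod_ring set) \<and>
   (\<forall>l<m. zmem s [1, l] = measurement CARD('a) \<Phi> (\<lambda>j. res CARD('a) (x j) i) l) \<and>
   (\<forall>j\<in>{1..CARD('a)}. zmem s [2, j] = acc CARD('a) (x j) i) \<and>
   (regs s 35 = 0 \<longleftrightarrow> (\<forall>l<m. measurement CARD('a) \<Phi> (\<lambda>j. res CARD('a) (x j) i) l = 0)) \<and>
   (regs s 35 ~= 0 --> zmem s [8] = int CARD('a) ^ i)"

abbreviation resid :: "nat => (nat => nat => int) => (nat => int) => nat => nat => int" where
  "resid p \<Phi> x i l \<equiv> measurement p \<Phi> (\<lambda>j. res p (x j) i) l"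

abbreviation supp :: "nat => (nat => int) => nat set" where
  "supp p x \<equiv> {j \<in> {1..p}. x j ~= 0}"

context
  fixes W m K B :: nat and k :: "nat => int" and \<Phi> :: "nat => nat => int" and x :: "nat => int" and M :: int
   and \<kappa> Y :: real and ty :: "'a::prime_card itself"
  assumes W: "32 * m + 32 < W" and m2: "2 \<le> m" and Wp: "(m + 2) * CARD('a) < W" and odd: "odd CARD('a)" and p3: "3 \<le> CARD('a)"
   and K: "\<And>a b :: 'a mod_ring. a ~= b ==> \<exists>t\<le>K. t < CARD('a) \<and> \<not> inseparable a b t"
   and mp: "m \<le> CARD('a)"
   and k: "\<forall>j\<in>{1..CARD('a)}. 1 \<le> k j \<and> k j < int CARD('a)"
   and \<Phi>: "admissible_matrix CARD('a) m k \<Phi>"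
   and M: "\<And>j. j \<in> {1..CARD('a)} ==> \<bar>x j\<bar> \<le> M" "1 \<le> M"
   and \<kappa>: "\<And>l j. l < m ==> j \<in> {1..CARD('a)} ==> \<bar>real_of_int (\<Phi> (l + 1) j)\<bar> \<le> \<kappa>" "1.7 \<le> \<kappa>" "\<kappa> \<le> real CARD('a)"
   and Y: "\<And>l. l < m ==> \<bar>real_of_int (measurement CARD('a) \<Phi> x l)\<bar> \<le> Y" "0 \<le> Y"
   and s: "2 * card {j \<in> {1..CARD('a)}. x j ~= 0} \<le> m"
   and B1: "\<And>v. \<bar>v\<bar> \<le> M * int CARD('a) ==> zbd B v"
   and B2: "\<And>v. \<bar>real_of_int v\<bar> \<le> Y + m * \<kappa> ==> zbd B v"
begin

text \<open>A nonzero residual measurement needs a coordinate with nonzero residual, and for such a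
  coordinate \<open>res_bounds\<close> limits p^i. This bounds the number of rounds and the integer
  in \<open>[8]\<close> alike.\<close>

lemma active_power: "resid CARD('a) \<Phi> x i l ~= 0 ==> int CARD('a) ^ i \<le> 2 * M - 1"
proof -
  assume "resid CARD('a) \<Phi> x i l ~= 0"
  then obtain j where j: "j \<in> {1..CARD('a)}" "\<Phi> (l + 1) j * res CARD('a) (x j) i ~= 0"
   unfolding measurement_def by (rule sum.not_neutral_contains_not_neutral)
  then have "res CARD('a) (x j) i ~= 0" by auto
  from res_bounds(1)[OF odd p3 this] M(1)[OF j(1)] show ?thesis by linarith
qed

lemma MP: "3 * M \<le> M * int CARD('a)" "int CARD('a) \<le> M * int CARD('a)"
proof -
  have "M * 3 \<le> M * int CARD('a)" using M(2) p3 by (intro mult_left_mono) simp_all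
  then show "3 * M \<le> M * int CARD('a)" by simp
  have "1 * int CARD('a) \<le> M * int CARD('a)" using M(2) by (intro mult_right_mono) simp_all
  then show "int CARD('a) \<le> M * int CARD('a)" by simp
qed

lemma zbd_y: "l < m ==> zbd B (resid CARD('a) \<Phi> x i l)"
proof (rule B2)
  assume l: "l < m"
  have "0 \<le> m * \<kappa>" using \<kappa>(2) by simp
  then show "\<bar>real_of_int (resid CARD('a) \<Phi> x i l)\<bar> \<le> Y + m * \<kappa>" using residual_bound[OF odd p3 m2 \<kappa>(1,2) Y s l, of i] by linarith
qed

lemma zbd_\<Phi>: "l < m ==> j \<in> {1..CARD('a)} ==> zbd B (\<Phi> (l + 1) j)"
proof (rule B1)
  assume "l < m" "j \<in> {1..CARD('a)}"
  then have "\<bar>real_of_int (\<Phi> (l + 1) j)\<bar> \<le> real CARD('a)" using \<kappa>(1,3) order_trans by blast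
  then have "\<bar>\<Phi> (l + 1) j\<bar> \<le> int CARD('a)" by linarith
  then show "\<bar>\<Phi> (l + 1) j\<bar> \<le> M * int CARD('a)" using MP(2) by linarith
qed

lemma bal_le_M: "j \<in> {1..CARD('a)} ==> \<bar>bal CARD('a) (res CARD('a) (x j) i)\<bar> \<le> M"
  using bal_props(3)[OF odd, of "res CARD('a) (x j) i"] res_bounds(2)[OF odd p3, of "x j" i] M(1)[of j] by linarith

text \<open>Splitting is charged only to the roots that are new in this round, nf minus the old
  count; everything else costs O(m^2).\<close>

lemma trm_iteration:
  assumes inv: "main_inv TYPE('a) m \<Phi> x i \<sigma>" and act: "regs \<sigma> 35 ~= 0"
  defines "E \<equiv> 280 * (bits ((CARD('a) - 1) div 2) + 13) + 4"
  shows "\<exists>nf. regs \<sigma> 31 \<le> nf \<and> nf \<le> m \<and>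
   trm CARD('a) W main_body \<sigma> (440 * (m + 1) ^ 2 + E * (nf - regs \<sigma> 31)\<^sup>2 * (K + 2)) (60 * (m + 1) ^ 2) B
    (\<lambda>s. main_inv TYPE('a) m \<Phi> x (Suc i) s \<and> regs s 31 = nf)"
proof -
  let ?F = "fe :: state => nat list => 'a mod_ring" and ?p = "CARD('a)"
  let ?r = "\<lambda>j. res ?p (x j) i"
  have m0: "0 < m" using m2 by simp
  have pW: "?p < W" using Wp by simp
  define nf where "nf = regs \<sigma> 31"
  define w where "w b = (of_int (k (index b) * ?r (index b)) :: 'a mod_ring)" for b :: "'a mod_ring"
  define R where "R = (\<lambda>j. - ?F \<sigma> [20, j, 0]) ` {..<nf} \<union> {b. w b ~= 0}"
  have base0: "base TYPE('a) m \<Phi> \<sigma>" and inj0: "inj_on (\<lambda>j. - ?F \<sigma> [20, j, 0]) {..<nf}"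
   and sub0: "(\<lambda>j. - ?F \<sigma> [20, j, 0]) ` {..<nf} \<subseteq> of_nat ` supp CARD('a) x"
   and y0: "\<forall>l<m. zmem \<sigma> [1, l] = resid CARD('a) \<Phi> x i l" and x0: "\<forall>j\<in>{1..?p}. zmem \<sigma> [2, j] = acc ?p (x j) i"
   and P0: "zmem \<sigma> [8] = int ?p ^ i" and nz: "\<not> (\<forall>l<m. resid CARD('a) \<Phi> x i l = 0)"
   using inv act unfolding main_inv_def nf_def by blast+
  note bs = base_def[of "TYPE('a)" m \<Phi>]
  have pow: "int ?p ^ i \<le> 2 * M - 1" using nz active_power by blast
  have wsub: "{b. w b ~= 0} \<subseteq> of_nat ` supp CARD('a) x"
  proof
   fix b assume "b \<in> {b. w b ~= 0}"
   then have "?r (index b) ~= 0" by (auto simp: w_def)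
   then have "x (index b) ~= 0" using res_0[OF odd p3, of i] by auto
   then show "b \<in> of_nat ` supp CARD('a) x" using index[of b] by (intro image_eqI[of _ _ "index b"]) simp_all
  qed
  have Rsub: "R \<subseteq> of_nat ` supp CARD('a) x" unfolding R_def using sub0 wsub by blast
  have "card R \<le> card (supp CARD('a) x)" by (rule surj_card_le[OF _ Rsub]) simp
  then have cR: "2 * card R \<le> m" "card R \<le> m" using s by linarith+
  have nfR: "nf \<le> card R"
  proof -
   have "nf = card ((\<lambda>j. - ?F \<sigma> [20, j, 0]) ` {..<nf})" using card_image[OF inj0] by simp
   also have "\<dots> \<le> card R" by (rule card_mono) (auto simp: R_def)
   finally show ?thesis .
  qed
  have mom: "of_int (resid CARD('a) \<Phi> x i l) = (\<Sum>b\<in>UNIV. w b * b ^ l)" if "l < m" for l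
   unfolding w_def by (rule of_int_measurement[OF k \<Phi> that])
  let ?C = "E * (card R - nf)\<^sup>2 * (K + 2)"
  let ?T = "(m + 1) ^ 2"
  let ?Q = "\<lambda>s. main_inv TYPE('a) m \<Phi> x (Suc i) s \<and> regs s 31 = card R"
  let ?end = "If (WLess (Const 0) (Reg 35)) (Do (ZOp [Const 8] ZMul [Const 8] [Const 3])) skip"
  have p0: "0 < ?p" by (rule p_pos)
  have c0: "canon ?p \<sigma>" and r0: "regs \<sigma> 1 = m" using base0 unfolding bs by blast+
  have zy: "zbd B (zmem \<sigma> [1, l])" if "l < m" for l using y0 that zbd_y by (simp del: One_nat_def)
  have "trm ?p W main_body \<sigma> ((2 + m * 4) + ((370 * ?T + ?C) + (30 * ?T + (20 * ?T + ((3 + m * 4) + 2)))))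
   (m * 2 + (0 + (20 * m + (20 * ?T + (m * 2 + 2))))) B ?Q"
   unfolding main_body_def
  proof (rule trm_Seq'[OF p0 c0 trm_reduce[OF W m0 c0 r0 zy]], assumption)
   fix s1 assume q1: "\<forall>l<m. ?F s1 [28, l] = of_int (zmem \<sigma> [1, l]) \<and> ?F s1 [10, l] = of_int (zmem \<sigma> [1, l])"
    and ag1: "agree reduce \<sigma> s1" and c1: "canon ?p s1"
   have base1: "base TYPE('a) m \<Phi> s1" by (rule base_agree[OF base0 ag1 c1]) (simp_all add: reduce_def reduce_step_def)
   have z1: "zmem s1 (a # as) = zmem \<sigma> (a # as)" for a as using agree_zmem[OF ag1] by (simp add: reduce_def reduce_step_def)
   have f1: "?F s1 (20 # as) = ?F \<sigma> (20 # as)" for as using agree_fe[OF ag1, of 20 as, where 'a = 'a] by (simp add: reduce_def reduce_step_def)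
   have r1: "regs s1 31 = nf" using agree_regs[OF ag1, of 31] by (simp add: reduce_def reduce_step_def nf_def)
   have s10: "?F s1 [10, l] = (\<Sum>b\<in>UNIV. w b * b ^ l)" "?F s1 [28, l] = (\<Sum>b\<in>UNIV. w b * b ^ l)" if "l < m" for l
    using q1 y0 mom[OF that] that by (simp_all del: One_nat_def)
   have b1: "canon ?p s1" "?F s1 [0] = 0" "regs s1 0 = ?p" "regs s1 1 = m" using base1 unfolding bs by blast+
   have inj1: "inj_on (\<lambda>j. - ?F s1 [20, j, 0]) {..<nf}" using inj0 unfolding f1 .
   have R1: "R = (\<lambda>j. - ?F s1 [20, j, 0]) ` {..<nf} \<union> {b. w b ~= 0}" unfolding R_def f1 ..
   have rt: "trm ?p W roots s1 (370 * ?T + ?C) 0 B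
    (\<lambda>s. regs s 31 = card R \<and> bij_betw (\<lambda>j. - ?F s [20, j, 0]) {..<card R} R \<and> nf \<le> card R \<and>
     (\<forall>i\<le>m. ?F s [26, i] = coeff (linprod R) i))"
    unfolding E_def R1
    by (rule trm_roots[OF W m0 pW odd K b1(1,2,3,4) r1 s10(1) inj1 cR(1)[unfolded R1]])
   show "trm ?p W (roots ;; digits ;; update ;; scan ;; ?end) s1
    ((370 * ?T + ?C) + (30 * ?T + (20 * ?T + ((3 + m * 4) + 2)))) (0 + (20 * m + (20 * ?T + (m * 2 + 2)))) B ?Q"
   proof (rule trm_Seq'[OF p0 c1 rt], elim conjE)
    fix s2 assume r2: "regs s2 31 = card R" and bij2: "bij_betw (\<lambda>j. - ?F s2 [20, j, 0]) {..<card R} R"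
     and P2: "\<forall>i\<le>m. ?F s2 [26, i] = coeff (linprod R) i" and ag2: "agree roots s1 s2" and c2: "canon ?p s2"
    have base2: "base TYPE('a) m \<Phi> s2" by (rule base_agree[OF base1 ag2 c2]) (simp_all add: root_defs)
    have z2: "zmem s2 (a # as) = zmem \<sigma> (a # as)" for a as using agree_zmem[OF ag2] z1 by (simp add: root_defs)
    have f2: "?F s2 [28, l] = (\<Sum>b\<in>UNIV. of_int (k (index b) * ?r (index b)) * b ^ l)" if "l < m" for l
     using agree_fe[OF ag2, of 28 "[l]", where 'a = 'a] s10(2)[OF that] unfolding w_def by (simp add: root_defs)
    have b2: "?F s2 [0] = 0" "regs s2 0 = ?p" "regs s2 1 = m" "regs s2 41 = (?p - 1) div 2" "zmem s2 [3] = int ?p" "zmem s2 [4] = 0"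
     and \<Phi>2: "\<And>i j. i \<in> {1..m} ==> j \<in> {1..?p} ==> zmem s2 [0, i, j] = \<Phi> i j" using base2 unfolding bs by blast+
    have P8: "zmem s2 [8] = int ?p ^ i" using z2 P0 by simp
    have one: "1 \<in> {1..m}" using m0 by simp
    have \<Phi>k: "[zmem s2 [0, 1, j] = k j] (mod int ?p)" if j: "j \<in> {1..?p}" for j
    proof -
     have "[\<Phi> 1 j = k j * int j ^ (1 - 1)] (mod int ?p)" using \<Phi> one j unfolding admissible_matrix_def by blast
     then show ?thesis using \<Phi>2[OF one j] by (simp del: One_nat_def) 
    qed
    have kj: "1 \<le> k j \<and> k j < int ?p" if "j \<in> {1..?p}" for j using k that by blast
    have w0: "(of_int (?r (index b)) :: 'a mod_ring) = 0" if "b \<notin> R" for b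
    proof -
     have "w b = 0" using that unfolding R_def by blast
     then show ?thesis using k_neq_0[OF k \<Phi> index(1), of b] by (simp add: w_def)
    qed
    have zp: "zbd B (int ?p)" by (rule B1) (use MP(2) in simp)
    then have pB: "?p \<le> B" by (simp add: zbd_def)
    have zP: "zbd B (int ?p ^ i)"
    proof (rule B1)
     have "\<bar>int ?p ^ i\<bar> = int ?p ^ i" by simp
     then show "\<bar>int ?p ^ i\<bar> \<le> M * int ?p" using pow MP(1) M(2) by linarith
    qed
    have zd: "zbd B (zmem s2 [0, 1, j]) \<and> zbd B (int ?p ^ i * bal ?p (?r j)) \<and>
     zbd B (zmem s2 [2, j]) \<and> zbd B (zmem s2 [2, j] + int ?p ^ i * bal ?p (?r j))" if j: "j \<in> {1..?p}" for j
    proof (intro conjI)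
     note db = digit_bounds[OF odd p3 M(1)[OF j]]
     have xj: "zmem s2 [2, j] = acc ?p (x j) i" using z2[of 2 "[j]"] x0 j by simp
     show "zbd B (zmem s2 [0, 1, j])" using zbd_\<Phi>[OF m0 j] \<Phi>2[OF one j] by simp
     show "zbd B (int ?p ^ i * bal ?p (?r j))" by (rule B1[OF db(2)])
     show "zbd B (zmem s2 [2, j])" unfolding xj by (rule B1[OF db(1)])
     show "zbd B (zmem s2 [2, j] + int ?p ^ i * bal ?p (?r j))"
     unfolding xj acc_simps(2)[OF odd p3, symmetric] by (rule B1[OF db(1)])
    qed
    let ?c = "\<lambda>u. - ?F s2 [20, u, 0]"
    have P2': "?F s2 [26, i] = coeff (linprod R) i" if "i \<le> m" for i using P2 that by blast
    have dg: "trm ?p W digits s2 (30 * ?T) (20 * m) B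
     (\<lambda>s. (\<forall>u<card R. wmem s [3, u] = index (?c u) \<and> zmem s [6, u] = - bal ?p (?r (index (?c u)))) \<and>
     (\<forall>j\<in>{1..?p}. zmem s [2, j] = zmem s2 [2, j] + int ?p ^ i * bal ?p (?r j)))"
     by (rule trm_digits[OF W m0 pW c2 b2(1,2,3) r2 b2(4,5,6) P8 \<Phi>k kj bij2 cR(2) P2' f2 w0 pB zP zd])
    show "trm ?p W (digits ;; update ;; scan ;; ?end) s2
     (30 * ?T + (20 * ?T + ((3 + m * 4) + 2))) (20 * m + (20 * ?T + (m * 2 + 2))) B ?Q"
    proof (rule trm_Seq'[OF p0 c2 dg], elim conjE)
     fix s3 assume d3: "\<forall>u<card R. wmem s3 [3, u] = index (?c u) \<and> zmem s3 [6, u] = - bal ?p (?r (index (?c u)))"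
     and x3: "\<forall>j\<in>{1..?p}. zmem s3 [2, j] = zmem s2 [2, j] + int ?p ^ i * bal ?p (?r j)"
     and ag3: "agree digits s2 s3" and c3: "canon ?p s3"
     have base3: "base TYPE('a) m \<Phi> s3" by (rule base_agree[OF base2 ag3 c3]) (simp_all add: digit_defs)
     have r3: "regs s3 31 = card R" using agree_regs[OF ag3, of 31] r2 by (simp add: digit_defs)
     have f3: "?F s3 (20 # as) = ?F s2 (20 # as)" for as using agree_fe[OF ag3, of 20 as, where 'a = 'a] by (simp add: digit_defs)
     have z3: "zmem s3 (1 # as) = zmem \<sigma> (1 # as)" "zmem s3 (8 # as) = zmem \<sigma> (8 # as)" for as
     using agree_zmem[OF ag3] z2 by (simp_all add: digit_defs)
     have b3: "regs s3 0 = ?p" "regs s3 1 = m" "zmem s3 [3] = int ?p" 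
     and \<Phi>3: "\<And>i j. i \<in> {1..m} ==> j \<in> {1..?p} ==> zmem s3 [0, i, j] = \<Phi> i j" using base3 unfolding bs by blast+
     define v where "v l u = zmem s3 [0, Suc l, wmem s3 [3, u]] * zmem s3 [6, u]" for l u
     have v: "v l u = \<Phi> (l + 1) (index (?c u)) * - bal ?p (?r (index (?c u)))" if "l < m" "u < card R" for l u
     proof -
     have "zmem s3 [0, Suc l, index (?c u)] = \<Phi> (Suc l) (index (?c u))" by (rule \<Phi>3) (use that index(1) in auto)
     then show ?thesis using d3 that unfolding v_def by simp
     qed
     have y3: "zmem s3 [1, l] = resid CARD('a) \<Phi> x i l" if "l < m" for l using z3(1)[of "[l]"] y0 that by simp
     \<comment> \<open>Columns outside R have digit 0, so the sum over the stored roots is the full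
       matrix product and \<open>measurement_step\<close> applies.\<close>
     have sumv: "resid CARD('a) \<Phi> x i l + (\<Sum>u<card R. v l u) = int ?p * resid CARD('a) \<Phi> x (Suc i) l" if l: "l < m" for l
     proof -
     let ?g = "\<lambda>j. \<Phi> (l + 1) j * - bal ?p (?r j)"
     have "(\<Sum>u<card R. v l u) = (\<Sum>u<card R. ?g (index (?c u)))" using v[OF l] by simp
     also have "\<dots> = (\<Sum>b\<in>R. ?g (index b))" by (rule sum.reindex_bij_betw[OF bij2])
     also have "\<dots> = (\<Sum>b\<in>(UNIV :: 'a mod_ring set). ?g (index b))"
     proof (rule sum.mono_neutral_left)
     show "\<forall>b\<in>(UNIV :: 'a mod_ring set) - R. ?g (index b) = 0"
     proof
     fix b assume "b \<in> UNIV - R"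
     then have "int ?p dvd ?r (index b)" using w0[of b] by (simp add: of_int_eq_0_iff_dvd)
     then show "?g (index b) = 0" by (simp add: bal_def)
     qed
     qed simp_all
     also have "\<dots> = (\<Sum>j = 1..?p. ?g j)" by (rule sum_index)
     finally show ?thesis using measurement_step[OF odd p3, of \<Phi> x i l] by simp
     qed
     then have quot: "(resid CARD('a) \<Phi> x i l + (\<Sum>u<card R. v l u)) div int ?p = resid CARD('a) \<Phi> x (Suc i) l" if "l < m" for l using that p0 by simp
     have zn: "zbd B (int (card R + 1))"
     proof (rule B1)
     have "card R + 1 \<le> ?p" using cR(1) mp p3 by linarith
     then show "\<bar>int (card R + 1)\<bar> \<le> M * int ?p" using MP(2) by linarith
     qed
     have z6: "zbd B (zmem s3 [6, u])" if "u < card R" for u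
     proof (rule B1)
     have "\<bar>zmem s3 [6, u]\<bar> \<le> M" using bal_le_M[OF index(1), of "?c u" i] d3 that by simp
     then show "\<bar>zmem s3 [6, u]\<bar> \<le> M * int ?p" using MP(1) M(2) by linarith
     qed
     have Bl: "zbd B (zmem s3 [1, l]) \<and> zbd B ((zmem s3 [1, l] + (\<Sum>u<card R. zmem s3 [0, Suc l, wmem s3 [3, u]] * zmem s3 [6, u])) div int ?p)"
     if "l < m" for l
     unfolding y3[OF that] v_def[symmetric] quot[OF that] using zbd_y[OF that] by blast
     have Bu: "zbd B (zmem s3 [0, Suc l, wmem s3 [3, u]]) \<and> zbd B (zmem s3 [0, Suc l, wmem s3 [3, u]] * zmem s3 [6, u])"
     if l: "l < m" and u: "u < card R" for l u
     proof
     let ?j = "index (?c u)"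
     have w3: "wmem s3 [3, u] = ?j" using d3 u by blast
     have "zmem s3 [0, Suc l, ?j] = \<Phi> (l + 1) ?j" using \<Phi>3[of "Suc l" ?j] index(1)[of "?c u"] l by simp
     then show "zbd B (zmem s3 [0, Suc l, wmem s3 [3, u]])" using zbd_\<Phi>[OF l index(1), of "?c u"] unfolding w3 by simp
     have "\<bar>\<Phi> (l + 1) ?j * - bal ?p (?r ?j)\<bar> \<le> int ?p * M"
     unfolding abs_mult abs_minus_cancel
     proof (rule mult_mono)
     have "\<bar>real_of_int (\<Phi> (l + 1) ?j)\<bar> \<le> real ?p" using \<kappa>(1)[OF l index(1), of "?c u"] \<kappa>(3) by linarith
     then show "\<bar>\<Phi> (l + 1) ?j\<bar> \<le> int ?p" by linarith
     show "\<bar>bal ?p (?r ?j)\<bar> \<le> M" by (rule bal_le_M[OF index(1)])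
     qed simp_all
     then show "zbd B (zmem s3 [0, Suc l, wmem s3 [3, u]] * zmem s3 [6, u])"
     unfolding v_def[symmetric] v[OF l u] by (intro B1) (simp add: mult.commute)
     qed
     have Bt: "zbd B (zmem s3 [1, l] div int ?p + (\<Sum>u<t. zmem s3 [0, Suc l, wmem s3 [3, u]] * zmem s3 [6, u] div int ?p))"
     if l: "l < m" and t: "t \<le> card R" for l t
     proof (rule B2)
     have "(\<Sum>u<t. v l u div int ?p) = (\<Sum>u<t. (\<Phi> (l + 1) (index (?c u)) * - bal ?p (?r (index (?c u)))) div int ?p)"
     by (rule sum.cong) (use v[OF l] t in simp_all)
     moreover have t2: "2 * t \<le> m" using t cR(1) by linarith
     note partial_sum_bound[OF odd p3 m2 \<kappa>(1,2) Y s l t2, of "\<lambda>u. index (?c u)" i "\<lambda>u. ?r (index (?c u))", OF _ _ _ index(1)]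
     ultimately show "\<bar>real_of_int (zmem s3 [1, l] div int ?p + (\<Sum>u<t. zmem s3 [0, Suc l, wmem s3 [3, u]] * zmem s3 [6, u] div int ?p))\<bar> \<le> Y + m * \<kappa>"
     unfolding y3[OF l] v_def[symmetric] by simp
     qed
     have up: "trm ?p W update s3 (20 * ?T) (20 * ?T) B (\<lambda>s. \<forall>l<m. zmem s [1, l] = resid CARD('a) \<Phi> x (Suc i) l)"
     by (rule trm_mono[OF trm_update[OF W m0 p0 c3 Wp b3(1,2) r3 cR(2) b3(3) zp zn z6 Bl Bu Bt] order_refl order_refl order_refl])
     (use y3 quot in \<open>simp_all add: v_def del: One_nat_def\<close>)
     show "trm ?p W (update ;; scan ;; ?end) s3 (20 * ?T + ((3 + m * 4) + 2)) (20 * ?T + (m * 2 + 2)) B ?Q"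
     proof (rule trm_Seq'[OF p0 c3 up])
     fix s4 assume y4: "\<forall>l<m. zmem s4 [1, l] = resid CARD('a) \<Phi> x (Suc i) l" and ag4: "agree update s3 s4" and c4: "canon ?p s4"
     have base4: "base TYPE('a) m \<Phi> s4" by (rule base_agree[OF base3 ag4 c4]) (simp_all add: update_defs)
     have b4: "regs s4 1 = m" "zmem s4 [4] = 0" using base4 unfolding bs by blast+
     have r4: "regs s4 31 = card R" using agree_regs[OF ag4, of 31] r3 by (simp add: update_defs)
     have f4: "?F s4 (20 # as) = ?F s2 (20 # as)" for as using agree_fe[OF ag4, of 20 as, where 'a = 'a] f3 by (simp add: update_defs)
     have z4: "zmem s4 (2 # as) = zmem s3 (2 # as)" "zmem s4 (8 # as) = zmem \<sigma> (8 # as)" for as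
     using agree_zmem[OF ag4] z3 by (simp_all add: update_defs)
     have zy4: "zbd B (zmem s4 [1, l])" if "l < m" for l using y4 that zbd_y by (simp del: One_nat_def)
     show "trm ?p W (scan ;; ?end) s4 ((3 + m * 4) + 2) (m * 2 + 2) B ?Q"
     proof (rule trm_Seq'[OF p0 c4 trm_scan[OF W m0 p0 c4 b4 zy4]], assumption)
     fix s5 assume q5: "regs s5 35 = 0 \<longleftrightarrow> (\<forall>l<m. zmem s4 [1, l] = 0)" and ag5: "agree scan s4 s5" and c5: "canon ?p s5"
     have base5: "base TYPE('a) m \<Phi> s5" by (rule base_agree[OF base4 ag5 c5]) (simp_all add: scan_def scan_step_def)
     have b5: "zmem s5 [3] = int ?p" using base5 unfolding bs by blast
     have r5: "regs s5 31 = card R" using agree_regs[OF ag5, of 31] r4 by (simp add: scan_def scan_step_def)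
     have f5: "?F s5 (20 # as) = ?F s2 (20 # as)" for as using agree_fe[OF ag5, of 20 as, where 'a = 'a] f4 by (simp add: scan_def scan_step_def)
     have z5: "zmem s5 (a # as) = zmem s4 (a # as)" for a as using agree_zmem[OF ag5] by (simp add: scan_def scan_step_def)
     have P5: "zmem s5 [8] = int ?p ^ i" using z5 z4 P0 by simp
     have q5': "regs s5 35 = 0 \<longleftrightarrow> (\<forall>l<m. resid CARD('a) \<Phi> x (Suc i) l = 0)" using q5 y4 by (simp del: One_nat_def)
     define s6 where "s6 = ev ?p W ?end s5"
     have s6: "regs s6 31 = card R" "regs s6 35 = regs s5 35" "?F s6 = ?F s5" using r5 by (simp_all add: s6_def)
     have z6': "zmem s6 (a # as) = zmem s5 (a # as)" if "a ~= 8" for a as using that by (simp add: s6_def)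
     have ev_ag: "agree ?end s5 s6"
     unfolding agree_def by (auto simp: s6_def)
     have c6: "canon ?p s6" using c5 by (simp add: s6_def canon_def)
     have base6: "base TYPE('a) m \<Phi> s6" by (rule base_agree[OF base5 ev_ag c6]) simp_all
     have zP: "zbd B (int ?p ^ i)"
    proof (rule B1)
     have "\<bar>int ?p ^ i\<bar> = int ?p ^ i" by simp
     then show "\<bar>int ?p ^ i\<bar> \<le> M * int ?p" using pow MP(1) M(2) by linarith
    qed
     \<comment> \<open>The test of register 35 matters here: a remaining residual guarantees that
       p^(i + 1) is at most 2M - 1.\<close>
     have zP': "zbd B (int ?p ^ i * int ?p)" if a35: "regs s5 35 ~= 0"
     proof (rule B1)
     have nz': "\<not> (\<forall>l<m. resid CARD('a) \<Phi> x (Suc i) l = 0)" by (rule a35[unfolded q5'])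
     have "int ?p ^ Suc i \<le> 2 * M - 1"
     proof (rule ccontr)
     assume "\<not> int ?p ^ Suc i \<le> 2 * M - 1"
     then have "resid CARD('a) \<Phi> x (Suc i) l = 0" for l using active_power[of "Suc i" l] by (rule contrapos_np)
     then show False using nz' by (elim notE) (intro allI impI)
     qed
     moreover have "\<bar>int ?p ^ i * int ?p\<bar> = int ?p ^ Suc i" by (simp add: mult.commute)
     ultimately show "\<bar>int ?p ^ i * int ?p\<bar> \<le> M * int ?p" using MP(1) M(2) by linarith
     qed
     have zg: "zgood ?p W B ?end s5" using zP zP' zp P5 b5 by (simp add: zval_def)
     have P6: "regs s6 35 ~= 0 --> zmem s6 [8] = int ?p ^ Suc i" using P5 b5 by (simp add: s6_def zval_def mult.commute)
     have im: "(\<lambda>j. - ?F s2 [20, j, 0]) ` {..<card R} = R" by (rule bij_betw_imp_surj_on[OF bij2])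
     have "main_inv TYPE('a) m \<Phi> x (Suc i) s6"
     unfolding main_inv_def
     proof (intro conjI)
     show "base TYPE('a) m \<Phi> s6" by (rule base6)
     show "inj_on (\<lambda>j. - ?F s6 [20, j, 0]) {..<regs s6 31}"
     unfolding s6 f5 by (rule bij_betw_imp_inj_on[OF bij2])
     show "(\<lambda>j. - ?F s6 [20, j, 0]) ` {..<regs s6 31} \<subseteq> of_nat ` supp CARD('a) x"
     unfolding s6 f5 im by (rule Rsub)
     show "\<forall>l<m. zmem s6 [1, l] = resid CARD('a) \<Phi> x (Suc i) l" using y4 z5 z6' by (simp del: One_nat_def)
     show "\<forall>j\<in>{1..?p}. zmem s6 [2, j] = acc ?p (x j) (Suc i)"
     unfolding acc_simps(2)[OF odd p3] using x3 x0 z5 z6' z4 z2 by simp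
     show "regs s6 35 = 0 \<longleftrightarrow> (\<forall>l<m. resid CARD('a) \<Phi> x (Suc i) l = 0)" unfolding s6 by (rule q5')
     qed (rule P6)
     then have Q6: "?Q (ev ?p W ?end s5)" using s6 unfolding s6_def[symmetric] by blast
     have "trm ?p W ?end s5 (steps ?end) (steps ?end) B ?Q" by (rule trm_ev[where Q = ?Q, OF _ zg Q6]) simp
     moreover have "steps ?end \<le> 2" by simp
     ultimately show "trm ?p W ?end s5 2 2 B ?Q" by (elim trm_mono) (assumption | rule order_refl)+
     qed
     qed
    qed
   qed
  qed
  then have "trm ?p W main_body \<sigma> (440 * ?T + ?C) (60 * ?T) B ?Q"
   by (elim trm_mono) (assumption | simp add: power2_eq_square algebra_simps)+
  then show ?thesis using nfR cR(2) unfolding nf_def by blast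
qed

text \<open>The potential must be a function of the state, while the round number occurs in the loop
  invariant only under an existential quantifier; it is recovered from the power in
  \<open>[8]\<close>.\<close>

definition level :: "int => nat" where "level v = (THE i. v = int CARD('a) ^ i)"

lemma level_power: "level (int CARD('a) ^ i) = i"
  unfolding level_def using p3 by (intro the_equality) (auto simp: power_inject_exp)

text \<open>The root counts increase through the rounds and the squares of their increments sum to
  at most m^2, so the costly splitting is paid once and not once per round.\<close>

theorem trm_main:
  assumes base: "base TYPE('a) m \<Phi> (ev CARD('a) W main_init \<sigma>)"
   and y: "\<And>l. l < m ==> zmem \<sigma> [1, l] = measurement CARD('a) \<Phi> x l" and z2: "\<And>j. zmem \<sigma> [2, j] = 0"
   and c: "canon CARD('a) \<sigma>" and r: "regs \<sigma> 0 = CARD('a)"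
   and N: "\<And>i. int CARD('a) ^ i \<le> 2 * M - 1 ==> i < N"
  defines "E \<equiv> 280 * (bits ((CARD('a) - 1) div 2) + 13) + 4"
  shows "trm CARD('a) W main \<sigma> (10 * (m + 1) ^ 2 + N * (441 * (m + 1) ^ 2) + E * (K + 2) * m\<^sup>2) (10 * (m + 1) ^ 2 + N * (60 * (m + 1) ^ 2)) B
   (\<lambda>s. \<forall>j\<in>{1..CARD('a)}. zmem s [2, j] = x j)"
proof -
  let ?p = "CARD('a)" and ?T = "(m + 1) ^ 2"
  let ?loop = "While (WLess (Const 0) (Reg 35)) main_body"
  let ?Q = "\<lambda>s. \<forall>j\<in>{1..?p}. zmem s [2, j] = x j"
  \<comment> \<open>A round is given 441 units of (m + 1)^2: 440 from \<open>trm_iteration\<close>,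
    and one more that covers the test. A state about to leave the loop keeps no potential.\<close>
  let ?\<Psi> = "\<lambda>s. if regs s 35 = 0 then 0 else (N - level (zmem s [8])) * (441 * ?T) + E * (K + 2) * (m - regs s 31)\<^sup>2"
  let ?\<Omega> = "\<lambda>s. if regs s 35 = 0 then 0 else (N - level (zmem s [8])) * (60 * ?T)"
  let ?I = "\<lambda>s. \<exists>i. main_inv TYPE('a) m \<Phi> x i s"
  have p0: "0 < ?p" by (rule p_pos)
  have m0: "0 < m" using m2 by simp
  have pW: "?p < W" using Wp by simp
  have loop: "trm ?p W ?loop s (Suc (?\<Psi> s)) (?\<Omega> s) B ?Q" if inv: "main_inv TYPE('a) m \<Phi> x 0 s" for s
  proof (rule trm_mono[OF trm_While[where I = ?I and \<Psi> = ?\<Psi> and \<Phi> = ?\<Omega>] order_refl order_refl order_refl])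
   show "?I s" using inv by blast
   fix s assume "?I s" and b: "cond_val (WLess (Const 0) (Reg 35)) s"
   then obtain i where i: "main_inv TYPE('a) m \<Phi> x i s" by blast
   have act: "regs s 35 ~= 0" using b by simp
   obtain nf where nf: "regs s 31 \<le> nf" "nf \<le> m"
    and t: "trm ?p W main_body s (440 * ?T + E * (nf - regs s 31)\<^sup>2 * (K + 2)) (60 * ?T) B
     (\<lambda>s. main_inv TYPE('a) m \<Phi> x (Suc i) s \<and> regs s 31 = nf)"
    using trm_iteration[OF i act] unfolding E_def by blast
   have lev: "level (zmem s [8]) = i" and nz: "\<not> (\<forall>l<m. resid CARD('a) \<Phi> x i l = 0)" using i act level_power unfolding main_inv_def by simp_all
   have iN: "i < N" using nz active_power N by blast
   define T1 where "T1 = 440 * ?T + E * (nf - regs s 31)\<^sup>2 * (K + 2)"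
   have dec: "T1 + 1 + ?\<Psi> s' \<le> ?\<Psi> s \<and> 60 * ?T + ?\<Omega> s' \<le> ?\<Omega> s" if s': "main_inv TYPE('a) m \<Phi> x (Suc i) s'" "regs s' 31 = nf" for s'
   proof -
    define a where "a = nf - regs s 31"
    define b where "b = m - nf"
    define n where "n = N - Suc i"
    have e: "m - regs s 31 = a + b" "N - i = Suc n" using nf iN by (simp_all add: a_def b_def n_def)
    have le: "?\<Psi> s' \<le> n * (441 * ?T) + E * (K + 2) * b\<^sup>2" "?\<Omega> s' \<le> n * (60 * ?T)"
     using s' level_power[of "Suc i"] unfolding main_inv_def by (auto simp: b_def n_def)
    have "a\<^sup>2 + b\<^sup>2 \<le> (a + b)\<^sup>2" by (simp add: power2_sum)
    then have "E * (K + 2) * (a\<^sup>2 + b\<^sup>2) \<le> E * (K + 2) * (a + b)\<^sup>2" by (rule mult_left_mono) simp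
    then have A: "E * (K + 2) * a\<^sup>2 + E * (K + 2) * b\<^sup>2 \<le> E * (K + 2) * (a + b)\<^sup>2" by (simp only: distrib_left)
    have T1: "T1 = 440 * ?T + E * (K + 2) * a\<^sup>2" by (simp only: T1_def a_def mult.assoc mult.commute mult.left_commute)
    have P: "?\<Psi> s = 441 * ?T + n * (441 * ?T) + E * (K + 2) * (a + b)\<^sup>2" "?\<Omega> s = 60 * ?T + n * (60 * ?T)"
     using act lev e by (simp_all only: if_False mult_Suc)
    have gen: "T1 + 1 + P' \<le> P \<and> 60 * t + O' \<le> O1"
     if "a1 + b1 \<le> c1" "T1 = 440 * t + a1" "P = 441 * t + n1 + c1" "O1 = 60 * t + n2" "P' \<le> n1 + b1" "O' \<le> n2" "1 \<le> t"
     for P P' O1 O' a1 b1 c1 t n1 n2 :: nat using that by linarith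
    show ?thesis by (rule gen[OF A T1 P le]) simp
   qed
   show "\<exists>T Z. trm ?p W main_body s T Z B (\<lambda>s'. ?I s' \<and> T + 1 + ?\<Psi> s' \<le> ?\<Psi> s \<and> Z + ?\<Omega> s' \<le> ?\<Omega> s)"
   proof (intro exI)
    show "trm ?p W main_body s T1 (60 * ?T) B (\<lambda>s'. ?I s' \<and> T1 + 1 + ?\<Psi> s' \<le> ?\<Psi> s \<and> 60 * ?T + ?\<Omega> s' \<le> ?\<Omega> s)"
    proof (rule trm_mono[OF t])
     fix s' assume h: "main_inv TYPE('a) m \<Phi> x (Suc i) s' \<and> regs s' 31 = nf"
     show "?I s' \<and> T1 + 1 + ?\<Psi> s' \<le> ?\<Psi> s \<and> 60 * ?T + ?\<Omega> s' \<le> ?\<Omega> s"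
     using dec[OF conjunct1[OF h] conjunct2[OF h]] conjunct1[OF h] by blast
    qed (simp_all add: T1_def)
   qed
  next
   fix s assume h: "?I s \<and> \<not> cond_val (WLess (Const 0) (Reg 35)) s"
   then obtain i where i: "main_inv TYPE('a) m \<Phi> x i s" by blast
   have "regs s 35 = 0" using h by simp
   \<comment> \<open>With all residual measurements 0, \<open>measurement_0\<close> makes the
     residual vector 0, so the digits collected so far already give x.\<close>
   then have y0: "\<forall>l<m. resid CARD('a) \<Phi> x i l = 0" and x0: "\<forall>j\<in>{1..?p}. zmem s [2, j] = acc ?p (x j) i" using i unfolding main_inv_def by simp_all
   have "card {j \<in> {1..?p}. res ?p (x j) i ~= 0} \<le> card (supp CARD('a) x)"
    by (rule card_mono) (use res_0[OF odd p3, of i] in auto)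
   then have "card {j \<in> {1..?p}. res ?p (x j) i ~= 0} \<le> m" using s by linarith
   then have "res ?p (x j) i = 0" if "j \<in> {1..?p}" for j by (rule measurement_0[OF k \<Phi> y0 _ that])
   then show "?Q s" using x0 acc_simps(3)[OF odd p3] by simp
  qed simp
  define s0 where "s0 = ev ?p W main_init \<sigma>"
  have base0: "base TYPE('a) m \<Phi> s0" using base unfolding s0_def .
  have z0: "zmem s0 = (zmem \<sigma>)([3] := int ?p, [8] := 1)" "regs s0 31 = 0" using r by (simp_all add: s0_def main_init_def)
  have zp: "zbd B (int ?p)" by (rule B1) (use MP(2) in simp)
  have z1: "zbd B 1" by (rule B1) (use MP(1) M(2) in linarith)
  have zg: "zgood ?p W B main_init \<sigma>" using zp z1 r by (simp add: main_init_def)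
  have st: "steps main_init \<le> 5" by (simp add: main_init_def)
  have "trm ?p W main_init \<sigma> (steps main_init) (steps main_init) B (\<lambda>s. s = s0)"
   by (rule trm_ev[where Q = "\<lambda>s. s = s0", OF _ zg]) (simp_all only: s0_def, simp add: main_init_def)
  then have init: "trm ?p W main_init \<sigma> 5 5 B (\<lambda>s. s = s0)" by (rule trm_mono[OF _ st st order_refl])
  have y0: "zmem s0 [1, l] = resid CARD('a) \<Phi> x 0 l" if "l < m" for l using y[OF that] by (simp add: z0)
  have "trm ?p W main \<sigma> (5 + ((3 + m * 4) + Suc (N * (441 * ?T) + E * (K + 2) * m\<^sup>2))) (5 + (m * 2 + N * (60 * ?T))) B ?Q"
   unfolding main_def
  proof (rule trm_Seq'[OF p0 c init])
   fix s0' assume e: "s0' = s0" and c0: "canon ?p s0'"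
   have b0: "regs s0' 1 = m" "zmem s0' [4] = 0" using base0 unfolding base_def e by blast+
   have zy: "zbd B (zmem s0' [1, l])" if "l < m" for l unfolding e y0[OF that] by (rule zbd_y[OF that])
   show "trm ?p W (scan ;; ?loop) s0' ((3 + m * 4) + Suc (N * (441 * ?T) + E * (K + 2) * m\<^sup>2)) (m * 2 + N * (60 * ?T)) B ?Q"
   proof (rule trm_Seq'[OF p0 c0 trm_scan[OF W m0 p0 c0 b0 zy]], assumption)
    fix s1 assume q: "regs s1 35 = 0 \<longleftrightarrow> (\<forall>l<m. zmem s0' [1, l] = 0)" and ag: "agree scan s0' s1" and c1: "canon ?p s1"
    have base1: "base TYPE('a) m \<Phi> s1"
     by (rule base_agree[OF base0 ag[unfolded e] c1]) (simp_all add: scan_def scan_step_def)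
    have zz: "zmem s1 (a # as) = zmem s0 (a # as)" for a as using agree_zmem[OF ag] e by (simp add: scan_def scan_step_def)
    have r1: "regs s1 31 = 0" using agree_regs[OF ag, of 31] e z0 by (simp add: scan_def scan_step_def)
    have x1: "zmem s1 [2, j] = acc ?p (x j) 0" for j using zz[of 2 "[j]"] z2 acc_simps(1)[OF odd p3] by (simp add: z0)
    have P1: "zmem s1 [8] = 1" using zz[of 8 "[]"] by (simp add: z0)
    have q1: "regs s1 35 = 0 \<longleftrightarrow> (\<forall>l<m. resid CARD('a) \<Phi> x 0 l = 0)" using q e y0 by (simp del: One_nat_def res.simps)
    have y1: "\<forall>l<m. zmem s1 [1, l] = resid CARD('a) \<Phi> x 0 l" using zz y0 by (simp del: One_nat_def res.simps)
    have inv: "main_inv TYPE('a) m \<Phi> x 0 s1"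
     unfolding main_inv_def r1 using base1 x1 P1 q1 y1 by (simp del: One_nat_def res.simps)
    have "level 1 = 0" using level_power[of 0] by simp
    then show "trm ?p W ?loop s1 (Suc (N * (441 * ?T) + E * (K + 2) * m\<^sup>2)) (N * (60 * ?T)) B ?Q"
     by (intro trm_mono[OF loop[OF inv]]) (simp_all add: r1 P1)
   qed
  qed
  then show ?thesis by (elim trm_mono) (assumption | simp add: power2_eq_square algebra_simps)+
qed

end

section \<open>The algorithm and its complexity\<close>

text \<open>For p = m = 2 the size bound leaves only the entries 0, 1 and -1. The second row
  annihilates column 2, so its measurement tells which coordinate of x is nonzero; the relevant
  entry is a unit and its own inverse, so one multiplication recovers that coordinate.\<close>

definition small :: com where
  "small = If (ZEq [Const 1, Const 1] [Const 4])
   (Do (ZOp [Const 2, Const 2] ZMul [Const 0, Const 1, Const 2] [Const 1, Const 0]))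
   (Do (ZOp [Const 2, Const 1] ZMul [Const 0, Const 2, Const 1] [Const 1, Const 1]))"

definition recover :: com where "recover = If (WEq (Reg 0) (Const 2)) small main"

definition zbound :: "nat => nat => (nat => nat => int) => (nat => int) => real" where
  "zbound p m \<Phi> x = max (real_of_int (max_abs p x) * real p)
   (real_of_int (Max ((\<lambda>l. \<bar>measurement p \<Phi> x l\<bar>) ` {..<m})) + real m * real p powr (1 - 1 / real m))"

definition lg :: "nat => real" where "lg p = log 2 (real p) + 1"

text \<open>T bounds field and control operations together. Of the three factors
  \<open>lg p\<close>, two come from the separation bound and one from powering.\<close>

definition solves :: "nat => nat => (nat => nat => int) => (nat => int) => bool" where
  "solves p m \<Phi> x \<longleftrightarrow> (\<exists>T Z B.
   trm p ((p + m) ^ 8) recover (recovery_input p m \<Phi> (measurement p \<Phi> x)) T Z B (recovery_output p x) \<and>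
   real T \<le> 80000 * (real m ^ 2 * log (real p) (real_of_int (max_abs p x)) + real m ^ 2 * (sqrt (real p) * lg p ^ 3)) \<and>
   real Z \<le> 80000 * (real m ^ 2 * max 1 (log (real p) (real_of_int (max_abs p x)))) \<and>
   real B \<le> zbound p m \<Phi> x)"

definition good :: "nat => bool" where
  "good p \<longleftrightarrow> (\<forall>m k \<Phi> x. 0 < m --> m \<le> p --> (\<forall>j\<in>{1..p}. 1 \<le> k j \<and> k j < int p) -->
   admissible_matrix p m k \<Phi> --> (\<exists>j\<in>{1..p}. x j ~= 0) --> real (norm0 p x) \<le> real m / 2 --> solves p m \<Phi> x)"

lemma max_abs:
  assumes "\<exists>j\<in>{1..p}. x j ~= 0"
  shows "j \<in> {1..p} ==> \<bar>x j\<bar> \<le> max_abs p x" "1 \<le> max_abs p x"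
proof -
  show a: "\<bar>x j\<bar> \<le> max_abs p x" if "j \<in> {1..p}" for j unfolding max_abs_def by (rule Max_ge) (use that in auto)
  obtain j where "j \<in> {1..p}" "x j ~= 0" using assms by blast
  with a[of j] show "1 \<le> max_abs p x" by linarith
qed

lemma zbound_nonneg: "(\<exists>j\<in>{1..p}. x j ~= 0) ==> 0 \<le> zbound p m \<Phi> x"
  using max_abs(2)[of p x] unfolding zbound_def by (intro max.coboundedI1) simp

lemma zbd_zbound:
  assumes "0 \<le> b" "\<bar>real_of_int v\<bar> \<le> b"
  shows "zbd (nat \<lfloor>b\<rfloor>) v"
proof -
  have "\<bar>v\<bar> \<le> \<lfloor>b\<rfloor>" using assms(2) by (simp add: le_floor_iff)
  then show ?thesis unfolding zbd_def by linarith
qed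

text \<open>A nonzero x has at least one nonzero coordinate, so m is at least 2; being at most p it
  equals 2, and exactly one coordinate is nonzero.\<close>

lemma good_2: "good 2"
  unfolding good_def
proof (intro allI impI)
  fix m k \<Phi> x
  assume m: "0 < m" "m \<le> 2" and k: "\<forall>j\<in>{1..2}. 1 \<le> k j \<and> k j < int 2" and \<Phi>: "admissible_matrix 2 m k \<Phi>"
   and x: "\<exists>j\<in>{1..2}. x j ~= (0::int)" and n: "real (norm0 2 x) \<le> real m / 2"
  have "{j \<in> {1..2}. x j ~= 0} ~= {}" "finite {j \<in> {1..2::nat}. x j ~= 0}" using x by auto
  then have "0 < norm0 2 x" unfolding norm0_def card_gt_0_iff by blast
  then have m2: "m = 2" and n1: "norm0 2 x = 1" using n m by linarith+
  have I: "{1..2::nat} = {1, 2}" by auto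
  have one: "x 1 = 0 \<or> x 2 = 0"
  proof (rule ccontr)
   assume "\<not> (x 1 = 0 \<or> x 2 = 0)"
   then have "{j \<in> {1..2::nat}. x j ~= 0} = {1, 2}" unfolding I by auto
   then show False using n1 unfolding norm0_def by simp
  qed
  have bd: "\<bar>\<Phi> i j\<bar> \<le> 1" if "i \<in> {1..2}" "j \<in> {1..2}" for i j
  proof -
   have "\<bar>real_of_int (\<Phi> i j)\<bar> \<le> 2 powr (1 - 1 / 2)" using \<Phi> that unfolding admissible_matrix_def m2 by fastforce
   also have "\<dots> < 2 powr 1" by (rule powr_less_mono) simp_all
   finally have "\<bar>real_of_int (\<Phi> i j)\<bar> < 2" by simp
   then show ?thesis by linarith
  qed
  have k1: "k j = 1" if "j \<in> {1..2}" for j using k that by force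
  have cg: "[\<Phi> i j = int j ^ (i - 1)] (mod 2)" if "i \<in> {1..2}" "j \<in> {1..2}" for i j
   using \<Phi> that k1[OF that(2)] unfolding admissible_matrix_def m2 by fastforce
  have "odd (\<Phi> 1 2)" "odd (\<Phi> 2 1)" "even (\<Phi> 2 2)" "odd (\<Phi> 1 1)"
   using cg[of 1 2] cg[of 2 1] cg[of 2 2] cg[of 1 1] unfolding cong_def by (simp_all add: even_iff_mod_2_eq_zero odd_iff_mod_2_eq_one)
  then have v: "\<Phi> 1 2 = 1 \<or> \<Phi> 1 2 = - 1" "\<Phi> 2 1 = 1 \<or> \<Phi> 2 1 = - 1" "\<Phi> 2 2 = 0"
   using bd[of 1 2] bd[of 2 1] bd[of 2 2] by (simp_all, presburger+)
  let ?y = "measurement 2 \<Phi> x"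
  let ?\<sigma> = "recovery_input 2 m \<Phi> ?y"
  define B where "B = nat \<lfloor>zbound 2 m \<Phi> x\<rfloor>"
  have y: "?y 0 = \<Phi> 1 1 * x 1 + \<Phi> 1 2 * x 2" "?y 1 = \<Phi> 2 1 * x 1"
   using v(3) unfolding measurement_def by (simp_all add: I numeral_2_eq_2)
  have z: "zmem ?\<sigma> [4] = 0" "zmem ?\<sigma> [1, 1] = ?y 1" "zmem ?\<sigma> [1, 0] = ?y 0" "zmem ?\<sigma> [0, 1, 2] = \<Phi> 1 2" "zmem ?\<sigma> [0, 2, 1] = \<Phi> 2 1"
   "zmem ?\<sigma> [2, 1] = 0" "zmem ?\<sigma> [2, 2] = 0"
   unfolding recovery_input_def m2 by (simp_all del: One_nat_def)
  have M: "\<bar>x 1\<bar> \<le> max_abs 2 x" "\<bar>x 2\<bar> \<le> max_abs 2 x" "1 \<le> max_abs 2 x" using max_abs[OF x] by simp_all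
  have zb: "zbd B w" if "\<bar>w\<bar> \<le> max_abs 2 x" for w
   unfolding B_def
  proof (rule zbd_zbound[OF zbound_nonneg[OF x]])
   have "\<bar>real_of_int w\<bar> \<le> real_of_int (max_abs 2 x) * real 2" using that M(3) by simp
   then show "\<bar>real_of_int w\<bar> \<le> zbound 2 m \<Phi> x" unfolding zbound_def by (rule max.coboundedI1)
  qed
  have b1: "zbd B (\<Phi> 1 2)" "zbd B (\<Phi> 2 1)" using v M(3) by (auto intro!: zb)
  have by1: "zbd B (?y 1)" unfolding y using v(2) M by (intro zb) auto
  have W: "(2 + m) ^ 8 = (65536::nat)" unfolding m2 by simp
  have Q: "zgood 2 W0 B small ?\<sigma> \<and> recovery_output 2 x (ev 2 W0 small ?\<sigma>)" for W0
  proof (cases "?y 1 = 0")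
   case True
   then have x1: "x 1 = 0" using y v(2) by auto
   have "\<Phi> 1 2 * ?y 0 = x 2" using y x1 v(1) by auto
   moreover have "zbd B (?y 0)" "zbd B (x 2)" unfolding y x1 using v(1) M by (auto intro!: zb)
   ultimately show ?thesis using True b1 by1 x1
    by (simp add: small_def zgood_Do(6) zval_def z recovery_output_def I del: One_nat_def zgood.simps(3))
  next
   case False
   then have x2: "x 2 = 0" using one y by auto
   have "\<Phi> 2 1 * ?y 1 = x 1" using y v(2) by auto
   moreover have "zbd B (x 1)" using M by (intro zb)
   ultimately show ?thesis using False b1 by1 x2
    by (simp add: small_def zgood_Do(6) zval_def z recovery_output_def I del: One_nat_def zgood.simps(3))
  qed
  have "trm 2 ((2 + m) ^ 8) small ?\<sigma> (steps small) (steps small) B (recovery_output 2 x)"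
   by (rule trm_ev[where Q = "recovery_output 2 x", OF _ conjunct1[OF Q] conjunct2[OF Q]]) (simp add: small_def)
  moreover have st: "steps small \<le> 2" by (simp add: small_def)
  ultimately have sm: "trm 2 ((2 + m) ^ 8) small ?\<sigma> 2 2 B (recovery_output 2 x)"
   by (elim trm_mono) (assumption | rule order_refl)+
  have r0: "regs ?\<sigma> 0 = 2" by (simp add: recovery_input_def)
  have t: "trm 2 ((2 + m) ^ 8) recover ?\<sigma> (Suc 2) 2 B (recovery_output 2 x)"
   unfolding recover_def by (rule trm_If) (use sm r0 in simp_all)
  have lM: "0 \<le> log (real 2) (real_of_int (max_abs 2 x))" using M(3) by simp
  have "1 * 1 \<le> sqrt (real 2) * lg 2 ^ 3" by (intro mult_mono) (simp_all add: lg_def)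
  then have "real (Suc 2) \<le> 80000 * (real m ^ 2 * log (real 2) (real_of_int (max_abs 2 x)) + real m ^ 2 * (sqrt (real 2) * lg 2 ^ 3))"
   using lM unfolding m2 by simp
  moreover have "real 2 \<le> 80000 * (real m ^ 2 * max 1 (log (real 2) (real_of_int (max_abs 2 x))))"
   unfolding m2 by (simp add: max_def)
  moreover have "real B \<le> zbound 2 m \<Phi> x" unfolding B_def using zbound_nonneg[OF x] by simp
  ultimately show "solves 2 m \<Phi> x" unfolding solves_def using t by blast
qed

lemma lg_ge: "2 \<le> p ==> 2 \<le> lg p"
  unfolding lg_def using log_le_cancel_iff[of 2 2 "real p"] by simp

lemma good_card:
  assumes odd: "odd CARD('a::prime_card)"
  shows "good CARD('a)"
  unfolding good_def
proof (intro allI impI)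
  let ?p = "CARD('a)"
  fix m k \<Phi> x
  assume m0: "0 < m" and mp: "m \<le> ?p" and k: "\<forall>j\<in>{1..?p}. 1 \<le> k j \<and> k j < int ?p" and \<Phi>: "admissible_matrix ?p m k \<Phi>"
   and x: "\<exists>j\<in>{1..?p}. x j ~= (0::int)" and n: "real (norm0 ?p x) \<le> real m / 2"
  have p2: "2 \<le> ?p" by (rule prime_ge_2_nat[OF prime_card])
  then have p3: "3 \<le> ?p" using odd by (cases "?p = 2") auto
  have s: "2 * card {j \<in> {1..?p}. x j ~= 0} \<le> m" using n unfolding norm0_def by linarith
  have "{j \<in> {1..?p}. x j ~= 0} ~= {}" "finite {j \<in> {1..?p}. x j ~= 0}" using x by auto
  then have "0 < card {j \<in> {1..?p}. x j ~= 0}" unfolding card_gt_0_iff by blast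
  then have m2: "2 \<le> m" using s by linarith
  define M where "M = max_abs ?p x"
  have M: "\<And>j. j \<in> {1..?p} ==> \<bar>x j\<bar> \<le> M" "1 \<le> M" unfolding M_def using max_abs[OF x] by blast+
  define \<kappa> where "\<kappa> = real ?p powr (1 - 1 / real m)"
  have \<kappa>1: "\<bar>real_of_int (\<Phi> (l + 1) j)\<bar> \<le> \<kappa>" if "l < m" "j \<in> {1..?p}" for l j
  proof -
   have "l + 1 \<in> {1..m}" using that by simp
   then show ?thesis using \<Phi> that(2) unfolding admissible_matrix_def \<kappa>_def by blast
  qed
  \<comment> \<open>m is at least 2, so the exponent 1 - 1/m is at least 1/2; and p is at least
    3.\<close>
  have \<kappa>2: "1.7 \<le> \<kappa>"
  proof -
   have "(1.7::real) \<le> sqrt 3" by (rule real_le_rsqrt) (simp add: power2_eq_square)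
   also have "\<dots> \<le> sqrt (real ?p)" using p3 by simp
   also have "\<dots> = real ?p powr (1 / 2)" by (simp add: powr_half_sqrt)
   also have "\<dots> \<le> \<kappa>" unfolding \<kappa>_def using m2 p3 by (intro powr_mono) (simp_all add: field_simps)
   finally show ?thesis .
  qed
  have "\<kappa> \<le> real ?p powr 1" unfolding \<kappa>_def using p3 by (intro powr_mono) simp_all
  then have \<kappa>3: "\<kappa> \<le> real ?p" using p3 by simp
  let ?Ym = "Max ((\<lambda>l. \<bar>measurement ?p \<Phi> x l\<bar>) ` {..<m})"
  define Y where "Y = real_of_int ?Ym"
  have Y1: "\<bar>real_of_int (measurement ?p \<Phi> x l)\<bar> \<le> Y" if "l < m" for l
  proof -
   have "\<bar>measurement ?p \<Phi> x l\<bar> \<le> ?Ym" by (rule Max_ge) (use that in auto)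
   then show ?thesis unfolding Y_def by linarith
  qed
  have Y2: "0 \<le> Y" using Y1[OF m0] by linarith
  define b where "b = zbound ?p m \<Phi> x"
  have b: "b = max (real_of_int M * real ?p) (Y + m * \<kappa>)" unfolding b_def zbound_def M_def Y_def \<kappa>_def ..
  have b0: "0 \<le> b" unfolding b_def by (rule zbound_nonneg[OF x])
  define B where "B = nat \<lfloor>b\<rfloor>"
  have B1: "zbd B v" if "\<bar>v\<bar> \<le> M * int ?p" for v
   unfolding B_def
  proof (rule zbd_zbound[OF b0])
   have "real_of_int \<bar>v\<bar> \<le> real_of_int (M * int ?p)" using that by (simp only: of_int_le_iff)
   then show "\<bar>real_of_int v\<bar> \<le> b" unfolding b by (intro max.coboundedI1) simp
  qed
  have B2: "zbd B v" if "\<bar>real_of_int v\<bar> \<le> Y + m * \<kappa>" for v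
   unfolding B_def by (rule zbd_zbound[OF b0]) (use that in \<open>simp add: b max.coboundedI2\<close>)
  define L where "L = lg ?p"
  have L: "2 \<le> L" unfolding L_def by (rule lg_ge[OF p2])
  define K where "K = nat \<lfloor>17 * sqrt (real ?p) * L ^ 2\<rfloor>"
  have K: "\<exists>t\<le>K. t < ?p \<and> \<not> inseparable a c t" if ac: "a ~= c" for a c :: "'a mod_ring"
  proof -
   obtain t where t: "t < ?p" "\<not> inseparable a c t" "real t \<le> 17 * sqrt (real ?p) * (log 2 (real ?p) + 1) ^ 2"
    using separation_bound[OF odd ac] by blast
   have "t \<le> K" using t(3) unfolding K_def L_def lg_def by (simp add: le_nat_floor)
   then show ?thesis using t by blast
  qed
  define lM where "lM = log (real ?p) (real_of_int M)"
  have lM: "0 \<le> lM" unfolding lM_def using M(2) p3 by simp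
  \<comment> \<open>p^i <= 2M - 1 < M p gives i < log_p M + 1, and the floor plus 2 exceeds every
    such i.\<close>
  define N where "N = nat \<lfloor>lM\<rfloor> + 2"
  have N: "i < N" if h: "int ?p ^ i \<le> 2 * M - 1" for i
  proof -
   have "int ?p ^ i < M * int ?p"
   proof -
    have "M * 2 \<le> M * int ?p" using M(2) p2 by (intro mult_left_mono) simp_all
    then show ?thesis using h by linarith
   qed
   then have "real_of_int (int ?p ^ i) < real_of_int (M * int ?p)" by (simp only: of_int_less_iff)
   then have lt: "real ?p ^ i < real_of_int M * real ?p" by simp
   have "real i = log (real ?p) (real ?p ^ i)" using p3 by simp
   also have "\<dots> < log (real ?p) (real_of_int M * real ?p)" using lt p3 by (intro log_less) simp_all
   also have "\<dots> = lM + 1" unfolding lM_def using M(2) p3 by (simp add: log_mult)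
   finally have "real i < lM + 1" .
   then show ?thesis unfolding N_def by linarith
  qed
  let ?W = "(?p + m) ^ 8"
  \<comment> \<open>The exponent 8 is generous: with p + m at least 5 it leaves ample room for index
    arithmetic and for the sums of remainders.\<close>
  have big: "78125 * (?p + m) \<le> ?W" "(?p + m) * (?p + m) * 5 \<le> ?W"
  proof -
   define q where "q = ?p + m"
   have e7: "q ^ 8 = q ^ 7 * q" using power_add[of q 7 1] by simp
   have e6: "q ^ 8 = q * q * q ^ 6" using power_add[of q 2 6] by (simp add: power2_eq_square)
   have 5: "5 \<le> q" using p3 m2 by (simp add: q_def)
   have "5 ^ 7 \<le> q ^ 7" by (rule power_mono[OF 5]) simp
   then have "5 ^ 7 * q \<le> q ^ 8" unfolding e7 by (rule mult_right_mono) simp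
   moreover have "(5::nat) ^ 7 = 78125" by simp
   ultimately show "78125 * (?p + m) \<le> ?W" unfolding q_def by simp
   have "5 ^ 6 \<le> q ^ 6" by (rule power_mono[OF 5]) simp
   moreover have "(5::nat) \<le> 5 ^ 6" by simp
   ultimately have "5 \<le> q ^ 6" by (rule order_trans[rotated])
   then have "q * q * 5 \<le> q ^ 8" unfolding e6 by (rule mult_left_mono) simp
   then show "(?p + m) * (?p + m) * 5 \<le> ?W" unfolding q_def .
  qed
  have W: "32 * m + 32 < ?W" by (rule less_le_trans[OF _ big(1)]) (use p3 in simp)
  have Wp: "(m + 2) * ?p < ?W"
  proof -
   have "(m + 2) * ?p \<le> (?p + m) * (?p + m)" using p2 by (intro mult_le_mono) simp_all
   also have "\<dots> < (?p + m) * (?p + m) * 5" using m0 by simp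
   finally show ?thesis using big(2) by (rule less_le_trans)
  qed
  let ?\<sigma> = "recovery_input ?p m \<Phi> (measurement ?p \<Phi> x)"
  have pW: "?p < ?W" by (rule less_le_trans[OF _ big(1)]) (use p3 in simp)
  have cn: "canon ?p ?\<sigma>" using p3 by (simp add: recovery_input_def canon_def)
  have rg: "regs ?\<sigma> 0 = ?p" "regs ?\<sigma> 1 = m" by (simp_all add: recovery_input_def)
  have base: "base TYPE('a) m \<Phi> (ev ?p ?W main_init ?\<sigma>)"
   unfolding base_def
  proof (intro conjI ballI)
   show "canon ?p (ev ?p ?W main_init ?\<sigma>)" using cn by (simp add: main_init_def canon_def)
   show "fe (ev ?p ?W main_init ?\<sigma>) [0] = (0 :: 'a mod_ring)" by (simp add: main_init_def fe_def recovery_input_def)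
   show "regs (ev ?p ?W main_init ?\<sigma>) 0 = ?p" "regs (ev ?p ?W main_init ?\<sigma>) 1 = m" using rg by (simp_all add: main_init_def)
   have "(?p - 1) mod ?W = ?p - 1" "((?p - 1) div 2) mod ?W = (?p - 1) div 2" using pW by (intro mod_less; linarith)+
   then show "regs (ev ?p ?W main_init ?\<sigma>) 41 = (?p - 1) div 2" using rg by (simp add: main_init_def del: One_nat_def)
   show "zmem (ev ?p ?W main_init ?\<sigma>) [3] = int ?p" "zmem (ev ?p ?W main_init ?\<sigma>) [4] = 0"
    using rg by (simp_all add: main_init_def) (simp add: recovery_input_def)
   fix i j assume "i \<in> {1..m}" "j \<in> {1..?p}"
   then show "zmem (ev ?p ?W main_init ?\<sigma>) [0, i, j] = \<Phi> i j" by (simp add: main_init_def) (simp add: recovery_input_def)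
  qed
  have y0: "zmem ?\<sigma> [1, l] = measurement ?p \<Phi> x l" if "l < m" for l using that by (simp add: recovery_input_def)
  have x0: "zmem ?\<sigma> [2, j] = 0" for j by (simp add: recovery_input_def)
  define E where "E = 280 * (bits ((?p - 1) div 2) + 13) + 4"
  define T where "T = 10 * (m + 1) ^ 2 + N * (441 * (m + 1) ^ 2) + E * (K + 2) * m\<^sup>2"
  define Z where "Z = 10 * (m + 1) ^ 2 + N * (60 * (m + 1) ^ 2)"
  have tm: "trm ?p ?W main ?\<sigma> T Z B (recovery_output ?p x)"
   unfolding recovery_output_def T_def Z_def E_def
   by (rule trm_main[OF W m2 Wp odd p3 K mp k \<Phi> M \<kappa>1 \<kappa>2 \<kappa>3 Y1 Y2 s B1 B2 base y0 x0 cn rg(1) N])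
  have t: "trm ?p ?W recover ?\<sigma> (Suc T) Z B (recovery_output ?p x)"
   unfolding recover_def by (rule trm_If) (use tm rg p3 in simp_all)
  have Nle: "real N \<le> lM + 2" unfolding N_def using lM by linarith
  have m1: "1 \<le> real m" using m0 by simp
  have sq: "real ((m + 1) ^ 2) \<le> 4 * real m ^ 2"
  proof -
   have "real (m + 1) ^ 2 \<le> (2 * real m) ^ 2" using m1 by (intro power_mono) simp_all
   then show ?thesis by (simp add: power_mult_distrib)
  qed
  have mm: "1 \<le> real m ^ 2" using m1 by simp
  have NT: "real N * real ((m + 1) ^ 2) \<le> (lM + 2) * (4 * real m ^ 2)" using Nle sq lM by (intro mult_mono) simp_all
  \<comment> \<open>3920 is 280 times 14: the bit length is at most L - 1, and the added 13 and 4
    are absorbed since L is at least 1.\<close>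
  have El: "real E \<le> 3920 * L"
  proof -
   let ?e = "(?p - 1) div 2"
   have e0: "0 < ?e" using p3 by simp
   have "2 * ?e \<le> ?p" by simp
   then have "2 ^ bits ?e \<le> ?p" using bits_le[OF e0] by linarith
   then have "real (2 ^ bits ?e) \<le> real ?p" by (simp only: of_nat_le_iff)
   then have "(2::real) ^ bits ?e \<le> real ?p" by simp
   then have "real (bits ?e) \<le> log 2 (real ?p)" using p3 by (simp add: le_log_iff powr_realpow)
   then show ?thesis using L unfolding E_def L_def lg_def by simp
  qed
  have sp: "1 \<le> sqrt (real ?p)" using p3 by simp
  have L2: "1 \<le> L ^ 2" "1 \<le> L ^ 3" using L by (simp_all add: one_le_power)
  have sL: "1 \<le> sqrt (real ?p) * L ^ 2" "1 \<le> sqrt (real ?p) * L ^ 3"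
   using mult_mono[OF sp L2(1)] mult_mono[OF sp L2(2)] by simp_all
  have Kl: "real (K + 2) \<le> 19 * (sqrt (real ?p) * L ^ 2)"
  proof -
   have "real K \<le> 17 * sqrt (real ?p) * L ^ 2" unfolding K_def using sL(1) by (intro of_nat_floor) simp
   then show ?thesis using sL(1) by simp
  qed
  have EK: "real (E * (K + 2)) \<le> 74480 * (sqrt (real ?p) * L ^ 3)"
  proof -
   have "real E * real (K + 2) \<le> (3920 * L) * (19 * (sqrt (real ?p) * L ^ 2))" using El Kl L by (intro mult_mono) simp_all
   also have "\<dots> = 74480 * (sqrt (real ?p) * L ^ 3)" by (simp add: power2_eq_square power3_eq_cube)
   finally show ?thesis by (simp only: of_nat_mult)
  qed
  have EKm: "real (E * (K + 2)) * real m ^ 2 \<le> 74480 * (real m ^ 2 * (sqrt (real ?p) * L ^ 3))"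
   using mult_right_mono[OF EK, of "real m ^ 2"] by (simp add: mult.assoc mult.commute mult.left_commute)
  define D where "D = real m ^ 2 * (sqrt (real ?p) * L ^ 3)"
  define G where "G = real m ^ 2 * lM"
  have D: "real m ^ 2 \<le> D" unfolding D_def using mult_left_mono[OF sL(2), of "real m ^ 2"] by simp
  have G: "0 \<le> G" unfolding G_def using lM by simp
  have NT': "real N * real ((m + 1) ^ 2) \<le> 4 * G + 8 * real m ^ 2" using NT unfolding G_def by (simp add: algebra_simps)
  have Tr: "real (Suc T) = 1 + 10 * real ((m + 1) ^ 2) + 441 * (real N * real ((m + 1) ^ 2)) + real (E * (K + 2)) * real m ^ 2"
   unfolding T_def by simp
  \<comment> \<open>74480 is 3920 times 19 and bounds the splitting cost. Rounding up to 80000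
    leaves 5520 d, enough for the 3569 r of the remaining terms.\<close>
  have gen: "1 + 10 * q + 441 * n + e \<le> 80000 * (g + d)"
   if "q \<le> 4 * r" "n \<le> 4 * g + 8 * r" "e \<le> 74480 * d" "r \<le> d" "0 \<le> g" "1 \<le> r" for q n e r g d :: real
  proof -
   have "10 * q \<le> 40 * r" "441 * n \<le> 1764 * g + 3528 * r" using that(1,2) by simp_all
   then have "1 + 10 * q + 441 * n + e \<le> r + 40 * r + (1764 * g + 3528 * r) + 74480 * d"
    using that(3,6) by (intro add_mono)
   also have "\<dots> = 3569 * r + 1764 * g + 74480 * d" by simp
   also have "\<dots> \<le> 5520 * d + 80000 * g + 74480 * d" using that(4,5,6) by (intro add_mono) simp_all
   also have "\<dots> = 80000 * (g + d)" by simp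
   finally show ?thesis .
  qed
  have "real (Suc T) \<le> 80000 * (G + D)" unfolding Tr by (rule gen[OF sq NT' EKm[folded D_def] D G mm])
  moreover have "real Z \<le> 80000 * (real m ^ 2 * max 1 lM)"
  proof -
   have Zr: "real Z = 10 * real ((m + 1) ^ 2) + 60 * (real N * real ((m + 1) ^ 2))" unfolding Z_def by simp
   have w: "real m ^ 2 * 1 \<le> real m ^ 2 * max 1 lM" "G \<le> real m ^ 2 * max 1 lM"
    unfolding G_def by (rule mult_left_mono; simp)+
   have gen2: "10 * q + 60 * n \<le> 80000 * w"
    if "r * 1 \<le> w" "g \<le> w" "q \<le> 4 * r" "n \<le> 4 * g + 8 * r" "0 \<le> r" "0 \<le> g" for q n r g w :: real using that by linarith
   show ?thesis unfolding Zr by (rule gen2[OF w sq NT' zero_le_power2 G])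
  qed
  moreover have "real B \<le> zbound ?p m \<Phi> x" unfolding B_def using b0 by (simp add: b_def)
  ultimately show "solves ?p m \<Phi> x" unfolding solves_def using t unfolding G_def D_def lM_def M_def L_def by blast
qed

text \<open>The field operations are analysed over \<open>'a mod_ring\<close>. To reach every prime, the type is
  instantiated with a set of counterexample size.\<close>

definition cex_size :: nat where
  "cex_size = (if \<exists>p. prime p \<and> \<not> good p then SOME p. prime p \<and> \<not> good p else 2)"

lemma cex_size: "prime cex_size" "prime p ==> \<not> good p ==> \<not> good cex_size"
proof -
  have "(\<exists>p. prime p \<and> \<not> good p) ==> prime cex_size \<and> \<not> good cex_size"
   unfolding cex_size_def by simp (rule someI_ex)
  then show "prime cex_size" "prime p ==> \<not> good p ==> \<not> good cex_size"
   using two_is_prime_nat by (cases "\<exists>p. prime p \<and> \<not> good p"; auto simp: cex_size_def)+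
qed

typedef cex = "{..<cex_size}"
  using prime_gt_0_nat[OF cex_size(1)] by blast

lemma card_cex: "CARD(cex) = cex_size"
  using type_definition.card[OF type_definition_cex] by simp

instance cex :: prime_card
  by standard (simp add: card_cex cex_size(1))

text \<open>If any prime failed, \<open>cex_size\<close> would be a failing prime; but it is the
  cardinality of a type, so \<open>good_card\<close> or, for the even prime, \<open>good_2\<close>
  excludes this.\<close>

lemma good_prime: "prime p ==> good p"
proof (rule ccontr)
  assume p: "prime p" "\<not> good p"
  have "good CARD(cex)"
  proof (cases "odd CARD(cex)")
   case False
   then have "CARD(cex) = 2" unfolding card_cex using cex_size(1) prime_odd_nat prime_ge_2_nat by (metis le_neq_implies_less)
   then show ?thesis using good_2 by simp
  qed (rule good_card)
  then show False using cex_size(2)[OF p] by (simp add: card_cex)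
qed

theorem mainTheorem1:
  fixes \<omega> :: real
  assumes "\<omega> > 2" and "linear_system_exponent \<omega>"
  shows "\<exists>(prog :: com) (e :: nat) (C :: real) (\<delta>\<^sub>1 :: nat \<Rightarrow> real) (\<delta>\<^sub>2 :: nat \<Rightarrow> real).
    \<delta>\<^sub>1 \<longlonglongrightarrow> 0 \<and> \<delta>\<^sub>2 \<longlonglongrightarrow> 0 \<and>
    (\<forall>(p :: nat) (m :: nat) (k :: nat \<Rightarrow> int) (\<Phi> :: nat \<Rightarrow> nat \<Rightarrow> int) (x :: nat \<Rightarrow> int).
      prime p \<longrightarrow> 0 < m \<longrightarrow> m \<le> p \<longrightarrow>
      (\<forall>j\<in>{1..p}. 1 \<le> k j \<and> k j < int p) \<longrightarrow>
      admissible_matrix p m k \<Phi> \<longrightarrow>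
      (\<exists>j\<in>{1..p}. x j \<noteq> 0) \<longrightarrow>
      real (norm0 p x) \<le> real m / 2 \<longrightarrow>
      (let M = real_of_int (max_abs p x);
           y = measurement p \<Phi> x;
           F = real m powr \<omega> * log (real p) M
                 + real m powr (2 + \<delta>\<^sub>1 p) * real p powr (1 / 2 + \<delta>\<^sub>2 p);
           Z = real m ^ 2 * max 1 (log (real p) M)
       in \<exists>\<kappa> \<sigma>. exec p ((p + m) ^ e) prog (recovery_input p m \<Phi> y) \<kappa> \<sigma> \<and>
            recovery_output p x \<sigma> \<and>
            real (fops \<kappa>) \<le> C * F \<and>
            real (zops \<kappa>) \<le> C * Z \<and>
            real (ctl \<kappa>) \<le> C * (F + Z) \<and>
            real (zmax \<kappa>) \<le> max (M * real p)
              (real_of_int (Max ((\<lambda>l. \<bar>y l\<bar>) ` {..<m})) + real m * real p powr (1 - 1 / real m))))"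
proof (intro exI conjI allI impI)
  show "(\<lambda>p :: nat. 0 :: real) \<longlonglongrightarrow> 0" by simp
  \<comment> \<open>This exponent is chosen so that raising p to it gives exactly
    \<open>lg p ^ 3\<close>; it tends to 0 because the numerator is only doubly logarithmic.\<close>
  show "(\<lambda>p :: nat. log (real p) (lg p ^ 3)) \<longlonglongrightarrow> 0"
   unfolding lg_def log_def by real_asymp
  fix p m k \<Phi> x
  assume p: "prime p" and m: "0 < m" "m \<le> p" and k: "\<forall>j\<in>{1..p}. 1 \<le> k j \<and> k j < int p" and \<Phi>: "admissible_matrix p m k \<Phi>"
   and x: "\<exists>j\<in>{1..p}. x j ~= (0::int)" and n: "real (norm0 p x) \<le> real m / 2"
  have p2: "2 \<le> p" by (rule prime_ge_2_nat[OF p])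
  let ?M = "real_of_int (max_abs p x)"
  let ?F = "real m powr \<omega> * log (real p) ?M + real m powr (2 + 0) * real p powr (1 / 2 + log (real p) (lg p ^ 3))"
  let ?Z = "real m ^ 2 * max 1 (log (real p) ?M)"
  have "solves p m \<Phi> x" using good_prime[OF p] m k \<Phi> x n unfolding good_def by blast
  then obtain T Z B where t: "trm p ((p + m) ^ 8) recover (recovery_input p m \<Phi> (measurement p \<Phi> x)) T Z B (recovery_output p x)"
   and T: "real T \<le> 80000 * (real m ^ 2 * log (real p) ?M + real m ^ 2 * (sqrt (real p) * lg p ^ 3))"
   and Z: "real Z \<le> 80000 * ?Z" and B: "real B \<le> zbound p m \<Phi> x"
   unfolding solves_def by blast
  from t obtain c s where c: "exec p ((p + m) ^ 8) recover (recovery_input p m \<Phi> (measurement p \<Phi> x)) c s" "ctl c + fops c \<le> T"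
   "zops c \<le> Z" "zmax c \<le> B" "recovery_output p x s" unfolding trm_def by blast
  have lM: "0 \<le> log (real p) ?M" using max_abs(2)[OF x] p2 by simp
  have m1: "1 \<le> real m" using m(1) by simp
  have "real m ^ 2 = real m powr 2" using m1 by simp
  also have "\<dots> \<le> real m powr \<omega>" using m1 assms(1) by (intro powr_mono) simp_all
  finally have mw: "real m ^ 2 * log (real p) ?M \<le> real m powr \<omega> * log (real p) ?M" by (rule mult_right_mono[OF _ lM])
  have "0 < lg p ^ 3" using lg_ge[OF p2] by simp
  then have "real p powr (1 / 2 + log (real p) (lg p ^ 3)) = sqrt (real p) * lg p ^ 3"
   using p2 by (simp add: powr_add powr_half_sqrt)
  then have eq: "real m powr (2 + 0) * real p powr (1 / 2 + log (real p) (lg p ^ 3)) = real m ^ 2 * (sqrt (real p) * lg p ^ 3)"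
   using m1 by simp
  have TF: "real T \<le> 80000 * ?F"
   unfolding eq by (rule order_trans[OF T]) (intro mult_left_mono add_right_mono mw, simp)
  have Z0: "0 \<le> ?Z" by simp
  have "real (fops c) \<le> real T" "real (ctl c) \<le> real T" "real (zops c) \<le> real Z" "real (zmax c) \<le> real B" using c by simp_all
  note cs = this
  have "80000 * ?F \<le> 80000 * (?F + ?Z)" using Z0 by (intro mult_left_mono) simp_all
  from order_trans[OF cs(2) order_trans[OF TF this]] order_trans[OF cs(1) TF] order_trans[OF cs(3) Z] order_trans[OF cs(4) B] c(1,5)
  show "let M = ?M; y = measurement p \<Phi> x;
     F = real m powr \<omega> * log (real p) M + real m powr (2 + 0) * real p powr (1 / 2 + log (real p) (lg p ^ 3));
     Z = real m ^ 2 * max 1 (log (real p) M)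
    in \<exists>\<kappa> \<sigma>. exec p ((p + m) ^ 8) recover (recovery_input p m \<Phi> y) \<kappa> \<sigma> \<and>
     recovery_output p x \<sigma> \<and> real (fops \<kappa>) \<le> 80000 * F \<and> real (zops \<kappa>) \<le> 80000 * Z \<and>
     real (ctl \<kappa>) \<le> 80000 * (F + Z) \<and>
     real (zmax \<kappa>) \<le> max (M * real p)
     (real_of_int (Max ((\<lambda>l. \<bar>y l\<bar>) ` {..<m})) + real m * real p powr (1 - 1 / real m))"
   unfolding Let_def zbound_def by blast
qed

end
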